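(* Let $T$ be a tree and let a group $\Gamma$ act on $T$ by automorphisms such that the action is minimal and strongly hyperbolic. Let $K$ be the fixator subgroup of some half-tree of $T$, and let $N=\ker(\Gamma\curvearrowright T)$ (so $N\subseteq K$). Then: (i) if $\Gamma$ is $C^*$-simple, then $K$ is either trivial or non-amenable; (ii) if $K=N$ and $N$ is $C^*$-simple, then $\Gamma$ is $C^*$-simple; (iii) if $K/N$ is non-amenable and $N$ is $C^*$-simple, then $\Gamma$ is $C^*$-simple. In particular, if $N$ is trivial, then $\Gamma$ is $C^*$-simple if and only if $K$ is trivial or non-amenable. Also, if $K$ is amenable, then $\Gamma$ is $C^*$-simple if and only if $K$ is trivial.
   Context: A tree $T$ has vertex set $V$, edge set $E$, source/range maps $s,r$, inversion $e\mapsto\bar e$, path metric $d$. A half-tree is the vertex set of one of the two components obtained by removing an edge (and its reverse), i.e. a set $Z_0(e)=\{v: d(v,s(e))>d(v,r(e))\}$; its fixator subgroup is the set of elements of $\Gamma$ fixing each of its vertices. $\ker(\Gamma\curvearrowright T)$ is the set of elements fixing every vertex. An automorphism is hyperbolic if it fixes no vertex and inverts no edge (it then has exactly two fixed points in the boundary $\partial T$ of cofinality classes of rays). The action is minimal if there is no proper invariant subtree, and strongly hyperbolic if $\Gamma$ contains two hyperbolic elements with disjoint fixed point sets in $\partial T$. $C^*$-simple means the reduced group $C^*$-algebra is simple. *)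

theory Defs
  imports "HOL-Analysis.Analysis" "HOL-Algebra.Group_Action" "HOL-Algebra.Coset"
begin

definition walk :: "'v set \<Rightarrow> ('v \<Rightarrow> 'v \<Rightarrow> bool) \<Rightarrow> 'v list \<Rightarrow> bool" where
  "walk V adj p \<longleftrightarrow> p \<noteq> [] \<and> set p \<subseteq> V \<and> (\<forall>i. Suc i < length p \<longrightarrow> adj (p ! i) (p ! Suc i))"

definition is_tree :: "'v set \<Rightarrow> ('v \<Rightarrow> 'v \<Rightarrow> bool) \<Rightarrow> bool" where
  "is_tree V adj \<longleftrightarrow> V \<noteq> {}
     \<and> (\<forall>x y. adj x y \<longrightarrow> x \<in> V \<and> y \<in> V \<and> adj y x \<and> x \<noteq> y)
     \<and> (\<forall>u\<in>V. \<forall>v\<in>V. \<exists>p. walk V adj p \<and> hd p = u \<and> last p = v)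
     \<and> \<not> (\<exists>p. walk V adj p \<and> distinct p \<and> length p \<ge> 3 \<and> adj (last p) (hd p))"

definition tdist :: "'v set \<Rightarrow> ('v \<Rightarrow> 'v \<Rightarrow> bool) \<Rightarrow> 'v \<Rightarrow> 'v \<Rightarrow> nat" where
  "tdist V adj u v = (LEAST n. \<exists>p. walk V adj p \<and> hd p = u \<and> last p = v \<and> length p = Suc n)"

definition half_tree :: "'v set \<Rightarrow> ('v \<Rightarrow> 'v \<Rightarrow> bool) \<Rightarrow> 'v \<Rightarrow> 'v \<Rightarrow> 'v set" where
  "half_tree V adj x y = {v \<in> V. tdist V adj v x > tdist V adj v y}"

definition tree_action :: "('g, 'b) monoid_scheme \<Rightarrow> 'v set \<Rightarrow> ('v \<Rightarrow> 'v \<Rightarrow> bool) \<Rightarrow> ('g \<Rightarrow> 'v \<Rightarrow> 'v) \<Rightarrow> bool" where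
  "tree_action G V adj \<phi> \<longleftrightarrow> is_tree V adj \<and> group_action G V \<phi>
     \<and> (\<forall>g\<in>carrier G. \<forall>x\<in>V. \<forall>y\<in>V. adj (\<phi> g x) (\<phi> g y) \<longleftrightarrow> adj x y)"

definition fixator :: "('g, 'b) monoid_scheme \<Rightarrow> ('g \<Rightarrow> 'v \<Rightarrow> 'v) \<Rightarrow> 'v set \<Rightarrow> 'g set" where
  "fixator G \<phi> Z = {g \<in> carrier G. \<forall>v\<in>Z. \<phi> g v = v}"

definition action_kernel :: "('g, 'b) monoid_scheme \<Rightarrow> 'v set \<Rightarrow> ('g \<Rightarrow> 'v \<Rightarrow> 'v) \<Rightarrow> 'g set" where
  "action_kernel G V \<phi> = fixator G \<phi> V"

definition minimal_action :: "('g, 'b) monoid_scheme \<Rightarrow> 'v set \<Rightarrow> ('v \<Rightarrow> 'v \<Rightarrow> bool) \<Rightarrow> ('g \<Rightarrow> 'v \<Rightarrow> 'v) \<Rightarrow> bool" where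
  "minimal_action G V adj \<phi> \<longleftrightarrow>
     (\<forall>W. W \<subseteq> V \<and> W \<noteq> {}
        \<and> (\<forall>u\<in>W. \<forall>v\<in>W. \<exists>p. walk W adj p \<and> hd p = u \<and> last p = v)
        \<and> (\<forall>g\<in>carrier G. \<phi> g ` W \<subseteq> W) \<longrightarrow> W = V)"

definition hyperbolic_aut :: "'v set \<Rightarrow> ('v \<Rightarrow> 'v \<Rightarrow> bool) \<Rightarrow> ('v \<Rightarrow> 'v) \<Rightarrow> bool" where
  "hyperbolic_aut V adj \<sigma> \<longleftrightarrow> (\<forall>v\<in>V. \<sigma> v \<noteq> v) \<and> \<not> (\<exists>x y. adj x y \<and> \<sigma> x = y \<and> \<sigma> y = x)"

text \<open>Rays; boundary points are cofinality classes of rays.\<close>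
definition is_ray :: "'v set \<Rightarrow> ('v \<Rightarrow> 'v \<Rightarrow> bool) \<Rightarrow> (nat \<Rightarrow> 'v) \<Rightarrow> bool" where
  "is_ray V adj r \<longleftrightarrow> (\<forall>n. r n \<in> V) \<and> (\<forall>n. adj (r n) (r (Suc n))) \<and> inj r"

definition cofinal :: "(nat \<Rightarrow> 'v) \<Rightarrow> (nat \<Rightarrow> 'v) \<Rightarrow> bool" where
  "cofinal r s \<longleftrightarrow> (\<exists>k l. \<forall>n. r (n + k) = s (n + l))"

definition fixes_end :: "('v \<Rightarrow> 'v) \<Rightarrow> (nat \<Rightarrow> 'v) \<Rightarrow> bool" where
  "fixes_end \<sigma> r \<longleftrightarrow> cofinal (\<sigma> \<circ> r) r"

definition strongly_hyperbolic :: "('g, 'b) monoid_scheme \<Rightarrow> 'v set \<Rightarrow> ('v \<Rightarrow> 'v \<Rightarrow> bool) \<Rightarrow> ('g \<Rightarrow> 'v \<Rightarrow> 'v) \<Rightarrow> bool" where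
  "strongly_hyperbolic G V adj \<phi> \<longleftrightarrow>
     (\<exists>g\<in>carrier G. \<exists>h\<in>carrier G. hyperbolic_aut V adj (\<phi> g) \<and> hyperbolic_aut V adj (\<phi> h)
        \<and> \<not> (\<exists>r. is_ray V adj r \<and> fixes_end (\<phi> g) r \<and> fixes_end (\<phi> h) r))"

definition l2 :: "('a, 'b) monoid_scheme \<Rightarrow> ('a \<Rightarrow> complex) set" where
  "l2 H = {f. (\<forall>x. x \<notin> carrier H \<longrightarrow> f x = 0) \<and> (\<lambda>x. (cmod (f x))\<^sup>2) summable_on carrier H}"

definition l2norm :: "('a, 'b) monoid_scheme \<Rightarrow> ('a \<Rightarrow> complex) \<Rightarrow> real" where
  "l2norm H f = sqrt (infsum (\<lambda>x. (cmod (f x))\<^sup>2) (carrier H))"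

text \<open>Left regular representation; operators are extended by 0 outside l^2(H).\<close>
definition lreg :: "('a, 'b) monoid_scheme \<Rightarrow> 'a \<Rightarrow> ('a \<Rightarrow> complex) \<Rightarrow> ('a \<Rightarrow> complex)" where
  "lreg H g f = (if f \<in> l2 H then (\<lambda>x. if x \<in> carrier H then f (inv\<^bsub>H\<^esub> g \<otimes>\<^bsub>H\<^esub> x) else 0) else (\<lambda>_. 0))"

definition bounded_ops :: "('a, 'b) monoid_scheme \<Rightarrow> (('a \<Rightarrow> complex) \<Rightarrow> ('a \<Rightarrow> complex)) set" where
  "bounded_ops H = {T. (\<forall>f. f \<notin> l2 H \<longrightarrow> T f = (\<lambda>_. 0))
      \<and> (\<forall>f\<in>l2 H. T f \<in> l2 H)
      \<and> (\<forall>f\<in>l2 H. \<forall>g\<in>l2 H. \<forall>c. T (\<lambda>x. f x + c * g x) = (\<lambda>x. T f x + c * T g x))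
      \<and> (\<exists>C. \<forall>f\<in>l2 H. l2norm H (T f) \<le> C * l2norm H f)}"

definition opnorm :: "('a, 'b) monoid_scheme \<Rightarrow> (('a \<Rightarrow> complex) \<Rightarrow> ('a \<Rightarrow> complex)) \<Rightarrow> real" where
  "opnorm H T = Sup {l2norm H (T f) | f. f \<in> l2 H \<and> l2norm H f \<le> 1}"

definition op_diff :: "(('a \<Rightarrow> complex) \<Rightarrow> ('a \<Rightarrow> complex)) \<Rightarrow> (('a \<Rightarrow> complex) \<Rightarrow> ('a \<Rightarrow> complex)) \<Rightarrow> (('a \<Rightarrow> complex) \<Rightarrow> ('a \<Rightarrow> complex))" where
  "op_diff T S = (\<lambda>f x. T f x - S f x)"

definition reg_span :: "('a, 'b) monoid_scheme \<Rightarrow> (('a \<Rightarrow> complex) \<Rightarrow> ('a \<Rightarrow> complex)) set" where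
  "reg_span H = {T. \<exists>S c. finite S \<and> S \<subseteq> carrier H \<and> T = (\<lambda>f x. \<Sum>g\<in>S. c g * lreg H g f x)}"

definition reduced_cstar :: "('a, 'b) monoid_scheme \<Rightarrow> (('a \<Rightarrow> complex) \<Rightarrow> ('a \<Rightarrow> complex)) set" where
  "reduced_cstar H = {T \<in> bounded_ops H. \<forall>\<epsilon>>0. \<exists>S\<in>reg_span H. opnorm H (op_diff T S) < \<epsilon>}"

definition closed_ideal :: "('a, 'b) monoid_scheme \<Rightarrow> (('a \<Rightarrow> complex) \<Rightarrow> ('a \<Rightarrow> complex)) set \<Rightarrow> (('a \<Rightarrow> complex) \<Rightarrow> ('a \<Rightarrow> complex)) set \<Rightarrow> bool" where
  "closed_ideal H A I \<longleftrightarrow> I \<subseteq> A \<and> (\<lambda>f x. 0) \<in> I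
     \<and> (\<forall>S\<in>I. \<forall>T\<in>I. \<forall>c. (\<lambda>f x. S f x + c * T f x) \<in> I)
     \<and> (\<forall>a\<in>A. \<forall>S\<in>I. a \<circ> S \<in> I \<and> S \<circ> a \<in> I)
     \<and> (\<forall>T\<in>A. (\<forall>\<epsilon>>0. \<exists>S\<in>I. opnorm H (op_diff T S) < \<epsilon>) \<longrightarrow> T \<in> I)"

definition C_star_simple :: "('a, 'b) monoid_scheme \<Rightarrow> bool" where
  "C_star_simple H \<longleftrightarrow>
     (\<forall>I. closed_ideal H (reduced_cstar H) I \<longrightarrow> I = {\<lambda>f x. 0} \<or> I = reduced_cstar H)"

definition bounded_on :: "'a set \<Rightarrow> ('a \<Rightarrow> real) \<Rightarrow> bool" where
  "bounded_on A f \<longleftrightarrow> (\<exists>B. \<forall>x\<in>A. \<bar>f x\<bar> \<le> B)"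

definition amenable :: "('a, 'b) monoid_scheme \<Rightarrow> bool" where
  "amenable H \<longleftrightarrow> (\<exists>m :: ('a \<Rightarrow> real) \<Rightarrow> real.
     (\<forall>f f'. bounded_on (carrier H) f \<longrightarrow> (\<forall>x\<in>carrier H. f x = f' x) \<longrightarrow> m f = m f')
     \<and> (\<forall>f g c. bounded_on (carrier H) f \<longrightarrow> bounded_on (carrier H) g \<longrightarrow>
           m (\<lambda>x. f x + c * g x) = m f + c * m g)
     \<and> (\<forall>f. bounded_on (carrier H) f \<longrightarrow> (\<forall>x\<in>carrier H. f x \<ge> 0) \<longrightarrow> m f \<ge> 0)
     \<and> m (\<lambda>_. 1) = 1
     \<and> (\<forall>f. bounded_on (carrier H) f \<longrightarrow> (\<forall>g\<in>carrier H. m (\<lambda>x. f (g \<otimes>\<^bsub>H\<^esub> x)) = m f)))"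

end

theory Submission
  imports Defs
begin

text \<open>
  Everything rests on averaging operators over conjugates. If for every finite combination of group
  elements outside \<open>N\<close> some average of its conjugates has arbitrarily small norm, then averaging an
  element of an ideal of the reduced algebra of \<open>\<Gamma>\<close> produces elements close to the reduced algebra of \<open>N\<close>,
  so simplicity passes from \<open>N\<close> to \<open>\<Gamma>\<close>.

  When \<open>K = N\<close>, finitely many elements outside \<open>N\<close> displace a common half-tree \<open>B\<close>. Translates of the
  complement of \<open>B\<close> into many disjoint half-trees give Powers' estimate, with norm \<open>O(k\<^sup>-\<^sup>1\<^sup>/\<^sup>2)\<close> for \<open>k\<close> conjugates.
  When \<open>K/N\<close> is non-amenable and \<open>f\<close> displaces the half-tree on which \<open>K\<close> is supported, conjugating \<open>f\<close>
  by elements \<open>h\<close> of \<open>K\<close> gives \<open>h (f h\<^sup>-\<^sup>1 f\<^sup>-\<^sup>1) f\<close>, where \<open>K\<close> and \<open>f K f\<^sup>-\<^sup>1\<close> commute modulo \<open>N\<close>; the average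
  over \<open>h\<close> is therefore bounded by an average over \<open>K/N\<close>, which Kesten's theorem makes small. Several
  \<open>f\<close> are treated at once by using disjoint half-trees.

  Conversely, let \<open>K\<close> be amenable and non-trivial. The fixators of the half-trees \<open>t\<^sup>n Z\<close>, with \<open>t\<close>
  translating \<open>Z\<close> into itself, have an amenable union \<open>H\<close>, so the quasi-regular representation on \<open>\<Gamma>/H\<close>
  is weakly contained in the regular one. For \<open>g\<^sub>1\<close>, \<open>g\<^sub>2\<close> supported on disjoint half-trees every
  coset is fixed by \<open>g\<^sub>2\<close>, or it and its \<open>g\<^sub>2\<close>-translate are fixed by \<open>g\<^sub>1\<close>. Hence
  \<open>(1 - g\<^sub>1) (1 - g\<^sub>2)\<close> acts as zero there, and the kernel is a non-trivial ideal.
\<close>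

section \<open>Square-summable functions and bounded operators\<close>

text \<open>The two sufficient conditions call for different averages because of one obstacle. If
  \<open>K = N\<close>, no element outside \<open>N\<close> fixes a half-tree pointwise, so a
  half-tree displaced by some elements contains a smaller one displaced by the next as well, and one
  half-tree serves a whole finite set. If \<open>K\<close> is larger, an element may fix the
  half-tree displaced by another, so each element keeps a half-tree of its own; conjugators
  supported in one of these disjoint half-trees fix the others pointwise, which is why the separate
  averages can be composed. The geometry is phrased in half-trees under inclusion. The hypotheses on
  the action become two facts: every half-tree can be moved into every other, and every half-tree
  contains two disjoint ones. Points of the boundary appear as decreasing sequences of half-trees
  with empty intersection. Amenability enters through almost invariant unit vectors. Their absence
  gives a norm gap that powers amplify; their presence replaces weak containment. Hahn--Banach links
  them to invariant means in both directions.\<close>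

lemma l2_outside: "f \<in> l2 H \<Longrightarrow> x \<notin> carrier H \<Longrightarrow> f x = 0"
  by (simp add: l2_def)

lemma l2_zero [simp]: "(\<lambda>_. 0) \<in> l2 H"
  by (simp add: l2_def)

lemma l2norm_zero [simp]: "l2norm H (\<lambda>_. 0) = 0"
  by (simp add: l2norm_def)

lemma l2norm_nonneg [simp]: "0 \<le> l2norm H f"
  unfolding l2norm_def by (auto intro!: infsum_nonneg)

lemma l2_L2_set_le:
  assumes "f \<in> l2 H" "finite F" "F \<subseteq> carrier H"
  shows "L2_set (\<lambda>x. cmod (f x)) F \<le> l2norm H f"
  unfolding L2_set_def l2norm_def
  using assms by (intro real_sqrt_le_mono finite_sum_le_infsum) (auto simp: l2_def)

text \<open>A sum of non-negative terms is the supremum of its finite partial sums, so both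
  membership and the norm bound can be tested on finite sets, where the triangle inequality for
  \<open>L2_set\<close> is available.\<close>

lemma l2_boundI:
  assumes "\<And>x. x \<notin> carrier H \<Longrightarrow> f x = 0"
    and b: "\<And>F. finite F \<Longrightarrow> F \<subseteq> carrier H \<Longrightarrow> L2_set (\<lambda>x. cmod (f x)) F \<le> C"
  shows "f \<in> l2 H" "l2norm H f \<le> C"
proof -
  have C0: "0 \<le> C" using b[of "{}"] by simp
  have s: "(\<Sum>x\<in>F. (cmod (f x))\<^sup>2) \<le> C\<^sup>2" if "finite F" "F \<subseteq> carrier H" for F
    using b[OF that] C0 by (metis L2_set_def real_sqrt_le_iff real_sqrt_unique)
  have sm: "(\<lambda>x. (cmod (f x))\<^sup>2) summable_on carrier H"
    by (rule nonneg_bdd_above_summable_on) (auto simp: bdd_above_def intro!: exI[of _ "C\<^sup>2"] s)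
  then show "f \<in> l2 H" using assms by (simp add: l2_def)
  have "infsum (\<lambda>x. (cmod (f x))\<^sup>2) (carrier H) \<le> C\<^sup>2"
    by (rule infsum_le_finite_sums[OF sm]) (use s in auto)
  then show "l2norm H f \<le> C" unfolding l2norm_def using C0 real_le_lsqrt
    by (simp add: infsum_nonneg real_le_lsqrt)
qed

lemma l2_lincomb:
  assumes "f \<in> l2 H" "g \<in> l2 H"
  shows "(\<lambda>x. f x + c * g x) \<in> l2 H"
    and "l2norm H (\<lambda>x. f x + c * g x) \<le> l2norm H f + cmod c * l2norm H g"
proof -
  have b: "L2_set (\<lambda>x. cmod (f x + c * g x)) F \<le> l2norm H f + cmod c * l2norm H g"
    if F: "finite F" "F \<subseteq> carrier H" for F
  proof -
    have "L2_set (\<lambda>x. cmod (f x + c * g x)) F \<le> L2_set (\<lambda>x. cmod (f x) + cmod c * cmod (g x)) F"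
      by (rule L2_set_mono) (auto intro: norm_triangle_le simp: norm_mult)
    also have "\<dots> \<le> L2_set (\<lambda>x. cmod (f x)) F + L2_set (\<lambda>x. cmod c * cmod (g x)) F"
      by (rule L2_set_triangle_ineq)
    also have "L2_set (\<lambda>x. cmod c * cmod (g x)) F = cmod c * L2_set (\<lambda>x. cmod (g x)) F"
      by (simp add: L2_set_right_distrib)
    finally show ?thesis using l2_L2_set_le[OF assms(1) F] l2_L2_set_le[OF assms(2) F]
      by (smt (verit) mult_left_mono norm_ge_zero)
  qed
  note * = l2_boundI[where H=H and f="\<lambda>x. f x + c * g x", OF _ b]
  show "(\<lambda>x. f x + c * g x) \<in> l2 H"
    "l2norm H (\<lambda>x. f x + c * g x) \<le> l2norm H f + cmod c * l2norm H g"
    using * assms by (auto simp: l2_outside)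
qed

lemma l2_add: "f \<in> l2 H \<Longrightarrow> g \<in> l2 H \<Longrightarrow> (\<lambda>x. f x + g x) \<in> l2 H"
  and l2norm_add: "f \<in> l2 H \<Longrightarrow> g \<in> l2 H \<Longrightarrow> l2norm H (\<lambda>x. f x + g x) \<le> l2norm H f + l2norm H g"
  using l2_lincomb[of f H g 1] by auto

lemma l2_diff: "f \<in> l2 H \<Longrightarrow> g \<in> l2 H \<Longrightarrow> (\<lambda>x. f x - g x) \<in> l2 H"
  and l2norm_diff: "f \<in> l2 H \<Longrightarrow> g \<in> l2 H \<Longrightarrow> l2norm H (\<lambda>x. f x - g x) \<le> l2norm H f + l2norm H g"
  using l2_lincomb[of f H g "-1"] by auto

lemma l2_scale: "f \<in> l2 H \<Longrightarrow> (\<lambda>x. c * f x) \<in> l2 H"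
  using l2_lincomb(1)[of "\<lambda>_. 0" H f c] by simp

lemma l2norm_scale: "f \<in> l2 H \<Longrightarrow> l2norm H (\<lambda>x. c * f x) = cmod c * l2norm H f"
  unfolding l2norm_def
  by (simp add: norm_mult power_mult_distrib infsum_cmult_right' real_sqrt_mult)

lemma l2norm_divide: "f \<in> l2 H \<Longrightarrow> l2norm H (\<lambda>x. f x / c) = l2norm H f / cmod c"
  using l2norm_scale[of f H "1/c"] by (simp add: norm_divide)

lemma l2_sum:
  assumes "finite I" "\<And>i. i \<in> I \<Longrightarrow> f i \<in> l2 H"
  shows "(\<lambda>x. \<Sum>i\<in>I. f i x) \<in> l2 H" "l2norm H (\<lambda>x. \<Sum>i\<in>I. f i x) \<le> (\<Sum>i\<in>I. l2norm H (f i))"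
proof -
  have "(\<lambda>x. \<Sum>i\<in>I. f i x) \<in> l2 H \<and> l2norm H (\<lambda>x. \<Sum>i\<in>I. f i x) \<le> (\<Sum>i\<in>I. l2norm H (f i))"
    using assms
  proof (induction I)
    case (insert a I)
    then show ?case using l2_add[of "f a" H "\<lambda>x. \<Sum>i\<in>I. f i x"] l2norm_add[of "f a" H "\<lambda>x. \<Sum>i\<in>I. f i x"]
      by fastforce
  qed simp
  then show "(\<lambda>x. \<Sum>i\<in>I. f i x) \<in> l2 H" "l2norm H (\<lambda>x. \<Sum>i\<in>I. f i x) \<le> (\<Sum>i\<in>I. l2norm H (f i))"
    by auto
qed

lemma l2_sum_list:
  assumes "\<And>i. i \<in> set l \<Longrightarrow> f i \<in> l2 H"
  shows "(\<lambda>x. \<Sum>i\<leftarrow>l. f i x) \<in> l2 H" "l2norm H (\<lambda>x. \<Sum>i\<leftarrow>l. f i x) \<le> (\<Sum>i\<leftarrow>l. l2norm H (f i))"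
proof -
  have "(\<lambda>x. \<Sum>i\<leftarrow>l. f i x) \<in> l2 H \<and> l2norm H (\<lambda>x. \<Sum>i\<leftarrow>l. f i x) \<le> (\<Sum>i\<leftarrow>l. l2norm H (f i))"
    using assms
  proof (induction l)
    case (Cons a l)
    then show ?case using l2_add[of "f a" H "\<lambda>x. \<Sum>i\<leftarrow>l. f i x"] l2norm_add[of "f a" H "\<lambda>x. \<Sum>i\<leftarrow>l. f i x"]
      by fastforce
  qed simp
  then show "(\<lambda>x. \<Sum>i\<leftarrow>l. f i x) \<in> l2 H" "l2norm H (\<lambda>x. \<Sum>i\<leftarrow>l. f i x) \<le> (\<Sum>i\<leftarrow>l. l2norm H (f i))"
    by auto
qed

lemma l2_cmod_le: "f \<in> l2 H \<Longrightarrow> cmod (f x) \<le> l2norm H f"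
  using l2_L2_set_le[of f H "{x}"] l2_outside[of f H x] by (cases "x \<in> carrier H") auto

lemma l2_finite_support:
  assumes "finite F" "F \<subseteq> carrier H" "\<And>x. x \<notin> F \<Longrightarrow> f x = 0"
  shows "f \<in> l2 H" "l2norm H f = L2_set (\<lambda>x. cmod (f x)) F"
proof -
  have le: "L2_set (\<lambda>x. cmod (f x)) E \<le> L2_set (\<lambda>x. cmod (f x)) F" if "finite E" for E
  proof -
    have "L2_set (\<lambda>x. cmod (f x)) E = L2_set (\<lambda>x. cmod (f x)) (E \<inter> F)"
      unfolding L2_set_def using that assms
      by (metis (mono_tags, lifting) Diff_iff IntI Int_lower1 norm_zero power_zero_numeral sum.mono_neutral_right zero_neq_numeral)
    also have "\<dots> \<le> L2_set (\<lambda>x. cmod (f x)) F"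
      unfolding L2_set_def using assms by (intro real_sqrt_le_mono sum_mono2) auto
    finally show ?thesis .
  qed
  have "f x = 0" if "x \<notin> carrier H" for x using assms that by auto
  note b = l2_boundI[of H f, OF this le]
  show "f \<in> l2 H" using b by blast
  then show "l2norm H f = L2_set (\<lambda>x. cmod (f x)) F"
    using l2_L2_set_le[of f H F] b assms by (simp add: order_antisym)
qed

lemma l2_restrict:
  assumes "f \<in> l2 H"
  shows "(\<lambda>x. if x \<in> X then f x else 0) \<in> l2 H"
    and "l2norm H (\<lambda>x. if x \<in> X then f x else 0) \<le> l2norm H f"
proof -
  have "L2_set (\<lambda>x. cmod (if x \<in> X then f x else 0)) F \<le> l2norm H f" if "finite F" "F \<subseteq> carrier H" for F
    by (rule order_trans[OF L2_set_mono l2_L2_set_le[OF assms that]]) auto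
  then show "(\<lambda>x. if x \<in> X then f x else 0) \<in> l2 H"
    "l2norm H (\<lambda>x. if x \<in> X then f x else 0) \<le> l2norm H f"
    using l2_boundI[of H "\<lambda>x. if x \<in> X then f x else 0" "l2norm H f"] assms by (auto simp: l2_outside)
qed

definition delta :: "'a \<Rightarrow> 'a \<Rightarrow> complex" where
  "delta g = (\<lambda>x. if x = g then 1 else 0)"

lemma delta_l2 [simp]: "g \<in> carrier H \<Longrightarrow> delta g \<in> l2 H"
  and l2norm_delta [simp]: "g \<in> carrier H \<Longrightarrow> l2norm H (delta g) = 1"
  using l2_finite_support[of "{g}" H "delta g"] by (auto simp: delta_def)

lemma l2norm_eq_0: "f \<in> l2 H \<Longrightarrow> l2norm H f = 0 \<Longrightarrow> f = (\<lambda>_. 0)"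
  using l2_cmod_le[of f H] by (intro ext) auto

text \<open>Needed for uniform convexity: two unit vectors whose sum has norm near 2 must be close
  to each other.\<close>

lemma l2_parallelogram:
  assumes "f \<in> l2 H" "g \<in> l2 H"
  shows "(l2norm H (\<lambda>x. f x + g x))\<^sup>2 + (l2norm H (\<lambda>x. f x - g x))\<^sup>2 = 2 * (l2norm H f)\<^sup>2 + 2 * (l2norm H g)\<^sup>2"
proof -
  have sq: "(l2norm H h)\<^sup>2 = infsum (\<lambda>x. (cmod (h x))\<^sup>2) (carrier H)" for h
    unfolding l2norm_def by (simp add: infsum_nonneg)
  have s: "h \<in> l2 H \<Longrightarrow> (\<lambda>x. (cmod (h x))\<^sup>2) summable_on carrier H" for h
    by (simp add: l2_def)
  have pt: "(cmod (a + b))\<^sup>2 + (cmod (a - b))\<^sup>2 = 2 * (cmod a)\<^sup>2 + 2 * (cmod b)\<^sup>2" for a b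
    unfolding cmod_power2 by (simp add: power2_eq_square algebra_simps)
  have "(l2norm H (\<lambda>x. f x + g x))\<^sup>2 + (l2norm H (\<lambda>x. f x - g x))\<^sup>2
     = infsum (\<lambda>x. (cmod (f x + g x))\<^sup>2 + (cmod (f x - g x))\<^sup>2) (carrier H)"
    unfolding sq by (subst infsum_add) (use s[OF l2_add[OF assms]] s[OF l2_diff[OF assms]] in auto)
  also have "\<dots> = infsum (\<lambda>x. 2 * (cmod (f x))\<^sup>2 + 2 * (cmod (g x))\<^sup>2) (carrier H)"
    by (simp add: pt)
  also have "\<dots> = 2 * (l2norm H f)\<^sup>2 + 2 * (l2norm H g)\<^sup>2"
    unfolding sq by (subst infsum_add) (use s assms in \<open>auto simp: infsum_cmult_right' intro!: summable_on_cmult_right\<close>)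
  finally show ?thesis .
qed

section \<open>Bounded operators and their norm\<close>

lemma bounded_opsI:
  assumes "\<And>f. f \<notin> l2 H \<Longrightarrow> T f = (\<lambda>_. 0)" "\<And>f. f \<in> l2 H \<Longrightarrow> T f \<in> l2 H"
    and "\<And>f g c. f \<in> l2 H \<Longrightarrow> g \<in> l2 H \<Longrightarrow> T (\<lambda>x. f x + c * g x) = (\<lambda>x. T f x + c * T g x)"
    and "\<And>f. f \<in> l2 H \<Longrightarrow> l2norm H (T f) \<le> C * l2norm H f"
  shows "T \<in> bounded_ops H"
  unfolding bounded_ops_def using assms by blast

lemma bounded_ops_outside: "T \<in> bounded_ops H \<Longrightarrow> f \<notin> l2 H \<Longrightarrow> T f = (\<lambda>_. 0)"
  and bounded_ops_l2: "T \<in> bounded_ops H \<Longrightarrow> f \<in> l2 H \<Longrightarrow> T f \<in> l2 H"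
  and bounded_ops_lin: "T \<in> bounded_ops H \<Longrightarrow> f \<in> l2 H \<Longrightarrow> g \<in> l2 H \<Longrightarrow>
     T (\<lambda>x. f x + c * g x) = (\<lambda>x. T f x + c * T g x)"
  by (auto simp: bounded_ops_def)

lemma bounded_ops_l2': "T \<in> bounded_ops H \<Longrightarrow> T f \<in> l2 H"
  by (cases "f \<in> l2 H") (auto simp: bounded_ops_l2 bounded_ops_outside)

lemma bounded_ops_zero:
  assumes "T \<in> bounded_ops H" shows "T (\<lambda>_. 0) = (\<lambda>_. 0)"
  using bounded_ops_lin[OF assms l2_zero l2_zero, of "-1"] by simp

lemma bounded_ops_scale: "T \<in> bounded_ops H \<Longrightarrow> f \<in> l2 H \<Longrightarrow> T (\<lambda>x. c * f x) = (\<lambda>x. c * T f x)"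
  using bounded_ops_lin[of T H "\<lambda>_. 0" f c] by (simp add: bounded_ops_zero)

lemma bounded_ops_add: "T \<in> bounded_ops H \<Longrightarrow> f \<in> l2 H \<Longrightarrow> g \<in> l2 H \<Longrightarrow> T (\<lambda>x. f x + g x) = (\<lambda>x. T f x + T g x)"
  using bounded_ops_lin[of T H f g 1] by simp

lemma bounded_ops_diff: "T \<in> bounded_ops H \<Longrightarrow> f \<in> l2 H \<Longrightarrow> g \<in> l2 H \<Longrightarrow> T (\<lambda>x. f x - g x) = (\<lambda>x. T f x - T g x)"
  using bounded_ops_lin[of T H f g "-1"] by simp

lemma bounded_ops_sum_list:
  assumes "T \<in> bounded_ops H" "\<And>i. i \<in> set l \<Longrightarrow> f i \<in> l2 H"
  shows "T (\<lambda>x. \<Sum>i\<leftarrow>l. f i x) = (\<lambda>x. \<Sum>i\<leftarrow>l. T (f i) x)"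
  using assms(2) by (induction l) (auto simp: bounded_ops_zero[OF assms(1)] bounded_ops_add[OF assms(1)] l2_sum_list)

lemma opnorm_bound:
  assumes "T \<in> bounded_ops H" "f \<in> l2 H"
  shows "l2norm H (T f) \<le> opnorm H T * l2norm H f"
proof (cases "l2norm H f = 0")
  case True
  then show ?thesis using l2norm_eq_0[OF assms(2)] bounded_ops_zero[OF assms(1)] by simp
next
  case False
  then have pos: "l2norm H f > 0" using l2norm_nonneg[of H f] by linarith
  obtain C where C: "\<And>f. f \<in> l2 H \<Longrightarrow> l2norm H (T f) \<le> C * l2norm H f"
    using assms(1) unfolding bounded_ops_def by blast
  have bdd: "bdd_above {l2norm H (T f) | f. f \<in> l2 H \<and> l2norm H f \<le> 1}"
  proof -
    have "l2norm H (T f) \<le> \<bar>C\<bar>" if "f \<in> l2 H" "l2norm H f \<le> 1" for f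
      by (smt (verit, best) C[OF that(1)] that(2) mult_left_le mult_right_mono l2norm_nonneg)
    then show ?thesis unfolding bdd_above_def by auto
  qed
  let ?g = "\<lambda>x. complex_of_real (1 / l2norm H f) * f x"
  have g: "?g \<in> l2 H" "l2norm H ?g = 1" using assms(2) pos by (auto simp: l2_scale l2norm_scale simp del: of_real_divide)
  have "l2norm H (T ?g) \<le> opnorm H T"
    unfolding opnorm_def by (rule cSup_upper[OF _ bdd]) (use g in auto)
  moreover have "l2norm H (T ?g) = l2norm H (T f) / l2norm H f"
    using assms pos by (simp add: bounded_ops_scale l2norm_scale bounded_ops_l2 del: of_real_divide)
  ultimately have "l2norm H (T f) / l2norm H f \<le> opnorm H T" by simp
  then show ?thesis using pos by (simp add: pos_divide_le_eq)
qed

lemma opnorm_le: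
  assumes "0 \<le> C" "\<And>f. f \<in> l2 H \<Longrightarrow> l2norm H (T f) \<le> C * l2norm H f"
  shows "opnorm H T \<le> C"
  unfolding opnorm_def
proof (rule cSup_least)
  show "{l2norm H (T f) |f. f \<in> l2 H \<and> l2norm H f \<le> 1} \<noteq> {}"
    by (auto intro!: exI[of _ "\<lambda>_. 0"])
next
  fix y assume "y \<in> {l2norm H (T f) |f. f \<in> l2 H \<and> l2norm H f \<le> 1}"
  then obtain f where f: "f \<in> l2 H" "l2norm H f \<le> 1" "y = l2norm H (T f)" by auto
  then show "y \<le> C" using assms(2)[of f] assms(1) mult_left_le[of "l2norm H f" C] by linarith
qed

lemma opnorm_nonneg: "T \<in> bounded_ops H \<Longrightarrow> 0 \<le> opnorm H T"
proof -
  assume T: "T \<in> bounded_ops H"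
  obtain C where C: "\<And>f. f \<in> l2 H \<Longrightarrow> l2norm H (T f) \<le> C * l2norm H f"
    using T unfolding bounded_ops_def by blast
  have "l2norm H (T f) \<le> \<bar>C\<bar>" if "f \<in> l2 H" "l2norm H f \<le> 1" for f
    by (smt (verit, best) C[OF that(1)] that(2) mult_left_le mult_right_mono l2norm_nonneg)
  then have bdd: "bdd_above {l2norm H (T f) | f. f \<in> l2 H \<and> l2norm H f \<le> 1}"
    unfolding bdd_above_def by auto
  have "0 \<in> {l2norm H (T f) | f. f \<in> l2 H \<and> l2norm H f \<le> 1}"
    using bounded_ops_zero[OF T] by (auto intro!: exI[of _ "\<lambda>_. 0"])
  then show ?thesis unfolding opnorm_def by (rule cSup_upper[OF _ bdd])
qed

lemma bounded_ops_lincomb: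
  assumes S: "S \<in> bounded_ops H" and T: "T \<in> bounded_ops H"
  shows "(\<lambda>f x. S f x + c * T f x) \<in> bounded_ops H"
proof (rule bounded_opsI[where C="opnorm H S + cmod c * opnorm H T"])
  fix f assume f: "f \<in> l2 H"
  note Sf = bounded_ops_l2[OF S f] and Tf = bounded_ops_l2[OF T f]
  show "(\<lambda>x. S f x + c * T f x) \<in> l2 H" using Sf Tf by (rule l2_lincomb)
  have "l2norm H (\<lambda>x. S f x + c * T f x) \<le> l2norm H (S f) + cmod c * l2norm H (T f)"
    using Sf Tf by (rule l2_lincomb)
  also have "\<dots> \<le> opnorm H S * l2norm H f + cmod c * (opnorm H T * l2norm H f)"
    using opnorm_bound[OF S f] opnorm_bound[OF T f] by (intro add_mono mult_left_mono) auto
  finally show "l2norm H (\<lambda>x. S f x + c * T f x) \<le> (opnorm H S + cmod c * opnorm H T) * l2norm H f"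
    by (simp add: algebra_simps)
qed (use S T in \<open>auto simp: bounded_ops_outside bounded_ops_lin algebra_simps\<close>)

lemma bounded_ops_op_diff: "S \<in> bounded_ops H \<Longrightarrow> T \<in> bounded_ops H \<Longrightarrow> op_diff S T \<in> bounded_ops H"
  using bounded_ops_lincomb[of S H T "-1"] by (simp add: op_diff_def)

lemma bounded_ops_zero_op: "(\<lambda>f x. 0) \<in> bounded_ops H"
  by (rule bounded_opsI[where C=0]) auto

lemma bounded_ops_comp:
  assumes S: "S \<in> bounded_ops H" and T: "T \<in> bounded_ops H"
  shows "S \<circ> T \<in> bounded_ops H"
proof (rule bounded_opsI[where C="opnorm H S * opnorm H T"])
  fix f assume f: "f \<in> l2 H"
  note Tf = bounded_ops_l2[OF T f]
  show "(S \<circ> T) f \<in> l2 H" using bounded_ops_l2[OF S Tf] by simp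
  show "l2norm H ((S \<circ> T) f) \<le> opnorm H S * opnorm H T * l2norm H f"
    using opnorm_bound[OF S Tf] opnorm_bound[OF T f] opnorm_nonneg[OF S]
    by (smt (verit, best) comp_apply mult.assoc mult_left_mono)
qed (use S T in \<open>auto simp: bounded_ops_outside bounded_ops_lin bounded_ops_zero bounded_ops_l2\<close>)

text \<open>An inequality for each vector replaces the supremum in \<open>opnorm\<close>, which is
  informative only for sets that are bounded above. Sums and compositions can then be estimated
  without any argument about suprema.\<close>

definition op_close :: "('a, 'b) monoid_scheme \<Rightarrow> (('a \<Rightarrow> complex) \<Rightarrow> ('a \<Rightarrow> complex)) \<Rightarrow> (('a \<Rightarrow> complex) \<Rightarrow> ('a \<Rightarrow> complex)) \<Rightarrow> real \<Rightarrow> bool" where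
  "op_close H S T \<epsilon> \<longleftrightarrow> (\<forall>f\<in>l2 H. l2norm H (\<lambda>x. S f x - T f x) \<le> \<epsilon> * l2norm H f)"

lemma op_closeD: "op_close H S T \<epsilon> \<Longrightarrow> f \<in> l2 H \<Longrightarrow> l2norm H (\<lambda>x. S f x - T f x) \<le> \<epsilon> * l2norm H f"
  by (simp add: op_close_def)

lemma op_close_refl: "0 \<le> \<epsilon> \<Longrightarrow> op_close H T T \<epsilon>"
  by (simp add: op_close_def)

lemma opnorm_imp_op_close:
  assumes "S \<in> bounded_ops H" "T \<in> bounded_ops H" "opnorm H (op_diff S T) < \<epsilon>"
  shows "op_close H S T \<epsilon>"
  unfolding op_close_def
proof
  fix f assume f: "f \<in> l2 H"
  have "l2norm H (op_diff S T f) \<le> opnorm H (op_diff S T) * l2norm H f"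
    by (rule opnorm_bound[OF bounded_ops_op_diff[OF assms(1,2)] f])
  also have "\<dots> \<le> \<epsilon> * l2norm H f" using assms(3) by (intro mult_right_mono) auto
  finally show "l2norm H (\<lambda>x. S f x - T f x) \<le> \<epsilon> * l2norm H f" by (simp add: op_diff_def)
qed

lemma op_close_imp_opnorm:
  assumes "op_close H S T \<delta>" "0 \<le> \<delta>" "\<delta> < \<epsilon>"
  shows "opnorm H (op_diff S T) < \<epsilon>"
  using opnorm_le[of \<delta> H "op_diff S T"] assms by (auto simp: op_close_def op_diff_def)

lemma op_close_trans:
  assumes "op_close H R S \<delta>" "op_close H S T \<epsilon>" "R \<in> bounded_ops H" "S \<in> bounded_ops H" "T \<in> bounded_ops H"
  shows "op_close H R T (\<delta> + \<epsilon>)"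
  unfolding op_close_def
proof
  fix f assume f: "f \<in> l2 H"
  have l: "(\<lambda>x. R f x - S f x) \<in> l2 H" "(\<lambda>x. S f x - T f x) \<in> l2 H"
    using l2_diff[OF bounded_ops_l2[OF assms(3) f] bounded_ops_l2[OF assms(4) f]]
      l2_diff[OF bounded_ops_l2[OF assms(4) f] bounded_ops_l2[OF assms(5) f]] by auto
  show "l2norm H (\<lambda>x. R f x - T f x) \<le> (\<delta> + \<epsilon>) * l2norm H f"
    using l2norm_add[OF l] op_closeD[OF assms(1) f] op_closeD[OF assms(2) f] by (simp add: algebra_simps)
qed

lemma op_close_lincomb:
  assumes S: "S \<in> bounded_ops H" and T: "T \<in> bounded_ops H"
    and XY: "X \<subseteq> bounded_ops H" "Y \<subseteq> bounded_ops H"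
    and SX: "\<And>\<epsilon>. \<epsilon> > 0 \<Longrightarrow> \<exists>S'\<in>X. op_close H S S' \<epsilon>"
    and TY: "\<And>\<epsilon>. \<epsilon> > 0 \<Longrightarrow> \<exists>T'\<in>Y. op_close H T T' \<epsilon>"
    and e: "\<epsilon> > 0"
  shows "\<exists>S'\<in>X. \<exists>T'\<in>Y. op_close H (\<lambda>f x. S f x + c * T f x) (\<lambda>f x. S' f x + c * T' f x) \<epsilon>"
proof -
  \<comment> \<open>The two errors enter with total weight \<open>1 + cmod c\<close>.\<close>
  let ?d = "\<epsilon> / (1 + cmod c)"
  have c: "1 + cmod c > 0" by (simp add: add_pos_nonneg)
  have d: "?d > 0" using e c by simp
  obtain S' where S': "S' \<in> X" "op_close H S S' ?d" using SX[OF d] by blast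
  obtain T' where T': "T' \<in> Y" "op_close H T T' ?d" using TY[OF d] by blast
  have "l2norm H (\<lambda>x. S f x + c * T f x - (S' f x + c * T' f x)) \<le> \<epsilon> * l2norm H f" if f: "f \<in> l2 H" for f
  proof -
    have b: "S' \<in> bounded_ops H" "T' \<in> bounded_ops H" using S' T' XY by auto
    note l = l2_diff[OF bounded_ops_l2[OF S f] bounded_ops_l2[OF b(1) f]]
      l2_diff[OF bounded_ops_l2[OF T f] bounded_ops_l2[OF b(2) f]]
    have "(\<lambda>x. S f x + c * T f x - (S' f x + c * T' f x)) = (\<lambda>x. (S f x - S' f x) + c * (T f x - T' f x))"
      by (auto simp: algebra_simps)
    then have "l2norm H (\<lambda>x. S f x + c * T f x - (S' f x + c * T' f x))
      \<le> ?d * l2norm H f + cmod c * (?d * l2norm H f)"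
      using order_trans[OF l2_lincomb(2)[OF l, of c]
        add_mono[OF op_closeD[OF S'(2) f] mult_left_mono[OF op_closeD[OF T'(2) f] norm_ge_zero]]]
      by simp
    also have "\<dots> = (?d * (1 + cmod c)) * l2norm H f"
      by (simp only: distrib_left distrib_right mult_1_right mult.assoc mult.left_commute)
    also have "?d * (1 + cmod c) = \<epsilon>" using c by simp
    finally show ?thesis .
  qed
  then show ?thesis using S' T' unfolding op_close_def by blast
qed

lemma op_close_comp:
  assumes Sb: "S \<in> bounded_ops H" and Tb: "T \<in> bounded_ops H"
    and XY: "X \<subseteq> bounded_ops H" "Y \<subseteq> bounded_ops H"
    and SX: "\<And>\<epsilon>. \<epsilon> > 0 \<Longrightarrow> \<exists>S'\<in>X. op_close H S S' \<epsilon>"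
    and TY: "\<And>\<epsilon>. \<epsilon> > 0 \<Longrightarrow> \<exists>T'\<in>Y. op_close H T T' \<epsilon>"
    and e: "\<epsilon> > 0"
  shows "\<exists>S'\<in>X. \<exists>T'\<in>Y. op_close H (S \<circ> T) (S' \<circ> T') \<epsilon>"
proof -
  let ?d = "\<epsilon> / 2 / (1 + opnorm H S)"
  have c: "1 + opnorm H S > 0" using opnorm_nonneg[OF Sb] by simp
  have d: "?d > 0" using e c by simp
  obtain T' where T': "T' \<in> Y" "op_close H T T' ?d" using TY[OF d] by blast
  have T'b: "T' \<in> bounded_ops H" using T' XY by auto
  \<comment> \<open>From \<open>S T - S' T' = S (T - T') + (S - S') T'\<close>. The tolerance for
    \<open>S'\<close> depends on the norm of \<open>T'\<close>, so \<open>T'\<close> is fixed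
    first.\<close>
  let ?d' = "\<epsilon> / 2 / (1 + opnorm H T')"
  have c': "1 + opnorm H T' > 0" using opnorm_nonneg[OF T'b] by simp
  have d': "?d' > 0" using e c' by simp
  obtain S' where S': "S' \<in> X" "op_close H S S' ?d'" using SX[OF d'] by blast
  have S'b: "S' \<in> bounded_ops H" using S' XY by auto
  have "l2norm H (\<lambda>x. (S \<circ> T) f x - (S' \<circ> T') f x) \<le> \<epsilon> * l2norm H f" if f: "f \<in> l2 H" for f
  proof -
    have l: "T f \<in> l2 H" "T' f \<in> l2 H" using f Tb T'b by (auto simp: bounded_ops_l2)
    have l1: "(\<lambda>x. T f x - T' f x) \<in> l2 H" using l by (rule l2_diff)
    have l2: "S (\<lambda>x. T f x - T' f x) \<in> l2 H" using Sb l1 by (rule bounded_ops_l2)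
    have l3: "(\<lambda>x. S (T' f) x - S' (T' f) x) \<in> l2 H" by (rule l2_diff[OF bounded_ops_l2[OF Sb l(2)] bounded_ops_l2[OF S'b l(2)]])
    have "(\<lambda>x. (S \<circ> T) f x - (S' \<circ> T') f x)
      = (\<lambda>x. S (\<lambda>x. T f x - T' f x) x + (S (T' f) x - S' (T' f) x))"
      using l by (simp add: bounded_ops_diff[OF Sb])
    then have "l2norm H (\<lambda>x. (S \<circ> T) f x - (S' \<circ> T') f x)
       \<le> l2norm H (S (\<lambda>x. T f x - T' f x)) + l2norm H (\<lambda>x. S (T' f) x - S' (T' f) x)"
      using l2norm_add[OF l2 l3] by simp
    also have "\<dots> \<le> opnorm H S * (?d * l2norm H f) + ?d' * (opnorm H T' * l2norm H f)"
    proof (rule add_mono)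
      show "l2norm H (S (\<lambda>x. T f x - T' f x)) \<le> opnorm H S * (?d * l2norm H f)"
        using opnorm_bound[OF Sb l1] mult_left_mono[OF op_closeD[OF T'(2) f] opnorm_nonneg[OF Sb]] by linarith
      show "l2norm H (\<lambda>x. S (T' f) x - S' (T' f) x) \<le> ?d' * (opnorm H T' * l2norm H f)"
        using op_closeD[OF S'(2) l(2)] mult_left_mono[OF opnorm_bound[OF T'b f], of ?d'] d' by linarith
    qed
    also have "\<dots> = (opnorm H S * ?d + ?d' * opnorm H T') * l2norm H f" by (simp add: algebra_simps)
    also have "\<dots> \<le> \<epsilon> * l2norm H f"
    proof (rule mult_right_mono)
      have "opnorm H S * ?d \<le> \<epsilon>/2" using c e by (simp add: field_simps)
      moreover have "?d' * opnorm H T' \<le> \<epsilon>/2" using c' e by (simp add: field_simps)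
      ultimately show "opnorm H S * ?d + ?d' * opnorm H T' \<le> \<epsilon>" by linarith
    qed simp
    finally show ?thesis .
  qed
  then show ?thesis using S' T' unfolding op_close_def by blast
qed

section \<open>The regular representation and averages of conjugates\<close>

lemma lreg_apply: "f \<in> l2 H \<Longrightarrow> x \<in> carrier H \<Longrightarrow> lreg H g f x = f (inv\<^bsub>H\<^esub> g \<otimes>\<^bsub>H\<^esub> x)"
  and lreg_outside: "f \<notin> l2 H \<Longrightarrow> lreg H g f = (\<lambda>_. 0)"
  and lreg_outside': "x \<notin> carrier H \<Longrightarrow> lreg H g f x = 0"
  by (auto simp: lreg_def)

context group
begin

lemma bij_betw_ltimes: "g \<in> carrier G \<Longrightarrow> bij_betw (\<lambda>x. g \<otimes> x) (carrier G) (carrier G)"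
  by (rule bij_betw_byWitness[where f'="\<lambda>x. inv g \<otimes> x"]) (auto simp: m_assoc[symmetric])

lemma lreg_l2 [simp]:
  assumes "g \<in> carrier G" shows "lreg G g f \<in> l2 G"
proof (cases "f \<in> l2 G")
  case True
  have "(\<lambda>x. (cmod (f x))\<^sup>2) summable_on carrier G" using True by (simp add: l2_def)
  then have "(\<lambda>x. (cmod (f (inv g \<otimes> x)))\<^sup>2) summable_on carrier G"
    using summable_on_reindex_bij_betw[OF bij_betw_ltimes[OF inv_closed[OF assms]], of "\<lambda>x. (cmod (f x))\<^sup>2"] by simp
  then have "(\<lambda>x. (cmod (lreg G g f x))\<^sup>2) summable_on carrier G"
    using True by (subst summable_on_cong[where g="\<lambda>x. (cmod (f (inv g \<otimes> x)))\<^sup>2"]) (auto simp: lreg_apply)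
  then show ?thesis by (simp add: l2_def lreg_outside')
qed (simp add: lreg_outside)

lemma l2norm_lreg [simp]:
  assumes "g \<in> carrier G" "f \<in> l2 G" shows "l2norm G (lreg G g f) = l2norm G f"
proof -
  have "infsum (\<lambda>x. (cmod (lreg G g f x))\<^sup>2) (carrier G) = infsum (\<lambda>x. (cmod (f (inv g \<otimes> x)))\<^sup>2) (carrier G)"
    using assms by (intro infsum_cong) (auto simp: lreg_apply)
  also have "\<dots> = infsum (\<lambda>x. (cmod (f x))\<^sup>2) (carrier G)"
    by (rule infsum_reindex_bij_betw[OF bij_betw_ltimes[OF inv_closed[OF assms(1)]]])
  finally show ?thesis by (simp add: l2norm_def)
qed

lemma lreg_lreg:
  assumes "g \<in> carrier G" "h \<in> carrier G"
  shows "lreg G g (lreg G h f) = lreg G (g \<otimes> h) f"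
proof (cases "f \<in> l2 G")
  case True
  show ?thesis
  proof
    fix x show "lreg G g (lreg G h f) x = lreg G (g \<otimes> h) f x"
      using assms True by (cases "x \<in> carrier G") (auto simp: lreg_outside' lreg_apply inv_mult_group m_assoc)
  qed
next
  case False
  then show ?thesis by (auto simp: lreg_outside lreg_def)
qed

lemma lreg_one: "f \<in> l2 G \<Longrightarrow> lreg G \<one> f = f"
  by (rule ext) (auto simp: lreg_def l2_outside)

lemma lreg_lin:
  assumes "f \<in> l2 G" "h \<in> l2 G"
  shows "lreg G g (\<lambda>x. f x + c * h x) = (\<lambda>x. lreg G g f x + c * lreg G g h x)"
  using assms l2_lincomb(1)[OF assms, of c] by (auto simp: lreg_def)

lemma lreg_bounded: "g \<in> carrier G \<Longrightarrow> lreg G g \<in> bounded_ops G"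
  by (rule bounded_opsI[where C=1]) (auto simp: lreg_outside lreg_lin)

lemma lreg_delta:
  assumes "g \<in> carrier G" "h \<in> carrier G" shows "lreg G g (delta h) = delta (g \<otimes> h)"
proof
  fix x
  have "inv g \<otimes> x = h \<longleftrightarrow> x = g \<otimes> h" if "x \<in> carrier G"
    using assms that by (metis inv_solve_left)
  then show "lreg G g (delta h) x = delta (g \<otimes> h) x"
    using assms by (cases "x \<in> carrier G") (auto simp: lreg_outside' lreg_apply, auto simp: delta_def)
qed

lemma reg_span_zero: "(\<lambda>f x. 0) \<in> reg_span G"
  unfolding reg_span_def by (auto intro!: exI[of _ "{}"])

lemma reg_span_lreg: "g \<in> carrier G \<Longrightarrow> lreg G g \<in> reg_span G"
  unfolding reg_span_def by (auto intro!: exI[of _ "{g}"] exI[of _ "\<lambda>_. 1"])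

lemma reg_span_lincomb:
  assumes "S \<in> reg_span G" "T \<in> reg_span G"
  shows "(\<lambda>f x. S f x + c * T f x) \<in> reg_span G"
proof -
  obtain X a where X: "finite X" "X \<subseteq> carrier G" "S = (\<lambda>f x. \<Sum>g\<in>X. a g * lreg G g f x)"
    using assms(1) by (auto simp: reg_span_def)
  obtain Y b where Y: "finite Y" "Y \<subseteq> carrier G" "T = (\<lambda>f x. \<Sum>g\<in>Y. b g * lreg G g f x)"
    using assms(2) by (auto simp: reg_span_def)
  let ?d = "\<lambda>g. (if g \<in> X then a g else 0) + c * (if g \<in> Y then b g else 0)"
  have "(\<lambda>f x. S f x + c * T f x) = (\<lambda>f x. \<Sum>g\<in>X \<union> Y. ?d g * lreg G g f x)"
  proof (intro ext)
    fix f x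
    have 1: "(\<Sum>g\<in>X. a g * lreg G g f x) = (\<Sum>g\<in>X \<union> Y. (if g \<in> X then a g else 0) * lreg G g f x)"
      using X Y by (intro sum.mono_neutral_cong_left) auto
    have 2: "(\<Sum>g\<in>Y. b g * lreg G g f x) = (\<Sum>g\<in>X \<union> Y. (if g \<in> Y then b g else 0) * lreg G g f x)"
      using X Y by (intro sum.mono_neutral_cong_left) auto
    show "S f x + c * T f x = (\<Sum>g\<in>X \<union> Y. ?d g * lreg G g f x)"
      unfolding X(3) Y(3) 1 2 by (simp only: sum_distrib_left sum.distrib[symmetric] distrib_right mult.assoc)
  qed
  then show ?thesis unfolding reg_span_def using X Y
    by (intro CollectI exI[of _ "X \<union> Y"] exI[of _ ?d]) auto
qed

lemma reg_span_induct [consumes 1, case_names zero add]: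
  assumes "T \<in> reg_span G" "P (\<lambda>f x. 0)"
    and step: "\<And>T g c. T \<in> reg_span G \<Longrightarrow> P T \<Longrightarrow> g \<in> carrier G \<Longrightarrow> P (\<lambda>f x. T f x + c * lreg G g f x)"
  shows "P T"
proof -
  obtain X a where X: "finite X" "X \<subseteq> carrier G" "T = (\<lambda>f x. \<Sum>g\<in>X. a g * lreg G g f x)"
    using assms(1) by (auto simp: reg_span_def)
  have "P (\<lambda>f x. \<Sum>g\<in>X. a g * lreg G g f x)" using X(1,2)
  proof (induction X)
    case (insert h X)
    have "(\<lambda>f x. \<Sum>g\<in>insert h X. a g * lreg G g f x)
        = (\<lambda>f x. (\<Sum>g\<in>X. a g * lreg G g f x) + a h * lreg G h f x)"
      using insert by (simp add: add.commute)
    moreover have "(\<lambda>f x. \<Sum>g\<in>X. a g * lreg G g f x) \<in> reg_span G"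
      using insert unfolding reg_span_def by blast
    ultimately show ?case using insert step by auto
  qed (use assms in simp)
  then show ?thesis using X by simp
qed

lemma reg_span_bounded: "T \<in> reg_span G \<Longrightarrow> T \<in> bounded_ops G"
  by (induction rule: reg_span_induct) (auto intro: bounded_ops_zero_op bounded_ops_lincomb lreg_bounded)

lemma reg_span_comp:
  assumes "S \<in> reg_span G" "T \<in> reg_span G"
  shows "S \<circ> T \<in> reg_span G"
proof -
  have 1: "lreg G g \<circ> T \<in> reg_span G" if g: "g \<in> carrier G" for g
    using assms(2)
  proof (induction rule: reg_span_induct)
    case zero
    have "lreg G g \<circ> (\<lambda>f x. 0) = (\<lambda>(f::'a\<Rightarrow>complex) x. 0)" by (auto simp: lreg_def)
    then show ?case using reg_span_zero by metis
  next
    case (add T h c)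
    have "lreg G g \<circ> (\<lambda>f x. T f x + c * lreg G h f x) = (\<lambda>f x. (lreg G g \<circ> T) f x + c * lreg G (g \<otimes> h) f x)"
    proof
      fix f
      show "(lreg G g \<circ> (\<lambda>f x. T f x + c * lreg G h f x)) f = (\<lambda>x. (lreg G g \<circ> T) f x + c * lreg G (g \<otimes> h) f x)"
        using bounded_ops_l2'[OF reg_span_bounded[OF add(1)], of f] add g
        by (simp add: lreg_lin lreg_lreg)
    qed
    then show ?case using reg_span_lincomb[OF add.IH reg_span_lreg, of "g \<otimes> h" c] add g by simp
  qed
  show ?thesis using assms(1)
  proof (induction rule: reg_span_induct)
    case zero
    have "(\<lambda>f x. 0) \<circ> T = (\<lambda>(f::'a\<Rightarrow>complex) (x::'a). 0::complex)" by auto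
    then show ?case using reg_span_zero by metis
  next
    case (add S h c)
    have "(\<lambda>f x. S f x + c * lreg G h f x) \<circ> T = (\<lambda>f x. (S \<circ> T) f x + c * (lreg G h \<circ> T) f x)" by auto
    then show ?case using reg_span_lincomb[OF add.IH 1] add by simp
  qed
qed

lemma reduced_cstar_iff:
  "T \<in> reduced_cstar G \<longleftrightarrow> T \<in> bounded_ops G \<and> (\<forall>\<epsilon>>0. \<exists>S\<in>reg_span G. op_close G T S \<epsilon>)"
  (is "_ \<longleftrightarrow> ?R")
proof
  assume T: "T \<in> reduced_cstar G"
  then have Tb: "T \<in> bounded_ops G" by (simp add: reduced_cstar_def)
  have "\<exists>S\<in>reg_span G. op_close G T S \<epsilon>" if e: "\<epsilon> > 0" for \<epsilon>
    using T e opnorm_imp_op_close[OF Tb reg_span_bounded] unfolding reduced_cstar_def by blast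
  then show ?R using Tb by blast
next
  assume R: ?R
  have "\<exists>S\<in>reg_span G. opnorm G (op_diff T S) < \<epsilon>" if e: "\<epsilon> > 0" for \<epsilon>
  proof -
    obtain S where S: "S \<in> reg_span G" "op_close G T S (\<epsilon>/2)"
      using R half_gt_zero[OF e] by blast
    then show ?thesis using op_close_imp_opnorm[OF S(2), of \<epsilon>] e by auto
  qed
  then show "T \<in> reduced_cstar G" using R by (auto simp: reduced_cstar_def)
qed

lemma reduced_cstar_bounded: "T \<in> reduced_cstar G \<Longrightarrow> T \<in> bounded_ops G"
  by (simp add: reduced_cstar_def)

lemma reduced_cstar_approx: "T \<in> reduced_cstar G \<Longrightarrow> \<epsilon> > 0 \<Longrightarrow> \<exists>S\<in>reg_span G. op_close G T S \<epsilon>"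
  using reduced_cstar_iff[of T] by blast

lemma reg_span_reduced_cstar: "T \<in> reg_span G \<Longrightarrow> T \<in> reduced_cstar G"
  unfolding reduced_cstar_iff using reg_span_bounded op_close_refl by (meson less_imp_le)

lemma lreg_reduced_cstar: "g \<in> carrier G \<Longrightarrow> lreg G g \<in> reduced_cstar G"
  by (simp add: reg_span_reduced_cstar reg_span_lreg)

lemma reduced_cstar_lincomb:
  assumes "S \<in> reduced_cstar G" "T \<in> reduced_cstar G"
  shows "(\<lambda>f x. S f x + c * T f x) \<in> reduced_cstar G"
  unfolding reduced_cstar_iff
proof (intro conjI allI impI)
  note b = reduced_cstar_bounded[OF assms(1)] reduced_cstar_bounded[OF assms(2)]
  have sub: "reg_span G \<subseteq> bounded_ops G" using reg_span_bounded by auto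
  show "(\<lambda>f x. S f x + c * T f x) \<in> bounded_ops G" using b by (rule bounded_ops_lincomb)
  fix \<epsilon> :: real assume "\<epsilon> > 0"
  then obtain S' T' where "S' \<in> reg_span G" "T' \<in> reg_span G"
    "op_close G (\<lambda>f x. S f x + c * T f x) (\<lambda>f x. S' f x + c * T' f x) \<epsilon>"
    using op_close_lincomb[OF b sub sub reduced_cstar_approx[OF assms(1)] reduced_cstar_approx[OF assms(2)], of \<epsilon> c]
    by blast
  then show "\<exists>R\<in>reg_span G. op_close G (\<lambda>f x. S f x + c * T f x) R \<epsilon>"
    using reg_span_lincomb by blast
qed

lemma reduced_cstar_comp:
  assumes "S \<in> reduced_cstar G" "T \<in> reduced_cstar G"
  shows "S \<circ> T \<in> reduced_cstar G"
  unfolding reduced_cstar_iff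
proof (intro conjI allI impI)
  note b = reduced_cstar_bounded[OF assms(1)] reduced_cstar_bounded[OF assms(2)]
  have sub: "reg_span G \<subseteq> bounded_ops G" using reg_span_bounded by auto
  show "S \<circ> T \<in> bounded_ops G" using b by (rule bounded_ops_comp)
  fix \<epsilon> :: real assume "\<epsilon> > 0"
  then obtain S' T' where "S' \<in> reg_span G" "T' \<in> reg_span G" "op_close G (S \<circ> T) (S' \<circ> T') \<epsilon>"
    using op_close_comp[OF b sub sub reduced_cstar_approx[OF assms(1)] reduced_cstar_approx[OF assms(2)], of \<epsilon>]
    by blast
  then show "\<exists>R\<in>reg_span G. op_close G (S \<circ> T) R \<epsilon>"
    using reg_span_comp by blast
qed

end

section \<open>Closed ideals and averages over lists of conjugators\<close>

lemma closed_ideal_closed: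
  assumes "closed_ideal H A I" "A \<subseteq> bounded_ops H" "T \<in> A" "\<And>\<epsilon>. \<epsilon> > 0 \<Longrightarrow> \<exists>S\<in>I. op_close H T S \<epsilon>"
  shows "T \<in> I"
proof -
  have "\<exists>S\<in>I. opnorm H (op_diff T S) < \<epsilon>" if "\<epsilon> > 0" for \<epsilon>
    using assms(4)[of "\<epsilon>/2"] op_close_imp_opnorm[of H T _ "\<epsilon>/2" \<epsilon>] that by auto
  then show ?thesis using assms(1,3) by (simp add: closed_ideal_def)
qed

lemma closed_idealI:
  assumes "I \<subseteq> A" "A \<subseteq> bounded_ops H" "(\<lambda>f x. 0) \<in> I"
    and "\<And>S T c. S \<in> I \<Longrightarrow> T \<in> I \<Longrightarrow> (\<lambda>f x. S f x + c * T f x) \<in> I"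
    and "\<And>a S. a \<in> A \<Longrightarrow> S \<in> I \<Longrightarrow> a \<circ> S \<in> I" "\<And>a S. a \<in> A \<Longrightarrow> S \<in> I \<Longrightarrow> S \<circ> a \<in> I"
    and "\<And>T. T \<in> A \<Longrightarrow> (\<And>\<epsilon>. \<epsilon> > 0 \<Longrightarrow> \<exists>S\<in>I. op_close H T S \<epsilon>) \<Longrightarrow> T \<in> I"
  shows "closed_ideal H A I"
proof -
  have "T \<in> I" if T: "T \<in> A" and c: "\<forall>\<epsilon>>0. \<exists>S\<in>I. opnorm H (op_diff T S) < \<epsilon>" for T
  proof (rule assms(7)[OF T])
    fix \<epsilon> :: real assume "\<epsilon> > 0"
    then obtain S where "S \<in> I" "opnorm H (op_diff T S) < \<epsilon>" using c by blast
    then show "\<exists>S\<in>I. op_close H T S \<epsilon>"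
      using opnorm_imp_op_close[of T H S \<epsilon>] T assms(1,2) by blast
  qed
  note closed = this
  show ?thesis unfolding closed_ideal_def
    by (intro conjI ballI allI impI; (rule assms(1,3))?; (rule assms(4-6); assumption)?; rule closed; assumption)
qed

text \<open>Lists instead of finite sets let a conjugator occur with multiplicity. A composite of
  two averages is then again an average, over \<open>list_prod\<close>.\<close>

definition conj_avg :: "('a, 'b) monoid_scheme \<Rightarrow> 'a list \<Rightarrow> (('a \<Rightarrow> complex) \<Rightarrow> ('a \<Rightarrow> complex)) \<Rightarrow> ('a \<Rightarrow> complex) \<Rightarrow> ('a \<Rightarrow> complex)" where
  "conj_avg H l T = (\<lambda>f x. (\<Sum>s\<leftarrow>l. lreg H s (T (lreg H (inv\<^bsub>H\<^esub> s) f)) x) / of_nat (length l))"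

definition list_prod :: "('a, 'b) monoid_scheme \<Rightarrow> 'a list \<Rightarrow> 'a list \<Rightarrow> 'a list" where
  "list_prod H l l' = concat (map (\<lambda>h. map (\<lambda>s. h \<otimes>\<^bsub>H\<^esub> s) l') l)"

lemma length_list_prod: "length (list_prod H l l') = length l * length l'"
  by (induction l) (auto simp: list_prod_def)

lemma sum_list_list_prod:
  "(\<Sum>s\<leftarrow>list_prod H l l'. \<phi> s) = (\<Sum>h\<leftarrow>l. \<Sum>s\<leftarrow>l'. \<phi> (h \<otimes>\<^bsub>H\<^esub> s))"
  by (induction l) (auto simp: list_prod_def o_def)

lemma sum_list_divide: "(\<Sum>s\<leftarrow>l. \<phi> s / (c::complex)) = (\<Sum>s\<leftarrow>l. \<phi> s) / c"
  by (induction l) (auto simp: add_divide_distrib)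

lemma list_prod_ne: "l \<noteq> [] \<Longrightarrow> l' \<noteq> [] \<Longrightarrow> list_prod H l l' \<noteq> []"
  using length_list_prod[of H l l'] by fastforce

lemma sum_list_le_const: "(\<And>s. s \<in> set l \<Longrightarrow> \<phi> s \<le> (c::real)) \<Longrightarrow> (\<Sum>s\<leftarrow>l. \<phi> s) \<le> of_nat (length l) * c"
proof (induction l)
  case (Cons a l)
  then have "\<phi> a \<le> c" "(\<Sum>s\<leftarrow>l. \<phi> s) \<le> of_nat (length l) * c" by auto
  then show ?case by (simp add: algebra_simps)
qed simp

lemma l2_list_average:
  assumes "\<And>s. s \<in> set l \<Longrightarrow> v s \<in> l2 H"
  shows "(\<lambda>x. (\<Sum>s\<leftarrow>l. v s x) / of_nat (length l)) \<in> l2 H"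
  using l2_scale[OF l2_sum_list(1), of l v H "1 / of_nat (length l)"] assms by auto

lemma l2norm_list_average:
  assumes "\<And>s. s \<in> set l \<Longrightarrow> v s \<in> l2 H" "\<And>s. s \<in> set l \<Longrightarrow> l2norm H (v s) \<le> C" "l \<noteq> []"
  shows "l2norm H (\<lambda>x. (\<Sum>s\<leftarrow>l. v s x) / of_nat (length l)) \<le> C"
proof -
  have "l2norm H (\<lambda>x. (\<Sum>s\<leftarrow>l. v s x) / of_nat (length l)) = l2norm H (\<lambda>x. \<Sum>s\<leftarrow>l. v s x) / of_nat (length l)"
    using l2norm_divide[OF l2_sum_list(1), of l v H] assms(1) by simp
  also have "\<dots> \<le> (of_nat (length l) * C) / of_nat (length l)"
    using l2_sum_list(2)[of l v H] assms(1) sum_list_le_const[of l "\<lambda>s. l2norm H (v s)" C] assms(2)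
    by (intro divide_right_mono) auto
  also have "\<dots> = C" using assms(3) by simp
  finally show ?thesis .
qed

context group
begin

lemma set_list_prod: "set l \<subseteq> carrier G \<Longrightarrow> set l' \<subseteq> carrier G \<Longrightarrow> set (list_prod G l l') \<subseteq> carrier G"
  by (auto simp: list_prod_def)

lemma lreg_diff: "f \<in> l2 G \<Longrightarrow> h \<in> l2 G \<Longrightarrow> lreg G g (\<lambda>x. f x - h x) = (\<lambda>x. lreg G g f x - lreg G g h x)"
  using lreg_lin[of f h g "-1"] by simp

lemma lreg_add: "f \<in> l2 G \<Longrightarrow> h \<in> l2 G \<Longrightarrow> lreg G g (\<lambda>x. f x + h x) = (\<lambda>x. lreg G g f x + lreg G g h x)"
  using lreg_lin[of f h g "1"] by simp

lemma lreg_list_average: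
  assumes "\<And>s. s \<in> set l \<Longrightarrow> v s \<in> l2 G" "g \<in> carrier G"
  shows "lreg G g (\<lambda>x. (\<Sum>s\<leftarrow>l. v s x) / of_nat (length l)) = (\<lambda>x. (\<Sum>s\<leftarrow>l. lreg G g (v s) x) / of_nat (length l))"
  using bounded_ops_scale[OF lreg_bounded[OF assms(2)] l2_sum_list(1), of l v "1 / of_nat (length l)"]
    bounded_ops_sum_list[OF lreg_bounded[OF assms(2)], of l v] assms(1) by simp

lemma conj_avg_l2:
  assumes "set l \<subseteq> carrier G"
  shows "conj_avg G l T f \<in> l2 G"
  unfolding conj_avg_def using assms by (intro l2_list_average) auto

lemma l2norm_conj_avg:
  assumes l: "set l \<subseteq> carrier G" "l \<noteq> []"
    and T: "\<And>f. f \<in> l2 G \<Longrightarrow> T f \<in> l2 G" "\<And>f. f \<in> l2 G \<Longrightarrow> l2norm G (T f) \<le> C * l2norm G f"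
    and f: "f \<in> l2 G"
  shows "l2norm G (conj_avg G l T f) \<le> C * l2norm G f"
  unfolding conj_avg_def
proof (rule l2norm_list_average[OF _ _ l(2)])
  fix s assume "s \<in> set l"
  then have s: "s \<in> carrier G" using l by auto
  then show "lreg G s (T (lreg G (inv s) f)) \<in> l2 G" by simp
  show "l2norm G (lreg G s (T (lreg G (inv s) f))) \<le> C * l2norm G f"
    using s f T(1)[of "lreg G (inv s) f"] T(2)[of "lreg G (inv s) f"] by simp
qed

lemma conj_avg_cong:
  assumes "set l \<subseteq> carrier G" "\<And>h. h \<in> l2 G \<Longrightarrow> S h = T h"
  shows "conj_avg G l S f = conj_avg G l T f"
proof -
  have "map (\<lambda>s. lreg G s (S (lreg G (inv s) f)) x) l = map (\<lambda>s. lreg G s (T (lreg G (inv s) f)) x) l" for x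
    using assms by (intro map_cong) auto
  then show ?thesis unfolding conj_avg_def by (simp only:)
qed

lemma conj_avg_add:
  assumes "\<And>f. f \<in> l2 G \<Longrightarrow> S f \<in> l2 G" "\<And>f. f \<in> l2 G \<Longrightarrow> T f \<in> l2 G" "set l \<subseteq> carrier G" "f \<in> l2 G"
  shows "conj_avg G l (\<lambda>f x. S f x + T f x) f = (\<lambda>x. conj_avg G l S f x + conj_avg G l T f x)"
proof
  fix x
  have "(\<Sum>s\<leftarrow>l. lreg G s (\<lambda>x. S (lreg G (inv s) f) x + T (lreg G (inv s) f) x) x)
     = (\<Sum>s\<leftarrow>l. lreg G s (S (lreg G (inv s) f)) x + lreg G s (T (lreg G (inv s) f)) x)"
  proof (rule arg_cong[where f=sum_list], rule map_cong)
    fix s assume "s \<in> set l"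
    then have "lreg G (inv s) f \<in> l2 G" using assms(3) by auto
    then show "lreg G s (\<lambda>x. S (lreg G (inv s) f) x + T (lreg G (inv s) f) x) x
      = lreg G s (S (lreg G (inv s) f)) x + lreg G s (T (lreg G (inv s) f)) x"
      using lreg_add[OF assms(1,2)] by simp
  qed simp
  then show "conj_avg G l (\<lambda>f x. S f x + T f x) f x = conj_avg G l S f x + conj_avg G l T f x"
    unfolding conj_avg_def by (simp add: sum_list_addf add_divide_distrib)
qed

lemma conj_avg_one:
  assumes "set l \<subseteq> carrier G" "l \<noteq> []" "f \<in> l2 G"
  shows "conj_avg G l (\<lambda>f. f) f = f"
proof
  fix x
  have "(\<Sum>s\<leftarrow>l. lreg G s (lreg G (inv s) f) x) = (\<Sum>s\<leftarrow>l. f x)"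
  proof (rule arg_cong[where f=sum_list], rule map_cong)
    fix s assume "s \<in> set l"
    then show "lreg G s (lreg G (inv s) f) x = f x" using assms by (auto simp: lreg_lreg lreg_one)
  qed simp
  then show "conj_avg G l (\<lambda>f. f) f x = f x" using assms(2) by (simp add: conj_avg_def sum_list_const_mult sum_list_triv)
qed

lemma conj_avg_lreg:
  assumes "set l \<subseteq> carrier G" "g \<in> carrier G"
  shows "conj_avg G l (lreg G g) f = (\<lambda>x. (\<Sum>s\<leftarrow>l. lreg G (s \<otimes> g \<otimes> inv s) f x) / of_nat (length l))"
proof
  fix x
  have "(\<Sum>s\<leftarrow>l. lreg G s (lreg G g (lreg G (inv s) f)) x) = (\<Sum>s\<leftarrow>l. lreg G (s \<otimes> g \<otimes> inv s) f x)"
  proof (rule arg_cong[where f=sum_list], rule map_cong)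
    fix s assume "s \<in> set l"
    then have "s \<in> carrier G" using assms by auto
    then show "lreg G s (lreg G g (lreg G (inv s) f)) x = lreg G (s \<otimes> g \<otimes> inv s) f x"
      using assms(2) by (simp add: lreg_lreg m_assoc)
  qed simp
  then show "conj_avg G l (lreg G g) f x = (\<Sum>s\<leftarrow>l. lreg G (s \<otimes> g \<otimes> inv s) f x) / of_nat (length l)"
    by (simp add: conj_avg_def)
qed

lemma conj_avg_list_prod:
  assumes "set l \<subseteq> carrier G" "set l' \<subseteq> carrier G"
  shows "conj_avg G (list_prod G l l') T f = conj_avg G l (conj_avg G l' T) f"
proof
  fix x
  have "(\<Sum>s\<leftarrow>l'. lreg G (h \<otimes> s) (T (lreg G (inv (h \<otimes> s)) f)) x) / of_nat (length l')
      = lreg G h (conj_avg G l' T (lreg G (inv h) f)) x" if h: "h \<in> set l" for h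
  proof -
    have hc: "h \<in> carrier G" using h assms by auto
    have "(\<Sum>s\<leftarrow>l'. lreg G (h \<otimes> s) (T (lreg G (inv (h \<otimes> s)) f)) x)
       = (\<Sum>s\<leftarrow>l'. lreg G h (lreg G s (T (lreg G (inv s) (lreg G (inv h) f)))) x)"
    proof (rule arg_cong[where f=sum_list], rule map_cong)
      fix s assume "s \<in> set l'"
      then have "s \<in> carrier G" using assms by auto
      then show "lreg G (h \<otimes> s) (T (lreg G (inv (h \<otimes> s)) f)) x
         = lreg G h (lreg G s (T (lreg G (inv s) (lreg G (inv h) f)))) x"
        using hc by (simp add: lreg_lreg inv_mult_group)
    qed simp
    moreover have "lreg G h (conj_avg G l' T (lreg G (inv h) f))
      = (\<lambda>x. (\<Sum>s\<leftarrow>l'. lreg G h (lreg G s (T (lreg G (inv s) (lreg G (inv h) f)))) x) / of_nat (length l'))"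
      unfolding conj_avg_def using assms(2) hc by (intro lreg_list_average) auto
    ultimately show ?thesis by simp
  qed
  then have e: "(\<Sum>h\<leftarrow>l. lreg G h (conj_avg G l' T (lreg G (inv h) f)) x)
      = (\<Sum>h\<leftarrow>l. (\<Sum>s\<leftarrow>l'. lreg G (h \<otimes> s) (T (lreg G (inv (h \<otimes> s)) f)) x) / of_nat (length l'))"
    by (intro arg_cong[where f=sum_list] map_cong) auto
  then show "conj_avg G (list_prod G l l') T f x = conj_avg G l (conj_avg G l' T) f x"
    unfolding conj_avg_def[of G l] conj_avg_def[of G "list_prod G l l'"] e
    by (simp add: sum_list_list_prod sum_list_divide length_list_prod mult.commute)
qed

lemma closed_ideal_conj_avg:
  assumes I: "closed_ideal G (reduced_cstar G) I" and T: "T \<in> I" and l: "set l \<subseteq> carrier G"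
  shows "conj_avg G l T \<in> I"
proof -
  have lin: "S \<in> I \<Longrightarrow> T \<in> I \<Longrightarrow> (\<lambda>f x. S f x + c * T f x) \<in> I" for S T c
    using I by (simp add: closed_ideal_def)
  have z: "(\<lambda>f x. 0) \<in> I" using I by (simp add: closed_ideal_def)
  have "(\<lambda>f x. \<Sum>s\<leftarrow>l. lreg G s (T (lreg G (inv s) f)) x) \<in> I" using l
  proof (induction l)
    case (Cons a l)
    have a: "a \<in> carrier G" using Cons by simp
    have "lreg G a \<circ> (T \<circ> lreg G (inv a)) \<in> I"
      using I T lreg_reduced_cstar[OF a] lreg_reduced_cstar[OF inv_closed[OF a]] unfolding closed_ideal_def by blast
    then have *: "(\<lambda>f. lreg G a (T (lreg G (inv a) f))) \<in> I" by (simp add: o_def)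
    show ?case using lin[OF *, of "\<lambda>f x. \<Sum>s\<leftarrow>l. lreg G s (T (lreg G (inv s) f)) x" 1] Cons by simp
  qed (use z in simp)
  from lin[OF z this, of "1 / of_nat (length l)"] show ?thesis
    unfolding conj_avg_def by simp
qed

lemma reduced_cstar_sub: "reduced_cstar G \<subseteq> bounded_ops G"
  by (auto simp: reduced_cstar_def)

lemma closed_ideal_full:
  assumes I: "closed_ideal G (reduced_cstar G) I" and one: "lreg G \<one> \<in> I"
  shows "I = reduced_cstar G"
proof
  show "I \<subseteq> reduced_cstar G" using I by (simp add: closed_ideal_def)
  show "reduced_cstar G \<subseteq> I"
  proof
    fix T assume T: "T \<in> reduced_cstar G"
    then have Tb: "T \<in> bounded_ops G" by (rule reduced_cstar_bounded)
    have "T \<circ> lreg G \<one> = T"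
    proof
      fix f show "(T \<circ> lreg G \<one>) f = T f"
        using bounded_ops_outside[OF Tb] bounded_ops_zero[OF Tb]
        by (cases "f \<in> l2 G") (auto simp: lreg_one lreg_outside)
    qed
    then show "T \<in> I" using I T one unfolding closed_ideal_def by (metis)
  qed
qed

text \<open>A Neumann series without inverses: with \<open>X' = X + T (1 - X)\<close> one has
  \<open>1 - X' = (1 - T) (1 - X)\<close>, so the iterates stay in the ideal while their distance to
  the identity falls like \<open>r ^ n\<close>.\<close>

lemma closed_ideal_near_one:
  assumes I: "closed_ideal G (reduced_cstar G) I" and T: "T \<in> I" and r: "0 \<le> r" "r < 1"
    and near: "\<And>f. f \<in> l2 G \<Longrightarrow> l2norm G (\<lambda>x. f x - T f x) \<le> r * l2norm G f"
  shows "lreg G \<one> \<in> I"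
proof -
  have lin: "S \<in> I \<Longrightarrow> T \<in> I \<Longrightarrow> (\<lambda>f x. S f x + c * T f x) \<in> I" for S T c
    using I by (simp add: closed_ideal_def)
  have sub: "I \<subseteq> reduced_cstar G" using I by (simp add: closed_ideal_def)
  have Ib: "S \<in> I \<Longrightarrow> S \<in> bounded_ops G" for S using sub reduced_cstar_sub by auto
  have step: "\<exists>X\<in>I. \<forall>f\<in>l2 G. l2norm G (\<lambda>x. f x - X f x) \<le> r ^ n * l2norm G f" for n
  proof (induction n)
    case 0
    then show ?case using I by (auto simp: closed_ideal_def intro!: bexI[of _ "\<lambda>f x. 0"])
  next
    case (Suc n)
    then obtain X where X: "X \<in> I" "\<And>f. f \<in> l2 G \<Longrightarrow> l2norm G (\<lambda>x. f x - X f x) \<le> r ^ n * l2norm G f"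
      by blast
    let ?a = "\<lambda>f x. lreg G \<one> f x + (-1) * X f x"
    have a: "?a \<in> reduced_cstar G" using X sub by (intro reduced_cstar_lincomb lreg_reduced_cstar) auto
    have Ta: "T \<circ> ?a \<in> I" using I T a unfolding closed_ideal_def by blast
    let ?Y = "\<lambda>f x. X f x + 1 * (T \<circ> ?a) f x"
    have "l2norm G (\<lambda>x. f x - ?Y f x) \<le> r ^ Suc n * l2norm G f" if f: "f \<in> l2 G" for f
    proof -
      have d: "(\<lambda>x. f x - X f x) \<in> l2 G" using f bounded_ops_l2[OF Ib[OF X(1)] f] by (rule l2_diff)
      have "(\<lambda>x. f x - ?Y f x) = (\<lambda>x. (f x - X f x) - T (\<lambda>x. f x - X f x) x)"
        using f by (simp add: lreg_one algebra_simps)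
      then have "l2norm G (\<lambda>x. f x - ?Y f x) \<le> r * l2norm G (\<lambda>x. f x - X f x)"
        using near[OF d] by simp
      also have "\<dots> \<le> r * (r ^ n * l2norm G f)" using X(2)[OF f] r by (intro mult_left_mono)
      finally show ?thesis by (simp add: mult.assoc)
    qed
    then show ?case using lin[OF X(1) Ta, of 1] by (intro bexI[of _ ?Y]) auto
  qed
  show ?thesis
  proof (rule closed_ideal_closed[OF I reduced_cstar_sub])
    show "lreg G \<one> \<in> reduced_cstar G" by (rule lreg_reduced_cstar) simp
    fix \<epsilon> :: real assume e: "\<epsilon> > 0"
    obtain n where n: "r ^ n < \<epsilon>" using real_arch_pow_inv[OF e r(2)] by blast
    obtain X where X: "X \<in> I" "\<And>f. f \<in> l2 G \<Longrightarrow> l2norm G (\<lambda>x. f x - X f x) \<le> r ^ n * l2norm G f"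
      using step by blast
    have "op_close G (lreg G \<one>) X \<epsilon>" unfolding op_close_def
    proof
      fix f assume f: "f \<in> l2 G"
      have "r ^ n * l2norm G f \<le> \<epsilon> * l2norm G f" using n by (intro mult_right_mono) auto
      then show "l2norm G (\<lambda>x. lreg G \<one> f x - X f x) \<le> \<epsilon> * l2norm G f"
        using X(2)[OF f] f by (simp add: lreg_one)
    qed
    then show "\<exists>S\<in>I. op_close G (lreg G \<one>) S \<epsilon>" using X(1) by blast
  qed
qed

section \<open>Reduction to finitely supported vectors\<close>

lemma reg_span_local:
  assumes "U \<in> reg_span G" "finite E"
  shows "\<exists>X. finite X \<and> X \<subseteq> carrier G \<and> (\<forall>f\<in>l2 G. \<forall>Y. X \<subseteq> Y \<longrightarrow> (\<forall>x\<in>E. U (\<lambda>x. if x \<in> Y then f x else 0) x = U f x))"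
  using assms(1)
proof (induction rule: reg_span_induct)
  case zero
  show ?case by (rule exI[of _ "{}"]) simp
next
  case (add T g c)
  from add.IH obtain X where X: "finite X" "X \<subseteq> carrier G"
    and "\<forall>f\<in>l2 G. \<forall>Y. X \<subseteq> Y \<longrightarrow> (\<forall>x\<in>E. T (\<lambda>x. if x \<in> Y then f x else 0) x = T f x)" by (elim exE conjE)
  then have TX: "T (\<lambda>x. if x \<in> Y then f x else 0) x = T f x" if "f \<in> l2 G" "X \<subseteq> Y" "x \<in> E" for f Y x
    using that by simp
  let ?X = "X \<union> (\<lambda>x. inv g \<otimes> x) ` (E \<inter> carrier G)"
  show ?case
  proof (intro exI[of _ ?X] conjI ballI allI impI)
    show "finite ?X" using X assms by auto
    show "?X \<subseteq> carrier G" using X add by auto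
    fix f Y x assume f: "f \<in> l2 G" "?X \<subseteq> Y" "x \<in> E"
    have "T (\<lambda>x. if x \<in> Y then f x else 0) x = T f x" using f by (intro TX) auto
    moreover have "lreg G g (\<lambda>x. if x \<in> Y then f x else 0) x = lreg G g f x"
      using f l2_restrict(1)[OF f(1), of Y] by (cases "x \<in> carrier G") (auto simp: lreg_outside' lreg_apply)
    ultimately show "T (\<lambda>x. if x \<in> Y then f x else 0) x + c * lreg G g (\<lambda>x. if x \<in> Y then f x else 0) x = T f x + c * lreg G g f x"
      by simp
  qed
qed

text \<open>On a finite set \<open>E\<close> a finite combination of translations sees only finitely
  many coordinates of its argument. Operator bounds may therefore be proved with finite sums, where
  splitting into cosets or fibres raises no question of summability.\<close>

lemma reg_span_bound_finite_support:
  assumes U: "U \<in> reg_span G" and C: "0 \<le> C"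
    and fin: "\<And>X E f. finite X \<Longrightarrow> X \<subseteq> carrier G \<Longrightarrow> finite E \<Longrightarrow> E \<subseteq> carrier G \<Longrightarrow> (\<And>x. x \<notin> X \<Longrightarrow> f x = 0) \<Longrightarrow>
        L2_set (\<lambda>x. cmod (U f x)) E \<le> C * L2_set (\<lambda>x. cmod (f x)) X"
    and f: "f \<in> l2 G"
  shows "l2norm G (U f) \<le> C * l2norm G f"
proof (rule l2_boundI(2))
  show "U f x = 0" if "x \<notin> carrier G" for x
    using bounded_ops_l2[OF reg_span_bounded[OF U] f] that by (rule l2_outside)
  fix E assume E: "finite E" "E \<subseteq> carrier G"
  obtain X where X: "finite X" "X \<subseteq> carrier G" and
    "\<forall>f\<in>l2 G. \<forall>Y. X \<subseteq> Y \<longrightarrow> (\<forall>x\<in>E. U (\<lambda>x. if x \<in> Y then f x else 0) x = U f x)"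
    using reg_span_local[OF U E(1)] by (elim exE conjE)
  then have XU: "U (\<lambda>x. if x \<in> X then f x else 0) x = U f x" if "x \<in> E" for x using that f by simp
  have "L2_set (\<lambda>x. cmod (U f x)) E = L2_set (\<lambda>x. cmod (U (\<lambda>x. if x \<in> X then f x else 0) x)) E"
    using XU by (intro L2_set_cong) auto
  also have "\<dots> \<le> C * L2_set (\<lambda>x. cmod (if x \<in> X then f x else 0)) X"
    using X E by (intro fin) auto
  also have "L2_set (\<lambda>x. cmod (if x \<in> X then f x else 0)) X = L2_set (\<lambda>x. cmod (f x)) X"
    by (intro L2_set_cong) auto
  also have "C * L2_set (\<lambda>x. cmod (f x)) X \<le> C * l2norm G f"
    using l2_L2_set_le[OF f X(1,2)] C by (intro mult_left_mono)
  finally show "L2_set (\<lambda>x. cmod (U f x)) E \<le> C * l2norm G f" .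
qed

lemma l2_approx_finite:
  assumes f: "f \<in> l2 G" and e: "\<epsilon> > 0"
  shows "\<exists>F. finite F \<and> F \<subseteq> carrier G \<and> l2norm G (\<lambda>x. f x - (if x \<in> F then f x else 0)) \<le> \<epsilon>"
proof -
  let ?p = "\<lambda>x. (cmod (f x))\<^sup>2"
  have s: "?p summable_on carrier G" using f by (simp add: l2_def)
  then have "(?p has_sum infsum ?p (carrier G)) (carrier G)" by simp
  then have "\<forall>\<^sub>F F in finite_subsets_at_top (carrier G). dist (sum ?p F) (infsum ?p (carrier G)) < \<epsilon>\<^sup>2"
    unfolding has_sum_def tendsto_iff using e by (meson zero_less_power)
  then obtain F where F: "finite F" "F \<subseteq> carrier G" "dist (sum ?p F) (infsum ?p (carrier G)) < \<epsilon>\<^sup>2"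
    unfolding eventually_finite_subsets_at_top by blast
  have "infsum ?p (carrier G) = infsum ?p F + infsum ?p (carrier G - F)"
    using infsum_Un_disjoint[of ?p F "carrier G - F", OF summable_on_subset_banach[OF s F(2)]
      summable_on_subset_banach[OF s Diff_subset] Diff_disjoint] Un_Diff_cancel[of F "carrier G"] Un_absorb1[OF F(2)]
    by simp
  then have "infsum ?p (carrier G - F) \<le> \<epsilon>\<^sup>2" using F by (simp add: dist_real_def abs_less_iff)
  moreover have "infsum (\<lambda>x. (cmod (f x - (if x \<in> F then f x else 0)))\<^sup>2) (carrier G) = infsum ?p (carrier G - F)"
    by (rule infsum_cong_neutral) auto
  ultimately have "l2norm G (\<lambda>x. f x - (if x \<in> F then f x else 0)) \<le> \<epsilon>"
    unfolding l2norm_def using e by (simp add: real_le_lsqrt infsum_nonneg)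
  then show ?thesis using F by blast
qed

text \<open>The functions \<open>delta g\<close> span a dense subspace, and a bounded operator is
  continuous.\<close>

lemma bounded_op_eq_0:
  assumes T: "T \<in> bounded_ops G" and d: "\<And>g. g \<in> carrier G \<Longrightarrow> T (delta g) = (\<lambda>_. 0)"
  shows "T = (\<lambda>f x. 0)"
proof
  fix f show "T f = (\<lambda>x. 0)"
  proof (cases "f \<in> l2 G")
    case True
    have fin: "T (\<lambda>x. if x \<in> F then f x else 0) = (\<lambda>_. 0)" if "finite F" "F \<subseteq> carrier G" for F
      using that
    proof (induction F)
      case empty
      then show ?case using bounded_ops_zero[OF T] by simp
    next
      case (insert a F)
      have "(\<lambda>x. if x \<in> insert a F then f x else 0) = (\<lambda>x. (if x \<in> F then f x else 0) + f a * delta a x)"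
        using insert by (auto simp: delta_def)
      then show ?case using insert d[of a] by (simp add: bounded_ops_lin[OF T l2_restrict(1)[OF True] delta_l2])
    qed
    have le: "l2norm G (T f) \<le> opnorm G T * \<epsilon>" if e: "\<epsilon> > 0" for \<epsilon>
    proof -
      obtain F where F: "finite F" "F \<subseteq> carrier G" "l2norm G (\<lambda>x. f x - (if x \<in> F then f x else 0)) \<le> \<epsilon>"
        using l2_approx_finite[OF True e] by blast
      have "T (\<lambda>x. f x - (if x \<in> F then f x else 0)) = T f"
        using bounded_ops_diff[OF T True l2_restrict(1)[OF True], of F] fin[OF F(1,2)] by simp
      then have "l2norm G (T f) \<le> opnorm G T * l2norm G (\<lambda>x. f x - (if x \<in> F then f x else 0))"
        using opnorm_bound[OF T l2_diff[OF True l2_restrict(1)[OF True]], of F] by simp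
      also have "\<dots> \<le> opnorm G T * \<epsilon>" using F opnorm_nonneg[OF T] by (intro mult_left_mono)
      finally show ?thesis .
    qed
    have "l2norm G (T f) \<le> 0 + \<epsilon>" if e: "\<epsilon> > 0" for \<epsilon>
    proof -
      have p: "opnorm G T + 1 > 0" using opnorm_nonneg[OF T] by simp
      have "l2norm G (T f) \<le> opnorm G T * (\<epsilon> / (opnorm G T + 1))" using e p by (intro le) simp
      also have "\<dots> \<le> \<epsilon>" using e p by (simp add: field_simps)
      finally show ?thesis by simp
    qed
    then have "l2norm G (T f) \<le> 0" by (rule field_le_epsilon)
    then show ?thesis using l2norm_eq_0[OF bounded_ops_l2[OF T True]] l2norm_nonneg[of G "T f"] by simp
  qed (rule bounded_ops_outside[OF T])
qed

text \<open>Left translation by \<open>N\<close> preserves every right coset of \<open>N\<close>.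
  The map \<rho> labels these cosets and thereby cuts \<open>l2 G\<close> into blocks invariant
  under \<open>N\<close>.\<close>

lemma right_coset_representatives:
  assumes N: "subgroup N G"
  obtains \<rho> where "\<And>x. x \<in> carrier G \<Longrightarrow> \<rho> x \<in> carrier G" "\<And>x. x \<in> carrier G \<Longrightarrow> \<exists>n\<in>N. x = n \<otimes> \<rho> x"
    "\<And>n x. n \<in> N \<Longrightarrow> x \<in> carrier G \<Longrightarrow> \<rho> (n \<otimes> x) = \<rho> x"
proof -
  have N_sub: "N \<subseteq> carrier G" using N by (rule subgroup.subset)
  define \<rho> where "\<rho> x = (SOME y. y \<in> N #> x)" for x
  have \<rho>: "\<rho> x \<in> N #> x" if "x \<in> carrier G" for x
    unfolding \<rho>_def by (rule someI[of _ x]) (rule rcos_self[OF that N])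
  have \<rho>c: "\<rho> x \<in> carrier G" if "x \<in> carrier G" for x
    using \<rho>[OF that] that r_coset_subset_G[OF N_sub] by auto
  have \<rho>n: "\<exists>n\<in>N. x = n \<otimes> \<rho> x" if x: "x \<in> carrier G" for x
  proof -
    obtain n where n: "n \<in> N" "\<rho> x = n \<otimes> x" using \<rho>[OF x] by (auto simp: r_coset_def)
    then have "x = inv n \<otimes> \<rho> x" using x N_sub by (metis inv_solve_left subset_iff \<rho>c)
    then show ?thesis using n N by (meson subgroup.m_inv_closed)
  qed
  have \<rho>m: "\<rho> (n \<otimes> x) = \<rho> x" if "n \<in> N" "x \<in> carrier G" for n x
  proof -
    have "N #> (n \<otimes> x) = N #> x"
      using that N N_sub coset_mult_assoc[of N n x] subgroup.rcos_const[OF N is_group, of n] by auto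
    then show ?thesis by (simp add: \<rho>_def)
  qed
  show ?thesis by (rule that[of \<rho>, OF \<rho>c \<rho>n \<rho>m])
qed

end

section \<open>Compression to a subgroup\<close>

locale subgroup_compression = group +
  fixes N
  assumes N: "subgroup N G"
begin

abbreviation "GN \<equiv> G\<lparr>carrier := N\<rparr>"

lemma N_sub: "N \<subseteq> carrier G" using N by (rule subgroup.subset)

lemma group_GN: "group GN" using N by (rule subgroup_imp_group)

lemma l2_GN_sub: "f \<in> l2 GN \<Longrightarrow> f \<in> l2 G"
proof -
  assume f: "f \<in> l2 GN"
  then have f0: "f x = 0" if "x \<notin> N" for x using that by (auto intro: l2_outside)
  have "(\<lambda>x. (cmod (f x))\<^sup>2) summable_on N \<longleftrightarrow> (\<lambda>x. (cmod (f x))\<^sup>2) summable_on carrier G"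
    by (rule summable_on_cong_neutral) (use N_sub f0 in auto)
  then show "f \<in> l2 G" using f f0 N_sub by (auto simp: l2_def)
qed

lemma l2norm_GN: "f \<in> l2 GN \<Longrightarrow> l2norm GN f = l2norm G f"
  unfolding l2norm_def using N_sub
  by (auto intro!: arg_cong[where f=sqrt] infsum_cong_neutral simp: l2_def)

lemma l2_GN_restrict:
  assumes "f \<in> l2 G"
  shows "(\<lambda>x. if x \<in> N then f x else 0) \<in> l2 GN"
    and "l2norm GN (\<lambda>x. if x \<in> N then f x else 0) \<le> l2norm G f"
proof -
  have b: "L2_set (\<lambda>x. cmod (if x \<in> N then f x else 0)) F \<le> l2norm G f" if "finite F" "F \<subseteq> carrier GN" for F
  proof -
    have "L2_set (\<lambda>x. cmod (if x \<in> N then f x else 0)) F = L2_set (\<lambda>x. cmod (f x)) F"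
      using that by (intro L2_set_cong) auto
    also have "\<dots> \<le> l2norm G f" using that N_sub by (intro l2_L2_set_le[OF assms]) auto
    finally show ?thesis .
  qed
  show "(\<lambda>x. if x \<in> N then f x else 0) \<in> l2 GN"
    "l2norm GN (\<lambda>x. if x \<in> N then f x else 0) \<le> l2norm G f"
    using l2_boundI[of GN "\<lambda>x. if x \<in> N then f x else 0", OF _ b] by auto
qed

text \<open>The corner \<open>P T P\<close> for the projection \<open>P\<close> of
  \<open>l2 G\<close> onto the functions supported on \<open>N\<close>. On the reduced algebra it is
  the canonical conditional expectation onto the algebra of \<open>N\<close>.\<close>

definition compr :: "(('a \<Rightarrow> complex) \<Rightarrow> ('a \<Rightarrow> complex)) \<Rightarrow> (('a \<Rightarrow> complex) \<Rightarrow> ('a \<Rightarrow> complex))" where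
  "compr T = (\<lambda>f x. if f \<in> l2 GN \<and> x \<in> N then T f x else 0)"

lemma compr_lincomb: "compr (\<lambda>f x. S f x + c * T f x) = (\<lambda>f x. compr S f x + c * compr T f x)"
  by (intro ext) (simp add: compr_def)

lemma compr_l2: "T \<in> bounded_ops G \<Longrightarrow> f \<in> l2 GN \<Longrightarrow> compr T f \<in> l2 GN"
  and l2norm_compr: "T \<in> bounded_ops G \<Longrightarrow> f \<in> l2 GN \<Longrightarrow> l2norm GN (compr T f) \<le> l2norm G (T f)"
  using l2_GN_restrict[of "T f"] bounded_ops_l2[of T G f] l2_GN_sub[of f] by (auto simp: compr_def)

lemma compr_bounded:
  assumes "T \<in> bounded_ops G" shows "compr T \<in> bounded_ops GN"
proof (rule bounded_opsI[where C="opnorm G T"])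
  fix f assume f: "f \<in> l2 GN"
  show "compr T f \<in> l2 GN" using assms f by (rule compr_l2)
  show "l2norm GN (compr T f) \<le> opnorm G T * l2norm GN f"
    using l2norm_compr[OF assms f] opnorm_bound[OF assms l2_GN_sub[OF f]] l2norm_GN[OF f] by simp
next
  fix f g c assume f: "f \<in> l2 GN" "g \<in> l2 GN"
  show "compr T (\<lambda>x. f x + c * g x) = (\<lambda>x. compr T f x + c * compr T g x)"
    using f l2_lincomb(1)[OF f, of c] bounded_ops_lin[OF assms l2_GN_sub[OF f(1)] l2_GN_sub[OF f(2)], of c]
    by (auto simp: compr_def)
qed (auto simp: compr_def)

lemma op_close_compr:
  assumes "S \<in> bounded_ops G" "T \<in> bounded_ops G" "op_close G S T \<epsilon>"
  shows "op_close GN (compr S) (compr T) \<epsilon>"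
  unfolding op_close_def
proof
  fix f assume f: "f \<in> l2 GN"
  have "(\<lambda>x. compr S f x - compr T f x) = compr (op_diff S T) f"
    by (auto simp: compr_def op_diff_def)
  then have "l2norm GN (\<lambda>x. compr S f x - compr T f x) \<le> l2norm G (op_diff S T f)"
    using l2norm_compr[OF bounded_ops_op_diff[OF assms(1,2)] f] by simp
  also have "\<dots> \<le> \<epsilon> * l2norm G f" using op_closeD[OF assms(3) l2_GN_sub[OF f]] by (simp add: op_diff_def)
  finally show "l2norm GN (\<lambda>x. compr S f x - compr T f x) \<le> \<epsilon> * l2norm GN f" using l2norm_GN[OF f] by simp
qed

lemma lreg_GN:
  assumes "n \<in> N" "f \<in> l2 GN" shows "lreg GN n f = lreg G n f"
proof
  fix x
  have nc: "n \<in> carrier G" using assms N_sub by auto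
  have "f (inv n \<otimes> x) = 0" if "x \<in> carrier G" "x \<notin> N"
  proof -
    have "inv n \<otimes> x \<notin> N"
    proof
      assume "inv n \<otimes> x \<in> N"
      then have "n \<otimes> (inv n \<otimes> x) \<in> N" using N assms by (simp add: subgroup.m_closed)
      then show False using that nc by (simp add: m_assoc[symmetric])
    qed
    then show ?thesis using assms by (auto intro: l2_outside)
  qed
  then show "lreg GN n f x = lreg G n f x"
    using assms l2_GN_sub[of f] N_sub N by (auto simp: lreg_def)
qed

text \<open>Translation by an element outside \<open>N\<close> moves \<open>N\<close> off itself, so
  compression deletes exactly the coefficients outside \<open>N\<close>.\<close>

lemma compr_lreg:
  assumes "g \<in> carrier G"
  shows "compr (lreg G g) = (if g \<in> N then lreg GN g else (\<lambda>f x. 0))"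
proof (intro ext)
  fix f x
  show "compr (lreg G g) f x = (if g \<in> N then lreg GN g else (\<lambda>f x. 0)) f x"
  proof (cases "f \<in> l2 GN \<and> x \<in> N")
    case True
    show ?thesis
    proof (cases "g \<in> N")
      case gN: True
      then show ?thesis using True lreg_GN[OF gN] by (simp add: compr_def)
    next
      case False
      have xc: "x \<in> carrier G" using True N_sub by auto
      have "inv g \<otimes> x \<notin> N"
      proof
        assume a: "inv g \<otimes> x \<in> N"
        have "x \<otimes> inv (inv g \<otimes> x) \<in> N" using a True N by (simp add: subgroup.m_closed subgroup.m_inv_closed)
        then show False using False xc assms by (simp add: inv_mult_group m_assoc[symmetric])
      qed
      then have "f (inv g \<otimes> x) = 0" using True by (auto intro: l2_outside)
      then show ?thesis using True False xc l2_GN_sub[of f] by (simp add: compr_def lreg_apply)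
    qed
  next
    case False
    then show ?thesis by (auto simp: compr_def lreg_def)
  qed
qed

lemma compr_reg_span: "S \<in> reg_span G \<Longrightarrow> compr S \<in> reg_span GN"
proof (induction rule: reg_span_induct)
  case zero
  have "compr (\<lambda>f x. 0) = (\<lambda>f x. 0)" by (auto simp: compr_def)
  then show ?case using group.reg_span_zero[OF group_GN] by simp
next
  case (add T g c)
  have "compr (lreg G g) \<in> reg_span GN"
    using add group.reg_span_zero[OF group_GN] group.reg_span_lreg[OF group_GN] by (simp add: compr_lreg)
  then show ?case using group.reg_span_lincomb[OF group_GN add.IH] by (simp add: compr_lincomb)
qed

lemma compr_reduced_cstar:
  assumes "T \<in> reduced_cstar G" shows "compr T \<in> reduced_cstar GN"
  unfolding group.reduced_cstar_iff[OF group_GN]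
proof (intro conjI allI impI)
  note Tb = reduced_cstar_bounded[OF assms]
  show "compr T \<in> bounded_ops GN" using Tb by (rule compr_bounded)
  fix \<epsilon> :: real assume "\<epsilon> > 0"
  then obtain S where S: "S \<in> reg_span G" "op_close G T S \<epsilon>" using reduced_cstar_approx[OF assms] by blast
  then show "\<exists>S\<in>reg_span GN. op_close GN (compr T) S \<epsilon>"
    using op_close_compr[OF Tb reg_span_bounded[OF S(1)] S(2)] compr_reg_span[OF S(1)] by blast
qed

text \<open>Half of the bimodule property of a conditional expectation: translation by an element of
  \<open>N\<close> commutes with cutting down to \<open>N\<close>. This is what turns the
  compression of an ideal into an ideal.\<close>

lemma compr_lreg_left:
  assumes n: "n \<in> N" and T: "T \<in> bounded_ops G"
  shows "lreg GN n \<circ> compr T = compr (lreg G n \<circ> T)"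
proof
  fix f
  have nc: "n \<in> carrier G" using n N_sub by auto
  show "(lreg GN n \<circ> compr T) f = compr (lreg G n \<circ> T) f"
  proof (cases "f \<in> l2 GN")
    case True
    have "compr T f \<in> l2 GN" using T True by (rule compr_l2)
    moreover have "T f \<in> l2 G" using bounded_ops_l2[OF T l2_GN_sub[OF True]] .
    ultimately have "lreg GN n (compr T f) x = compr (lreg G n \<circ> T) f x" for x
      using True N n N_sub by (auto simp: lreg_def compr_def subgroup.m_closed subgroup.m_inv_closed)
    then show ?thesis by auto
  next
    case False
    then have "compr T f = (\<lambda>_. 0)" "compr (lreg G n \<circ> T) f = (\<lambda>_. 0)" by (auto simp: compr_def)
    then show ?thesis by (auto simp: lreg_def)
  qed
qed

lemma compr_lreg_right:
  assumes n: "n \<in> N" and T: "T \<in> bounded_ops G"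
  shows "compr T \<circ> lreg GN n = compr (T \<circ> lreg G n)"
proof
  fix f
  have nc: "n \<in> carrier G" using n N_sub by auto
  show "(compr T \<circ> lreg GN n) f = compr (T \<circ> lreg G n) f"
  proof (cases "f \<in> l2 GN")
    case True
    then show ?thesis using group.lreg_l2[OF group_GN, of n f] n by (auto simp: compr_def lreg_GN[OF n])
  next
    case False
    then have "lreg GN n f = (\<lambda>_. 0)" "compr (T \<circ> lreg G n) f = (\<lambda>_. 0)" by (auto simp: lreg_def compr_def)
    then show ?thesis using bounded_ops_zero[OF compr_bounded[OF T]] by simp
  qed
qed

text \<open>As a space acted on by \<open>N\<close>, \<open>l2 G\<close> is an orthogonal sum of
  copies of \<open>l2 GN\<close>, one for each right coset. A combination over \<open>N\<close> acts
  on all copies in the same way, so a bound on one copy is a bound on the whole.\<close>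

lemma reg_span_GN_bound:
  assumes Y: "finite Y" "Y \<subseteq> N" and C: "0 \<le> C"
    and b: "\<And>f. f \<in> l2 GN \<Longrightarrow> l2norm GN (\<lambda>x. \<Sum>g\<in>Y. d g * lreg GN g f x) \<le> C * l2norm GN f"
    and f: "f \<in> l2 G"
  shows "l2norm G (\<lambda>x. \<Sum>g\<in>Y. d g * lreg G g f x) \<le> C * l2norm G f"
proof -
  define U where "U = (\<lambda>f x. \<Sum>g\<in>Y. d g * lreg G g f x)"
  have YG: "Y \<subseteq> carrier G" using Y N_sub by auto
  have U: "U \<in> reg_span G" unfolding U_def reg_span_def using Y YG by blast
  obtain \<rho> where \<rho>c: "\<And>x. x \<in> carrier G \<Longrightarrow> \<rho> x \<in> carrier G"
    and \<rho>n: "\<And>x. x \<in> carrier G \<Longrightarrow> \<exists>n\<in>N. x = n \<otimes> \<rho> x"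
    and \<rho>m: "\<And>n x. n \<in> N \<Longrightarrow> x \<in> carrier G \<Longrightarrow> \<rho> (n \<otimes> x) = \<rho> x"
    using right_coset_representatives[OF N] by blast
  have "l2norm G (U f) \<le> C * l2norm G f"
  proof (rule reg_span_bound_finite_support[OF U C _ f])
    fix X E and f :: "'a \<Rightarrow> complex" assume X: "finite X" "X \<subseteq> carrier G" and E: "finite E" "E \<subseteq> carrier G" and f0: "\<And>x. x \<notin> X \<Longrightarrow> f x = 0"
    have fl: "f \<in> l2 G" using l2_finite_support(1)[OF X f0] .
    have piece: "(\<Sum>x\<in>{x\<in>E. \<rho> x = r}. (cmod (U f x))\<^sup>2) \<le> C\<^sup>2 * (\<Sum>x\<in>{x\<in>X. \<rho> x = r}. (cmod (f x))\<^sup>2)"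
      if r: "r \<in> \<rho> ` E" for r
    proof -
      have rc: "r \<in> carrier G" using r E \<rho>c by auto
      have rr: "\<rho> r = r"
      proof -
        obtain x where x: "x \<in> E" "r = \<rho> x" using r by auto
        obtain n where "n \<in> N" "x = n \<otimes> r" using \<rho>n[of x] x E by auto
        then show ?thesis using \<rho>m[of n r] x rc by simp
      qed
      \<comment> \<open>The block of \<open>f\<close> over the coset of \<open>r\<close>, read as a
        function on \<open>N\<close> by right translation.\<close>
      define h where "h = (\<lambda>n. if n \<in> N then f (n \<otimes> r) else 0)"
      let ?X = "{x\<in>X. \<rho> x = r}" and ?E = "{x\<in>E. \<rho> x = r}"
      let ?t = "\<lambda>x. x \<otimes> inv r"
      have inj: "inj_on ?t (carrier G)" using rc by (intro inj_onI) auto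
      have inN: "?t x \<in> N" "?t x \<otimes> r = x" if x: "x \<in> carrier G" "\<rho> x = r" for x
      proof -
        obtain n where n: "n \<in> N" "x = n \<otimes> r" using \<rho>n[OF x(1)] x by auto
        then have "n \<in> carrier G" using N_sub by auto
        then show "?t x \<in> N" "?t x \<otimes> r = x" using n rc by (auto simp: m_assoc)
      qed
      have hX: "finite (?t ` ?X)" "?t ` ?X \<subseteq> carrier GN" using X inN by auto
      have h0: "h n = 0" if "n \<notin> ?t ` ?X" for n
      proof (cases "n \<in> N")
        case True
        then have nc: "n \<in> carrier G" using N_sub by auto
        have "n \<otimes> r \<notin> X"
        proof
          assume a: "n \<otimes> r \<in> X"
          have "\<rho> (n \<otimes> r) = r" using \<rho>m[OF True rc] rr by simp
          moreover have "?t (n \<otimes> r) = n" using nc rc by (simp add: m_assoc)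
          ultimately show False using a that by (metis (mono_tags, lifting) imageI mem_Collect_eq)
        qed
        then show ?thesis by (simp add: h_def f0)
      qed (simp add: h_def)
      have hl: "h \<in> l2 GN" and hn: "l2norm GN h = L2_set (\<lambda>x. cmod (h x)) (?t ` ?X)"
        using l2_finite_support[OF hX h0] by auto
      have hsum: "(l2norm GN h)\<^sup>2 = (\<Sum>x\<in>?X. (cmod (f x))\<^sup>2)"
      proof -
        have "(l2norm GN h)\<^sup>2 = (\<Sum>n\<in>?t ` ?X. (cmod (h n))\<^sup>2)"
          unfolding hn L2_set_def by (simp add: sum_nonneg)
        also have "\<dots> = (\<Sum>x\<in>?X. (cmod (h (?t x)))\<^sup>2)"
          using inj X by (subst sum.reindex) (auto intro: inj_on_subset)
        also have "\<dots> = (\<Sum>x\<in>?X. (cmod (f x))\<^sup>2)"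
          using inN X by (intro sum.cong) (auto simp: h_def subset_iff)
        finally show ?thesis .
      qed
      let ?V = "\<lambda>x. \<Sum>g\<in>Y. d g * lreg GN g h x"
      have Vl: "?V \<in> l2 GN"
        using l2_sum(1)[OF Y(1), of "\<lambda>g x. d g * lreg GN g h x" GN] Y group.lreg_l2[OF group_GN]
        by (auto intro!: l2_scale)
      have UV: "U f x = ?V (?t x)" if x: "x \<in> ?E" for x
      proof -
        have xc: "x \<in> carrier G" "\<rho> x = r" using x E by auto
        have "lreg G g f x = lreg GN g h (?t x)" if g: "g \<in> Y" for g
        proof -
          have gN: "g \<in> N" "g \<in> carrier G" using g Y N_sub by auto
          have "lreg GN g h (?t x) = h (inv g \<otimes> ?t x)"
            using hl inN[OF xc] gN N by (simp add: lreg_apply)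
          also have "\<dots> = f (inv g \<otimes> ?t x \<otimes> r)"
            using inN[OF xc] gN N by (simp add: h_def subgroup.m_closed subgroup.m_inv_closed)
          also have "inv g \<otimes> ?t x \<otimes> r = inv g \<otimes> x" using xc gN rc by (simp add: m_assoc)
          finally show ?thesis using fl xc by (simp add: lreg_apply)
        qed
        then show ?thesis unfolding U_def by (intro sum.cong) auto
      qed
      have "(\<Sum>x\<in>?E. (cmod (U f x))\<^sup>2) = (\<Sum>x\<in>?E. (cmod (?V (?t x)))\<^sup>2)" using UV by (intro sum.cong) auto
      also have "\<dots> = (\<Sum>n\<in>?t ` ?E. (cmod (?V n))\<^sup>2)"
        using inj E by (subst sum.reindex) (auto intro: inj_on_subset)
      also have "\<dots> = (L2_set (\<lambda>n. cmod (?V n)) (?t ` ?E))\<^sup>2" by (simp add: L2_set_def sum_nonneg)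
      also have "\<dots> \<le> (l2norm GN ?V)\<^sup>2"
        using E inN by (intro power_mono l2_L2_set_le[OF Vl]) auto
      also have "\<dots> \<le> (C * l2norm GN h)\<^sup>2" using b[OF hl] by (intro power_mono) auto
      also have "\<dots> = C\<^sup>2 * (\<Sum>x\<in>?X. (cmod (f x))\<^sup>2)" by (simp add: power_mult_distrib hsum)
      finally show ?thesis .
    qed
    have "(\<Sum>x\<in>E. (cmod (U f x))\<^sup>2) = (\<Sum>r\<in>\<rho> ` E. \<Sum>x\<in>{x\<in>E. \<rho> x = r}. (cmod (U f x))\<^sup>2)"
      by (rule sum.image_gen[OF E(1)])
    also have "\<dots> \<le> (\<Sum>r\<in>\<rho> ` E. C\<^sup>2 * (\<Sum>x\<in>{x\<in>X. \<rho> x = r}. (cmod (f x))\<^sup>2))"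
      using piece by (rule sum_mono)
    also have "\<dots> = C\<^sup>2 * (\<Sum>r\<in>\<rho> ` E. \<Sum>x\<in>{x\<in>X. \<rho> x = r}. (cmod (f x))\<^sup>2)" by (simp add: sum_distrib_left)
    also have "\<dots> \<le> C\<^sup>2 * (\<Sum>r\<in>\<rho> ` E \<union> \<rho> ` X. \<Sum>x\<in>{x\<in>X. \<rho> x = r}. (cmod (f x))\<^sup>2)"
      using E X by (intro mult_left_mono sum_mono2) (auto simp: sum_nonneg)
    also have "(\<Sum>r\<in>\<rho> ` E \<union> \<rho> ` X. \<Sum>x\<in>{x\<in>X. \<rho> x = r}. (cmod (f x))\<^sup>2) = (\<Sum>x\<in>X. (cmod (f x))\<^sup>2)"
      using E X by (intro sum.group) auto
    finally have "(\<Sum>x\<in>E. (cmod (U f x))\<^sup>2) \<le> C\<^sup>2 * (\<Sum>x\<in>X. (cmod (f x))\<^sup>2)" .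
    then show "L2_set (\<lambda>x. cmod (U f x)) E \<le> C * L2_set (\<lambda>x. cmod (f x)) X"
      unfolding L2_set_def using C by (metis real_sqrt_le_iff real_sqrt_mult real_sqrt_unique)
  qed
  then show ?thesis by (simp add: U_def)
qed

text \<open>The closure is taken explicitly because the compression of a closed ideal is not visibly
  closed.\<close>

definition compr_ideal where
  "compr_ideal I = {X \<in> reduced_cstar GN. \<forall>\<epsilon>>0. \<exists>T\<in>compr ` I. op_close GN X T \<epsilon>}"

lemma compr_ideal_ideal:
  assumes I: "closed_ideal G (reduced_cstar G) I"
  shows "closed_ideal GN (reduced_cstar GN) (compr_ideal I)"
proof -
  interpret GN: group GN by (rule group_GN)
  have lin: "S \<in> I \<Longrightarrow> T \<in> I \<Longrightarrow> (\<lambda>f x. S f x + c * T f x) \<in> I" for S T c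
    using I by (simp add: closed_ideal_def)
  have z: "(\<lambda>f x. 0) \<in> I" using I by (simp add: closed_ideal_def)
  have mul: "a \<in> reduced_cstar G \<Longrightarrow> S \<in> I \<Longrightarrow> a \<circ> S \<in> I" "a \<in> reduced_cstar G \<Longrightarrow> S \<in> I \<Longrightarrow> S \<circ> a \<in> I" for a S
    using I by (simp_all add: closed_ideal_def)
  have sub: "I \<subseteq> reduced_cstar G" using I by (simp add: closed_ideal_def)
  have Ib: "S \<in> I \<Longrightarrow> S \<in> bounded_ops G" for S using sub reduced_cstar_sub by auto
  have cIb: "compr ` I \<subseteq> bounded_ops GN" using Ib compr_bounded by auto
  have rsb: "reg_span GN \<subseteq> bounded_ops GN" using GN.reg_span_bounded by auto
  have clin: "(\<lambda>f x. S f x + c * T f x) \<in> compr ` I" if ST: "S \<in> compr ` I" "T \<in> compr ` I" for S T c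
  proof -
    obtain S' T' where S': "S' \<in> I" "S = compr S'" and T': "T' \<in> I" "T = compr T'" using ST by auto
    show ?thesis unfolding S'(2) T'(2) compr_lincomb[symmetric] using lin[OF S'(1) T'(1)] by (rule imageI)
  qed
  have cz: "(\<lambda>f x. 0) \<in> compr ` I"
    using z by (intro image_eqI[of _ _ "\<lambda>f x. 0"]) (auto simp: compr_def)
  have left: "S \<circ> T \<in> compr ` I" if S: "S \<in> reg_span GN" and T: "T \<in> compr ` I" for S T
    using S
  proof (induction rule: GN.reg_span_induct)
    case zero
    have "(\<lambda>f x. 0) \<circ> T = (\<lambda>(f::'a\<Rightarrow>complex) (x::'a). 0::complex)" by auto
    then show ?case using cz by metis
  next
    case (add S n c)
    obtain T' where T': "T' \<in> I" "T = compr T'" using T by auto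
    have n: "n \<in> N" using add by simp
    then have "lreg GN n \<circ> T \<in> compr ` I"
      using compr_lreg_left[OF n Ib[OF T'(1)]] T' mul(1)[OF lreg_reduced_cstar T'(1), of n] N_sub by auto
    from clin[OF add.IH this, of c] show ?case by (simp add: o_def)
  qed
  have right: "T \<circ> S \<in> compr ` I" if S: "S \<in> reg_span GN" and T: "T \<in> compr ` I" for S T
    using S
  proof (induction rule: GN.reg_span_induct)
    case zero
    have "T \<circ> (\<lambda>f x. 0) = (\<lambda>(f::'a\<Rightarrow>complex) (x::'a). 0::complex)"
      using bounded_ops_zero[of T GN] cIb T by auto
    then show ?case using cz by metis
  next
    case (add S n c)
    obtain T' where T': "T' \<in> I" "T = compr T'" using T by auto
    have n: "n \<in> N" using add by simp
    then have *: "T \<circ> lreg GN n \<in> compr ` I"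
      using compr_lreg_right[OF n Ib[OF T'(1)]] T' mul(2)[OF lreg_reduced_cstar T'(1), of n] N_sub by auto
    have Tb: "T \<in> bounded_ops GN" using T cIb by auto
    have "T \<circ> (\<lambda>f x. S f x + c * lreg GN n f x) = (\<lambda>f x. (T \<circ> S) f x + c * (T \<circ> lreg GN n) f x)"
      using bounded_ops_lin[OF Tb bounded_ops_l2'[OF GN.reg_span_bounded[OF add(1)]] GN.lreg_l2[OF add(2)]]
      by (simp add: o_def)
    then show ?case using clin[OF add.IH *, of c] by simp
  qed
  show ?thesis
  proof (rule closed_idealI)
    show "compr_ideal I \<subseteq> reduced_cstar GN" by (auto simp: compr_ideal_def)
    show "reduced_cstar GN \<subseteq> bounded_ops GN" by (rule GN.reduced_cstar_sub)
    have cmem: "X \<in> compr_ideal I" if "X \<in> compr ` I" for X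
    proof -
      have "X \<in> reduced_cstar GN" using that sub compr_reduced_cstar by auto
      then show ?thesis unfolding compr_ideal_def using that op_close_refl[of _ GN X] less_imp_le by blast
    qed
    show "(\<lambda>f x. 0) \<in> compr_ideal I" using cz by (rule cmem)
    have J: "X \<in> reduced_cstar GN" "X \<in> bounded_ops GN" "\<And>\<epsilon>. \<epsilon> > 0 \<Longrightarrow> \<exists>T\<in>compr ` I. op_close GN X T \<epsilon>"
      if "X \<in> compr_ideal I" for X
      using that GN.reduced_cstar_bounded[of X] unfolding compr_ideal_def by blast+
    {
      fix S T c assume S: "S \<in> compr_ideal I" and T: "T \<in> compr_ideal I"
      have "\<exists>R\<in>compr ` I. op_close GN (\<lambda>f x. S f x + c * T f x) R \<epsilon>" if e: "\<epsilon> > 0" for \<epsilon>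
        using op_close_lincomb[OF J(2)[OF S] J(2)[OF T] cIb cIb J(3)[OF S] J(3)[OF T] e, of c] clin by blast
      then show "(\<lambda>f x. S f x + c * T f x) \<in> compr_ideal I"
        using GN.reduced_cstar_lincomb[OF J(1)[OF S] J(1)[OF T]] by (simp add: compr_ideal_def)
    }
    {
      fix a S assume a: "a \<in> reduced_cstar GN" and S: "S \<in> compr_ideal I"
      note ab = GN.reduced_cstar_bounded[OF a]
      have "\<exists>R\<in>compr ` I. op_close GN (a \<circ> S) R \<epsilon>" if e: "\<epsilon> > 0" for \<epsilon>
        using op_close_comp[OF ab J(2)[OF S] rsb cIb GN.reduced_cstar_approx[OF a] J(3)[OF S] e] left by blast
      then show "a \<circ> S \<in> compr_ideal I"
        using GN.reduced_cstar_comp[OF a J(1)[OF S]] by (simp add: compr_ideal_def)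
      have "\<exists>R\<in>compr ` I. op_close GN (S \<circ> a) R \<epsilon>" if e: "\<epsilon> > 0" for \<epsilon>
        using op_close_comp[OF J(2)[OF S] ab cIb rsb J(3)[OF S] GN.reduced_cstar_approx[OF a] e] right by blast
      then show "S \<circ> a \<in> compr_ideal I"
        using GN.reduced_cstar_comp[OF J(1)[OF S] a] by (simp add: compr_ideal_def)
    }
    fix T assume T: "T \<in> reduced_cstar GN" and c: "\<And>\<epsilon>. \<epsilon> > 0 \<Longrightarrow> \<exists>S\<in>compr_ideal I. op_close GN T S \<epsilon>"
    have "\<exists>R\<in>compr ` I. op_close GN T R \<epsilon>" if e: "\<epsilon> > 0" for \<epsilon>
    proof -
      have e2: "\<epsilon>/2 > 0" using e by simp
      obtain S where S: "S \<in> compr_ideal I" "op_close GN T S (\<epsilon>/2)" using c[OF e2] by blast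
      obtain R where R: "R \<in> compr ` I" "op_close GN S R (\<epsilon>/2)" using J(3)[OF S(1) e2] by blast
      have "op_close GN T R (\<epsilon>/2 + \<epsilon>/2)"
        using op_close_trans[OF S(2) R(2) GN.reduced_cstar_bounded[OF T] J(2)[OF S(1)]] R cIb by blast
      then show ?thesis using R by auto
    qed
    then show "T \<in> compr_ideal I" using T by (simp add: compr_ideal_def)
  qed
qed

text \<open>A nonzero operator has a nonzero matrix coefficient, from \<open>g\<close> to
  \<open>k\<close> say. Multiplying by translations on both sides stays in the ideal and moves that
  coefficient to the pair of identities, where compression keeps it.\<close>

lemma compr_ideal_nontrivial:
  assumes I: "closed_ideal G (reduced_cstar G) I" and T: "T \<in> I" "T \<noteq> (\<lambda>f x. 0)"
  shows "compr_ideal I \<noteq> {\<lambda>f x. 0}"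
proof -
  have sub: "I \<subseteq> reduced_cstar G" using I by (simp add: closed_ideal_def)
  have Tb: "T \<in> bounded_ops G" using T sub reduced_cstar_sub by auto
  obtain g where g: "g \<in> carrier G" "T (delta g) \<noteq> (\<lambda>_. 0)" using bounded_op_eq_0[OF Tb] T(2) by blast
  then obtain k where k: "T (delta g) k \<noteq> 0" by auto
  have kc: "k \<in> carrier G"
    using k bounded_ops_l2[OF Tb delta_l2[OF g(1)]] l2_outside by fastforce
  let ?T = "lreg G (inv k) \<circ> (T \<circ> lreg G g)"
  have "T \<circ> lreg G g \<in> I" using I T lreg_reduced_cstar[OF g(1)] by (simp add: closed_ideal_def)
  then have TI: "?T \<in> I" using I lreg_reduced_cstar[OF inv_closed[OF kc]] by (simp add: closed_ideal_def)
  have one: "\<one> \<in> N" using N by (rule subgroup.one_closed)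
  have "compr ?T (delta \<one>) \<one> = T (delta g) k"
    using one g kc bounded_ops_l2[OF Tb delta_l2[OF g(1)]] by (simp add: compr_def lreg_delta lreg_apply)
  then have "compr ?T \<noteq> (\<lambda>f x. 0)" using k by (metis)
  moreover have "compr ?T \<in> compr_ideal I"
    unfolding compr_ideal_def using compr_reduced_cstar[of ?T] TI sub op_close_refl
    by (auto intro!: exI[of _ ?T] bexI[of _ ?T] op_close_refl)
  ultimately show ?thesis by (metis singletonD)
qed

end

text \<open>Simplicity of the smaller algebra supplies an ideal element whose compression is close
  to 1. It is 1 plus a small combination over \<open>N\<close>, a combination off \<open>N\<close>
  and a small error. Averaging keeps the small terms small, and \<open>avg\<close> makes the
  combination off \<open>N\<close> small too; the result is an element of the ideal at distance less
  than 1 from the identity.\<close>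

theorem (in group) C_star_simple_criterion:
  assumes N: "subgroup N G" and simple: "C_star_simple (G\<lparr>carrier := N\<rparr>)"
    and avg: "\<And>F c \<epsilon>. finite F \<Longrightarrow> F \<subseteq> carrier G - N \<Longrightarrow> \<epsilon> > 0 \<Longrightarrow>
      \<exists>l. l \<noteq> [] \<and> set l \<subseteq> carrier G \<and>
        (\<forall>f\<in>l2 G. l2norm G (conj_avg G l (\<lambda>f x. \<Sum>g\<in>F. c g * lreg G g f x) f) \<le> \<epsilon> * l2norm G f)"
  shows "C_star_simple G"
  unfolding C_star_simple_def
proof (intro allI impI)
  interpret subgroup_compression G N
    by (intro subgroup_compression.intro is_group subgroup_compression_axioms.intro N)
  interpret GN: group GN by (rule group_GN)
  fix I assume I: "closed_ideal G (reduced_cstar G) I"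
  show "I = {\<lambda>f x. 0} \<or> I = reduced_cstar G"
  proof (cases "I = {\<lambda>f x. 0}")
    case False
    have z: "(\<lambda>f x. 0) \<in> I" and sub: "I \<subseteq> reduced_cstar G" using I by (auto simp: closed_ideal_def)
    then obtain T0 where T0: "T0 \<in> I" "T0 \<noteq> (\<lambda>f x. 0)" using False by blast
    have "compr_ideal I = reduced_cstar GN"
      using simple compr_ideal_ideal[OF I] compr_ideal_nontrivial[OF I T0] unfolding C_star_simple_def by blast
    then have "lreg GN \<one>\<^bsub>GN\<^esub> \<in> compr_ideal I" using GN.lreg_reduced_cstar[OF GN.one_closed] by simp
    then obtain T where T: "T \<in> I" "op_close GN (lreg GN \<one>\<^bsub>GN\<^esub>) (compr T) (1/8)"
      unfolding compr_ideal_def by (auto elim!: allE[of _ "1/8"])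
    have Tr: "T \<in> reduced_cstar G" using T sub by auto
    note Tb = reduced_cstar_bounded[OF Tr]
    obtain S where S: "S \<in> reg_span G" "op_close G T S (1/8)" using reduced_cstar_approx[OF Tr, of "1/8"] by auto
    note Sb = reg_span_bounded[OF S(1)]
    obtain X c where X: "finite X" "X \<subseteq> carrier G" "S = (\<lambda>f x. \<Sum>g\<in>X. c g * lreg G g f x)"
      using S(1) by (auto simp: reg_span_def)
    \<comment> \<open>\<open>d\<close> lists the coefficients of \<open>S - 1\<close> inside
      \<open>N\<close>; \<open>\<one>\<close> is inserted into \<open>Y\<close> because it may be
      missing from \<open>X\<close>.\<close>
    define d where "d g = (if g \<in> X then c g else 0) - (if g = \<one> then 1 else 0)" for g
    define Y where "Y = insert \<one> (X \<inter> N)"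
    have one: "\<one> \<in> N" using N by (rule subgroup.one_closed)
    have Y: "finite Y" "Y \<subseteq> N" using X one by (auto simp: Y_def)
    have dsum: "(\<Sum>g\<in>Y. d g * \<phi> g) = (\<Sum>g\<in>X \<inter> N. c g * \<phi> g) - \<phi> \<one>" for \<phi> :: "'a \<Rightarrow> complex"
    proof -
      have "(\<Sum>g\<in>Y. d g * \<phi> g) = (\<Sum>g\<in>Y. (if g \<in> X then c g else 0) * \<phi> g) - (\<Sum>g\<in>Y. (if g = \<one> then 1 else 0) * \<phi> g)"
        unfolding d_def by (simp add: left_diff_distrib sum_subtractf)
      also have "(\<Sum>g\<in>Y. (if g = \<one> then 1 else 0) * \<phi> g) = (\<Sum>g\<in>Y. if g = \<one> then \<phi> g else 0)"
        by (intro sum.cong) auto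
      also have "\<dots> = \<phi> \<one>" using Y by (simp add: sum.delta Y_def)
      also have "(\<Sum>g\<in>Y. (if g \<in> X then c g else 0) * \<phi> g) = (\<Sum>g\<in>X \<inter> N. c g * \<phi> g)"
        using Y X one by (intro sum.mono_neutral_cong_right) (auto simp: Y_def)
      finally show ?thesis .
    qed
    have cS: "compr S f x = (\<Sum>g\<in>X \<inter> N. c g * lreg GN g f x)" if f: "f \<in> l2 GN" for f x
    proof -
      have "compr S f x = (\<Sum>g\<in>X. c g * compr (lreg G g) f x)"
        unfolding X(3) by (cases "f \<in> l2 GN \<and> x \<in> N") (auto simp: compr_def)
      also have "\<dots> = (\<Sum>g\<in>X. c g * (if g \<in> N then lreg GN g f x else 0))"
        using X by (intro sum.cong) (auto simp: compr_lreg)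
      also have "\<dots> = (\<Sum>g\<in>X \<inter> N. c g * lreg GN g f x)"
        using X by (intro sum.mono_neutral_cong_right) auto
      finally show ?thesis .
    qed
    have close: "op_close GN (lreg GN \<one>\<^bsub>GN\<^esub>) (compr S) (1/8 + 1/8)"
      by (rule op_close_trans[OF T(2) op_close_compr[OF Tb Sb S(2)] GN.lreg_bounded compr_bounded[OF Tb] compr_bounded[OF Sb]])
        (simp add: one)
    have small_N: "l2norm GN (\<lambda>x. \<Sum>g\<in>Y. d g * lreg GN g f x) \<le> 1/4 * l2norm GN f" if f: "f \<in> l2 GN" for f
    proof -
      have "(\<lambda>x. \<Sum>g\<in>Y. d g * lreg GN g f x) = (\<lambda>x. - 1 * (lreg GN \<one>\<^bsub>GN\<^esub> f x - compr S f x))"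
        using f by (auto simp: dsum cS)
      moreover have "(\<lambda>x. lreg GN \<one>\<^bsub>GN\<^esub> f x - compr S f x) \<in> l2 GN"
        using l2_diff[OF GN.lreg_l2[OF GN.one_closed] compr_l2[OF Sb f]] .
      ultimately have "l2norm GN (\<lambda>x. \<Sum>g\<in>Y. d g * lreg GN g f x) = l2norm GN (\<lambda>x. lreg GN \<one>\<^bsub>GN\<^esub> f x - compr S f x)"
        using l2norm_scale[of "\<lambda>x. lreg GN \<one>\<^bsub>GN\<^esub> f x - compr S f x" GN "-1"] by simp
      then show ?thesis using op_closeD[OF close f] by simp
    qed
    define U where "U = (\<lambda>f x. \<Sum>g\<in>Y. d g * lreg G g f x)"
    define R where "R = (\<lambda>f x. \<Sum>g\<in>X - N. c g * lreg G g f x)"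
    have Ub: "U \<in> bounded_ops G"
      unfolding U_def using Y N_sub by (intro reg_span_bounded) (auto simp: reg_span_def)
    have Rb: "R \<in> bounded_ops G"
      unfolding R_def using X by (intro reg_span_bounded) (auto simp: reg_span_def)
    have U: "l2norm G (U f) \<le> 1/4 * l2norm G f" if "f \<in> l2 G" for f
      unfolding U_def using reg_span_GN_bound[OF Y _ small_N that] by simp
    have SUR: "S f x = f x + U f x + R f x" if f: "f \<in> l2 G" for f x
    proof -
      have "U f x = (\<Sum>g\<in>X \<inter> N. c g * lreg G g f x) - f x" unfolding U_def dsum using f by (simp add: lreg_one)
      moreover have "S f x = (\<Sum>g\<in>X \<inter> N. c g * lreg G g f x) + R f x"
        unfolding X(3) R_def using sum.Int_Diff[OF X(1)] by blast
      ultimately show ?thesis by simp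
    qed
    obtain l where l: "l \<noteq> []" "set l \<subseteq> carrier G" and
      lR: "\<And>f. f \<in> l2 G \<Longrightarrow> l2norm G (conj_avg G l R f) \<le> 1/4 * l2norm G f"
      using avg[of "X - N" "1/4" c] X unfolding R_def by (auto simp: Diff_mono)
    have avT: "conj_avg G l T \<in> I" using closed_ideal_conj_avg[OF I T(1) l(2)] .
    \<comment> \<open>The budget is 1/4 for the part in \<open>N\<close> (two errors of 1/8 from the
      approximations), 1/4 for the averaged part off \<open>N\<close>, and 1/8 for
      \<open>T - S\<close>.\<close>
    have "l2norm G (\<lambda>x. f x - conj_avg G l T f x) \<le> 5/8 * l2norm G f" if f: "f \<in> l2 G" for f
    proof -
      define Q where "Q = (\<lambda>f x. T f x - S f x)"
      have Qb: "Q \<in> bounded_ops G" using bounded_ops_op_diff[OF Tb Sb] by (simp add: op_diff_def Q_def)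
      note bl = bounded_ops_l2[OF Tb] bounded_ops_l2[OF Ub] bounded_ops_l2[OF Rb] bounded_ops_l2[OF Qb]
      have Tdec: "T h = (\<lambda>x. (h x + U h x) + (R h x + Q h x))" if "h \<in> l2 G" for h
        using SUR[OF that] by (auto simp: Q_def)
      have "conj_avg G l T f = conj_avg G l (\<lambda>h x. (h x + U h x) + (R h x + Q h x)) f"
        using Tdec by (rule conj_avg_cong[OF l(2)])
      also have "\<dots> = (\<lambda>x. conj_avg G l (\<lambda>h x. h x + U h x) f x + conj_avg G l (\<lambda>h x. R h x + Q h x) f x)"
        by (rule conj_avg_add[OF _ _ l(2) f]) (simp_all add: bl l2_add)
      also have "\<dots> = (\<lambda>x. (f x + conj_avg G l U f x) + (conj_avg G l R f x + conj_avg G l Q f x))"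
        using conj_avg_add[OF _ bl(2) l(2) f, of "\<lambda>h. h"] conj_avg_add[OF bl(3) bl(4) l(2) f] conj_avg_one[OF l(2,1) f]
        by simp
      finally have eq: "(\<lambda>x. f x - conj_avg G l T f x)
        = (\<lambda>x. - 1 * (conj_avg G l U f x + (conj_avg G l R f x + conj_avg G l Q f x)))" by (simp add: algebra_simps)
      note cl = conj_avg_l2[OF l(2)]
      have "l2norm G (\<lambda>x. f x - conj_avg G l T f x) = l2norm G (\<lambda>x. conj_avg G l U f x + (conj_avg G l R f x + conj_avg G l Q f x))"
        unfolding eq using l2norm_scale[OF l2_add[OF cl l2_add[OF cl cl]], where c="-1"] by simp
      also have "\<dots> \<le> l2norm G (conj_avg G l U f) + (l2norm G (conj_avg G l R f) + l2norm G (conj_avg G l Q f))"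
        using l2norm_add[OF cl l2_add[OF cl cl], of U f R f Q f] l2norm_add[OF cl cl, of R f Q f] by linarith
      also have "\<dots> \<le> 1/4 * l2norm G f + (1/4 * l2norm G f + 1/8 * l2norm G f)"
        using l2norm_conj_avg[OF l(2,1) bl(2) U f] lR[OF f]
          l2norm_conj_avg[OF l(2,1) bl(4) _ f, where C="1/8"] op_closeD[OF S(2)] unfolding Q_def
        by (intro add_mono) auto
      finally show ?thesis by simp
    qed
    then have "lreg G \<one> \<in> I" by (intro closed_ideal_near_one[OF I avT, of "5/8"]) auto
    then show ?thesis using closed_ideal_full[OF I] by blast
  qed simp
qed

section \<open>The Hahn--Banach theorem\<close>

text \<open>Homogeneity is asked only as an inequality, which is what infima of such functionals
  inherit directly; equality follows by scaling back with \<open>1/c\<close>.\<close>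

definition sublinear_on :: "('i \<Rightarrow> real) set \<Rightarrow> (('i \<Rightarrow> real) \<Rightarrow> real) \<Rightarrow> bool" where
  "sublinear_on E p \<longleftrightarrow> (\<forall>f\<in>E. \<forall>g\<in>E. p (\<lambda>x. f x + g x) \<le> p f + p g)
     \<and> (\<forall>f\<in>E. \<forall>c>0. p (\<lambda>x. c * f x) \<le> c * p f)"

lemma sublinear_onI:
  assumes "\<And>f g. f \<in> E \<Longrightarrow> g \<in> E \<Longrightarrow> p (\<lambda>x. f x + g x) \<le> p f + p g"
    and "\<And>f c. f \<in> E \<Longrightarrow> c > 0 \<Longrightarrow> p (\<lambda>x. c * f x) \<le> c * p f"
  shows "sublinear_on E p"
  using assms by (simp add: sublinear_on_def)

lemma sublinear_on_add: "sublinear_on E p \<Longrightarrow> f \<in> E \<Longrightarrow> g \<in> E \<Longrightarrow> p (\<lambda>x. f x + g x) \<le> p f + p g"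
  and sublinear_on_le: "sublinear_on E p \<Longrightarrow> f \<in> E \<Longrightarrow> c > 0 \<Longrightarrow> p (\<lambda>x. c * f x) \<le> c * p f"
  by (simp_all add: sublinear_on_def)

locale function_space =
  fixes E :: "('i \<Rightarrow> real) set"
  assumes E0: "(\<lambda>_. 0) \<in> E"
    and Elin: "\<And>f g c. f \<in> E \<Longrightarrow> g \<in> E \<Longrightarrow> (\<lambda>x. f x + c * g x) \<in> E"
begin

lemma Escale: "f \<in> E \<Longrightarrow> (\<lambda>x. c * f x) \<in> E"
  using Elin[OF E0, of f c] by simp

lemma Eadd: "f \<in> E \<Longrightarrow> g \<in> E \<Longrightarrow> (\<lambda>x. f x + g x) \<in> E"
  using Elin[of f g 1] by simp

lemma Eneg: "f \<in> E \<Longrightarrow> (\<lambda>x. - f x) \<in> E"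
  using Escale[of f "-1"] by simp

lemma sublinear_scale:
  assumes "sublinear_on E p" "f \<in> E" "c > 0"
  shows "p (\<lambda>x. c * f x) = c * p f"
proof (rule antisym)
  show "p (\<lambda>x. c * f x) \<le> c * p f" using assms by (rule sublinear_on_le)
  have "p (\<lambda>x. (1/c) * (c * f x)) \<le> (1/c) * p (\<lambda>x. c * f x)"
    using assms by (intro sublinear_on_le[of E p]) (auto simp: Escale)
  then show "c * p f \<le> p (\<lambda>x. c * f x)" using assms(3) by (simp add: field_simps)
qed

lemma sublinear_zero: "sublinear_on E p \<Longrightarrow> p (\<lambda>_. 0) = 0"
  using sublinear_scale[OF _ E0, of p 2] by simp

lemma sublinear_scale': "sublinear_on E p \<Longrightarrow> f \<in> E \<Longrightarrow> c \<ge> 0 \<Longrightarrow> p (\<lambda>x. c * f x) = c * p f"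
  using sublinear_scale[of p f c] sublinear_zero[of p] by (cases "c = 0") auto

lemma sublinear_neg: "sublinear_on E p \<Longrightarrow> f \<in> E \<Longrightarrow> - p (\<lambda>x. - f x) \<le> p f"
  using sublinear_on_add[of E p f "\<lambda>x. - f x"] Eneg[of f] sublinear_zero[of p] by simp

text \<open>Minimal sublinear functionals turn out to be linear, which yields the Hahn--Banach theorem.\<close>

lemma minimal_sublinear_exists:
  assumes p: "sublinear_on E p"
  obtains m where "sublinear_on E m" "\<And>f. f \<in> E \<Longrightarrow> m f \<le> p f"
    "\<And>q. sublinear_on E q \<Longrightarrow> (\<And>f. f \<in> E \<Longrightarrow> q f \<le> m f) \<Longrightarrow> (\<And>f. f \<in> E \<Longrightarrow> q f = m f)"
proof -
  \<comment> \<open>The order compares functionals only on \<open>E\<close>; fixing the value 0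
    elsewhere makes it antisymmetric.\<close>
  define Q where "Q = {q. (\<forall>f. f \<notin> E \<longrightarrow> q f = 0) \<and> sublinear_on E q \<and> (\<forall>f\<in>E. q f \<le> p f)}"
  define P where "P q q' \<longleftrightarrow> (\<forall>f\<in>E. q' f \<le> (q f :: real))" for q q' :: "('i \<Rightarrow> real) \<Rightarrow> real"
  have ext: "q = q'" if "q \<in> Q" "q' \<in> Q" "\<And>f. f \<in> E \<Longrightarrow> q f = q' f" for q q'
  proof
    fix f show "q f = q' f" using that by (cases "f \<in> E") (auto simp: Q_def)
  qed
  have restr: "sublinear_on E (\<lambda>f. if f \<in> E then q f else 0)" if "sublinear_on E q" for q
    using that by (auto simp: sublinear_on_def Eadd Escale)
  have po: "partial_order_on Q (relation_of P Q)"
  proof (rule partial_order_on_relation_ofI)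
    show "P a b \<Longrightarrow> P b c \<Longrightarrow> P a c" for a b c unfolding P_def by (meson order_trans)
    show "a \<in> Q \<Longrightarrow> b \<in> Q \<Longrightarrow> P a b \<Longrightarrow> P b a \<Longrightarrow> a = b" for a b
      by (rule ext) (auto simp: P_def intro: antisym)
  qed (auto simp: P_def)
  have chain: "\<exists>u\<in>Q. \<forall>a\<in>C. P a u" if C: "C \<in> Chains (relation_of P Q)" for C
  proof (cases "C = {}")
    case True
    have "(\<lambda>f. if f \<in> E then p f else 0) \<in> Q" using restr[OF p] by (auto simp: Q_def)
    then show ?thesis using True by auto
  next
    case False
    have CQ: "C \<subseteq> Q" using C by (auto simp: Chains_def relation_of_def)
    have tot: "P a b \<or> P b a" if "a \<in> C" "b \<in> C" for a b
      using C that by (auto simp: Chains_def relation_of_def)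
    have sl: "sublinear_on E q" "f \<in> E \<Longrightarrow> q f \<le> p f" if "q \<in> C" for q f using CQ that by (auto simp: Q_def)
    define u where "u = (\<lambda>f. if f \<in> E then (INF q\<in>C. q f) else 0)"
    have bdd: "bdd_below ((\<lambda>q. q f) ` C)" if f: "f \<in> E" for f
    proof (rule bdd_belowI[of _ "- p (\<lambda>x. - f x)"])
      fix y assume "y \<in> (\<lambda>q. q f) ` C"
      then obtain q where "q \<in> C" "y = q f" by auto
      then show "- p (\<lambda>x. - f x) \<le> y"
        using sublinear_neg[OF sl(1) f, of q] sl(2)[of q "\<lambda>x. - f x"] Eneg[OF f] by linarith
    qed
    have ule: "u f \<le> q f" if "f \<in> E" "q \<in> C" for f q
      using that by (auto simp: u_def intro: cINF_lower[OF bdd])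
    have uge: "c \<le> u f" if "f \<in> E" "\<And>q. q \<in> C \<Longrightarrow> c \<le> q f" for f c
      using that False by (auto simp: u_def intro: cINF_greatest)
    have "sublinear_on E u"
    proof (rule sublinear_onI)
      fix f g assume f: "f \<in> E" and g: "g \<in> E"
      \<comment> \<open>Two members of the chain are comparable, so the smaller one bounds both
        terms at once. This makes the infimum subadditive.\<close>
      have fg: "u (\<lambda>x. f x + g x) \<le> q1 f + q2 g" if q: "q1 \<in> C" "q2 \<in> C" for q1 q2
      proof -
        obtain q where q': "q \<in> C" "q f \<le> q1 f" "q g \<le> q2 g"
          using tot[OF q] q f g unfolding P_def by (metis order_refl)
        then show ?thesis
          using ule[OF Eadd[OF f g] q'(1)] sublinear_on_add[OF sl(1)[OF q'(1)] f g] by linarith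
      qed
      have "u (\<lambda>x. f x + g x) - u g \<le> u f"
      proof (rule uge[OF f])
        fix q1 assume q1: "q1 \<in> C"
        have "u (\<lambda>x. f x + g x) - q1 f \<le> u g"
          using fg[OF q1] by (intro uge[OF g]) (simp add: algebra_simps)
        then show "u (\<lambda>x. f x + g x) - u g \<le> q1 f" by simp
      qed
      then show "u (\<lambda>x. f x + g x) \<le> u f + u g" by simp
    next
      fix f and c :: real assume f: "f \<in> E" and c: "c > 0"
      have "u (\<lambda>x. c * f x) / c \<le> u f"
      proof (rule uge[OF f])
        fix q assume q: "q \<in> C"
        then show "u (\<lambda>x. c * f x) / c \<le> q f"
          using ule[OF Escale[OF f] q, of c] sublinear_on_le[OF sl(1)[OF q] f c] c by (simp add: field_simps)
      qed
      then show "u (\<lambda>x. c * f x) \<le> c * u f" using c by (simp add: field_simps)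
    qed
    moreover have "u f \<le> p f" if "f \<in> E" for f
    proof -
      obtain q where "q \<in> C" using False by auto
      then show ?thesis using ule[OF that] sl(2)[OF _ that] by fastforce
    qed
    ultimately have "u \<in> Q" by (auto simp: Q_def u_def)
    then show ?thesis using ule by (auto simp: P_def)
  qed
  obtain m where m: "m \<in> Q" "\<And>a. a \<in> Q \<Longrightarrow> P m a \<Longrightarrow> a = m" using predicate_Zorn[OF po chain] by blast
  show ?thesis
  proof (rule that)
    show ms: "sublinear_on E m" and mp: "\<And>f. f \<in> E \<Longrightarrow> m f \<le> p f" using m(1) by (auto simp: Q_def)
    fix q f assume q: "sublinear_on E q" "\<And>f. f \<in> E \<Longrightarrow> q f \<le> m f" and f: "f \<in> E"
    have "(\<lambda>f. if f \<in> E then q f else 0) \<in> Q"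
      using restr[OF q(1)] q(2) mp by (force simp: Q_def)
    moreover have "P m (\<lambda>f. if f \<in> E then q f else 0)" using q(2) by (simp add: P_def)
    ultimately have "(\<lambda>f. if f \<in> E then q f else 0) = m" by (rule m(2))
    from fun_cong[OF this, of f] show "q f = m f" using f by simp
  qed
qed

theorem hahn_banach_functional:
  assumes p: "sublinear_on E p"
  obtains F where "\<And>f g c. f \<in> E \<Longrightarrow> g \<in> E \<Longrightarrow> F (\<lambda>x. f x + c * g x) = F f + c * F g"
    "\<And>f. f \<in> E \<Longrightarrow> F f \<le> p f"
proof -
  obtain m where m: "sublinear_on E m" "\<And>f. f \<in> E \<Longrightarrow> m f \<le> p f"
    and min: "\<And>q f. sublinear_on E q \<Longrightarrow> (\<And>f. f \<in> E \<Longrightarrow> q f \<le> m f) \<Longrightarrow> f \<in> E \<Longrightarrow> q f = m f"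
    using minimal_sublinear_exists[OF p] by blast
  have add: "m (\<lambda>x. f x + g x) = m f + m g" if f: "f \<in> E" and g: "g \<in> E" for f g
  proof (rule antisym)
    show "m (\<lambda>x. f x + g x) \<le> m f + m g" using m(1) f g by (rule sublinear_on_add)
    \<comment> \<open>\<open>q\<close> is sublinear and lies below \<open>m\<close> (take
      \<open>t = 0\<close>), so minimality gives \<open>q = m\<close>. The value
      \<open>t = 1\<close> then yields the missing inequality of additivity.\<close>
    define q where "q = (\<lambda>h. INF t\<in>{0..}. m (\<lambda>x. h x + t * g x) - t * m g)"
    have bdd: "bdd_below ((\<lambda>t. m (\<lambda>x. h x + t * g x) - t * m g) ` {0..})" if h: "h \<in> E" for h
    proof (rule bdd_belowI[of _ "- m (\<lambda>x. - h x)"])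
      fix y assume "y \<in> (\<lambda>t. m (\<lambda>x. h x + t * g x) - t * m g) ` {0..}"
      then obtain t where t: "t \<ge> 0" "y = m (\<lambda>x. h x + t * g x) - t * m g" by auto
      have "m (\<lambda>x. (h x + t * g x) + (- h x)) \<le> m (\<lambda>x. h x + t * g x) + m (\<lambda>x. - h x)"
        by (rule sublinear_on_add[OF m(1) Elin[OF h g] Eneg[OF h]])
      then show "- m (\<lambda>x. - h x) \<le> y" using t sublinear_scale'[OF m(1) g t(1)] by simp
    qed
    have qle: "q h \<le> m (\<lambda>x. h x + t * g x) - t * m g" if "h \<in> E" "t \<ge> 0" for h t
      unfolding q_def using that by (intro cINF_lower[OF bdd]) auto
    have qge: "c \<le> q h" if "h \<in> E" "\<And>t. t \<ge> 0 \<Longrightarrow> c \<le> m (\<lambda>x. h x + t * g x) - t * m g" for h c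
      unfolding q_def using that by (intro cINF_greatest) auto
    have "sublinear_on E q"
    proof (rule sublinear_onI)
      fix h k assume h: "h \<in> E" and k: "k \<in> E"
      have hk: "q (\<lambda>x. h x + k x) \<le> (m (\<lambda>x. h x + s * g x) - s * m g) + (m (\<lambda>x. k x + t * g x) - t * m g)"
        if st: "s \<ge> 0" "t \<ge> 0" for s t
      proof -
        have "q (\<lambda>x. h x + k x) \<le> m (\<lambda>x. (h x + k x) + (s + t) * g x) - (s + t) * m g"
          using st by (intro qle Eadd h k) auto
        also have "(\<lambda>x. (h x + k x) + (s + t) * g x) = (\<lambda>x. (h x + s * g x) + (k x + t * g x))"
          by (auto simp: algebra_simps)
        also have "m \<dots> \<le> m (\<lambda>x. h x + s * g x) + m (\<lambda>x. k x + t * g x)"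
          by (rule sublinear_on_add[OF m(1) Elin[OF h g] Elin[OF k g]])
        finally show ?thesis by (simp add: algebra_simps)
      qed
      have "q (\<lambda>x. h x + k x) - q k \<le> q h"
      proof (rule qge[OF h])
        fix s :: real assume s: "s \<ge> 0"
        have "q (\<lambda>x. h x + k x) - (m (\<lambda>x. h x + s * g x) - s * m g) \<le> q k"
          using hk[OF s] by (intro qge[OF k]) (simp add: algebra_simps)
        then show "q (\<lambda>x. h x + k x) - q k \<le> m (\<lambda>x. h x + s * g x) - s * m g" by simp
      qed
      then show "q (\<lambda>x. h x + k x) \<le> q h + q k" by simp
    next
      fix h and c :: real assume h: "h \<in> E" and c: "c > 0"
      have "q (\<lambda>x. c * h x) / c \<le> q h"
      proof (rule qge[OF h])
        fix t :: real assume t: "t \<ge> 0"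
        have "q (\<lambda>x. c * h x) \<le> m (\<lambda>x. c * h x + (c * t) * g x) - (c * t) * m g"
          using c t by (intro qle Escale h) auto
        also have "(\<lambda>x. c * h x + (c * t) * g x) = (\<lambda>x. c * (h x + t * g x))" by (auto simp: algebra_simps)
        also have "m \<dots> = c * m (\<lambda>x. h x + t * g x)" by (rule sublinear_scale[OF m(1) Elin[OF h g] c])
        finally show "q (\<lambda>x. c * h x) / c \<le> m (\<lambda>x. h x + t * g x) - t * m g" using c by (simp add: field_simps)
      qed
      then show "q (\<lambda>x. c * h x) \<le> c * q h" using c by (simp add: field_simps)
    qed
    moreover have "q h \<le> m h" if "h \<in> E" for h using qle[OF that, of 0] by simp
    ultimately have "q f = m f" using f by (rule min)
    then show "m f + m g \<le> m (\<lambda>x. f x + g x)" using qle[OF f, of 1] by simp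
  qed
  have scale: "m (\<lambda>x. c * g x) = c * m g" if g: "g \<in> E" for c g
  proof (cases "c \<ge> 0")
    case True
    then show ?thesis using sublinear_scale'[OF m(1) g] by simp
  next
    case False
    have "m (\<lambda>x. c * g x + (- c) * g x) = m (\<lambda>x. c * g x) + m (\<lambda>x. (- c) * g x)"
      by (rule add[OF Escale[OF g] Escale[OF g]])
    moreover have "m (\<lambda>x. (- c) * g x) = - c * m g" using False by (intro sublinear_scale'[OF m(1) g]) auto
    ultimately show ?thesis using sublinear_zero[OF m(1)] by simp
  qed
  show ?thesis
    by (rule that[of m]) (use add scale Escale m in auto)
qed

end

section \<open>Amenability and almost invariant vectors\<close>

definition avg_op :: "('a, 'b) monoid_scheme \<Rightarrow> 'a list \<Rightarrow> ('a \<Rightarrow> complex) \<Rightarrow> 'a \<Rightarrow> complex" where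
  "avg_op H l f = (\<lambda>x. (\<Sum>s\<leftarrow>l. lreg H s f x) / of_nat (length l))"

text \<open>For a unit vector \<psi> this is integration against the probability density given by
  the squared modulus of \<psi>.\<close>

definition mean_of :: "('a, 'b) monoid_scheme \<Rightarrow> ('a \<Rightarrow> complex) \<Rightarrow> ('a \<Rightarrow> real) \<Rightarrow> real" where
  "mean_of H \<psi> u = infsum (\<lambda>x. (cmod (\<psi> x))\<^sup>2 * u x) (carrier H)"

definition almost_inv :: "('a, 'b) monoid_scheme \<Rightarrow> 'a set \<Rightarrow> real \<Rightarrow> ('a \<Rightarrow> complex) set" where
  "almost_inv H S \<epsilon> = {\<psi>\<in>l2 H. l2norm H \<psi> = 1 \<and> (\<forall>s\<in>S. l2norm H (\<lambda>x. lreg H s \<psi> x - \<psi> x) \<le> \<epsilon>)}"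

lemma l2_sq_summable: "f \<in> l2 H \<Longrightarrow> (\<lambda>x. (cmod (f x))\<^sup>2) summable_on carrier H"
  by (simp add: l2_def)

lemma l2norm_sq: "(l2norm H f)\<^sup>2 = infsum (\<lambda>x. (cmod (f x))\<^sup>2) (carrier H)"
  unfolding l2norm_def by (simp add: infsum_nonneg)

lemma mean_of_summable:
  assumes "\<psi> \<in> l2 H" "bounded_on (carrier H) u"
  shows "(\<lambda>x. (cmod (\<psi> x))\<^sup>2 * u x) summable_on carrier H"
proof -
  obtain B where B: "\<And>x. x \<in> carrier H \<Longrightarrow> \<bar>u x\<bar> \<le> B" using assms(2) by (auto simp: bounded_on_def)
  have "(\<lambda>x. norm ((cmod (\<psi> x))\<^sup>2 * u x)) summable_on carrier H"
  proof (rule Infinite_Sum.abs_summable_on_comparison_test'[where g="\<lambda>x. (cmod (\<psi> x))\<^sup>2 * B"])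
    show "(\<lambda>x. (cmod (\<psi> x))\<^sup>2 * B) summable_on carrier H"
      using l2_sq_summable[OF assms(1)] by (rule summable_on_cmult_left)
  qed (use B in \<open>auto simp: abs_mult intro!: mult_left_mono\<close>)
  then show ?thesis by (rule abs_summable_summable)
qed

lemma mean_of_lin:
  assumes "\<psi> \<in> l2 H" "bounded_on (carrier H) u" "bounded_on (carrier H) v"
  shows "mean_of H \<psi> (\<lambda>x. u x + c * v x) = mean_of H \<psi> u + c * mean_of H \<psi> v"
proof -
  have "mean_of H \<psi> (\<lambda>x. u x + c * v x)
     = infsum (\<lambda>x. (cmod (\<psi> x))\<^sup>2 * u x + c * ((cmod (\<psi> x))\<^sup>2 * v x)) (carrier H)"
    unfolding mean_of_def by (intro infsum_cong) (simp add: algebra_simps)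
  also have "\<dots> = mean_of H \<psi> u + c * mean_of H \<psi> v"
    unfolding mean_of_def
    using mean_of_summable[OF assms(1,2)] mean_of_summable[OF assms(1,3)]
    by (subst infsum_add) (auto intro: summable_on_cmult_right simp: infsum_cmult_right')
  finally show ?thesis .
qed

lemma mean_of_le:
  assumes "\<psi> \<in> l2 H" "l2norm H \<psi> = 1" "bounded_on (carrier H) u" "\<And>x. x \<in> carrier H \<Longrightarrow> u x \<le> c"
  shows "mean_of H \<psi> u \<le> c"
proof -
  have "mean_of H \<psi> u \<le> infsum (\<lambda>x. (cmod (\<psi> x))\<^sup>2 * c) (carrier H)"
    unfolding mean_of_def using assms l2_sq_summable[OF assms(1)]
    by (intro infsum_mono mean_of_summable summable_on_cmult_left) (auto intro: mult_left_mono)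
  also have "\<dots> = c" using assms(2) l2norm_sq[of H \<psi>] by (simp add: infsum_cmult_left')
  finally show ?thesis .
qed

lemma bounded_on_lin:
  assumes "bounded_on A u" "bounded_on A v" shows "bounded_on A (\<lambda>x. u x + c * v x)"
proof -
  obtain B C where B: "\<And>x. x \<in> A \<Longrightarrow> \<bar>u x\<bar> \<le> B" "\<And>x. x \<in> A \<Longrightarrow> \<bar>v x\<bar> \<le> C" using assms by (auto simp: bounded_on_def)
  have "\<bar>u x + c * v x\<bar> \<le> B + \<bar>c\<bar> * C" if "x \<in> A" for x
  proof -
    have "\<bar>c * v x\<bar> \<le> \<bar>c\<bar> * C" using B(2)[OF that] by (auto simp: abs_mult intro: mult_left_mono)
    then show ?thesis using B(1)[OF that] by linarith
  qed
  then show ?thesis by (auto simp: bounded_on_def)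
qed

context group
begin

lemma mean_of_translate:
  assumes "\<psi> \<in> l2 G" "s \<in> carrier G"
  shows "mean_of G \<psi> (\<lambda>x. u (s \<otimes> x)) = mean_of G (lreg G s \<psi>) u"
proof -
  have "mean_of G (lreg G s \<psi>) u = infsum (\<lambda>x. (cmod (lreg G s \<psi> (s \<otimes> x)))\<^sup>2 * u (s \<otimes> x)) (carrier G)"
    unfolding mean_of_def
    by (rule infsum_reindex_bij_betw[OF bij_betw_ltimes[OF assms(2)], symmetric])
  also have "\<dots> = mean_of G \<psi> (\<lambda>x. u (s \<otimes> x))"
    unfolding mean_of_def using assms by (intro infsum_cong) (auto simp: lreg_apply m_assoc[symmetric])
  finally show ?thesis by simp
qed

text \<open>If \<psi> is nearly invariant, so is the density it defines, in the norm of summable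
  functions; bounded functions are therefore integrated almost invariantly.\<close>

lemma mean_of_almost_inv:
  assumes \<psi>: "\<psi> \<in> almost_inv G S \<epsilon>" and s: "s \<in> S" "S \<subseteq> carrier G" and e: "\<epsilon> > 0"
    and B: "\<And>x. x \<in> carrier G \<Longrightarrow> \<bar>u x\<bar> \<le> B"
  shows "\<bar>mean_of G \<psi> (\<lambda>x. u (s \<otimes> x)) - mean_of G \<psi> u\<bar> \<le> 3 * \<epsilon> * B"
proof -
  have sc: "s \<in> carrier G" using s by auto
  have p: "\<psi> \<in> l2 G" "l2norm G \<psi> = 1" "l2norm G (\<lambda>x. lreg G s \<psi> x - \<psi> x) \<le> \<epsilon>"
    using \<psi> s by (auto simp: almost_inv_def)
  have B0: "0 \<le> B" using B[OF one_closed] by linarith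
  have bu: "bounded_on (carrier G) u" using B by (auto simp: bounded_on_def)
  let ?a = "lreg G s \<psi>"
  have al: "?a \<in> l2 G" "l2norm G ?a = 1" using sc p by auto
  have dl: "(\<lambda>x. ?a x - \<psi> x) \<in> l2 G" using al(1) p(1) by (rule l2_diff)
  \<comment> \<open>Weighted AM-GM in place of Cauchy-Schwarz: with \<open>D\<close> the modulus of
    the difference and \<open>A\<close>, \<open>B\<close> the two moduli, \<open>D (A + B)\<close>
    is split with weight \<epsilon>. Summation gives \<epsilon>/2 + 2\<epsilon>, which is below
    3\<epsilon>.\<close>
  let ?g = "\<lambda>x. (1/(2*\<epsilon>)) * (cmod (?a x - \<psi> x))\<^sup>2 + \<epsilon> * ((cmod (?a x))\<^sup>2 + (cmod (\<psi> x))\<^sup>2)"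
  have pt: "\<bar>(cmod (?a x))\<^sup>2 * u x - (cmod (\<psi> x))\<^sup>2 * u x\<bar> \<le> B * ?g x" if x: "x \<in> carrier G" for x
  proof -
    let ?A = "cmod (?a x)" and ?B = "cmod (\<psi> x)" and ?D = "cmod (?a x - \<psi> x)"
    have d: "\<bar>?A - ?B\<bar> \<le> ?D" by (rule norm_triangle_ineq3)
    have "\<bar>?A\<^sup>2 - ?B\<^sup>2\<bar> = \<bar>?A - ?B\<bar> * (?A + ?B)"
      by (simp add: power2_eq_square square_diff_square_factored abs_mult mult.commute)
    also have "\<dots> \<le> ?D * (?A + ?B)" using d by (intro mult_right_mono) auto
    also have "\<dots> \<le> (1/(2*\<epsilon>)) * ?D\<^sup>2 + (\<epsilon>/2) * (?A + ?B)\<^sup>2"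
    proof -
      have "0 \<le> (?D - \<epsilon> * (?A + ?B))\<^sup>2 / (2 * \<epsilon>)" using e by simp
      also have "\<dots> = (1/(2*\<epsilon>)) * ?D\<^sup>2 + (\<epsilon>/2) * (?A + ?B)\<^sup>2 - ?D * (?A + ?B)"
        using e by (simp add: field_simps power2_eq_square)
      finally show ?thesis by simp
    qed
    also have "\<dots> \<le> ?g x"
    proof -
      have "(?A + ?B)\<^sup>2 \<le> 2 * (?A\<^sup>2 + ?B\<^sup>2)"
        using sum_squares_bound[of ?A ?B] by (simp add: power2_sum)
      then show ?thesis using e by (simp add: mult_left_mono)
    qed
    finally have "\<bar>?A\<^sup>2 - ?B\<^sup>2\<bar> \<le> ?g x" .
    then have "\<bar>?A\<^sup>2 - ?B\<^sup>2\<bar> * \<bar>u x\<bar> \<le> ?g x * B" using B[OF x] by (intro mult_mono) auto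
    then have "\<bar>(?A\<^sup>2 - ?B\<^sup>2) * u x\<bar> \<le> B * ?g x" unfolding abs_mult by (simp only: mult.commute[of B])
    then show ?thesis by (simp only: left_diff_distrib)
  qed
  have gs: "?g summable_on carrier G"
    using l2_sq_summable[OF dl] l2_sq_summable[OF al(1)] l2_sq_summable[OF p(1)]
    by (intro summable_on_add summable_on_cmult_right)
  have ginf: "infsum ?g (carrier G) \<le> 3 * \<epsilon>"
  proof -
    have "infsum ?g (carrier G) = (1/(2*\<epsilon>)) * (l2norm G (\<lambda>x. ?a x - \<psi> x))\<^sup>2 + \<epsilon> * ((l2norm G ?a)\<^sup>2 + (l2norm G \<psi>)\<^sup>2)"
      unfolding l2norm_sq using l2_sq_summable[OF dl] l2_sq_summable[OF al(1)] l2_sq_summable[OF p(1)]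
      by (simp only: infsum_add infsum_cmult_right' summable_on_add summable_on_cmult_right)
    also have "\<dots> \<le> (1/(2*\<epsilon>)) * \<epsilon>\<^sup>2 + \<epsilon> * (1 + 1)"
      using al p e by (intro add_mono mult_left_mono power_mono) auto
    also have "\<dots> \<le> 3 * \<epsilon>" using e by (simp add: power2_eq_square)
    finally show ?thesis .
  qed
  have sums: "(\<lambda>x. (cmod (?a x))\<^sup>2 * u x) summable_on carrier G" "(\<lambda>x. (cmod (\<psi> x))\<^sup>2 * u x) summable_on carrier G"
    using mean_of_summable[OF al(1) bu] mean_of_summable[OF p(1) bu] .
  have cmp: "infsum X (carrier G) \<le> infsum Y (carrier G) + 3 * \<epsilon> * B"
    if XY: "X summable_on carrier G" "Y summable_on carrier G" "\<And>x. x \<in> carrier G \<Longrightarrow> X x \<le> Y x + B * ?g x" for X Y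
  proof -
    have "infsum X (carrier G) \<le> infsum (\<lambda>x. Y x + B * ?g x) (carrier G)"
      by (intro infsum_mono summable_on_add summable_on_cmult_right XY gs)
    also have "\<dots> = infsum Y (carrier G) + B * infsum ?g (carrier G)"
      by (subst infsum_add) (auto simp only: infsum_cmult_right' intro!: XY summable_on_cmult_right gs)
    also have "B * infsum ?g (carrier G) \<le> B * (3 * \<epsilon>)" using ginf B0 by (rule mult_left_mono)
    finally show ?thesis by (simp add: mult_ac)
  qed
  have up: "mean_of G ?a u \<le> mean_of G \<psi> u + 3 * \<epsilon> * B"
    unfolding mean_of_def by (rule cmp[OF sums]) (drule pt, linarith)
  have lo: "mean_of G \<psi> u \<le> mean_of G ?a u + 3 * \<epsilon> * B"
    unfolding mean_of_def by (rule cmp[OF sums(2,1)]) (drule pt, linarith)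
  show ?thesis using up lo mean_of_translate[OF p(1) sc, of u] by linarith
qed

text \<open>The invariant mean is a limit of the means given by ever more invariant vectors. Instead
  of choosing an ultrafilter, the upper limit over the pairs \<open>(S, \<epsilon>)\<close> is taken
  as a sublinear functional; a linear functional below it is automatically positive, normalised and
  invariant.\<close>

lemma amenable_if_almost_inv:
  assumes inv: "\<And>S \<epsilon>. finite S \<Longrightarrow> S \<subseteq> carrier G \<Longrightarrow> \<epsilon> > 0 \<Longrightarrow> almost_inv G S \<epsilon> \<noteq> {}"
  shows "amenable G"
proof -
  define E where "E = {u. bounded_on (carrier G) u}"
  interpret function_space E
    by unfold_locales (auto simp: E_def bounded_on_lin, auto simp: bounded_on_def)
  define ub where "ub u c \<longleftrightarrow> (\<exists>S \<epsilon>. finite S \<and> S \<subseteq> carrier G \<and> \<epsilon> > 0 \<and> (\<forall>\<psi>\<in>almost_inv G S \<epsilon>. mean_of G \<psi> u \<le> c))" for u c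
  define q where "q u = Inf {c. ub u c}" for u
  have mono: "almost_inv G (S \<union> S') (min \<epsilon> \<epsilon>') \<subseteq> almost_inv G S \<epsilon> \<inter> almost_inv G S' \<epsilon>'" for S S' \<epsilon> \<epsilon>'
    by (auto simp: almost_inv_def)
  have ub_add: "ub (\<lambda>x. u x + v x) (c + d)" if u: "u \<in> E" "v \<in> E" and c: "ub u c" "ub v d" for u v c d
  proof -
    obtain S \<epsilon> S' \<epsilon>' where S: "finite S" "S \<subseteq> carrier G" "\<epsilon> > 0" "\<forall>\<psi>\<in>almost_inv G S \<epsilon>. mean_of G \<psi> u \<le> c"
      and S': "finite S'" "S' \<subseteq> carrier G" "\<epsilon>' > 0" "\<forall>\<psi>\<in>almost_inv G S' \<epsilon>'. mean_of G \<psi> v \<le> d"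
      using c unfolding ub_def by blast
    have "mean_of G \<psi> (\<lambda>x. u x + v x) \<le> c + d" if \<psi>: "\<psi> \<in> almost_inv G (S \<union> S') (min \<epsilon> \<epsilon>')" for \<psi>
    proof -
      have "\<psi> \<in> l2 G" using \<psi> by (simp add: almost_inv_def)
      then have "mean_of G \<psi> (\<lambda>x. u x + v x) = mean_of G \<psi> u + mean_of G \<psi> v"
        using mean_of_lin[of \<psi> G u v 1] u by (simp add: E_def)
      moreover have "mean_of G \<psi> u \<le> c" "mean_of G \<psi> v \<le> d" using mono \<psi> S(4) S'(4) by blast+
      ultimately show ?thesis by simp
    qed
    moreover have "finite (S \<union> S')" "S \<union> S' \<subseteq> carrier G" "min \<epsilon> \<epsilon>' > 0" using S S' by auto
    ultimately show ?thesis unfolding ub_def by blast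
  qed
  \<comment> \<open>Non-emptiness of the sets \<open>almost_inv\<close> keeps the upper limit from
    falling to minus infinity.\<close>
  have ub_ge: "0 \<le> c + d" if u: "u \<in> E" and c: "ub u c" "ub (\<lambda>x. - u x) d" for u c d
  proof -
    have "ub (\<lambda>x. u x + - u x) (c + d)" using u Eneg[OF u] c by (intro ub_add)
    then obtain S \<epsilon> where "finite S" "S \<subseteq> carrier G" "\<epsilon> > 0" "\<forall>\<psi>\<in>almost_inv G S \<epsilon>. mean_of G \<psi> (\<lambda>x. 0) \<le> c + d"
      unfolding ub_def by auto
    then show ?thesis using inv[of S \<epsilon>] by (auto simp: mean_of_def)
  qed
  have ub_sup: "ub u B" if u: "u \<in> E" and B: "\<And>x. x \<in> carrier G \<Longrightarrow> u x \<le> B" for u B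
    unfolding ub_def using u mean_of_le[OF _ _ _ B]
    by (intro exI[of _ "{}"] exI[of _ 1]) (auto simp: almost_inv_def E_def)
  have ex_ub: "\<exists>c. ub u c" if "u \<in> E" for u
  proof -
    have "bounded_on (carrier G) u" using that by (simp add: E_def)
    then obtain B where "\<And>x. x \<in> carrier G \<Longrightarrow> \<bar>u x\<bar> \<le> B" by (auto simp: bounded_on_def)
    then have "\<And>x. x \<in> carrier G \<Longrightarrow> u x \<le> B" by (meson abs_le_iff)
    then show ?thesis using ub_sup[OF that] by blast
  qed
  have bdd: "bdd_below {c. ub u c}" if u: "u \<in> E" for u
  proof -
    obtain d where "ub (\<lambda>x. - u x) d" using ex_ub[OF Eneg[OF u]] by blast
    then show ?thesis using ub_ge[OF u] by (intro bdd_belowI[of _ "- d"]) fastforce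
  qed
  have qle: "q u \<le> c" if "u \<in> E" "ub u c" for u c unfolding q_def using that by (intro cInf_lower bdd) auto
  have qge: "d \<le> q u" if "u \<in> E" "\<And>c. ub u c \<Longrightarrow> d \<le> c" for u d
    unfolding q_def using that ex_ub[OF that(1)] by (intro cInf_greatest) auto
  have "sublinear_on E q"
  proof (rule sublinear_onI)
    fix u v assume u: "u \<in> E" and v: "v \<in> E"
    have "q (\<lambda>x. u x + v x) - q v \<le> q u"
    proof (rule qge[OF u])
      fix c assume c: "ub u c"
      have "q (\<lambda>x. u x + v x) - c \<le> q v"
        using qle[OF Eadd[OF u v] ub_add[OF u v c]] by (intro qge[OF v]) (simp add: algebra_simps)
      then show "q (\<lambda>x. u x + v x) - q v \<le> c" by simp
    qed
    then show "q (\<lambda>x. u x + v x) \<le> q u + q v" by simp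
  next
    fix u and c :: real assume u: "u \<in> E" and c: "c > 0"
    have "q (\<lambda>x. c * u x) / c \<le> q u"
    proof (rule qge[OF u])
      fix d assume "ub u d"
      then have "ub (\<lambda>x. c * u x) (c * d)"
        unfolding ub_def mean_of_def using c by (simp add: mult.left_commute infsum_cmult_right')
      then show "q (\<lambda>x. c * u x) / c \<le> d" using qle[OF Escale[OF u]] c by (simp add: divide_le_eq mult.commute)
    qed
    then show "q (\<lambda>x. c * u x) \<le> c * q u" using c by (simp add: divide_le_eq mult.commute)
  qed
  then obtain m where m: "\<And>f g c. f \<in> E \<Longrightarrow> g \<in> E \<Longrightarrow> m (\<lambda>x. f x + c * g x) = m f + c * m g" "\<And>f. f \<in> E \<Longrightarrow> m f \<le> q f"
    using hahn_banach_functional by blast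
  have m0: "m (\<lambda>x. 0) = 0" using m(1)[OF E0 E0, of 1] by simp
  have mneg: "m (\<lambda>x. - f x) = - m f" if "f \<in> E" for f using m(1)[OF E0 that, of "-1"] m0 by simp
  have mle: "m f \<le> c" if "f \<in> E" "ub f c" for f c using m(2)[OF that(1)] qle[OF that] by linarith
  have msup: "m f \<le> c" if "f \<in> E" "\<And>x. x \<in> carrier G \<Longrightarrow> f x \<le> c" for f c
    using mle[OF that(1) ub_sup[OF that]] by blast
  show ?thesis unfolding amenable_def
  proof (intro exI[of _ m] conjI allI impI ballI)
    fix f f' :: "'a \<Rightarrow> real" assume f: "bounded_on (carrier G) f" "\<forall>x\<in>carrier G. f x = f' x"
    then have E: "f \<in> E" "f' \<in> E" by (auto simp: E_def bounded_on_def)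
    have dE: "(\<lambda>x. f x + (-1) * f' x) \<in> E" using E by (rule Elin)
    have "m (\<lambda>x. f x + (-1) * f' x) \<le> 0" by (rule msup[OF dE]) (use f in auto)
    moreover have "m (\<lambda>x. - (f x + (-1) * f' x)) \<le> 0" by (rule msup[OF Eneg[OF dE]]) (use f in auto)
    ultimately show "m f = m f'" using mneg[OF dE] m(1)[OF E, of "-1"] by linarith
  next
    fix f g :: "'a \<Rightarrow> real" and c assume "bounded_on (carrier G) f" "bounded_on (carrier G) g"
    then show "m (\<lambda>x. f x + c * g x) = m f + c * m g" by (intro m(1)) (auto simp: E_def)
  next
    fix f assume f: "bounded_on (carrier G) f" "\<forall>x\<in>carrier G. 0 \<le> f x"
    then have E: "f \<in> E" by (simp add: E_def)
    have "m (\<lambda>x. - f x) \<le> 0" by (rule msup[OF Eneg[OF E]]) (use f in auto)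
    then show "0 \<le> m f" using mneg[OF E] by simp
  next
    have E: "(\<lambda>_. 1) \<in> E" by (auto simp: E_def bounded_on_def)
    have "m (\<lambda>_. 1) \<le> 1" by (rule msup[OF E]) auto
    moreover have "m (\<lambda>_. - 1) \<le> -1" by (rule msup[OF Eneg[OF E]]) auto
    ultimately show "m (\<lambda>_. 1) = 1" using mneg[OF E] by linarith
  next
    fix f g assume f: "bounded_on (carrier G) f" and g: "g \<in> carrier G"
    obtain B where B: "\<And>x. x \<in> carrier G \<Longrightarrow> \<bar>f x\<bar> \<le> B" using f by (auto simp: bounded_on_def)
    have B0: "0 \<le> B" using B[OF one_closed] by linarith
    have fE: "f \<in> E" using f by (simp add: E_def)
    have tE: "(\<lambda>x. f (g \<otimes> x)) \<in> E" using B g by (auto simp: E_def bounded_on_def)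
    have dE: "(\<lambda>x. f (g \<otimes> x) + (-1) * f x) \<in> E" using tE fE by (rule Elin)
    have "\<bar>m (\<lambda>x. f (g \<otimes> x) + (-1) * f x)\<bar> \<le> 0 + \<eta>" if eta: "\<eta> > 0" for \<eta>
    proof -
      \<comment> \<open>Matches the bound \<open>3 * \<epsilon> * B\<close> for almost invariant
        vectors; the summand 1 covers \<open>B = 0\<close>.\<close>
      define \<epsilon> where "\<epsilon> = \<eta> / (3 * (B + 1))"
      have e: "\<epsilon> > 0" using eta B0 by (simp add: \<epsilon>_def)
      have eB: "3 * \<epsilon> * B \<le> \<eta>" using eta B0 by (simp add: \<epsilon>_def field_simps)
      have b: "\<bar>mean_of G \<psi> (\<lambda>x. f (g \<otimes> x) + (-1) * f x)\<bar> \<le> \<eta>" if \<psi>: "\<psi> \<in> almost_inv G {g} \<epsilon>" for \<psi>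
      proof -
        have "\<psi> \<in> l2 G" using \<psi> by (simp add: almost_inv_def)
        then have "mean_of G \<psi> (\<lambda>x. f (g \<otimes> x) + (-1) * f x) = mean_of G \<psi> (\<lambda>x. f (g \<otimes> x)) + (-1) * mean_of G \<psi> f"
          using tE fE by (intro mean_of_lin) (auto simp: E_def)
        then show ?thesis using mean_of_almost_inv[OF \<psi> _ _ e, of g f B] B g eB by simp
      qed
      have "m (\<lambda>x. f (g \<otimes> x) + (-1) * f x) \<le> \<eta>"
        by (rule mle[OF dE]) (use b g e in \<open>auto simp: ub_def abs_le_iff intro!: exI[of _ "{g}"] exI[of _ \<epsilon>]\<close>)
      moreover have "m (\<lambda>x. - (f (g \<otimes> x) + (-1) * f x)) \<le> \<eta>"
      proof (rule mle[OF Eneg[OF dE]])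
        have "mean_of G \<psi> (\<lambda>x. - (f (g \<otimes> x) + (-1) * f x)) = - mean_of G \<psi> (\<lambda>x. f (g \<otimes> x) + (-1) * f x)" for \<psi>
          unfolding mean_of_def by (simp only: mult_minus_right infsum_uminus)
        then show "ub (\<lambda>x. - (f (g \<otimes> x) + (-1) * f x)) \<eta>"
          unfolding ub_def using b g e by (intro exI[of _ "{g}"] exI[of _ \<epsilon>]) (auto simp: abs_le_iff)
      qed
      ultimately show ?thesis using mneg[OF dE] by linarith
    qed
    then have "\<bar>m (\<lambda>x. f (g \<otimes> x) + (-1) * f x)\<bar> \<le> 0" by (rule field_le_epsilon)
    then show "m (\<lambda>x. f (g \<otimes> x)) = m f" using m(1)[OF tE fE, of "-1"] by simp
  qed
qed

section \<open>Averaging operators and the norm gap of non-amenable groups\<close>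

lemma avg_op_l2: "set l \<subseteq> carrier G \<Longrightarrow> avg_op G l f \<in> l2 G"
  unfolding avg_op_def by (intro l2_list_average) auto

lemma avg_op_list_prod:
  assumes "set l \<subseteq> carrier G" "set l' \<subseteq> carrier G"
  shows "avg_op G (list_prod G l l') f = avg_op G l (avg_op G l' f)"
proof
  fix x
  have "(\<Sum>s\<leftarrow>l'. lreg G (h \<otimes> s) f x) / of_nat (length l') = lreg G h (avg_op G l' f) x" if h: "h \<in> set l" for h
  proof -
    have hc: "h \<in> carrier G" using h assms by auto
    have "lreg G h (avg_op G l' f) = (\<lambda>x. (\<Sum>s\<leftarrow>l'. lreg G h (lreg G s f) x) / of_nat (length l'))"
      unfolding avg_op_def using assms(2) hc by (intro lreg_list_average) auto
    moreover have "(\<Sum>s\<leftarrow>l'. lreg G h (lreg G s f) x) = (\<Sum>s\<leftarrow>l'. lreg G (h \<otimes> s) f x)"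
    proof (rule arg_cong[where f=sum_list], rule map_cong)
      fix s assume "s \<in> set l'"
      then have "s \<in> carrier G" using assms by auto
      then show "lreg G h (lreg G s f) x = lreg G (h \<otimes> s) f x" using hc by (simp add: lreg_lreg)
    qed simp
    ultimately show ?thesis by simp
  qed
  then have e: "(\<Sum>h\<leftarrow>l. lreg G h (avg_op G l' f) x)
      = (\<Sum>h\<leftarrow>l. (\<Sum>s\<leftarrow>l'. lreg G (h \<otimes> s) f x) / of_nat (length l'))"
    by (intro arg_cong[where f=sum_list] map_cong) auto
  show "avg_op G (list_prod G l l') f x = avg_op G l (avg_op G l' f) x"
    unfolding avg_op_def[of G l] avg_op_def[of G "list_prod G l l'"] e
    by (simp add: sum_list_list_prod sum_list_divide length_list_prod mult.commute)
qed

text \<open>Uniform convexity: an average of unit vectors can only have norm close to one if they are all close together.\<close>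

lemma almost_inv_from_avg:
  assumes S: "finite S" "S \<subseteq> carrier G" and e: "\<epsilon> > 0"
    and big: "\<And>l c. l \<noteq> [] \<Longrightarrow> set l \<subseteq> carrier G \<Longrightarrow> 0 \<le> c \<Longrightarrow> c < 1 \<Longrightarrow>
       \<exists>\<psi>\<in>l2 G. l2norm G (avg_op G l \<psi>) > c * l2norm G \<psi>"
  shows "almost_inv G S \<epsilon> \<noteq> {}"
proof -
  obtain l1 where l1: "set l1 = S" using finite_list[OF S(1)] by blast
  \<comment> \<open>The identity is included so that every translate is compared with \<psi>
    itself.\<close>
  define l where "l = \<one> # l1"
  define n where "n = real (length l)"
  have n: "n > 0" by (simp add: n_def l_def)
  \<comment> \<open>Apart from the terms for \<open>\<one>\<close> and \<open>s\<close>, the sum has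
    norm at most \<open>n - 2\<close>, which leaves more than \<open>2 - n * \<delta>\<close> for
    these two. The parallelogram law then bounds their squared distance by
    \<open>4 * n * \<delta>\<close>; the minimum with \<open>1/n\<close> keeps
    \<open>2 - n * \<delta>\<close> positive.\<close>
  define \<delta> where "\<delta> = min (1/n) (\<epsilon>\<^sup>2 / (4 * n))"
  have d: "\<delta> > 0" "n * \<delta> \<le> 1" "4 * n * \<delta> \<le> \<epsilon>\<^sup>2" "\<delta> \<le> 1"
  proof -
    have n1: "n \<ge> 1" by (simp add: n_def l_def)
    have a: "\<delta> \<le> 1/n" "\<delta> \<le> \<epsilon>\<^sup>2 / (4 * n)" by (auto simp: \<delta>_def)
    show "\<delta> > 0" using n e by (simp add: \<delta>_def)
    show "n * \<delta> \<le> 1" using a(1) n by (simp add: pos_le_divide_eq mult.commute)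
    show "4 * n * \<delta> \<le> \<epsilon>\<^sup>2" using a(2) n by (simp add: pos_le_divide_eq mult.commute)
    show "\<delta> \<le> 1" using a(1) n1 n by (meson order_trans divide_le_eq_1_pos)
  qed
  have lc: "set l \<subseteq> carrier G" "l \<noteq> []" using l1 S by (auto simp: l_def)
  obtain \<psi>0 where p0: "\<psi>0 \<in> l2 G" "l2norm G (avg_op G l \<psi>0) > (1 - \<delta>) * l2norm G \<psi>0"
    using big[OF lc(2,1), of "1 - \<delta>"] d by auto
  have pos: "l2norm G \<psi>0 > 0"
  proof (rule ccontr)
    assume "\<not> l2norm G \<psi>0 > 0"
    then have "l2norm G \<psi>0 = 0" using l2norm_nonneg[of G \<psi>0] by linarith
    then have "\<psi>0 = (\<lambda>_. 0)" using p0(1) by (intro l2norm_eq_0)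
    then have "avg_op G l \<psi>0 = (\<lambda>_. 0)" by (auto simp: avg_op_def lreg_def)
    then show False using p0(2) \<open>l2norm G \<psi>0 = 0\<close> by simp
  qed
  let ?k = "complex_of_real (1 / l2norm G \<psi>0)"
  define \<psi> where "\<psi> = (\<lambda>x. ?k * \<psi>0 x)"
  have p: "\<psi> \<in> l2 G" unfolding \<psi>_def using p0(1) by (rule l2_scale)
  have p1: "l2norm G \<psi> = 1" unfolding \<psi>_def l2norm_scale[OF p0(1)] using pos by (simp del: of_real_divide)
  have lp: "lreg G s \<psi> = (\<lambda>x. ?k * lreg G s \<psi>0 x)" if "s \<in> carrier G" for s
    unfolding \<psi>_def by (rule bounded_ops_scale[OF lreg_bounded[OF that] p0(1)])
  have "(\<Sum>s\<leftarrow>l. lreg G s \<psi> x) = ?k * (\<Sum>s\<leftarrow>l. lreg G s \<psi>0 x)" for x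
  proof -
    have "map (\<lambda>s. lreg G s \<psi> x) l = map (\<lambda>s. ?k * lreg G s \<psi>0 x) l"
      using lp lc by (intro map_cong) (auto simp: fun_eq_iff)
    from arg_cong[OF this, of sum_list] show ?thesis by (simp only: sum_list_const_mult)
  qed
  then have "(\<lambda>x. \<Sum>s\<leftarrow>l. lreg G s \<psi> x) = (\<lambda>x. (?k * of_nat (length l)) * avg_op G l \<psi>0 x)"
    using lc(2) by (auto simp: avg_op_def)
  then have "l2norm G (\<lambda>x. \<Sum>s\<leftarrow>l. lreg G s \<psi> x) = cmod (?k * of_nat (length l)) * l2norm G (avg_op G l \<psi>0)"
    by (simp only: l2norm_scale[OF avg_op_l2[OF lc(1)]])
  also have "\<dots> = n / l2norm G \<psi>0 * l2norm G (avg_op G l \<psi>0)"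
    using pos by (simp add: n_def norm_mult norm_divide)
  also have "\<dots> > n / l2norm G \<psi>0 * ((1 - \<delta>) * l2norm G \<psi>0)"
    using p0(2) pos n by (intro mult_strict_left_mono) auto
  also have "n / l2norm G \<psi>0 * ((1 - \<delta>) * l2norm G \<psi>0) = n * (1 - \<delta>)" using pos by simp
  finally have tot: "l2norm G (\<lambda>x. \<Sum>s\<leftarrow>l. lreg G s \<psi> x) > n * (1 - \<delta>)" .
  have close: "l2norm G (\<lambda>x. lreg G s \<psi> x - \<psi> x) \<le> \<epsilon>" if s: "s \<in> S" for s
  proof -
    have sc: "s \<in> carrier G" using s S by auto
    obtain a b where ab: "l1 = a @ s # b" using s l1 split_list[of s l1] by blast
    have abc: "set (a @ b) \<subseteq> carrier G" using lc ab by (auto simp: l_def)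
    let ?v = "\<lambda>x. lreg G s \<psi> x + \<psi> x" and ?w = "\<lambda>x. \<Sum>s\<leftarrow>a @ b. lreg G s \<psi> x"
    have v: "?v \<in> l2 G" using lreg_l2[OF sc] p by (rule l2_add)
    have w: "?w \<in> l2 G" using abc by (intro l2_sum_list) auto
    have "l2norm G ?w \<le> (\<Sum>s\<leftarrow>a @ b. l2norm G (lreg G s \<psi>))" using abc by (intro l2_sum_list) auto
    also have "\<dots> \<le> of_nat (length (a @ b)) * 1" using abc p p1 by (intro sum_list_le_const) auto
    also have "\<dots> = n - 2" by (simp add: n_def l_def ab)
    finally have wn: "l2norm G ?w \<le> n - 2" .
    have "(\<lambda>x. \<Sum>s\<leftarrow>l. lreg G s \<psi> x) = (\<lambda>x. ?v x + ?w x)"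
      by (auto simp: l_def ab lreg_one[OF p])
    then have "n * (1 - \<delta>) < l2norm G ?v + (n - 2)" using tot l2norm_add[OF v w] wn by simp
    then have vn: "2 - n * \<delta> < l2norm G ?v" by (simp add: algebra_simps)
    have "(l2norm G ?v)\<^sup>2 + (l2norm G (\<lambda>x. lreg G s \<psi> x - \<psi> x))\<^sup>2 = 4"
      using l2_parallelogram[OF lreg_l2[OF sc, of \<psi>] p] sc p p1 by simp
    moreover have "(2 - n * \<delta>)\<^sup>2 \<le> (l2norm G ?v)\<^sup>2" using vn d by (intro power_mono) auto
    moreover have "4 - (2 - n * \<delta>)\<^sup>2 \<le> 4 * n * \<delta>"
      using zero_le_power2[of "n * \<delta>"] by (simp add: power2_diff)
    ultimately have "(l2norm G (\<lambda>x. lreg G s \<psi> x - \<psi> x))\<^sup>2 \<le> \<epsilon>\<^sup>2" using d by linarith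
    then show ?thesis using e by (meson less_imp_le power2_le_imp_le)
  qed
  show ?thesis using p p1 close by (auto simp: almost_inv_def)
qed

text \<open>If no average were a strict contraction, uniform convexity would produce almost
  invariant vectors and hence an invariant mean. One average of norm at most \<open>c < 1\<close>
  suffices, since its powers are again averages and have norm at most \<open>c ^ n\<close>.\<close>

theorem kesten:
  assumes "\<not> amenable G" "\<epsilon> > 0"
  obtains l where "l \<noteq> []" "set l \<subseteq> carrier G" "\<And>f. f \<in> l2 G \<Longrightarrow> l2norm G (avg_op G l f) \<le> \<epsilon> * l2norm G f"
proof -
  have "\<exists>l c. l \<noteq> [] \<and> set l \<subseteq> carrier G \<and> 0 \<le> c \<and> c < 1 \<and>
       (\<forall>\<psi>\<in>l2 G. l2norm G (avg_op G l \<psi>) \<le> c * l2norm G \<psi>)"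
  proof (rule ccontr)
    assume neg: "\<not> ?thesis"
    have "\<exists>\<psi>\<in>l2 G. l2norm G (avg_op G l \<psi>) > c * l2norm G \<psi>"
      if "l \<noteq> []" "set l \<subseteq> carrier G" "0 \<le> c" "c < 1" for l and c :: real
      using neg that by (meson not_le)
    then have "amenable G" by (intro amenable_if_almost_inv almost_inv_from_avg)
    then show False using assms(1) by blast
  qed
  then obtain l c where l: "l \<noteq> []" "set l \<subseteq> carrier G" "0 \<le> c" "c < 1"
    and lc: "\<And>\<psi>. \<psi> \<in> l2 G \<Longrightarrow> l2norm G (avg_op G l \<psi>) \<le> c * l2norm G \<psi>" by blast
  have pow: "\<exists>l'. l' \<noteq> [] \<and> set l' \<subseteq> carrier G \<and> (\<forall>\<psi>\<in>l2 G. l2norm G (avg_op G l' \<psi>) \<le> c ^ n * l2norm G \<psi>)" for n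
  proof (induction n)
    case 0
    then show ?case by (intro exI[of _ "[\<one>]"]) (auto simp: avg_op_def lreg_one)
  next
    case (Suc n)
    then obtain l' where l': "l' \<noteq> []" "set l' \<subseteq> carrier G"
      "\<forall>\<psi>\<in>l2 G. l2norm G (avg_op G l' \<psi>) \<le> c ^ n * l2norm G \<psi>" by (elim exE conjE)
    have "l2norm G (avg_op G (list_prod G l l') \<psi>) \<le> c ^ Suc n * l2norm G \<psi>" if p: "\<psi> \<in> l2 G" for \<psi>
    proof -
      have "l2norm G (avg_op G (list_prod G l l') \<psi>) \<le> c * l2norm G (avg_op G l' \<psi>)"
        unfolding avg_op_list_prod[OF l(2) l'(2)] by (rule lc[OF avg_op_l2[OF l'(2)]])
      also have "\<dots> \<le> c * (c ^ n * l2norm G \<psi>)" using bspec[OF l'(3) p] l(3) by (intro mult_left_mono)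
      finally show ?thesis by simp
    qed
    then show ?case using list_prod_ne[OF l(1) l'(1)] set_list_prod[OF l(2) l'(2)] by blast
  qed
  obtain n where n: "c ^ n < \<epsilon>" using real_arch_pow_inv[OF assms(2) l(4)] by blast
  from pow[of n] obtain l' where l': "l' \<noteq> []" "set l' \<subseteq> carrier G"
      "\<forall>\<psi>\<in>l2 G. l2norm G (avg_op G l' \<psi>) \<le> c ^ n * l2norm G \<psi>" by (elim exE conjE)
  show ?thesis
  proof (rule that[OF l'(1,2)])
    fix f assume f: "f \<in> l2 G"
    have "c ^ n * l2norm G f \<le> \<epsilon> * l2norm G f" using n by (intro mult_right_mono) auto
    then show "l2norm G (avg_op G l' f) \<le> \<epsilon> * l2norm G f" using bspec[OF l'(3) f] by linarith
  qed
qed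

end

section \<open>From an invariant mean to almost invariant vectors\<close>

definition fin_norm :: "('i \<Rightarrow> real) \<Rightarrow> real" where
  "fin_norm y = (\<Sum>i | y i \<noteq> 0. \<bar>y i\<bar>)"

lemma fin_norm_eq: "finite A \<Longrightarrow> (\<And>i. i \<notin> A \<Longrightarrow> y i = 0) \<Longrightarrow> fin_norm y = (\<Sum>i\<in>A. \<bar>y i\<bar>)"
  unfolding fin_norm_def by (intro sum.mono_neutral_left) auto

lemma fin_norm_triangle:
  assumes "finite {i. y i \<noteq> 0}" "finite {i. z i \<noteq> 0}"
  shows "fin_norm (\<lambda>i. y i + z i) \<le> fin_norm y + fin_norm z"
proof -
  let ?A = "{i. y i \<noteq> 0} \<union> {i. z i \<noteq> 0}"
  have f: "finite ?A" using assms by auto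
  have "fin_norm (\<lambda>i. y i + z i) = (\<Sum>i\<in>?A. \<bar>y i + z i\<bar>)" using f by (intro fin_norm_eq) auto
  also have "\<dots> \<le> (\<Sum>i\<in>?A. \<bar>y i\<bar> + \<bar>z i\<bar>)" by (intro sum_mono) auto
  also have "\<dots> = (\<Sum>i\<in>?A. \<bar>y i\<bar>) + (\<Sum>i\<in>?A. \<bar>z i\<bar>)" by (rule sum.distrib)
  also have "\<dots> = fin_norm y + fin_norm z" using f fin_norm_eq[OF f, of y] fin_norm_eq[OF f, of z] by auto
  finally show ?thesis .
qed

lemma fin_norm_scale: "fin_norm (\<lambda>i. c * y i) = \<bar>c\<bar> * fin_norm y"
proof (cases "c = 0")
  case True
  then show ?thesis by (simp add: fin_norm_def)
next
  case False
  then show ?thesis by (simp add: fin_norm_def abs_mult sum_distrib_left)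
qed

lemma fin_norm_nonneg: "0 \<le> fin_norm y"
  by (simp add: fin_norm_def sum_nonneg)

context group
begin

text \<open>By separation. If all non-negative finitely supported \<open>p\<close> were displaced by
  at least \<delta> times their mass, Hahn--Banach would give a functional of norm at most 1 that is
  uniformly positive on all displacements. Read on point masses, it is a bounded function that is at
  least \<delta> everywhere, yet is a sum of functions of the form translate minus original, so
  every invariant mean sends it to 0.\<close>

lemma reiter:
  assumes am: "amenable G" and S: "finite S" "S \<subseteq> carrier G" and \<delta>: "\<delta> > 0"
  shows "\<exists>p X. finite X \<and> X \<subseteq> carrier G \<and> (\<forall>x. 0 \<le> p x) \<and> (\<forall>x. x \<notin> X \<longrightarrow> p x = 0) \<and>
     fin_norm (\<lambda>(s, x). if s \<in> S \<and> x \<in> carrier G then p (inv s \<otimes> x) - p x else 0) < \<delta> * sum p X"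
proof (rule ccontr)
  define D :: "('a \<Rightarrow> real) \<Rightarrow> 'a \<times> 'a \<Rightarrow> real" where
    "D p = (\<lambda>(s, x). if s \<in> S \<and> x \<in> carrier G then p (inv s \<otimes> x) - p x else 0)" for p
  define P where "P = {p :: 'a \<Rightarrow> real. finite {x. p x \<noteq> 0} \<and> {x. p x \<noteq> 0} \<subseteq> carrier G \<and> (\<forall>x. 0 \<le> p x)}"
  assume contra: "\<not> ?thesis"
  then have contra': "\<forall>p X. finite X \<longrightarrow> X \<subseteq> carrier G \<longrightarrow> (\<forall>x. 0 \<le> p x) \<longrightarrow> (\<forall>x. x \<notin> X \<longrightarrow> p x = 0) \<longrightarrow>
      \<not> fin_norm (D p) < \<delta> * sum p X" unfolding D_def by blast
  have neg: "\<delta> * fin_norm p \<le> fin_norm (D p)" if p: "p \<in> P" for p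
  proof -
    have "sum p {x. p x \<noteq> 0} = fin_norm p"
      unfolding fin_norm_def using p by (intro sum.cong) (auto simp: P_def)
    moreover have "\<not> fin_norm (D p) < \<delta> * sum p {x. p x \<noteq> 0}"
      using contra' p by (simp add: P_def)
    ultimately show ?thesis by simp
  qed
  define E where "E = {y :: 'a \<times> 'a \<Rightarrow> real. finite {i. y i \<noteq> 0}}"
  interpret function_space E
  proof
    fix f g c assume "f \<in> E" "g \<in> E"
    then have "finite ({i. f i \<noteq> 0} \<union> {i. g i \<noteq> 0})" by (simp add: E_def)
    moreover have "{i. f i + c * g i \<noteq> 0} \<subseteq> {i. f i \<noteq> 0} \<union> {i. g i \<noteq> 0}" by auto
    ultimately show "(\<lambda>x. f x + c * g x) \<in> E" unfolding E_def by (simp add: finite_subset)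
  qed (simp add: E_def)
  have DE: "D p \<in> E" if "p \<in> P" for p
  proof -
    have "{i. D p i \<noteq> 0} \<subseteq> (\<Union>s\<in>S. Pair s ` ((\<lambda>x. s \<otimes> x) ` {x. p x \<noteq> 0} \<union> {x. p x \<noteq> 0}))"
    proof
      fix i assume "i \<in> {i. D p i \<noteq> 0}"
      then obtain s x where i: "i = (s, x)" "s \<in> S" "x \<in> carrier G" "p (inv s \<otimes> x) \<noteq> 0 \<or> p x \<noteq> 0"
        by (cases i) (auto simp: D_def split: if_splits)
      have "x = s \<otimes> (inv s \<otimes> x)" using i S by (simp add: m_assoc[symmetric] subset_iff)
      then have "x \<in> (\<lambda>x. s \<otimes> x) ` {x. p x \<noteq> 0} \<union> {x. p x \<noteq> 0}" using i(4) by blast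
      then show "i \<in> (\<Union>s\<in>S. Pair s ` ((\<lambda>x. s \<otimes> x) ` {x. p x \<noteq> 0} \<union> {x. p x \<noteq> 0}))" using i by blast
    qed
    moreover have "finite (\<Union>s\<in>S. Pair s ` ((\<lambda>x. s \<otimes> x) ` {x. p x \<noteq> 0} \<union> {x. p x \<noteq> 0}))"
      using S that by (auto simp: P_def)
    ultimately show ?thesis unfolding E_def by (auto intro: finite_subset)
  qed
  have Padd: "(\<lambda>x. p x + r x) \<in> P" if "p \<in> P" "r \<in> P" for p r
  proof -
    have "finite ({i. p i \<noteq> 0} \<union> {i. r i \<noteq> 0})" using that by (simp add: P_def)
    then have "finite {i. p i + r i \<noteq> 0}" by (rule rev_finite_subset) auto
    moreover have "{i. p i + r i \<noteq> 0} \<subseteq> carrier G" using that by (force simp: P_def)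
    ultimately show ?thesis using that by (auto simp: P_def)
  qed
  have Pscale: "(\<lambda>x. c * p x) \<in> P" if "p \<in> P" "c > 0" for p c
    using that by (auto simp: P_def)
  have P0: "(\<lambda>x. 0) \<in> P" by (simp add: P_def)
  have D0: "D (\<lambda>x. 0) = (\<lambda>_. 0)" by (auto simp: D_def)
  have Dadd: "D (\<lambda>x. p x + r x) = (\<lambda>i. D p i + D r i)" for p r by (auto simp: D_def)
  have Dscale: "D (\<lambda>x. c * p x) = (\<lambda>i. c * D p i)" for p c by (auto simp: D_def right_diff_distrib)
  \<comment> \<open>Additivity of the norm on the cone of non-negative functions is what lets the
    term with \<delta> be subtracted without losing subadditivity of \<open>q\<close>.\<close>
  have Pn: "fin_norm (\<lambda>x. p x + r x) = fin_norm p + fin_norm r" if "p \<in> P" "r \<in> P" for p r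
  proof -
    let ?A = "{i. p i \<noteq> 0} \<union> {i. r i \<noteq> 0}"
    have f: "finite ?A" using that by (simp add: P_def)
    have "fin_norm (\<lambda>x. p x + r x) = (\<Sum>i\<in>?A. \<bar>p i + r i\<bar>)" using f by (intro fin_norm_eq) auto
    also have "\<dots> = (\<Sum>i\<in>?A. \<bar>p i\<bar> + \<bar>r i\<bar>)" using that by (intro sum.cong) (auto simp: P_def)
    also have "\<dots> = (\<Sum>i\<in>?A. \<bar>p i\<bar>) + (\<Sum>i\<in>?A. \<bar>r i\<bar>)" by (rule sum.distrib)
    also have "\<dots> = fin_norm p + fin_norm r" using f fin_norm_eq[OF f, of p] fin_norm_eq[OF f, of r] by auto
    finally show ?thesis .
  qed
  \<comment> \<open>With \<open>p = 0\<close> a functional below \<open>q\<close> has norm at most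
    1; evaluated at the negative of \<open>D p\<close> it gives
    \<open>\<delta> * fin_norm p \<le> F (D p)\<close>.\<close>
  define q where "q y = (INF p\<in>P. fin_norm (\<lambda>i. y i + D p i) - \<delta> * fin_norm p)" for y
  have bdd: "bdd_below ((\<lambda>p. fin_norm (\<lambda>i. y i + D p i) - \<delta> * fin_norm p) ` P)" if y: "y \<in> E" for y
  proof (rule bdd_belowI2[of _ "- fin_norm y"])
    fix p assume p: "p \<in> P"
    have "fin_norm (\<lambda>i. (y i + D p i) + (- 1) * y i) \<le> fin_norm (\<lambda>i. y i + D p i) + fin_norm (\<lambda>i. (-1) * y i)"
      using Eadd[OF y DE[OF p]] Escale[OF y, of "-1"] by (intro fin_norm_triangle) (auto simp: E_def)
    then have "fin_norm (D p) \<le> fin_norm (\<lambda>i. y i + D p i) + fin_norm y"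
      using fin_norm_scale[of "-1" y] by simp
    then show "- fin_norm y \<le> fin_norm (\<lambda>i. y i + D p i) - \<delta> * fin_norm p" using neg[OF p] by linarith
  qed
  have qle: "q y \<le> fin_norm (\<lambda>i. y i + D p i) - \<delta> * fin_norm p" if "y \<in> E" "p \<in> P" for y p
    unfolding q_def using that by (intro cINF_lower[OF bdd])
  have qge: "c \<le> q y" if "y \<in> E" "\<And>p. p \<in> P \<Longrightarrow> c \<le> fin_norm (\<lambda>i. y i + D p i) - \<delta> * fin_norm p" for c y
    unfolding q_def using that P0 by (intro cINF_greatest) auto
  have "sublinear_on E q"
  proof (rule sublinear_onI)
    fix y z assume y: "y \<in> E" and z: "z \<in> E"
    have yz: "q (\<lambda>i. y i + z i) \<le> (fin_norm (\<lambda>i. y i + D p i) - \<delta> * fin_norm p) + (fin_norm (\<lambda>i. z i + D r i) - \<delta> * fin_norm r)"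
      if pr: "p \<in> P" "r \<in> P" for p r
    proof -
      have "q (\<lambda>i. y i + z i) \<le> fin_norm (\<lambda>i. (y i + z i) + D (\<lambda>x. p x + r x) i) - \<delta> * fin_norm (\<lambda>x. p x + r x)"
        by (rule qle[OF Eadd[OF y z] Padd[OF pr]])
      also have "(\<lambda>i. (y i + z i) + D (\<lambda>x. p x + r x) i) = (\<lambda>i. (y i + D p i) + (z i + D r i))"
        unfolding Dadd by auto
      also have "fin_norm \<dots> \<le> fin_norm (\<lambda>i. y i + D p i) + fin_norm (\<lambda>i. z i + D r i)"
        using Eadd[OF y DE[OF pr(1)]] Eadd[OF z DE[OF pr(2)]] by (intro fin_norm_triangle) (auto simp: E_def)
      finally show ?thesis using Pn[OF pr] by (simp add: algebra_simps)
    qed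
    have "q (\<lambda>i. y i + z i) - q z \<le> q y"
    proof (rule qge[OF y])
      fix p assume p: "p \<in> P"
      have "q (\<lambda>i. y i + z i) - (fin_norm (\<lambda>i. y i + D p i) - \<delta> * fin_norm p) \<le> q z"
        using yz[OF p] by (intro qge[OF z]) (simp add: algebra_simps)
      then show "q (\<lambda>i. y i + z i) - q z \<le> fin_norm (\<lambda>i. y i + D p i) - \<delta> * fin_norm p" by simp
    qed
    then show "q (\<lambda>i. y i + z i) \<le> q y + q z" by simp
  next
    fix y and c :: real assume y: "y \<in> E" and c: "c > 0"
    have "q (\<lambda>i. c * y i) / c \<le> q y"
    proof (rule qge[OF y])
      fix p assume p: "p \<in> P"
      have "q (\<lambda>i. c * y i) \<le> fin_norm (\<lambda>i. c * y i + D (\<lambda>x. c * p x) i) - \<delta> * fin_norm (\<lambda>x. c * p x)"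
        by (rule qle[OF Escale[OF y] Pscale[OF p c]])
      also have "(\<lambda>i. c * y i + D (\<lambda>x. c * p x) i) = (\<lambda>i. c * (y i + D p i))"
        unfolding Dscale by (auto simp: algebra_simps)
      finally have "q (\<lambda>i. c * y i) \<le> c * (fin_norm (\<lambda>i. y i + D p i) - \<delta> * fin_norm p)"
        unfolding fin_norm_scale using c by (simp add: right_diff_distrib mult.left_commute)
      then show "q (\<lambda>i. c * y i) / c \<le> fin_norm (\<lambda>i. y i + D p i) - \<delta> * fin_norm p"
        using c by (simp add: divide_le_eq mult.commute)
    qed
    then show "q (\<lambda>i. c * y i) \<le> c * q y" using c by (simp add: divide_le_eq mult.commute)
  qed
  then obtain F where Flin: "\<And>f g c. f \<in> E \<Longrightarrow> g \<in> E \<Longrightarrow> F (\<lambda>x. f x + c * g x) = F f + c * F g"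
    and Fq: "\<And>f. f \<in> E \<Longrightarrow> F f \<le> q f" using hahn_banach_functional by blast
  have F0: "F (\<lambda>_. 0) = 0" using Flin[OF E0 E0, of 1] by simp
  have Fneg: "F (\<lambda>x. - f x) = - F f" if "f \<in> E" for f using Flin[OF E0 that, of "-1"] F0 by simp
  have Fnorm: "F y \<le> fin_norm y" if "y \<in> E" for y
    using Fq[OF that] qle[OF that P0] D0 by (simp add: fin_norm_def)
  have FD: "\<delta> * fin_norm p \<le> F (D p)" if p: "p \<in> P" for p
    using Fq[OF Eneg[OF DE[OF p]]] qle[OF Eneg[OF DE[OF p]] p] Fneg[OF DE[OF p]] by (simp add: fin_norm_def)
  define e where "e i = (\<lambda>j. if j = i then 1 else 0 :: real)" for i :: "'a \<times> 'a"
  have eE: "e i \<in> E" for i by (simp add: e_def E_def)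
  have en: "fin_norm (e i) = 1" for i using fin_norm_eq[of "{i}" "e i"] by (simp add: e_def)
  have Fe: "\<bar>F (e i)\<bar> \<le> 1" for i
    using Fnorm[OF eE, of i] Fnorm[OF Eneg[OF eE], of i] Fneg[OF eE, of i] en[of i] fin_norm_scale[of "-1" "e i"]
    by (simp add: abs_le_iff)
  \<comment> \<open>\<open>u S x\<close> is \<open>F (D p)\<close> for the point mass
    \<open>p\<close> at \<open>x\<close>. The set \<open>T\<close> is left variable so that
    linearity can be proved by induction on it.\<close>
  define u where "u T x = (\<Sum>s\<in>T. F (e (s, s \<otimes> x)) + (-1) * F (e (s, x)))" for T x
  have u_ge: "\<delta> \<le> u S x" if x: "x \<in> carrier G" for x
  proof -
    define p where "p = (\<lambda>y. if y = x then 1 else 0 :: real)"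
    have p: "p \<in> P" using x by (auto simp: P_def p_def)
    have pn: "fin_norm p = 1" using fin_norm_eq[of "{x}" p] by (simp add: p_def)
    have Fs: "(\<lambda>i. \<Sum>s\<in>T. e (s, s \<otimes> x) i + (-1) * e (s, x) i) \<in> E
       \<and> F (\<lambda>i. \<Sum>s\<in>T. e (s, s \<otimes> x) i + (-1) * e (s, x) i) = u T x" if "finite T" for T
      using that
    proof (induction T)
      case empty
      then show ?case using E0 F0 by (simp add: u_def)
    next
      case (insert s T)
      let ?y = "\<lambda>i. \<Sum>s\<in>T. e (s, s \<otimes> x) i + (-1) * e (s, x) i" and ?z = "\<lambda>i. e (s, s \<otimes> x) i + (-1) * e (s, x) i"
      have z: "?z \<in> E" using eE eE by (rule Elin)
      have eq: "(\<lambda>i. \<Sum>s\<in>insert s T. e (s, s \<otimes> x) i + (-1) * e (s, x) i) = (\<lambda>i. ?y i + 1 * ?z i)"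
        using insert by (auto simp: add.commute)
      show ?case unfolding eq using Elin[OF _ z, of ?y 1] Flin[OF _ z, of ?y 1] Flin[OF eE eE, of "(s, s \<otimes> x)" "-1" "(s, x)"] insert
        by (simp add: u_def)
    qed
    have "D p = (\<lambda>i. \<Sum>s\<in>S. e (s, s \<otimes> x) i + (-1) * e (s, x) i)"
    proof
      fix i :: "'a \<times> 'a"
      obtain t y where i: "i = (t, y)" by (cases i)
      have "(\<Sum>s\<in>S. e (s, s \<otimes> x) i + (-1) * e (s, x) i)
        = (\<Sum>s\<in>S. if s = t then (if y = t \<otimes> x then 1 else 0) - (if y = x then 1 else 0) else 0)"
        by (intro sum.cong) (auto simp: e_def i)
      also have "\<dots> = (if t \<in> S then (if y = t \<otimes> x then 1 else 0) - (if y = x then 1 else 0) else 0)"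
        using S(1) by (simp add: sum.delta')
      also have "\<dots> = D p i"
      proof (cases "t \<in> S \<and> y \<in> carrier G")
        case True
        then have tc: "t \<in> carrier G" using S by auto
        have "inv t \<otimes> y = x \<longleftrightarrow> y = t \<otimes> x" using True tc x by (metis inv_solve_left)
        then show ?thesis using True by (simp add: D_def p_def i)
      next
        case False
        then show ?thesis using x S by (auto simp: D_def i)
      qed
      finally show "D p i = (\<Sum>s\<in>S. e (s, s \<otimes> x) i + (-1) * e (s, x) i)" by simp
    qed
    then have "F (D p) = u S x" using Fs[OF S(1)] by simp
    then show ?thesis using FD[OF p] pn by simp
  qed
  obtain m :: "('a \<Rightarrow> real) \<Rightarrow> real" where
      mlin: "\<And>f g c. bounded_on (carrier G) f \<Longrightarrow> bounded_on (carrier G) g \<Longrightarrow> m (\<lambda>x. f x + c * g x) = m f + c * m g"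
    and mpos: "\<And>f. bounded_on (carrier G) f \<Longrightarrow> (\<forall>x\<in>carrier G. f x \<ge> 0) \<Longrightarrow> m f \<ge> 0"
    and m1: "m (\<lambda>_. 1) = 1"
    and minv: "\<And>f g. bounded_on (carrier G) f \<Longrightarrow> g \<in> carrier G \<Longrightarrow> m (\<lambda>x. f (g \<otimes> x)) = m f"
    using am unfolding amenable_def by blast
  have bF: "bounded_on (carrier G) (\<lambda>x. F (e (s, h x)))" for s h using Fe by (auto simp: bounded_on_def)
  have b0: "bounded_on (carrier G) (\<lambda>_. 0 :: real)" by (auto simp: bounded_on_def intro: exI[of _ 0])
  have m0: "m (\<lambda>_. 0) = 0" using mlin[OF b0 b0, of 1] by simp
  have mu: "bounded_on (carrier G) (u T) \<and> m (u T) = 0" if "finite T" "T \<subseteq> S" for T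
    using that
  proof (induction T)
    case empty
    then show ?case using m0 b0 by (simp add: u_def[abs_def])
  next
    case (insert s T)
    have sc: "s \<in> carrier G" using insert S by auto
    let ?z = "\<lambda>x. F (e (s, s \<otimes> x)) + (-1) * F (e (s, x))"
    have bz: "bounded_on (carrier G) ?z" by (rule bounded_on_lin[OF bF bF])
    have mz: "m ?z = 0" using mlin[OF bF[of s "\<lambda>x. s \<otimes> x"] bF[of s "\<lambda>x. x"], of "-1"] minv[OF bF[of s "\<lambda>x. x"] sc] by simp
    have eq: "u (insert s T) = (\<lambda>x. u T x + 1 * ?z x)" using insert by (auto simp: u_def)
    show ?case unfolding eq using bounded_on_lin[OF _ bz, of "u T" 1] mlin[OF _ bz, of "u T" 1] mz insert by simp
  qed
  have b1: "bounded_on (carrier G) (\<lambda>_. 1)" by (auto simp: bounded_on_def)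
  have bu: "bounded_on (carrier G) (u S)" and mu0: "m (u S) = 0" using mu[OF S(1)] by auto
  have "0 \<le> m (\<lambda>x. u S x + (- \<delta>) * 1)"
    using u_ge by (intro mpos bounded_on_lin[OF bu b1]) auto
  then show False using mlin[OF bu b1, of "- \<delta>"] m1 mu0 \<delta> by simp
qed

text \<open>Square roots turn almost invariant densities into almost invariant vectors, since the
  square of \<open>sqrt a - sqrt b\<close> is at most the modulus of \<open>a - b\<close>. Hence the
  tolerance is squared when \<open>reiter\<close> is applied.\<close>

theorem amenable_almost_inv:
  assumes am: "amenable G" and S: "finite S" "S \<subseteq> carrier G" and e: "\<epsilon> > 0"
  shows "almost_inv G S \<epsilon> \<noteq> {}"
proof -
  obtain p X where X: "finite X" "X \<subseteq> carrier G" and p: "\<And>x. 0 \<le> p x" "\<And>x. x \<notin> X \<Longrightarrow> p x = 0"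
    and D: "fin_norm (\<lambda>(s, x). if s \<in> S \<and> x \<in> carrier G then p (inv s \<otimes> x) - p x else 0) < \<epsilon>\<^sup>2 * sum p X" (is "fin_norm ?D < _")
    using reiter[OF am S, of "\<epsilon>\<^sup>2"] e by auto
  define M where "M = sum p X"
  have M: "M > 0"
  proof -
    have "0 < \<epsilon>\<^sup>2 * sum p X" using D fin_norm_nonneg[of ?D] by linarith
    then show ?thesis using e unfolding M_def by (simp add: zero_less_mult_iff)
  qed
  define \<psi> where "\<psi> = (\<lambda>x. complex_of_real (sqrt (p x / M)))"
  have p0: "\<psi> x = 0" if "x \<notin> X" for x using p(2)[OF that] by (simp add: \<psi>_def)
  have pl: "\<psi> \<in> l2 G" and pn: "l2norm G \<psi> = L2_set (\<lambda>x. cmod (\<psi> x)) X"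
    using l2_finite_support[OF X p0] by auto
  have cm: "(cmod (\<psi> x))\<^sup>2 = p x / M" for x using p(1) M by (simp add: \<psi>_def)
  have p1: "l2norm G \<psi> = 1"
    unfolding pn L2_set_def cm using M by (simp add: sum_divide_distrib[symmetric] M_def)
  have "l2norm G (\<lambda>x. lreg G s \<psi> x - \<psi> x) \<le> \<epsilon>" if s: "s \<in> S" for s
  proof -
    have sc: "s \<in> carrier G" using s S by auto
    let ?Y = "X \<union> (\<lambda>x. s \<otimes> x) ` X"
    have Y: "finite ?Y" "?Y \<subseteq> carrier G" using X sc by auto
    have mem: "inv s \<otimes> x \<notin> X" if "x \<notin> ?Y" "x \<in> carrier G" for x
    proof
      assume "inv s \<otimes> x \<in> X"
      moreover have "x = s \<otimes> (inv s \<otimes> x)" using that sc by (simp add: m_assoc[symmetric])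
      ultimately show False using that by blast
    qed
    have z: "lreg G s \<psi> x - \<psi> x = 0" if "x \<notin> ?Y" for x
      using that mem[OF that] p0 pl by (cases "x \<in> carrier G") (auto simp: lreg_apply lreg_outside')
    have sq: "(sqrt a - sqrt b)\<^sup>2 \<le> \<bar>a - b\<bar>" if "0 \<le> a" "0 \<le> b" for a b :: real
    proof -
      have "(sqrt a - sqrt b)\<^sup>2 = \<bar>sqrt a - sqrt b\<bar> * \<bar>sqrt a - sqrt b\<bar>" by (simp add: power2_eq_square)
      also have "\<dots> \<le> \<bar>sqrt a - sqrt b\<bar> * (sqrt a + sqrt b)" using that by (intro mult_left_mono) (auto simp: abs_le_iff)
      also have "\<dots> = \<bar>(sqrt a - sqrt b) * (sqrt a + sqrt b)\<bar>" using that by (simp add: abs_mult)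
      also have "(sqrt a - sqrt b) * (sqrt a + sqrt b) = a - b" using that by (simp add: algebra_simps)
      finally show ?thesis .
    qed
    have n: "l2norm G (\<lambda>x. lreg G s \<psi> x - \<psi> x) = L2_set (\<lambda>x. cmod (lreg G s \<psi> x - \<psi> x)) ?Y"
      using Y z by (intro l2_finite_support(2)) auto
    have "(l2norm G (\<lambda>x. lreg G s \<psi> x - \<psi> x))\<^sup>2 = (\<Sum>x\<in>?Y. (cmod (lreg G s \<psi> x - \<psi> x))\<^sup>2)"
      unfolding n by (simp add: L2_set_def sum_nonneg)
    also have "\<dots> \<le> (\<Sum>x\<in>?Y. \<bar>?D (s, x)\<bar> / M)"
    proof (rule sum_mono)
      fix x assume "x \<in> ?Y"
      then have xc: "x \<in> carrier G" using Y by auto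
      have "(cmod (lreg G s \<psi> x - \<psi> x))\<^sup>2 = (sqrt (p (inv s \<otimes> x) / M) - sqrt (p x / M))\<^sup>2"
        using pl xc unfolding lreg_apply[OF pl xc] unfolding \<psi>_def by (simp only: of_real_diff[symmetric] norm_of_real power2_abs)
      also have "\<dots> \<le> \<bar>p (inv s \<otimes> x) / M - p x / M\<bar>" using p(1) M by (intro sq) auto
      also have "\<dots> = \<bar>?D (s, x)\<bar> / M" using xc s M by (simp add: diff_divide_distrib[symmetric] abs_divide)
      finally show "(cmod (lreg G s \<psi> x - \<psi> x))\<^sup>2 \<le> \<bar>?D (s, x)\<bar> / M" .
    qed
    also have "\<dots> = (\<Sum>i\<in>Pair s ` ?Y. \<bar>?D i\<bar>) / M"
      by (subst sum.reindex) (auto simp: sum_divide_distrib inj_on_def)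
    also have "\<dots> \<le> fin_norm ?D / M"
    proof (rule divide_right_mono)
      let ?B = "\<Union>s\<in>S. Pair s ` (X \<union> (\<lambda>x. s \<otimes> x) ` X)"
      have B: "finite ?B" using S X by auto
      have "fin_norm ?D = (\<Sum>i\<in>?B. \<bar>?D i\<bar>)"
      proof (rule fin_norm_eq[OF B])
        fix i assume i: "i \<notin> ?B"
        obtain t x where tx: "i = (t, x)" by (cases i)
        show "?D i = 0"
        proof (cases "t \<in> S \<and> x \<in> carrier G")
          case True
          then have tc: "t \<in> carrier G" using S by auto
          have nx: "x \<notin> X" "x \<notin> (\<lambda>x. t \<otimes> x) ` X" using i True tx by auto
          have "inv t \<otimes> x \<notin> X"
          proof
            assume "inv t \<otimes> x \<in> X"
            moreover have "x = t \<otimes> (inv t \<otimes> x)" using True tc by (simp add: m_assoc[symmetric])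
            ultimately show False using nx by blast
          qed
          then show ?thesis using nx p(2) tx by simp
        qed (auto simp: tx)
      qed
      moreover have "(\<Sum>i\<in>Pair s ` ?Y. \<bar>?D i\<bar>) \<le> (\<Sum>i\<in>?B. \<bar>?D i\<bar>)"
        using B s by (intro sum_mono2) auto
      ultimately show "(\<Sum>i\<in>Pair s ` ?Y. \<bar>?D i\<bar>) \<le> fin_norm ?D" by simp
    qed (use M in simp)
    also have "\<dots> \<le> \<epsilon>\<^sup>2" using D M unfolding M_def[symmetric] by (simp add: divide_le_eq)
    finally show ?thesis using e by (meson less_imp_le power2_le_imp_le)
  qed
  then show ?thesis using pl p1 by (auto simp: almost_inv_def)
qed

end

section \<open>Trees and half-trees\<close>

locale tree =
  fixes V :: "'v set" and adj :: "'v \<Rightarrow> 'v \<Rightarrow> bool"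
  assumes tree: "is_tree V adj"
begin

lemma adjD: "adj x y \<Longrightarrow> x \<in> V" "adj x y \<Longrightarrow> y \<in> V" "adj x y \<Longrightarrow> adj y x" "adj x y \<Longrightarrow> x \<noteq> y"
  using tree unfolding is_tree_def by blast+

lemma V_ne: "V \<noteq> {}" using tree by (simp add: is_tree_def)

lemma acyclic: "walk V adj p \<Longrightarrow> distinct p \<Longrightarrow> length p \<ge> 3 \<Longrightarrow> \<not> adj (last p) (hd p)"
  using tree unfolding is_tree_def by blast

lemma connected: "u \<in> V \<Longrightarrow> v \<in> V \<Longrightarrow> \<exists>p. walk V adj p \<and> hd p = u \<and> last p = v"
  using tree unfolding is_tree_def by blast

lemma walk_iff: "walk W adj p \<longleftrightarrow> p \<noteq> [] \<and> set p \<subseteq> W \<and> successively adj p"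
  by (auto simp: walk_def successively_conv_nth)

lemma successively_rtranclp: "successively r p \<Longrightarrow> p \<noteq> [] \<Longrightarrow> r\<^sup>*\<^sup>* (hd p) (last p)"
proof (induction p)
  case (Cons a p)
  then show ?case
    by (cases p) (auto intro: converse_rtranclp_into_rtranclp)
qed simp

lemma rtranclp_distinct_path:
  assumes "r\<^sup>*\<^sup>* x y"
  shows "\<exists>p. p \<noteq> [] \<and> hd p = x \<and> last p = y \<and> distinct p \<and> successively r p \<and> set p \<subseteq> {v. r\<^sup>*\<^sup>* x v}"
  using assms
proof (induction rule: rtranclp_induct)
  case base
  show ?case by (intro exI[of _ "[x]"]) auto
next
  case (step y z)
  then obtain p where p: "p \<noteq> []" "hd p = x" "last p = y" "distinct p" "successively r p" "set p \<subseteq> {v. r\<^sup>*\<^sup>* x v}"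
    by blast
  show ?case
  proof (cases "z \<in> set p")
    case True
    then obtain a b where ab: "p = a @ z # b" using split_list[of z p] by blast
    have "hd (a @ [z]) = x" using p(2) ab by (cases a) auto
    then show ?thesis using p ab
      by (intro exI[of _ "a @ [z]"]) (auto simp: successively_append_iff)
  next
    case False
    have "r\<^sup>*\<^sup>* x z" using step by auto
    then show ?thesis using p False step(2)
      by (intro exI[of _ "p @ [z]"]) (auto simp: successively_append_iff)
  qed
qed

lemma adj_rtranclp: "u \<in> V \<Longrightarrow> v \<in> V \<Longrightarrow> adj\<^sup>*\<^sup>* u v"
  using connected[of u v] successively_rtranclp by (auto simp: walk_iff)

section \<open>The two components left by deleting an edge\<close>

definition cut :: "'v \<Rightarrow> 'v \<Rightarrow> 'v \<Rightarrow> 'v \<Rightarrow> bool" where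
  "cut a b x y \<longleftrightarrow> adj x y \<and> \<not> (x = a \<and> y = b) \<and> \<not> (x = b \<and> y = a)"

lemma cut_sym: "(cut a b)\<^sup>*\<^sup>* x y \<Longrightarrow> (cut a b)\<^sup>*\<^sup>* y x"
proof -
  have "symp (cut a b)" using adjD(3) by (auto simp: cut_def symp_def)
  then show "(cut a b)\<^sup>*\<^sup>* x y \<Longrightarrow> (cut a b)\<^sup>*\<^sup>* y x" using symp_rtranclp by (metis sympD)
qed

lemma cut_commute: "cut a b = cut b a"
  by (auto simp: cut_def fun_eq_iff)

lemma cut_V: "(cut a b)\<^sup>*\<^sup>* x y \<Longrightarrow> x \<in> V \<Longrightarrow> y \<in> V"
  by (induction rule: rtranclp_induct) (auto simp: cut_def adjD)

text \<open>A path joining the ends of the edge without using it would close up to a cycle. It has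
  at least three vertices because the ends differ and the edge itself is forbidden.\<close>

lemma cut_separates:
  assumes "adj a b" shows "\<not> (cut a b)\<^sup>*\<^sup>* b a"
proof
  assume "(cut a b)\<^sup>*\<^sup>* b a"
  then obtain p where p: "p \<noteq> []" "hd p = b" "last p = a" "distinct p" "successively (cut a b) p"
    "set p \<subseteq> {v. (cut a b)\<^sup>*\<^sup>* b v}"
    using rtranclp_distinct_path[of "cut a b" b a] by blast
  have "set p \<subseteq> V" using p(6) cut_V adjD(2)[OF assms] by blast
  moreover have "successively adj p" using p(5) by (rule successively_mono) (auto simp: cut_def)
  ultimately have w: "walk V adj p" using p(1) by (simp add: walk_iff)
  have "length p \<ge> 3"
  proof (rule ccontr)
    assume "\<not> length p \<ge> 3"
    then consider x where "p = [x]" | x y where "p = [x, y]"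
      using p(1) by (cases p; cases "tl p"; cases "tl (tl p)") auto
    then show False
      using p adjD(4)[OF assms] by cases (auto simp: cut_def)
  qed
  then show False using acyclic[OF w p(4)] p assms by simp
qed

definition side :: "'v \<Rightarrow> 'v \<Rightarrow> 'v set" where "side a b = {v. (cut a b)\<^sup>*\<^sup>* b v}"

lemma side_cover:
  assumes ab: "adj a b" and v: "v \<in> V" shows "v \<in> side a b \<or> v \<in> side b a"
  using adj_rtranclp[OF adjD(2)[OF ab] v]
proof (induction rule: rtranclp_induct)
  case base
  show ?case by (simp add: side_def)
next
  case (step y z)
  show ?case
  proof (cases "cut a b y z")
    case True
    then show ?thesis using step(3) cut_commute[of a b] by (auto simp: side_def intro: rtranclp.rtrancl_into_rtrancl)
  next
    case False
    then have "z = a \<or> z = b" using step(2) by (auto simp: cut_def)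
    then show ?thesis by (auto simp: side_def)
  qed
qed

lemma side_disjoint: "adj a b \<Longrightarrow> side a b \<inter> side b a = {}"
proof (rule ccontr)
  assume ab: "adj a b" and "side a b \<inter> side b a \<noteq> {}"
  then obtain v where "(cut a b)\<^sup>*\<^sup>* b v" "(cut b a)\<^sup>*\<^sup>* a v" by (auto simp: side_def)
  then have "(cut a b)\<^sup>*\<^sup>* b a" using cut_sym cut_commute by (metis rtranclp_trans)
  then show False using cut_separates[OF ab] by simp
qed

lemma side_cross:
  assumes ab: "adj a b" and uv: "adj u v" "u \<in> side a b" "v \<notin> side a b"
  shows "u = b \<and> v = a"
proof -
  have "\<not> cut a b u v" using uv by (auto simp: side_def intro: rtranclp.rtrancl_into_rtrancl)
  then have "(u = a \<and> v = b) \<or> (u = b \<and> v = a)" using uv by (auto simp: cut_def)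
  moreover have "b \<in> side a b" by (simp add: side_def)
  ultimately show ?thesis using uv(3) by auto
qed

lemma tdist_walk:
  assumes "u \<in> V" "v \<in> V"
  shows "\<exists>p. walk V adj p \<and> hd p = u \<and> last p = v \<and> length p = Suc (tdist V adj u v)"
proof -
  obtain p where "walk V adj p" "hd p = u" "last p = v" using connected[OF assms] by blast
  then have "\<exists>n p. walk V adj p \<and> hd p = u \<and> last p = v \<and> length p = Suc n"
    by (metis length_greater_0_conv gr0_conv_Suc walk_iff)
  then show ?thesis unfolding tdist_def by (rule LeastI_ex)
qed

lemma tdist_le: "walk V adj p \<Longrightarrow> tdist V adj (hd p) (last p) \<le> length p - 1"
proof -
  assume w: "walk V adj p"
  then have "length p = Suc (length p - 1)" by (simp add: walk_iff)
  then show ?thesis unfolding tdist_def using w by (intro Least_le) blast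
qed

lemma tdist_sym:
  assumes "u \<in> V" "v \<in> V" shows "tdist V adj u v = tdist V adj v u"
proof -
  have le: "tdist V adj v u \<le> tdist V adj u v" if uv: "u \<in> V" "v \<in> V" for u v
  proof -
    obtain p where p: "walk V adj p" "hd p = u" "last p = v" "length p = Suc (tdist V adj u v)"
      using tdist_walk[OF uv] by blast
    have "successively adj (rev p)" using p(1) adjD(3) by (auto simp: walk_iff elim: successively_mono)
    then have "walk V adj (rev p)" using p by (simp add: walk_iff)
    from tdist_le[OF this] show ?thesis using p by (simp add: hd_rev last_rev)
  qed
  show ?thesis using le[OF assms] le[OF assms(2,1)] by simp
qed

text \<open>A geodesic from \<open>v\<close> to \<open>a\<close> has to leave the component of
  \<open>b\<close>, and the deleted edge is the only exit; so it visits \<open>b\<close> strictly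
  before \<open>a\<close>.\<close>

lemma side_tdist:
  assumes ab: "adj a b" and v: "v \<in> side a b"
  shows "tdist V adj v b < tdist V adj v a"
proof -
  have vV: "v \<in> V" using v cut_V adjD(2)[OF ab] by (auto simp: side_def)
  obtain p where p: "walk V adj p" "hd p = v" "last p = a" "length p = Suc (tdist V adj v a)"
    using tdist_walk[OF vV adjD(1)[OF ab]] by blast
  have ne: "p \<noteq> []" and adjp: "\<And>i. Suc i < length p \<Longrightarrow> adj (p ! i) (p ! Suc i)" using p(1) by (auto simp: walk_def)
  have aside: "a \<notin> side a b" using cut_separates[OF ab] by (simp add: side_def)
  have "p ! 0 \<in> side a b" using p(2) v ne by (simp add: hd_conv_nth)
  moreover have "p ! (length p - 1) \<notin> side a b" using p(3) ne aside by (simp add: last_conv_nth)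
  ultimately obtain i where i: "i < length p - 1" "p ! i \<in> side a b" "p ! Suc i \<notin> side a b"
  proof -
    have "\<exists>i<n. p ! i \<in> side a b \<and> p ! Suc i \<notin> side a b" if "p ! 0 \<in> side a b" "p ! n \<notin> side a b" for n
      using that
    proof (induction n)
      case (Suc n)
      then show ?case by (cases "p ! n \<in> side a b") (auto simp: less_Suc_eq)
    qed simp
    then show ?thesis using that \<open>p ! 0 \<in> side a b\<close> \<open>p ! (length p - 1) \<notin> side a b\<close> by blast
  qed
  have ib: "p ! i = b" using side_cross[OF ab adjp i(2,3)] i(1) by simp
  let ?q = "take (Suc i) p"
  have "walk V adj ?q" using p(1) ne by (auto simp: walk_def dest: in_set_takeD)
  from tdist_le[OF this] have "tdist V adj v b \<le> i"
  proof -
    have "\<not> length p \<le> Suc i" using i(1) by simp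
    then show ?thesis using \<open>tdist V adj (hd ?q) (last ?q) \<le> length ?q - 1\<close> p(2) ib ne
      by (simp add: last_conv_nth min_def)
  qed
  then show ?thesis using i(1) p(4) by simp
qed

text \<open>Each component lies in the matching half-tree, the components cover \<open>V\<close> and
  the two half-trees are disjoint, so the inclusions are equalities. From here on connectivity takes
  the place of distances.\<close>

lemma half_tree_side:
  assumes ab: "adj a b" shows "half_tree V adj a b = side a b"
proof -
  have "side a b \<subseteq> half_tree V adj a b"
    using side_tdist[OF ab] cut_V adjD(2)[OF ab] by (auto simp: half_tree_def side_def)
  moreover have "side b a \<subseteq> half_tree V adj b a"
    using side_tdist[OF adjD(3)[OF ab]] cut_V adjD(1)[OF ab] by (auto simp: half_tree_def side_def)
  moreover have "half_tree V adj a b \<inter> half_tree V adj b a = {}" by (auto simp: half_tree_def)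
  moreover have "half_tree V adj a b \<subseteq> V" by (auto simp: half_tree_def)
  ultimately show ?thesis using side_cover[OF ab] by blast
qed

section \<open>Half-trees as a nested family of sets\<close>

abbreviation Z :: "'v \<Rightarrow> 'v \<Rightarrow> 'v set" where "Z \<equiv> half_tree V adj"

definition HH :: "'v set set" where "HH = {Z a b | a b. adj a b}"

lemma HH_I: "adj a b \<Longrightarrow> Z a b \<in> HH" by (auto simp: HH_def)

lemma Z_head: "adj a b \<Longrightarrow> b \<in> Z a b"
  and Z_tail: "adj a b \<Longrightarrow> a \<notin> Z a b"
  using cut_separates[of a b] by (auto simp: half_tree_side side_def)

lemma Z_sub: "Z a b \<subseteq> V" by (auto simp: half_tree_def)

lemma Z_compl: "adj a b \<Longrightarrow> V - Z a b = Z b a"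
  using side_cover[of a b] side_disjoint[of a b] Z_sub[of b a] adjD(3)[of a b]
  by (auto simp: half_tree_side)

lemma Z_cross: "adj a b \<Longrightarrow> adj u v \<Longrightarrow> u \<in> Z a b \<Longrightarrow> v \<notin> Z a b \<Longrightarrow> u = b \<and> v = a"
  using side_cross[of a b u v] by (simp add: half_tree_side)

lemma HH_sub: "A \<in> HH \<Longrightarrow> A \<subseteq> V" using Z_sub by (auto simp: HH_def)
lemma HH_ne: "A \<in> HH \<Longrightarrow> A \<noteq> {}" using Z_head by (auto simp: HH_def)
lemma HH_compl: "A \<in> HH \<Longrightarrow> V - A \<in> HH" using Z_compl HH_I adjD(3) by (force simp: HH_def)
lemma HH_neV: "A \<in> HH \<Longrightarrow> A \<noteq> V" using HH_ne[OF HH_compl, of A] by auto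

lemma HH_cross: "A \<in> HH \<Longrightarrow> adj u v \<Longrightarrow> u \<in> A \<Longrightarrow> v \<notin> A \<Longrightarrow> A = Z v u"
  using Z_cross by (auto simp: HH_def)

text \<open>\<open>B\<close> is connected, and the only edge crossing the boundary of
  \<open>Z a b\<close> is the one between \<open>a\<close> and \<open>b\<close>, whose ends are
  outside \<open>B\<close>.\<close>

lemma HH_avoid:
  assumes B: "B \<in> HH" and ab: "adj a b" "a \<notin> B" "b \<notin> B"
  shows "B \<subseteq> Z a b \<or> B \<inter> Z a b = {}"
proof -
  obtain c d where cd: "adj c d" "B = Z c d" using B by (auto simp: HH_def)
  have same: "v \<in> Z a b \<longleftrightarrow> d \<in> Z a b" if "v \<in> B" for v
  proof -
    have "(cut c d)\<^sup>*\<^sup>* d v" using that cd by (simp add: half_tree_side side_def)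
    then show ?thesis
    proof (induction rule: rtranclp_induct)
      case (step y z)
      have yB: "y \<in> B" "z \<in> B" using step(1,2) cd by (auto simp: half_tree_side side_def)
      have adj: "adj y z" "adj z y" using step(2) adjD(3) by (auto simp: cut_def)
      have "y \<in> Z a b \<longleftrightarrow> z \<in> Z a b"
        using Z_cross[OF ab(1) adj(1)] Z_cross[OF ab(1) adj(2)] yB ab by blast
      then show ?case using step(3) by simp
    qed simp
  qed
  then show ?thesis by blast
qed

lemma HH_nested:
  assumes A: "A \<in> HH" and B: "B \<in> HH"
  shows "A \<subseteq> B \<or> B \<subseteq> A \<or> A \<inter> B = {} \<or> A \<union> B = V"
proof -
  obtain a b where ab: "adj a b" "A = Z a b" using A by (auto simp: HH_def)
  have sub: "A \<subseteq> V" "B \<subseteq> V" using A B by (auto dest: HH_sub)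
  have aV: "a \<in> V" "b \<in> V" using ab adjD by auto
  consider "a \<notin> B" "b \<notin> B" | "a \<in> B" "b \<in> B" | "a \<in> B" "b \<notin> B" | "a \<notin> B" "b \<in> B" by blast
  then show ?thesis
  proof cases
    case 1
    then show ?thesis using HH_avoid[OF B ab(1)] ab by blast
  next
    case 2
    then have "V - B \<subseteq> A \<or> (V - B) \<inter> A = {}" using HH_avoid[OF HH_compl[OF B] ab(1)] ab by blast
    then show ?thesis using sub by blast
  next
    case 3
    then have "B = Z b a" using HH_cross[OF B ab(1)] by blast
    then show ?thesis using Z_compl[OF ab(1)] ab by blast
  next
    case 4
    then have "B = Z a b" using HH_cross[OF B adjD(3)[OF ab(1)]] by blast
    then show ?thesis using ab by blast
  qed
qed

text \<open>Each step of a walk from \<open>u\<close> to \<open>v\<close> leaves at most one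
  half-tree, the one determined by that edge.\<close>

lemma HH_sep_finite:
  assumes "u \<in> V" "v \<in> V" shows "finite {A \<in> HH. u \<in> A \<and> v \<notin> A}"
  using adj_rtranclp[OF assms]
proof (induction rule: converse_rtranclp_induct)
  case (step u w)
  have "{A \<in> HH. u \<in> A \<and> v \<notin> A} \<subseteq> insert (Z w u) {A \<in> HH. w \<in> A \<and> v \<notin> A}"
    using HH_cross[OF _ step(1)] by blast
  then show ?case using step(3) by (simp add: finite_subset)
qed simp

lemma first_step:
  assumes "u \<in> V" "v \<in> V" "u \<noteq> v" shows "\<exists>w. adj u w \<and> v \<in> Z u w"
proof -
  have "v = u \<or> (\<exists>w. adj u w \<and> v \<in> Z u w)" using adj_rtranclp[OF assms(1,2)]
  proof (induction rule: rtranclp_induct)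
    case (step y z)
    show ?case
    proof (cases "y = u")
      case True
      then show ?thesis using step(2) Z_head by blast
    next
      case False
      then obtain w where "adj u w" "y \<in> Z u w" using step(3) by blast
      then show ?thesis using Z_cross[of u w y z] step(2) by blast
    qed
  qed simp
  then show ?thesis using assms by simp
qed

lemma HH_separates:
  assumes "u \<in> V" "v \<in> V" "u \<noteq> v" shows "\<exists>A\<in>HH. u \<in> A \<and> v \<notin> A"
proof -
  obtain w where w: "adj v w" "u \<in> Z v w" using first_step[of v u] assms by auto
  then show ?thesis using Z_tail[OF w(1)] HH_I by blast
qed

text \<open>Geodesics and convexity without distances: a step towards \<open>v\<close> strictly
  lowers the number of half-trees that contain the current vertex but not \<open>v\<close>, and it
  never leaves a half-tree containing both ends. The use is that complements of unions of half-trees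
  span subtrees.\<close>

lemma convex_walk:
  assumes "u \<in> V" "v \<in> V"
  shows "\<exists>p. walk V adj p \<and> hd p = u \<and> last p = v \<and> (\<forall>A\<in>HH. u \<in> A \<longrightarrow> v \<in> A \<longrightarrow> set p \<subseteq> A)"
  using assms(1)
proof (induction "card {A \<in> HH. u \<in> A \<and> v \<notin> A}" arbitrary: u rule: less_induct)
  case (less u)
  show ?case
  proof (cases "u = v")
    case True
    then show ?thesis using less(2) by (intro exI[of _ "[u]"]) (auto simp: walk_iff)
  next
    case False
    obtain w where w: "adj u w" "v \<in> Z u w" using first_step[OF less(2) assms(2) False] by blast
    have wV: "w \<in> V" using adjD(2)[OF w(1)] .
    have nx: "w \<in> A" if "A \<in> HH" "u \<in> A" "v \<in> A" for A
    proof (rule ccontr)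
      assume "w \<notin> A"
      then have "A = Z w u" using HH_cross[OF that(1) w(1) that(2)] by simp
      then show False using that(3) w Z_compl[OF w(1)] by blast
    qed
    have "{A \<in> HH. w \<in> A \<and> v \<notin> A} \<subset> {A \<in> HH. u \<in> A \<and> v \<notin> A}"
    proof
      show "{A \<in> HH. w \<in> A \<and> v \<notin> A} \<subseteq> {A \<in> HH. u \<in> A \<and> v \<notin> A}"
      proof
        fix A assume A: "A \<in> {A \<in> HH. w \<in> A \<and> v \<notin> A}"
        have "u \<in> A"
        proof (rule ccontr)
          assume "u \<notin> A"
          then have "A = Z u w" using HH_cross[of A w u] A adjD(3)[OF w(1)] by simp
          then show False using A w by simp
        qed
        then show "A \<in> {A \<in> HH. u \<in> A \<and> v \<notin> A}" using A by simp
      qed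
      have "Z w u \<in> {A \<in> HH. u \<in> A \<and> v \<notin> A}" "Z w u \<notin> {A \<in> HH. w \<in> A \<and> v \<notin> A}"
        using Z_compl[OF w(1)] w Z_head[OF adjD(3)[OF w(1)]] Z_tail[OF adjD(3)[OF w(1)]] HH_I[OF adjD(3)[OF w(1)]] by auto
      then show "{A \<in> HH. w \<in> A \<and> v \<notin> A} \<noteq> {A \<in> HH. u \<in> A \<and> v \<notin> A}" by blast
    qed
    then have "card {A \<in> HH. w \<in> A \<and> v \<notin> A} < card {A \<in> HH. u \<in> A \<and> v \<notin> A}"
      by (rule psubset_card_mono[OF HH_sep_finite[OF less(2) assms(2)]])
    from less(1)[OF this wV] obtain p where p: "walk V adj p" "hd p = w" "last p = v"
      "\<forall>A\<in>HH. w \<in> A \<longrightarrow> v \<in> A \<longrightarrow> set p \<subseteq> A" by blast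
    have "walk V adj (u # p)" using p w less(2) by (cases p) (auto simp: walk_iff)
    moreover have "last (u # p) = v" using p by (simp add: walk_iff)
    moreover have "\<forall>A\<in>HH. u \<in> A \<longrightarrow> v \<in> A \<longrightarrow> set (u # p) \<subseteq> A" using p(4) nx by auto
    ultimately show ?thesis by (intro exI[of _ "u # p"]) auto
  qed
qed

lemma Z_disjoint:
  assumes "adj v w" "adj v w'" "w \<noteq> w'" shows "Z v w \<inter> Z v w' = {}"
proof -
  have "\<not> Z v w \<subseteq> Z v w'"
    using Z_head[OF assms(1)] Z_cross[OF assms(2) adjD(3)[OF assms(1)]] Z_tail[OF assms(2)] assms(3) by blast
  moreover have "\<not> Z v w' \<subseteq> Z v w"
    using Z_head[OF assms(2)] Z_cross[OF assms(1) adjD(3)[OF assms(2)]] Z_tail[OF assms(1)] assms(3) by blast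
  moreover have "Z v w \<union> Z v w' \<noteq> V" using Z_tail[OF assms(1)] Z_tail[OF assms(2)] adjD(1)[OF assms(1)] by blast
  ultimately show ?thesis using HH_nested[OF HH_I[OF assms(1)] HH_I[OF assms(2)]] by blast
qed

end

section \<open>Group actions on trees\<close>

locale tree_act = tree V adj for V :: "'v set" and adj +
  fixes G :: "('g, 'm) monoid_scheme" (structure) and \<phi> :: "'g \<Rightarrow> 'v \<Rightarrow> 'v"
  assumes act: "tree_action G V adj \<phi>"
begin

sublocale group_action G V \<phi>
  using act by (simp add: tree_action_def)

sublocale group G
  using group_hom by (simp add: group_hom_def)

lemma adj_act: "g \<in> carrier G \<Longrightarrow> x \<in> V \<Longrightarrow> y \<in> V \<Longrightarrow> adj (\<phi> g x) (\<phi> g y) \<longleftrightarrow> adj x y"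
  using act by (simp add: tree_action_def)

lemma adj_actI: "g \<in> carrier G \<Longrightarrow> adj x y \<Longrightarrow> adj (\<phi> g x) (\<phi> g y)"
  using adj_act adjD by blast

lemma act_V: "g \<in> carrier G \<Longrightarrow> x \<in> V \<Longrightarrow> \<phi> g x \<in> V"
  by (rule element_image) auto

lemma act_one: "x \<in> V \<Longrightarrow> \<phi> \<one> x = x"
  using id_eq_one by (metis restrict_apply)

lemma act_mult: "g \<in> carrier G \<Longrightarrow> h \<in> carrier G \<Longrightarrow> x \<in> V \<Longrightarrow> \<phi> (g \<otimes> h) x = \<phi> g (\<phi> h x)"
  by (rule composition_rule) auto

lemma act_inv: "g \<in> carrier G \<Longrightarrow> x \<in> V \<Longrightarrow> \<phi> (inv g) (\<phi> g x) = x" "g \<in> carrier G \<Longrightarrow> x \<in> V \<Longrightarrow> \<phi> g (\<phi> (inv g) x) = x"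
  by (simp_all add: act_mult[symmetric] act_one)

lemma act_inj: "g \<in> carrier G \<Longrightarrow> x \<in> V \<Longrightarrow> y \<in> V \<Longrightarrow> \<phi> g x = \<phi> g y \<longleftrightarrow> x = y"
  by (metis act_inv(1))

definition im :: "'g \<Rightarrow> 'v set \<Rightarrow> 'v set" where "im g A = \<phi> g ` A"

lemma im_sub: "g \<in> carrier G \<Longrightarrow> A \<subseteq> V \<Longrightarrow> im g A \<subseteq> V"
  by (auto simp: im_def act_V)

lemma im_one: "A \<subseteq> V \<Longrightarrow> im \<one> A = A"
  by (force simp: im_def act_one)

lemma im_mult: "g \<in> carrier G \<Longrightarrow> h \<in> carrier G \<Longrightarrow> A \<subseteq> V \<Longrightarrow> im (g \<otimes> h) A = im g (im h A)"
  by (force simp: im_def act_mult)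

lemma im_inv: "g \<in> carrier G \<Longrightarrow> A \<subseteq> V \<Longrightarrow> im (inv g) (im g A) = A" "g \<in> carrier G \<Longrightarrow> A \<subseteq> V \<Longrightarrow> im g (im (inv g) A) = A"
  by (simp_all add: im_mult[symmetric] im_one)

lemma im_mono: "A \<subseteq> B \<Longrightarrow> im g A \<subseteq> im g B"
  by (auto simp: im_def)

lemma im_mem: "g \<in> carrier G \<Longrightarrow> A \<subseteq> V \<Longrightarrow> x \<in> V \<Longrightarrow> \<phi> g x \<in> im g A \<longleftrightarrow> x \<in> A"
  by (auto simp: im_def act_inj subset_iff)

lemma im_mem_inv: "g \<in> carrier G \<Longrightarrow> A \<subseteq> V \<Longrightarrow> x \<in> V \<Longrightarrow> x \<in> im g A \<longleftrightarrow> \<phi> (inv g) x \<in> A"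
  using im_mem[of g A "\<phi> (inv g) x"] by (simp add: act_inv act_V)

lemma im_subset_iff: "g \<in> carrier G \<Longrightarrow> A \<subseteq> V \<Longrightarrow> B \<subseteq> V \<Longrightarrow> im g A \<subseteq> im g B \<longleftrightarrow> A \<subseteq> B"
  using im_mono[of A B g] im_mono[of "im g A" "im g B" "inv g"] by (auto simp: im_inv)

lemma im_eq_iff: "g \<in> carrier G \<Longrightarrow> A \<subseteq> V \<Longrightarrow> B \<subseteq> V \<Longrightarrow> im g A = im g B \<longleftrightarrow> A = B"
  by (metis im_inv(1))

lemma im_disjoint_iff: "g \<in> carrier G \<Longrightarrow> A \<subseteq> V \<Longrightarrow> B \<subseteq> V \<Longrightarrow> im g A \<inter> im g B = {} \<longleftrightarrow> A \<inter> B = {}"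
  by (auto simp: im_def act_inj subset_iff)

lemma im_compl: "g \<in> carrier G \<Longrightarrow> A \<subseteq> V \<Longrightarrow> im g (V - A) = V - im g A"
  using inj_on_image_set_diff[OF inj_prop, of g V A] surj_prop[of g] by (simp add: im_def)

lemma im_tdist_le:
  assumes g: "g \<in> carrier G" and uv: "u \<in> V" "v \<in> V"
  shows "tdist V adj (\<phi> g u) (\<phi> g v) \<le> tdist V adj u v"
proof -
  obtain p where p: "walk V adj p" "hd p = u" "last p = v" "length p = Suc (tdist V adj u v)"
    using tdist_walk[OF uv] by blast
  have "walk V adj (map (\<phi> g) p)"
    using p(1) g act_V adj_actI by (auto simp: walk_def subset_iff)
  from tdist_le[OF this] show ?thesis using p by (simp add: walk_def hd_map last_map)
qed

lemma im_tdist: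
  assumes g: "g \<in> carrier G" and uv: "u \<in> V" "v \<in> V"
  shows "tdist V adj (\<phi> g u) (\<phi> g v) = tdist V adj u v"
  using im_tdist_le[OF assms] im_tdist_le[of "inv g" "\<phi> g u" "\<phi> g v"] assms by (simp add: act_inv act_V)

lemma im_Z:
  assumes g: "g \<in> carrier G" and ab: "adj a b" shows "im g (Z a b) = Z (\<phi> g a) (\<phi> g b)"
proof (rule Set.set_eqI)
  fix v
  have aV: "a \<in> V" "b \<in> V" using ab adjD by auto
  show "v \<in> im g (Z a b) \<longleftrightarrow> v \<in> Z (\<phi> g a) (\<phi> g b)"
  proof (cases "v \<in> V")
    case True
    define w where "w = \<phi> (inv g) v"
    have w: "w \<in> V" "v = \<phi> g w" using True g by (auto simp: w_def act_inv act_V)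
    show ?thesis unfolding w(2) im_mem[OF g Z_sub w(1)] using w(1) g aV
      by (simp add: half_tree_def im_tdist act_V)
  next
    case False
    then show ?thesis using Z_sub im_sub[OF g Z_sub] by blast
  qed
qed

lemma im_HH: "g \<in> carrier G \<Longrightarrow> A \<in> HH \<Longrightarrow> im g A \<in> HH"
  using im_Z HH_I adj_actI by (auto simp: HH_def)

text \<open>A vertex \<open>v0\<close> of least displacement lies on the axis. The half-tree in
  front of the first edge from \<open>v0\<close> towards its image is therefore carried properly
  into itself.\<close>

lemma hyperbolic_translates:
  assumes g: "g \<in> carrier G" and h: "hyperbolic_aut V adj (\<phi> g)"
  shows "\<exists>A\<in>HH. im g A \<subset> A"
proof -
  have nofix: "\<phi> g v \<noteq> v" if "v \<in> V" for v using h that by (simp add: hyperbolic_aut_def)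
  have noinv: "\<not> (adj x y \<and> \<phi> g x = y \<and> \<phi> g y = x)" for x y using h by (auto simp: hyperbolic_aut_def)
  obtain u where u: "u \<in> V" using V_ne by blast
  obtain v0 where v0: "v0 \<in> V" and min: "\<And>v. v \<in> V \<Longrightarrow> tdist V adj v0 (\<phi> g v0) \<le> tdist V adj v (\<phi> g v)"
    using ex_has_least_nat[of "\<lambda>v. v \<in> V" u "\<lambda>v. tdist V adj v (\<phi> g v)"] u by blast
  let ?n = "tdist V adj v0 (\<phi> g v0)"
  have gv0: "\<phi> g v0 \<in> V" using act_V[OF g v0] .
  obtain v1 where v1: "adj v0 v1" "\<phi> g v0 \<in> Z v0 v1" using first_step[OF v0 gv0 nofix[OF v0, symmetric]] by blast
  have v1V: "v1 \<in> V" "\<phi> g v1 \<in> V" using adjD(2)[OF v1(1)] act_V[OF g] by auto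
  have ge: "adj (\<phi> g v0) (\<phi> g v1)" using adj_actI[OF g v1(1)] .
  let ?A = "Z v0 v1" and ?B = "Z (\<phi> g v0) (\<phi> g v1)"
  \<comment> \<open>Were \<open>v0\<close> in \<open>?B\<close>, then either \<open>v1\<close> is
    there too and is moved less than \<open>v0\<close>, or the edge from \<open>v0\<close> to
    \<open>v1\<close> is inverted.\<close>
  have 1: "v0 \<notin> ?B"
  proof
    assume a: "v0 \<in> ?B"
    show False
    proof (cases "v1 \<in> ?B")
      case True
      have "tdist V adj v1 (\<phi> g v1) < tdist V adj v1 (\<phi> g v0)" using True by (simp add: half_tree_def)
      also have "\<dots> = tdist V adj (\<phi> g v0) v1" using v1V gv0 by (intro tdist_sym)
      also have "\<dots> < tdist V adj (\<phi> g v0) v0" using v1(2) by (simp add: half_tree_def)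
      also have "\<dots> = ?n" using v0 gv0 by (intro tdist_sym)
      finally show False using min[OF v1V(1)] by simp
    next
      case False
      then have "v0 = \<phi> g v1 \<and> v1 = \<phi> g v0" using Z_cross[OF ge v1(1) a] by blast
      then show False using noinv[of v0 v1] v1(1) by metis
    qed
  qed
  have 2: "v1 \<notin> ?B"
  proof
    assume "v1 \<in> ?B"
    then have "v1 = \<phi> g v1" using Z_cross[OF ge adjD(3)[OF v1(1)] _ 1] by blast
    then show False using nofix[OF v1V(1)] by simp
  qed
  have 3: "\<phi> g v1 \<in> ?A"
  proof (rule ccontr)
    assume "\<phi> g v1 \<notin> ?A"
    then have "\<phi> g v0 = v1 \<and> \<phi> g v1 = v0" using Z_cross[OF v1(1) ge v1(2)] by blast
    then show False using noinv[of v0 v1] v1(1) by blast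
  qed
  have "?B \<subseteq> ?A" using HH_avoid[OF HH_I[OF ge] v1(1) 1 2] 3 Z_head[OF ge] by blast
  moreover have "?B \<noteq> ?A" using v1(2) Z_tail[OF ge] by blast
  ultimately have "im g ?A \<subset> ?A" unfolding im_Z[OF g v1(1)] by blast
  then show ?thesis using HH_I[OF v1(1)] by blast
qed

text \<open>For a half-tree this says that its edge lies on the axis of some hyperbolic element of
  the group.\<close>

definition transl :: "'v set \<Rightarrow> bool" where "transl A \<longleftrightarrow> (\<exists>g\<in>carrier G. im g A \<subset> A)"

lemma im_psubset_inv:
  assumes "g \<in> carrier G" "A \<subseteq> V" "A \<subset> im g A" shows "im (inv g) A \<subset> A"
  using assms im_mono[of A "im g A" "inv g"] im_inv(1)[of g A] im_inv(2)[of g A] by auto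

lemma im_psubset_compl:
  assumes g: "g \<in> carrier G" "A \<subseteq> V" "im g A \<subset> A" shows "im (inv g) (V - A) \<subset> V - A"
proof (rule im_psubset_inv)
  show "V - A \<subset> im g (V - A)" unfolding im_compl[OF g(1,2)] using g im_sub[OF g(1,2)] by blast
qed (use g in auto)

lemma transl_compl:
  assumes "A \<subseteq> V" "transl A" shows "transl (V - A)"
proof -
  obtain g where g: "g \<in> carrier G" "im g A \<subset> A" using assms(2) by (auto simp: transl_def)
  show ?thesis unfolding transl_def
    using im_psubset_compl[OF g(1) assms(1) g(2)] inv_closed[OF g(1)] by (rule bexI)
qed

lemma transl_im:
  assumes "A \<subseteq> V" "transl A" "s \<in> carrier G" shows "transl (im s A)"
proof -
  obtain g where g: "g \<in> carrier G" "im g A \<subset> A" using assms by (auto simp: transl_def)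
  have gA: "im g A \<subseteq> V" using g assms by auto
  have "im (s \<otimes> g \<otimes> inv s) (im s A) = im s (im g A)"
    using assms g by (simp add: im_mult im_sub im_inv)
  moreover have "im s (im g A) \<subset> im s A"
    using g im_subset_iff[OF assms(3) gA assms(1)] im_eq_iff[OF assms(3) gA assms(1)] by blast
  ultimately show ?thesis unfolding transl_def using assms g by (intro bexI[of _ "s \<otimes> g \<otimes> inv s"]) auto
qed

text \<open>A basis of neighbourhoods of one end of the tree; such sequences stand for points of the
  boundary.\<close>

definition shrinking :: "(nat \<Rightarrow> 'v set) \<Rightarrow> bool" where
  "shrinking A \<longleftrightarrow> (\<forall>n. A n \<in> HH) \<and> decseq A \<and> (\<forall>v\<in>V. \<exists>n. v \<notin> A n)"

lemma shrinkingD: "shrinking A \<Longrightarrow> A n \<in> HH" "shrinking A \<Longrightarrow> m \<le> n \<Longrightarrow> A n \<subseteq> A m"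
  by (auto simp: shrinking_def dest: decseqD)

lemma shrinking_avoid:
  assumes "shrinking A" "u \<in> V" "v \<in> V" shows "\<exists>n. u \<notin> A n \<and> v \<notin> A n"
proof -
  obtain m n where "u \<notin> A m" "v \<notin> A n" using assms unfolding shrinking_def by blast
  then show ?thesis using shrinkingD(2)[OF assms(1), of m "max m n"] shrinkingD(2)[OF assms(1), of n "max m n"] by auto
qed

text \<open>A vertex common to all the images would be separated from a vertex off \<open>A\<close>
  by infinitely many distinct half-trees.\<close>

lemma shrinking_powers:
  assumes g: "g \<in> carrier G" and A: "A \<in> HH" "im g A \<subset> A"
  shows "shrinking (\<lambda>n. im (g [^] (n::nat)) A)"
proof -
  have AV: "A \<subseteq> V" using HH_sub[OF A(1)] .
  have suc: "im (g [^] Suc n) A = im (g [^] n) (im g A)" for n :: nat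
    using g AV by (simp add: im_mult)
  have less: "im (g [^] Suc n) A \<subset> im (g [^] n) A" for n :: nat
    unfolding suc using A(2) im_subset_iff[of "g [^] n" "im g A" A] im_eq_iff[of "g [^] n" "im g A" A] g AV by auto
  then have dec: "decseq (\<lambda>n::nat. im (g [^] n) A)" by (intro decseq_SucI) auto
  have HHn: "im (g [^] n) A \<in> HH" for n :: nat using im_HH[OF _ A(1)] g by simp
  have "\<exists>n::nat. v \<notin> im (g [^] n) A" if v: "v \<in> V" for v
  proof (rule ccontr)
    assume a: "\<not> ?thesis"
    obtain a where a0: "a \<in> V" "a \<notin> A" using HH_neV[OF A(1)] AV by blast
    have an: "a \<notin> im (g [^] n) A" for n :: nat
      using decseqD[OF dec, of 0 n] a0 im_one[OF AV] by auto
    have "range (\<lambda>n::nat. im (g [^] n) A) \<subseteq> {B \<in> HH. v \<in> B \<and> a \<notin> B}" using a HHn an by auto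
    then have "finite (range (\<lambda>n::nat. im (g [^] n) A))" using HH_sep_finite[OF v a0(1)] by (rule finite_subset)
    moreover have "inj (\<lambda>n::nat. im (g [^] n) A)"
    proof (rule linorder_injI)
      fix m n :: nat assume "m < n"
      then have "im (g [^] n) A \<subseteq> im (g [^] Suc m) A" using decseqD[OF dec, of "Suc m" n] by simp
      then show "im (g [^] m) A \<noteq> im (g [^] n) A" using less[of m] by blast
    qed
    ultimately show False using finite_imageD[of "\<lambda>n::nat. im (g [^] n) A" UNIV] by auto
  qed
  then show ?thesis using dec HHn by (simp add: shrinking_def)
qed

lemma shrinking_im:
  assumes A: "shrinking A" and g: "g \<in> carrier G" shows "shrinking (\<lambda>n. im g (A n))"
proof -
  have HA: "A n \<in> HH" for n using A by (rule shrinkingD)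
  have "\<exists>n. v \<notin> im g (A n)" if v: "v \<in> V" for v
  proof -
    have "\<phi> (inv g) v \<in> V" using g v by (simp add: act_V)
    then obtain n where "\<phi> (inv g) v \<notin> A n" using A by (auto simp: shrinking_def)
    then show ?thesis using im_mem_inv[OF g HH_sub[OF HA] v] by blast
  qed
  moreover have "decseq (\<lambda>n. im g (A n))" using A im_mono by (auto simp: shrinking_def decseq_def)
  ultimately show ?thesis using im_HH[OF g HA] by (simp add: shrinking_def)
qed

text \<open>Far out, the sequence misses a chosen vertex of \<open>B\<close> and a chosen vertex off
  \<open>B\<close>. This rules out two of the four nestings of half-trees.\<close>

lemma shrinking_dichotomy:
  assumes A: "shrinking A" and B: "B \<in> HH"
  shows "\<exists>n. A n \<subseteq> B \<or> A n \<inter> B = {}"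
proof -
  obtain b c where bc: "b \<in> B" "c \<in> V" "c \<notin> B" using HH_ne[OF B] HH_neV[OF B] HH_sub[OF B] by blast
  have bV: "b \<in> V" using bc HH_sub[OF B] by auto
  obtain n where "b \<notin> A n" "c \<notin> A n" using shrinking_avoid[OF A bV bc(2)] by blast
  then show ?thesis using HH_nested[OF shrinkingD(1)[OF A] B, of n] bc by blast
qed

text \<open>The other positions of \<open>A\<close> and its image are excluded: equality would put
  \<open>A\<close> inside every power of \<open>g\<close> applied to \<open>A1\<close>, proper
  inclusion would make \<open>A\<close> translated, and the two cannot cover \<open>V\<close> as
  both lie in \<open>A1\<close>.\<close>

lemma not_transl_disjoint:
  assumes g: "g \<in> carrier G" and A1: "A1 \<in> HH" "im g A1 \<subset> A1" and A: "A \<in> HH" "A \<subseteq> A1" "\<not> transl A"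
  shows "im g A \<inter> A = {}"
proof -
  have V: "A \<subseteq> V" "A1 \<subseteq> V" using HH_sub A A1 by auto
  have ne: "im g A \<noteq> A"
  proof
    assume e: "im g A = A"
    have "A \<subseteq> im (g [^] n) A1" for n :: nat
    proof (induction n)
      case 0
      then show ?case using A im_one[OF V(2)] by simp
    next
      case (Suc n)
      have "im (g [^] Suc n) A1 = im g (im (g [^] n) A1)"
        unfolding nat_pow_Suc2[OF g] using g V by (intro im_mult) auto
      then show ?case using im_mono[OF Suc, of g] e by simp
    qed
    then show False using shrinking_powers[OF g A1] HH_ne[OF A(1)] V by (force simp: shrinking_def)
  qed
  have "\<not> im g A \<subseteq> A" using A(3) ne g by (auto simp: transl_def)
  moreover have "\<not> A \<subseteq> im g A"
    using im_psubset_inv[OF g V(1)] A(3) ne inv_closed[OF g] unfolding transl_def by blast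
  moreover have "im g A \<union> A \<noteq> V"
  proof
    assume "im g A \<union> A = V"
    moreover have "im g A \<subseteq> A1" using order_trans[OF im_mono[OF A(2)] psubset_imp_subset[OF A1(2)]] .
    ultimately have "V \<subseteq> A1" using A(2) by auto
    then show False using HH_neV[OF A1(1)] V(2) by auto
  qed
  ultimately show ?thesis using HH_nested[OF im_HH[OF g A(1)] A(1)] by blast
qed

text \<open>The edges lying on axes form a convex family. Were \<open>A\<close> not translated,
  \<open>g\<close> would push \<open>A\<close> off itself and \<open>h\<close> would push the
  complement of \<open>A\<close> back into \<open>A\<close>, so that \<open>h g\<close> maps
  \<open>A\<close> into itself.\<close>

lemma transl_between:
  assumes A1: "A1 \<in> HH" "transl A1" and A2: "A2 \<in> HH" "transl A2" and A: "A \<in> HH" "A \<subseteq> A1" "A2 \<subseteq> A"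
  shows "transl A"
proof (rule ccontr)
  assume n: "\<not> transl A"
  have V: "A \<subseteq> V" "A1 \<subseteq> V" "A2 \<subseteq> V" using HH_sub A A1 A2 by auto
  obtain g where g: "g \<in> carrier G" "im g A1 \<subset> A1" using A1 by (auto simp: transl_def)
  obtain h where h: "h \<in> carrier G" "im h (V - A2) \<subset> V - A2" using transl_compl[OF V(3) A2(2)] by (auto simp: transl_def)
  have gA: "im g A \<inter> A = {}" using not_transl_disjoint[OF g(1) A1(1) g(2) A(1,2) n] .
  have nn: "V - (V - A) = A" using V(1) by blast
  have n': "\<not> transl (V - A)" using transl_compl[of "V - A"] n nn by auto
  have hA: "im h (V - A) \<inter> (V - A) = {}"
    using not_transl_disjoint[OF h(1) HH_compl[OF A2(1)] h(2) HH_compl[OF A(1)] _ n'] A(3) by blast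
  have hA': "im h (V - A) \<subseteq> A" using hA im_sub[OF h(1), of "V - A"] by blast
  have gA': "im g A \<subseteq> V - A" using gA im_sub[OF g(1) V(1)] by blast
  have "im (h \<otimes> g) A = im h (im g A)" using g h V by (simp add: im_mult)
  moreover have sub: "im h (im g A) \<subseteq> im h (V - A)" using im_mono[OF gA'] .
  moreover have "\<not> im (h \<otimes> g) A \<subset> A" using n g h by (auto simp: transl_def)
  \<comment> \<open>A proper inclusion of the image under \<open>h g\<close> in \<open>A\<close> is
    excluded by assumption. Equality makes \<open>g\<close> carry \<open>A\<close> onto its
    complement, which is impossible inside \<open>A1\<close>.\<close>
  ultimately have "im h (im g A) = im h (V - A)" using hA' by blast
  then have "im g A = V - A" using im_eq_iff[OF h(1) im_sub[OF g(1) V(1)], of "V - A"] by blast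
  then have "im g A \<union> A = V" using V by blast
  moreover have "im g A \<subseteq> A1" using order_trans[OF im_mono[OF A(2)] psubset_imp_subset[OF g(2)]] .
  ultimately have "V \<subseteq> A1" using A(2) by auto
  then show False using HH_neV[OF A1(1)] V(2) by auto
qed

text \<open>By \<open>transl_between\<close>, one of the two sides of an untranslated half-tree
  contains no translated half-tree. Removing all translates of that side \<open>B\<close> leaves an
  invariant subtree. It is non-empty, since it keeps an end of the edge bounding \<open>T\<close>,
  and it misses \<open>B\<close>, contrary to minimality.\<close>

lemma minimal_all_transl:
  assumes min: "minimal_action G V adj \<phi>" and T: "T \<in> HH" "transl T" and A: "A \<in> HH"
  shows "transl A"
proof (rule ccontr)
  assume n: "\<not> transl A"
  have V: "A \<subseteq> V" using HH_sub[OF A] .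
  have nn: "V - (V - A) = A" using V by (simp add: double_diff)
  have n': "\<not> transl (V - A)" using transl_compl[of "V - A"] n nn by auto
  have "(\<forall>T\<in>HH. transl T \<longrightarrow> \<not> T \<subseteq> A) \<or> (\<forall>T\<in>HH. transl T \<longrightarrow> \<not> T \<subseteq> V - A)"
  proof (rule ccontr)
    assume "\<not> ?thesis"
    then obtain T1 T2 where T: "T1 \<in> HH" "transl T1" "T1 \<subseteq> A" "T2 \<in> HH" "transl T2" "T2 \<subseteq> V - A" by blast
    have "A \<subseteq> V - T2" using T(6) V by blast
    then have "transl A"
      using transl_between[OF HH_compl[OF T(4)] transl_compl[OF HH_sub[OF T(4)] T(5)] T(1,2) A _ T(3)] by blast
    then show False using n by simp
  qed
  then have "\<exists>B. B \<in> HH \<and> \<not> transl B \<and> (\<forall>T\<in>HH. transl T \<longrightarrow> \<not> T \<subseteq> B)"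
  proof
    assume "\<forall>T\<in>HH. transl T \<longrightarrow> \<not> T \<subseteq> A"
    then show ?thesis using A n by (intro exI[of _ A] conjI)
  next
    assume "\<forall>T\<in>HH. transl T \<longrightarrow> \<not> T \<subseteq> V - A"
    then show ?thesis using HH_compl[OF A] n' by (intro exI[of _ "V - A"] conjI)
  qed
  then obtain B where B: "B \<in> HH" "\<not> transl B" and noT: "\<And>T. T \<in> HH \<Longrightarrow> transl T \<Longrightarrow> \<not> T \<subseteq> B"
    by blast
  have BV: "B \<subseteq> V" using HH_sub[OF B(1)] .
  define W where "W = V - (\<Union>s\<in>carrier G. im s B)"
  have "W = V"
  proof (rule min[unfolded minimal_action_def, rule_format], intro conjI ballI)
    show "W \<subseteq> V" by (auto simp: W_def)
    obtain a b where ab: "adj a b" "T = Z a b" using T by (auto simp: HH_def)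
    have "a \<notin> im s B" if s: "s \<in> carrier G" for s
    proof
      assume a: "a \<in> im s B"
      have sB: "im s B \<in> HH" using im_HH[OF s B(1)] .
      have noT': "\<not> R \<subseteq> im s B" if R: "R \<in> HH" "transl R" for R
      proof
        assume "R \<subseteq> im s B"
        then have "im (inv s) R \<subseteq> B" using im_mono[of R "im s B" "inv s"] im_inv(1)[OF s BV] by simp
        then show False using noT[OF im_HH[OF inv_closed[OF s] R(1)] transl_im[OF HH_sub[OF R(1)] R(2) inv_closed[OF s]]] by simp
      qed
      have nT: "\<not> T \<subseteq> im s B" "\<not> V - T \<subseteq> im s B"
        using noT' T HH_compl[OF T(1)] transl_compl[OF HH_sub[OF T(1)] T(2)] by auto
      show False
      proof (cases "b \<in> im s B")
        case True
        then have "V - im s B \<subseteq> T \<or> (V - im s B) \<inter> T = {}"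
          using HH_avoid[OF HH_compl[OF sB] ab(1)] a ab by blast
        then show False using nT HH_sub[OF T(1)] by blast
      next
        case False
        then have "im s B = Z b a" using HH_cross[OF sB ab(1) a] by simp
        then show False using nT(2) Z_compl[OF ab(1)] ab by simp
      qed
    qed
    then show "W \<noteq> {}" using adjD(1)[OF ab(1)] by (auto simp: W_def)
  next
    fix u v assume uv: "u \<in> W" "v \<in> W"
    then obtain p where p: "walk V adj p" "hd p = u" "last p = v" "\<forall>A\<in>HH. u \<in> A \<longrightarrow> v \<in> A \<longrightarrow> set p \<subseteq> A"
      using convex_walk[of u v] by (auto simp: W_def)
    have "set p \<subseteq> V - im s B" if s: "s \<in> carrier G" for s
      using p(4) HH_compl[OF im_HH[OF s B(1)]] uv s by (auto simp: W_def)
    then have "set p \<subseteq> W" using p(1) by (auto simp: W_def walk_iff)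
    then show "\<exists>p. walk W adj p \<and> hd p = u \<and> last p = v" using p by (auto simp: walk_iff)
  next
    fix g assume g: "g \<in> carrier G"
    show "\<phi> g ` W \<subseteq> W"
    proof
      fix y assume "y \<in> \<phi> g ` W"
      then obtain x where x: "x \<in> W" "y = \<phi> g x" by auto
      have xV: "x \<in> V" using x by (simp add: W_def)
      have "y \<notin> im s B" if s: "s \<in> carrier G" for s
      proof
        assume "y \<in> im s B"
        then have "\<phi> (inv g) y \<in> im (inv g) (im s B)" by (auto simp: im_def)
        then have "x \<in> im (inv g \<otimes> s) B" using x xV g s BV by (simp add: act_inv im_mult)
        then show False using x g s by (auto simp: W_def)
      qed
      then show "y \<in> W" using x xV act_V[OF g] by (auto simp: W_def)
    qed
  qed
  moreover have "B \<inter> W = {}" using im_one[OF BV] by (force simp: W_def)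
  ultimately show False using HH_ne[OF B(1)] BV by blast
qed

text \<open>The bridge to boundary points given by rays: from every vertex exactly one neighbour
  \<open>nx\<close> faces the end, and iterating \<open>nx\<close> traces a ray. An element
  preserving the family commutes with \<open>nx\<close>, so it maps the ray to a cofinal
  one.\<close>

lemma end_ray:
  assumes A: "shrinking A"
  shows "\<exists>r. is_ray V adj r \<and> (\<forall>\<gamma>\<in>carrier G. (\<forall>m. \<exists>n. im \<gamma> (A n) \<subseteq> A m) \<longrightarrow> fixes_end (\<phi> \<gamma>) r)"
proof -
  have HA: "A n \<in> HH" for n using A by (rule shrinkingD)
  have mono: "m \<le> n \<Longrightarrow> A n \<subseteq> A m" for m n using A by (rule shrinkingD)
  define P where "P v w \<longleftrightarrow> adj v w \<and> (\<exists>m. A m \<subseteq> Z v w)" for v w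
  have ex: "\<exists>w. P v w" if v: "v \<in> V" for v
  proof -
    obtain m where m: "v \<notin> A m" using A v by (auto simp: shrinking_def)
    obtain u where u: "u \<in> A m" using HH_ne[OF HA] by blast
    have uv: "u \<in> V" "v \<noteq> u" using u m HH_sub[OF HA, of m] by auto
    obtain w where w: "adj v w" "u \<in> Z v w" using first_step[OF v uv] by blast
    have "A m \<subseteq> Z v w"
    proof (rule ccontr)
      assume n: "\<not> A m \<subseteq> Z v w"
      have "A m \<union> Z v w \<noteq> V" using m v Z_tail[OF w(1)] by auto
      moreover have "A m \<inter> Z v w \<noteq> {}" using u w by auto
      ultimately have "Z v w \<subseteq> A m" using HH_nested[OF HA HH_I[OF w(1)], of m] n by auto
      then have "w \<in> A m" using Z_head[OF w(1)] by auto
      then have "A m = Z v w" using HH_cross[OF HA adjD(3)[OF w(1)] _ m] by auto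
      then show False using n by simp
    qed
    then show ?thesis using w by (auto simp: P_def)
  qed
  have uniq: "w = w'" if vw: "adj v w" "adj v w'" "B \<in> HH" "B \<subseteq> Z v w" "B \<subseteq> Z v w'" for v w w' B
    using Z_disjoint[OF vw(1,2)] HH_ne[OF vw(3)] vw(4,5) by blast
  define nx where "nx v = (SOME w. P v w)" for v
  have nxP: "P v (nx v)" if "v \<in> V" for v unfolding nx_def using ex[OF that] by (rule someI_ex)
  have nx_eq: "nx v = w" if v: "v \<in> V" and w: "P v w" for v w
  proof -
    obtain m m' where m: "A m \<subseteq> Z v (nx v)" "A m' \<subseteq> Z v w" using nxP[OF v] w by (auto simp: P_def)
    then have "A (max m m') \<subseteq> Z v (nx v)" "A (max m m') \<subseteq> Z v w"
      using mono[of m "max m m'"] mono[of m' "max m m'"] by auto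
    then show ?thesis using uniq[OF _ _ HA] nxP[OF v] w by (auto simp: P_def)
  qed
  have nxV: "nx v \<in> V" "adj v (nx v)" if "v \<in> V" for v using nxP[OF that] adjD(2) by (auto simp: P_def)
  have powV: "(nx ^^ k) v \<in> V" if "v \<in> V" for k v using that nxV by (induction k) auto
  \<comment> \<open>Far out the family lies on one side of any given edge, so of two adjacent
    vertices one is \<open>nx\<close> of the other. Hence all forward orbits merge.\<close>
  have merge: "\<exists>k l. (nx ^^ k) u = (nx ^^ l) v" if u: "u \<in> V" and v: "v \<in> V" for u v
    using adj_rtranclp[OF u v]
  proof (induction rule: rtranclp_induct)
    case base
    then show ?case by blast
  next
    case (step y z)
    then obtain k l where kl: "(nx ^^ k) u = (nx ^^ l) y" by blast
    have yz: "y \<in> V" "z \<in> V" using adjD step(2) by auto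
    obtain n where "A n \<subseteq> Z y z \<or> A n \<inter> Z y z = {}" using shrinking_dichotomy[OF A HH_I[OF step(2)]] by blast
    then have "A n \<subseteq> Z y z \<or> A n \<subseteq> Z z y" using Z_compl[OF step(2)] HH_sub[OF HA, of n] by blast
    then have "nx y = z \<or> nx z = y"
      using nx_eq[OF yz(1), of z] nx_eq[OF yz(2), of y] step(2) adjD(3)[OF step(2)] by (auto simp: P_def)
    then show ?case
    proof
      assume nz: "nx y = z"
      have "(nx ^^ Suc k) u = (nx ^^ l) (nx y)" using kl by (simp add: funpow_swap1)
      then show ?thesis unfolding nz by blast
    next
      assume "nx z = y"
      then have "(nx ^^ k) u = (nx ^^ Suc l) z" using kl by (simp add: funpow_swap1)
      then show ?thesis by blast
    qed
  qed
  obtain v0 where v0: "v0 \<in> V" using V_ne by blast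
  define r where "r n = (nx ^^ n) v0" for n
  have rV: "r n \<in> V" for n using powV[OF v0] by (simp add: r_def)
  have rS: "r (Suc n) = nx (r n)" for n by (simp add: r_def)
  have ra: "adj (r n) (r (Suc n))" for n unfolding rS by (rule nxV(2)[OF rV])
  \<comment> \<open>No backtracking: both half-trees contain a far member of the family and so
    cannot be opposite.\<close>
  have rZ: "Z (r (Suc n)) (r (Suc (Suc n))) \<subseteq> Z (r n) (r (Suc n))" for n
  proof -
    let ?v = "r n" and ?w = "r (Suc n)" and ?x = "r (Suc (Suc n))"
    obtain m m' where m: "A m \<subseteq> Z ?v ?w" "A m' \<subseteq> Z ?w ?x"
      using nxP[OF rV, of n] nxP[OF rV, of "Suc n"] by (auto simp: P_def rS)
    have ne: "?x \<noteq> ?v"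
    proof
      assume "?x = ?v"
      then have "A (max m m') \<subseteq> Z ?v ?w \<inter> Z ?w ?v"
        using m mono[of m "max m m'"] mono[of m' "max m m'"] by auto
      then show False using Z_compl[OF ra[of n]] HH_ne[OF HA, of "max m m'"] by blast
    qed
    have 1: "?w \<notin> Z ?w ?x" by (rule Z_tail[OF ra])
    have 2: "?v \<notin> Z ?w ?x" using Z_cross[OF ra ra _ 1] ne by auto
    have 3: "?x \<in> Z ?v ?w" using Z_cross[OF ra[of n] ra[of "Suc n"] Z_head[OF ra]] ne by auto
    show ?thesis using HH_avoid[OF HH_I[OF ra] ra 2 1] 3 Z_head[OF ra[of "Suc n"]] by blast
  qed
  have rZ': "Z (r (n + k)) (r (Suc (n + k))) \<subseteq> Z (r n) (r (Suc n))" for n k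
  proof (induction k)
    case (Suc k)
    then show ?case using rZ[of "n + k"] by simp
  qed simp
  have "inj r"
  proof (rule linorder_injI)
    fix n k :: nat assume "n < k"
    then obtain j where j: "k = Suc (n + j)" using less_imp_Suc_add by blast
    have "r k \<in> Z (r n) (r (Suc n))" unfolding j using rZ'[of n j] Z_head[OF ra[of "n + j"]] by auto
    then show "r n \<noteq> r k" using Z_tail[OF ra[of n]] by auto
  qed
  then have ray: "is_ray V adj r" using rV ra by (simp add: is_ray_def)
  have "fixes_end (\<phi> \<gamma>) r" if g: "\<gamma> \<in> carrier G" and inv: "\<forall>m. \<exists>n. im \<gamma> (A n) \<subseteq> A m" for \<gamma>
  proof -
    \<comment> \<open>Both neighbours face the image of one far member of the family, and at most
      one neighbour can.\<close>
    have eq: "\<phi> \<gamma> (nx v) = nx (\<phi> \<gamma> v)" if v: "v \<in> V" for v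
    proof -
      have gv: "\<phi> \<gamma> v \<in> V" using act_V[OF g v] .
      obtain m where m: "A m \<subseteq> Z v (nx v)" using nxP[OF v] by (auto simp: P_def)
      obtain m' where m': "A m' \<subseteq> Z (\<phi> \<gamma> v) (nx (\<phi> \<gamma> v))" using nxP[OF gv] by (auto simp: P_def)
      obtain n where n: "im \<gamma> (A n) \<subseteq> A m'" using inv by blast
      have a: "im \<gamma> (A (max m n)) \<subseteq> Z (\<phi> \<gamma> v) (\<phi> \<gamma> (nx v))"
        using im_mono[OF order_trans[OF mono[of m "max m n"] m], of \<gamma>] im_Z[OF g nxV(2)[OF v]] by simp
      have b: "im \<gamma> (A (max m n)) \<subseteq> Z (\<phi> \<gamma> v) (nx (\<phi> \<gamma> v))"
        using order_trans[OF order_trans[OF im_mono[OF mono[of n "max m n"]] n] m'] by simp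
      show ?thesis
        by (rule uniq[OF adj_actI[OF g nxV(2)[OF v]] nxV(2)[OF gv] im_HH[OF g HA] a b])
    qed
    have pow: "\<phi> \<gamma> ((nx ^^ n) v) = (nx ^^ n) (\<phi> \<gamma> v)" if v: "v \<in> V" for n v
      using eq[OF powV[OF v]] by (induction n) auto
    obtain k l where kl: "(nx ^^ k) (\<phi> \<gamma> v0) = (nx ^^ l) v0" using merge[OF act_V[OF g v0] v0] by blast
    have "(\<phi> \<gamma> \<circ> r) (n + k) = r (n + l)" for n
      using kl pow[OF v0, of "n + k"] by (simp add: r_def funpow_add)
    then show ?thesis unfolding fixes_end_def cofinal_def by blast
  qed
  then show ?thesis using ray by blast
qed

end

locale nonelementary_tree_act = tree_act +
  assumes minimal: "minimal_action G V adj \<phi>" and sh: "strongly_hyperbolic G V adj \<phi>"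
begin

section \<open>Moving and separating half-trees\<close>

lemma hyperbolic_pair:
  "\<exists>g\<in>carrier G. \<exists>h\<in>carrier G. hyperbolic_aut V adj (\<phi> g) \<and> hyperbolic_aut V adj (\<phi> h)
     \<and> \<not> (\<exists>r. is_ray V adj r \<and> fixes_end (\<phi> g) r \<and> fixes_end (\<phi> h) r)"
  using sh by (simp only: strongly_hyperbolic_def)

lemma no_common_end:
  assumes "shrinking A" "g \<in> carrier G" "h \<in> carrier G"
    and "\<not> (\<exists>r. is_ray V adj r \<and> fixes_end (\<phi> g) r \<and> fixes_end (\<phi> h) r)"
    and "\<And>m. \<exists>n. im g (A n) \<subseteq> A m" "\<And>m. \<exists>n. im h (A n) \<subseteq> A m"
  shows False
proof -
  obtain r where r: "is_ray V adj r" "\<forall>\<gamma>\<in>carrier G. (\<forall>m. \<exists>n. im \<gamma> (A n) \<subseteq> A m) \<longrightarrow> fixes_end (\<phi> \<gamma>) r"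
    using end_ray[OF assms(1)] by (elim exE conjE)
  have "fixes_end (\<phi> g) r" "fixes_end (\<phi> h) r"
    using bspec[OF r(2) assms(2)] bspec[OF r(2) assms(3)] assms(5,6) by simp_all
  then show False using assms(4) r(1) by simp
qed

lemma transl_all: "A \<in> HH \<Longrightarrow> \<exists>t\<in>carrier G. im t A \<subset> A"
proof -
  assume A: "A \<in> HH"
  obtain g where g: "g \<in> carrier G" "hyperbolic_aut V adj (\<phi> g)" using hyperbolic_pair by (elim bexE conjE)
  obtain T where T: "T \<in> HH" "im g T \<subset> T" using hyperbolic_translates[OF g] by auto
  have "transl T" using T g by (auto simp: transl_def)
  from minimal_all_transl[OF minimal T(1) this A] show ?thesis by (simp add: transl_def)
qed

text \<open>If every translate of \<open>A\<close> met \<open>A\<close>, every group element would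
  fix the end defined by the powers of \<open>t\<close>: by the dichotomy, far images lie inside or
  are disjoint, and disjointness is excluded. This contradicts the pair of hyperbolic elements
  without a common end.\<close>

lemma flip: "A \<in> HH \<Longrightarrow> \<exists>t\<in>carrier G. im t A \<inter> A = {}"
proof (rule ccontr)
  assume A: "A \<in> HH" and n: "\<not> ?thesis"
  have AV: "A \<subseteq> V" using HH_sub[OF A] .
  obtain t where t: "t \<in> carrier G" "im t A \<subset> A" using transl_all[OF A] by blast
  let ?A = "\<lambda>n::nat. im (t [^] n) A"
  have sA: "shrinking ?A" using shrinking_powers[OF t(1) A t(2)] .
  have inv: "\<exists>n. im \<gamma> (?A n) \<subseteq> ?A m" if g: "\<gamma> \<in> carrier G" for \<gamma> m
  proof -
    have mc: "t [^] m \<in> carrier G" using t by simp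
    obtain k where k: "im \<gamma> (?A k) \<subseteq> ?A m \<or> im \<gamma> (?A k) \<inter> ?A m = {}"
      using shrinking_dichotomy[OF shrinking_im[OF sA g] shrinkingD(1)[OF sA]] by blast
    have kc: "t [^] k \<in> carrier G" using t by simp
    \<comment> \<open>Disjointness of the two shrunken half-trees, pulled back by powers of
      \<open>t\<close>, would be disjointness of \<open>A\<close> from a translate of
      itself.\<close>
    let ?s = "inv (t [^] m) \<otimes> (\<gamma> \<otimes> t [^] k)"
    have "im ?s A = im (inv (t [^] m)) (im \<gamma> (?A k))" using g mc kc AV by (simp add: im_mult im_sub)
    moreover have "A = im (inv (t [^] m)) (?A m)" using im_inv(1)[OF mc AV] by simp
    ultimately have "im ?s A \<inter> A = im (inv (t [^] m)) (im \<gamma> (?A k)) \<inter> im (inv (t [^] m)) (?A m)" by simp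
    moreover have "im ?s A \<inter> A \<noteq> {}" using n g mc kc by auto
    ultimately have "im \<gamma> (?A k) \<inter> ?A m \<noteq> {}"
      using im_disjoint_iff[OF inv_closed[OF mc] im_sub[OF g im_sub[OF kc AV]] im_sub[OF mc AV]] by simp
    then show ?thesis using k by auto
  qed
  obtain g h where gh: "g \<in> carrier G" "h \<in> carrier G"
    "\<not> (\<exists>r. is_ray V adj r \<and> fixes_end (\<phi> g) r \<and> fixes_end (\<phi> h) r)"
    using hyperbolic_pair by (elim bexE conjE)
  show False by (rule no_common_end[OF sA gh inv[OF gh(1)] inv[OF gh(2)]])
qed

text \<open>As in double skewering, \<open>t\<close> is composed of flips of the two half-trees.\<close>

lemma move_into:
  assumes A: "A \<in> HH" and B: "B \<in> HH" shows "\<exists>t\<in>carrier G. im t A \<subseteq> B"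
proof -
  have V: "A \<subseteq> V" "B \<subseteq> V" using HH_sub A B by auto
  obtain s where s: "s \<in> carrier G" "im s A \<inter> A = {}" using flip[OF A] by blast
  obtain t where t: "t \<in> carrier G" "im t (V - B) \<inter> (V - B) = {}" using flip[OF HH_compl[OF B]] by blast
  have s': "im s A \<subseteq> V - A" using s im_sub[OF s(1) V(1)] by auto
  have t': "im t (V - B) \<subseteq> B" using t im_sub[OF t(1), of "V - B"] by auto
  consider "A \<subseteq> B" | "B \<subseteq> A" | "A \<inter> B = {}" | "A \<union> B = V" using HH_nested[OF A B] by blast
  then show ?thesis
  proof cases
    case 1
    then show ?thesis using im_one[OF V(1)] by (intro bexI[of _ \<one>]) auto
  next
    case 2
    have "im s A \<subseteq> V - B" using s' 2 by auto
    then have "im t (im s A) \<subseteq> B" using im_mono[of "im s A" "V - B" t] t' by auto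
    then show ?thesis using s t V by (intro bexI[of _ "t \<otimes> s"]) (auto simp: im_mult)
  next
    case 3
    then have "A \<subseteq> V - B" using V by auto
    then have "im t A \<subseteq> B" using im_mono[of A "V - B" t] t' by auto
    then show ?thesis using t by auto
  next
    case 4
    then have "im s A \<subseteq> B" using s' by auto
    then show ?thesis using s by auto
  qed
qed

text \<open>Take neighbourhoods of the two ends of \<open>g\<close> and of one end of
  \<open>h\<close>. If they never become pairwise disjoint, the end of \<open>h\<close> coincides
  with one of the ends of \<open>g\<close>, and the two elements share a fixed end.\<close>

lemma facing_triple: "\<exists>D1\<in>HH. \<exists>D2\<in>HH. \<exists>D3\<in>HH. D1 \<inter> D2 = {} \<and> D1 \<inter> D3 = {} \<and> D2 \<inter> D3 = {}"
proof (rule ccontr)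
  assume n: "\<not> ?thesis"
  have no3: False if D: "D1 \<in> HH" "D2 \<in> HH" "D3 \<in> HH" "D1 \<inter> D2 = {}" "D1 \<inter> D3 = {}" "D2 \<inter> D3 = {}" for D1 D2 D3
    by (rule notE[OF n]) (intro bexI[of _ D1] bexI[of _ D2] bexI[of _ D3] conjI D)
  obtain g h where gh: "g \<in> carrier G" "h \<in> carrier G" "hyperbolic_aut V adj (\<phi> g)" "hyperbolic_aut V adj (\<phi> h)"
    and noend: "\<not> (\<exists>r. is_ray V adj r \<and> fixes_end (\<phi> g) r \<and> fixes_end (\<phi> h) r)"
    using hyperbolic_pair by (elim bexE conjE)
  obtain A where A: "A \<in> HH" "im g A \<subset> A" using hyperbolic_translates[OF gh(1,3)] by auto
  obtain B where B: "B \<in> HH" "im h B \<subset> B" using hyperbolic_translates[OF gh(2,4)] by auto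
  have V: "A \<subseteq> V" "B \<subseteq> V" using HH_sub A B by auto
  let ?A = "\<lambda>n::nat. im (g [^] n) A" and ?A' = "\<lambda>n::nat. im (inv g [^] n) (V - A)" and ?B = "\<lambda>n::nat. im (h [^] n) B"
  have sA: "shrinking ?A" using shrinking_powers[OF gh(1) A] .
  have sA': "shrinking ?A'"
    using shrinking_powers[OF inv_closed[OF gh(1)] HH_compl[OF A(1)] im_psubset_compl[OF gh(1) V(1) A(2)]] .
  have sB: "shrinking ?B" using shrinking_powers[OF gh(2) B] .
  have disj: "?A m \<inter> ?A' m = {}" for m
    using shrinkingD(2)[OF sA, of 0 m] shrinkingD(2)[OF sA', of 0 m] im_one[OF V(1)] im_one[of "V - A"] by auto
  have one: "(\<exists>k. ?B k \<subseteq> ?A m) \<or> (\<exists>k. ?B k \<subseteq> ?A' m)" for m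
  proof (rule ccontr)
    assume a: "\<not> ?thesis"
    obtain k where k: "?B k \<inter> ?A m = {}" using shrinking_dichotomy[OF sB shrinkingD(1)[OF sA]] a by blast
    obtain k' where k': "?B k' \<inter> ?A' m = {}" using shrinking_dichotomy[OF sB shrinkingD(1)[OF sA']] a by blast
    have "?B (max k k') \<inter> ?A m = {}" "?B (max k k') \<inter> ?A' m = {}"
      using k k' shrinkingD(2)[OF sB, of k "max k k'"] shrinkingD(2)[OF sB, of k' "max k k'"] by auto
    then show False using no3[OF shrinkingD(1)[OF sB] shrinkingD(1)[OF sA] shrinkingD(1)[OF sA'] _ _ disj] by auto
  qed
  \<comment> \<open>If the sets \<open>?B k\<close> enter every \<open>C m\<close>, both sequences
    define the same end, which \<open>h\<close> then preserves.\<close>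
  have concl: False if sC: "shrinking C" and BC: "\<And>m. \<exists>k. ?B k \<subseteq> C m" and gC: "\<And>m. \<exists>n. im g (C n) \<subseteq> C m" for C
  proof (rule no_common_end[OF sC gh(1,2) noend gC])
    fix m
    obtain k where k: "?B k \<subseteq> C m" using BC by blast
    have Bk: "?B k \<in> HH" by (rule shrinkingD(1)[OF sB])
    obtain j where j: "C j \<subseteq> ?B k \<or> C j \<inter> ?B k = {}" using shrinking_dichotomy[OF sC Bk] by blast
    have "C j \<inter> ?B k \<noteq> {}"
    proof -
      obtain i where i: "?B i \<subseteq> C j" using BC by blast
      have "?B (max i k) \<subseteq> C j \<inter> ?B k"
        using i shrinkingD(2)[OF sB, of i "max i k"] shrinkingD(2)[OF sB, of k "max i k"] by auto
      then show ?thesis using HH_ne[OF shrinkingD(1)[OF sB, of "max i k"]] by auto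
    qed
    then have "C j \<subseteq> ?B k" using j by auto
    then have "im h (C j) \<subseteq> im h (?B k)" by (rule im_mono)
    also have "im h (?B k) = ?B (Suc k)"
      unfolding nat_pow_Suc2[OF gh(2)] using gh V by (intro im_mult[symmetric]) auto
    also have "\<dots> \<subseteq> ?B k" by (rule shrinkingD(2)[OF sB]) simp
    also have "\<dots> \<subseteq> C m" by (rule k)
    finally show "\<exists>n. im h (C n) \<subseteq> C m" by (rule exI)
  qed
  show False
  proof (cases "\<forall>m. \<exists>k. ?B k \<subseteq> ?A m")
    case True
    show False
    proof (rule concl[OF sA])
      show "\<exists>k. ?B k \<subseteq> ?A m" for m using True by auto
      have "im g (?A m) = ?A (Suc m)" for m
        unfolding nat_pow_Suc2[OF gh(1)] using gh V by (intro im_mult[symmetric]) auto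
      moreover have "?A (Suc m) \<subseteq> ?A m" for m by (rule shrinkingD(2)[OF sA]) simp
      ultimately have "im g (?A m) \<subseteq> ?A m" for m by simp
      then show "\<exists>n. im g (?A n) \<subseteq> ?A m" for m by (rule exI)
    qed
  next
    case False
    \<comment> \<open>As \<open>?A\<close> decreases, the first alternative of \<open>one\<close>
      fails for all indices from \<open>m0\<close> on; so the second holds there, and by
      monotonicity everywhere.\<close>
    then obtain m0 where m0: "\<not> (\<exists>k. ?B k \<subseteq> ?A m0)" by auto
    show False
    proof (rule concl[OF sA'])
      fix m
      let ?M = "max m m0"
      have "\<not> (\<exists>k. ?B k \<subseteq> ?A ?M)" using m0 shrinkingD(2)[OF sA, of m0 ?M] by auto
      then obtain k where "?B k \<subseteq> ?A' ?M" using one[of ?M] by auto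
      then show "\<exists>k. ?B k \<subseteq> ?A' m" using shrinkingD(2)[OF sA', of m ?M] by (intro exI[of _ k]) auto
      have "im g (?A' (Suc m)) = im g (im (inv g) (?A' m))"
        unfolding nat_pow_Suc2[OF inv_closed[OF gh(1)]] using gh V
        by (intro arg_cong[where f="im g"] im_mult) auto
      also have "\<dots> = ?A' m" using gh by (intro im_inv im_sub) auto
      finally show "\<exists>n. im g (?A' n) \<subseteq> ?A' m" by (intro exI[of _ "Suc m"]) simp
    qed
  qed
qed

text \<open>Two members of a facing triple lie in the complement of the third, and that complement
  can be moved into \<open>A\<close>.\<close>

lemma two_disjoint:
  assumes A: "A \<in> HH" shows "\<exists>D1\<in>HH. \<exists>D2\<in>HH. D1 \<subseteq> A \<and> D2 \<subseteq> A \<and> D1 \<inter> D2 = {}"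
proof -
  obtain D1 D2 D3 where D: "D1 \<in> HH" "D2 \<in> HH" "D3 \<in> HH" "D1 \<inter> D2 = {}" "D1 \<inter> D3 = {}" "D2 \<inter> D3 = {}"
    using facing_triple by auto
  have V: "D1 \<subseteq> V" "D2 \<subseteq> V" using HH_sub D by auto
  obtain t where t: "t \<in> carrier G" "im t (V - D3) \<subseteq> A" using move_into[OF HH_compl[OF D(3)] A] by blast
  have "D1 \<subseteq> V - D3" "D2 \<subseteq> V - D3" using D V by auto
  then have "im t D1 \<subseteq> A" "im t D2 \<subseteq> A"
    using order_trans[OF im_mono t(2)] by simp_all
  moreover have "im t D1 \<inter> im t D2 = {}" using im_disjoint_iff[OF t(1) V] D by simp
  ultimately show ?thesis using im_HH[OF t(1)] D by auto
qed

text \<open>Two disjoint half-trees cannot both contain far members of the sequence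
  \<open>?B\<close>, so one of them avoids the attracting end. It lies in a single shell between
  consecutive sets \<open>?B\<close>, and \<open>f\<close> moves it to the next.\<close>

lemma displaced_if_translated:
  assumes f: "f \<in> carrier G" and B: "B \<in> HH" "im f B \<subset> B"
  shows "\<exists>D\<in>HH. D \<subseteq> B \<and> im f D \<inter> D = {}"
proof -
  have BV: "B \<subseteq> V" using HH_sub[OF B(1)] .
  let ?B = "\<lambda>n::nat. im (f [^] n) B"
  have sB: "shrinking ?B" using shrinking_powers[OF f B] .
  obtain D1 D2 where D12: "D1 \<in> HH" "D2 \<in> HH" "D1 \<subseteq> B" "D2 \<subseteq> B" "D1 \<inter> D2 = {}" using two_disjoint[OF B(1)] by auto
  have "(\<forall>n. \<not> ?B n \<subseteq> D1) \<or> (\<forall>n. \<not> ?B n \<subseteq> D2)"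
  proof (rule ccontr)
    assume "\<not> ?thesis"
    then obtain n m where nm: "?B n \<subseteq> D1" "?B m \<subseteq> D2" by auto
    then have "?B (max n m) \<subseteq> D1 \<inter> D2" using shrinkingD(2)[OF sB, of n "max n m"] shrinkingD(2)[OF sB, of m "max n m"] by auto
    then show False using D12 HH_ne[OF shrinkingD(1)[OF sB, of "max n m"]] by auto
  qed
  then obtain D where D: "D \<in> HH" "D \<subseteq> B" "\<And>n. \<not> ?B n \<subseteq> D"
  proof
    assume "\<forall>n. \<not> ?B n \<subseteq> D1"
    then show ?thesis using D12 that[of D1] by auto
  next
    assume "\<forall>n. \<not> ?B n \<subseteq> D2"
    then show ?thesis using D12 that[of D2] by auto
  qed
  obtain m where m: "?B m \<inter> D = {}" using shrinking_dichotomy[OF sB D(1)] D(3) by auto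
  have dich: "D \<subseteq> ?B n \<or> ?B n \<inter> D = {}" for n
  proof -
    have "?B n \<subseteq> B" using shrinkingD(2)[OF sB, of 0 n] im_one[OF BV] by auto
    then have "?B n \<union> D \<noteq> V" using D(2) HH_neV[OF B(1)] BV by auto
    then show ?thesis using HH_nested[OF shrinkingD(1)[OF sB, of n] D(1)] D(3) by auto
  qed
  \<comment> \<open>With \<open>k = Suc j\<close>, minimality puts \<open>D\<close> inside
    \<open>?B j\<close> but off \<open>?B k\<close>, while \<open>f\<close> maps \<open>?B j\<close>
    onto \<open>?B k\<close>.\<close>
  define k where "k = (LEAST n. ?B n \<inter> D = {})"
  have k: "?B k \<inter> D = {}" unfolding k_def using m by (rule LeastI)
  have "k \<noteq> 0"
  proof
    assume "k = 0"
    then show False using k im_one[OF BV] D(2) HH_ne[OF D(1)] by auto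
  qed
  then obtain j where j: "k = Suc j" by (cases k) auto
  have "?B j \<inter> D \<noteq> {}" using not_less_Least[of j "\<lambda>n. ?B n \<inter> D = {}"] j unfolding k_def by auto
  then have "D \<subseteq> ?B j" using dich[of j] by auto
  then have "im f D \<subseteq> im f (?B j)" by (rule im_mono)
  also have "im f (?B j) = ?B k"
    unfolding j nat_pow_Suc2[OF f] using f BV by (intro im_mult[symmetric]) auto
  finally have "im f D \<inter> D = {}" using k by auto
  then show ?thesis using D by auto
qed

text \<open>Since half-trees separate vertices, some half-tree inside \<open>A\<close> is not
  preserved by \<open>f\<close>. If it is nested with its image the translation lemma applies, if it
  is disjoint from it there is nothing to do, and the covering case is the obstacle.\<close>

lemma displaced_sub:
  assumes f: "f \<in> carrier G" and A: "A \<in> HH" and v: "v \<in> A" "\<phi> f v \<noteq> v"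
  shows "\<exists>B\<in>HH. B \<subseteq> A \<and> im f B \<inter> B = {}"
proof -
  have AV: "A \<subseteq> V" using HH_sub[OF A] .
  have vV: "v \<in> V" "\<phi> f v \<in> V" using v AV act_V[OF f] by auto
  have "\<exists>B\<in>HH. B \<subseteq> A \<and> im f B \<noteq> B"
  proof (rule ccontr)
    assume "\<not> ?thesis"
    then have fixB: "im f B = B" if "B \<in> HH" "B \<subseteq> A" for B using that by auto
    obtain C where C: "C \<in> HH" "v \<in> C" "\<phi> f v \<notin> C" using HH_separates[OF vV] v by auto
    have CV: "C \<subseteq> V" using HH_sub[OF C(1)] .
    consider "A \<subseteq> C" | "C \<subseteq> A" | "A \<inter> C = {}" | "A \<union> C = V" using HH_nested[OF A C(1)] by blast
    then show False
    proof cases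
      case 1
      have "\<phi> f v \<in> im f A" using v by (auto simp: im_def)
      then show False using fixB[OF A] 1 C by auto
    next
      case 2
      have "\<phi> f v \<in> im f C" using C by (auto simp: im_def)
      then show False using fixB[OF C(1) 2] C by auto
    next
      case 3
      then show False using v C by auto
    next
      case 4
      then have "im f (V - C) = V - C" using fixB[OF HH_compl[OF C(1)]] by auto
      then have "im f C = C" using im_compl[OF f CV] im_sub[OF f CV] CV by auto
      moreover have "\<phi> f v \<in> im f C" using C by (auto simp: im_def)
      ultimately show False using C by auto
    qed
  qed
  then obtain B where B: "B \<in> HH" "B \<subseteq> A" "im f B \<noteq> B" by auto
  have nest: "\<exists>D\<in>HH. D \<subseteq> B \<and> im f D \<inter> D = {}"
    if B: "B \<in> HH" "im f B \<noteq> B" "im f B \<union> B \<noteq> V" for B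
  proof -
    have BV: "B \<subseteq> V" using HH_sub[OF B(1)] .
    consider "im f B \<subset> B" | "B \<subset> im f B" | "im f B \<inter> B = {}"
      using HH_nested[OF im_HH[OF f B(1)] B(1)] B(2,3) by blast
    then show ?thesis
    proof cases
      case 1
      then show ?thesis using displaced_if_translated[OF f B(1)] by auto
    next
      case 2
      obtain D where D: "D \<in> HH" "D \<subseteq> B" "im (inv f) D \<inter> D = {}"
        using displaced_if_translated[OF inv_closed[OF f] B(1) im_psubset_inv[OF f BV 2]] by auto
      have DV: "D \<subseteq> V" using HH_sub[OF D(1)] .
      have "im f (im (inv f) D) \<inter> im f D = {}"
        using im_disjoint_iff[OF f im_sub[OF inv_closed[OF f] DV] DV] D(3) by simp
      then have "im f D \<inter> D = {}" using im_inv(2)[OF f DV] by auto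
      then show ?thesis using D by auto
    next
      case 3
      then show ?thesis using B by auto
    qed
  qed
  show ?thesis
  proof (cases "im f B \<union> B = V")
    case False
    then show ?thesis using nest[OF B(1,3)] B(2) by auto
  next
    case True
    have BV: "B \<subseteq> V" using HH_sub[OF B(1)] .
    \<comment> \<open>When \<open>B\<close> and its image cover \<open>V\<close>, the image of the
      complement lies in \<open>B\<close> and is tried in its place.\<close>
    define C where "C = im f (V - B)"
    have C: "C \<in> HH" using im_HH[OF f HH_compl[OF B(1)]] by (simp add: C_def)
    have CB: "C \<subseteq> B" using True im_compl[OF f BV] by (auto simp: C_def)
    have inj: "im f C = C \<longleftrightarrow> C = V - B" unfolding C_def using im_eq_iff[OF f im_sub[OF f], of "V - B" "V - B"] by auto
    have nC: "im f C \<noteq> C" using inj CB HH_ne[OF C] by auto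
    show ?thesis
    proof (cases "im f C \<union> C = V")
      case False
      then show ?thesis using nest[OF C nC] CB B(2) by auto
    next
      case T2: True
      \<comment> \<open>If \<open>C\<close> also covers \<open>V\<close> with its image, then
        \<open>C = B\<close>; so \<open>f\<close> exchanges \<open>B\<close> with its complement and
        \<open>B\<close> is displaced after all.\<close>
      have "im f (V - C) \<subseteq> C" using im_compl[OF f HH_sub[OF C]] T2 by auto
      then have "im f (V - C) \<subseteq> im f (V - B)" by (simp add: C_def)
      then have "V - C \<subseteq> V - B" using im_subset_iff[OF f, of "V - C" "V - B"] by auto
      then have "C = B" using CB BV by auto
      then have "V - im f B = B" using im_compl[OF f BV] by (simp add: C_def)
      then have "im f B \<inter> B = {}" by auto
      then show ?thesis using B by auto
    qed
  qed
qed

text \<open>Of two disjoint half-trees \<open>C1\<close>, \<open>C2\<close> in \<open>B\<close>, one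
  is always a suitable replacement for \<open>B\<close>. If \<open>C1\<close> and \<open>A'\<close>
  are comparable, the smaller of them avoids \<open>C2\<close>; otherwise \<open>A'\<close> or the
  complement of \<open>C1\<close> serves as the part of \<open>A'\<close> kept off
  \<open>C1\<close>.\<close>

lemma dodge:
  assumes "finite AA" "AA \<subseteq> HH" "A \<in> HH"
  shows "\<exists>B\<in>HH. B \<subseteq> A \<and> (\<forall>A'\<in>AA. \<exists>A''\<in>HH. A'' \<subseteq> A' \<and> A'' \<inter> B = {})"
  using assms(1,2)
proof (induction AA)
  case empty
  then show ?case using assms(3) by auto
next
  case (insert A' AA)
  then obtain B where B: "B \<in> HH" "B \<subseteq> A" "\<forall>A'\<in>AA. \<exists>A''\<in>HH. A'' \<subseteq> A' \<and> A'' \<inter> B = {}" by auto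
  obtain C1 C2 where C: "C1 \<in> HH" "C2 \<in> HH" "C1 \<subseteq> B" "C2 \<subseteq> B" "C1 \<inter> C2 = {}" using two_disjoint[OF B(1)] by auto
  have A': "A' \<in> HH" using insert by auto
  have good: "\<exists>A''\<in>HH. A'' \<subseteq> A' \<and> A'' \<inter> C = {}" if "C \<in> HH" "\<not> C \<subseteq> A'" "\<not> A' \<subseteq> C" for C
  proof -
    have "A' \<inter> C = {} \<or> A' \<union> C = V" using HH_nested[OF A' that(1)] that by auto
    then show ?thesis
    proof
      assume "A' \<inter> C = {}"
      then show ?thesis using A' by auto
    next
      assume "A' \<union> C = V"
      then have "V - C \<subseteq> A'" by auto
      then show ?thesis using HH_compl[OF that(1)] by (intro bexI[of _ "V - C"]) auto
    qed
  qed
  have "(\<exists>A''\<in>HH. A'' \<subseteq> A' \<and> A'' \<inter> C1 = {}) \<or> (\<exists>A''\<in>HH. A'' \<subseteq> A' \<and> A'' \<inter> C2 = {})"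
  proof -
    consider "C1 \<subseteq> A'" | "A' \<subseteq> C1" | "\<not> C1 \<subseteq> A'" "\<not> A' \<subseteq> C1" by blast
    then show ?thesis
    proof cases
      case 1
      then have "\<exists>A''\<in>HH. A'' \<subseteq> A' \<and> A'' \<inter> C2 = {}" using C by (intro bexI[of _ C1]) auto
      then show ?thesis by simp
    next
      case 2
      then have "\<exists>A''\<in>HH. A'' \<subseteq> A' \<and> A'' \<inter> C2 = {}" using C A' by (intro bexI[of _ A']) auto
      then show ?thesis by simp
    next
      case 3
      then show ?thesis using good[OF C(1)] by simp
    qed
  qed
  then obtain C where C': "C \<in> HH" "C \<subseteq> B" "\<exists>A''\<in>HH. A'' \<subseteq> A' \<and> A'' \<inter> C = {}"
    using C(1-4) by (elim disjE) (assumption | rule that)+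
  have "\<exists>A''\<in>HH. A'' \<subseteq> X \<and> A'' \<inter> C = {}" if X: "X \<in> AA" for X
  proof -
    obtain A'' where "A'' \<in> HH" "A'' \<subseteq> X" "A'' \<inter> B = {}" using B(3) X by auto
    then show ?thesis using C'(2) by (intro bexI[of _ A'']) auto
  qed
  then have "\<forall>X\<in>insert A' AA. \<exists>A''\<in>HH. A'' \<subseteq> X \<and> A'' \<inter> C = {}" using C'(3) by simp
  moreover have "C \<subseteq> A" using C'(2) B(2) by auto
  ultimately show ?case using C'(1) by (intro bexI[of _ C] conjI)
qed

lemma disjointify:
  assumes "set As \<subseteq> HH"
  shows "\<exists>Bs. length Bs = length As \<and> set Bs \<subseteq> HH \<and> (\<forall>i<length As. Bs ! i \<subseteq> As ! i) \<and>
     (\<forall>i<length As. \<forall>j<length As. i \<noteq> j \<longrightarrow> Bs ! i \<inter> Bs ! j = {})"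
  using assms
proof (induction "length As" arbitrary: As)
  case 0
  then show ?case by auto
next
  case (Suc n)
  then obtain A As' where As: "As = A # As'" "length As' = n" by (cases As) auto
  obtain B where B: "B \<in> HH" "B \<subseteq> A" "\<forall>A'\<in>set As'. \<exists>A''\<in>HH. A'' \<subseteq> A' \<and> A'' \<inter> B = {}"
    using dodge[of "set As'" A] Suc.prems As by auto
  define d where "d A' = (SOME A''. A'' \<in> HH \<and> A'' \<subseteq> A' \<and> A'' \<inter> B = {})" for A'
  have d: "d A' \<in> HH \<and> d A' \<subseteq> A' \<and> d A' \<inter> B = {}" if "A' \<in> set As'" for A'
    unfolding d_def by (rule someI_ex) (use B(3) that in auto)
  have "set (map d As') \<subseteq> HH" using d by auto
  then obtain Bs where Bs: "length Bs = n" "set Bs \<subseteq> HH" "\<And>i. i < n \<Longrightarrow> Bs ! i \<subseteq> d (As' ! i)"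
    "\<And>i j. i < n \<Longrightarrow> j < n \<Longrightarrow> i \<noteq> j \<Longrightarrow> Bs ! i \<inter> Bs ! j = {}"
    using Suc.hyps(1)[of "map d As'"] As(2) by auto
  have dB: "Bs ! i \<subseteq> As' ! i" "Bs ! i \<inter> B = {}" if "i < n" for i
    using Bs(3)[OF that] d[of "As' ! i"] As(2) that by auto
  show ?case
  proof (intro exI[of _ "B # Bs"] conjI allI impI)
    show "length (B # Bs) = length As" using As Bs by simp
    show "set (B # Bs) \<subseteq> HH" using B Bs by simp
    show "(B # Bs) ! i \<subseteq> As ! i" if "i < length As" for i
      using that As B(2) dB(1) by (cases i) auto
    show "(B # Bs) ! i \<inter> (B # Bs) ! j = {}" if ij: "i < length As" "j < length As" "i \<noteq> j" for i j
    proof (cases i)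
      case 0
      then obtain j' where "j = Suc j'" using ij by (cases j) auto
      then show ?thesis using 0 ij As dB(2)[of j'] by auto
    next
      case (Suc i')
      then show ?thesis using ij As dB(2)[of i'] Bs(4)[of i'] by (cases j) auto
    qed
  qed
qed

end

section \<open>Norm estimates for averages of conjugates\<close>

lemma l2_pythagoras:
  assumes "finite I" "\<And>i. i \<in> I \<Longrightarrow> w i \<in> l2 H" "\<And>i j x. i \<in> I \<Longrightarrow> j \<in> I \<Longrightarrow> i \<noteq> j \<Longrightarrow> w i x = 0 \<or> w j x = 0"
  shows "(l2norm H (\<lambda>x. \<Sum>i\<in>I. w i x))\<^sup>2 = (\<Sum>i\<in>I. (l2norm H (w i))\<^sup>2)"
  using assms
proof (induction I)
  case empty
  then show ?case by simp
next
  case (insert a I)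
  let ?v = "\<lambda>x. \<Sum>i\<in>I. w i x"
  have v: "?v \<in> l2 H" using insert by (intro l2_sum) auto
  have wa: "w a \<in> l2 H" using insert by auto
  have pt: "(cmod (w a x + ?v x))\<^sup>2 = (cmod (w a x))\<^sup>2 + (cmod (?v x))\<^sup>2" for x
  proof (cases "w a x = 0")
    case False
    have "w i x = 0" if "i \<in> I" for i using insert(5)[of a i x] insert(2) that False by auto
    then have "?v x = 0" by simp
    then show ?thesis by simp
  qed simp
  have "(l2norm H (\<lambda>x. \<Sum>i\<in>insert a I. w i x))\<^sup>2 = infsum (\<lambda>x. (cmod (w a x))\<^sup>2 + (cmod (?v x))\<^sup>2) (carrier H)"
    unfolding l2norm_sq using insert by (simp add: pt)
  also have "\<dots> = (l2norm H (w a))\<^sup>2 + (l2norm H ?v)\<^sup>2"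
    unfolding l2norm_sq using l2_sq_summable[OF wa] l2_sq_summable[OF v] by (rule infsum_add)
  also have "(l2norm H ?v)\<^sup>2 = (\<Sum>i\<in>I. (l2norm H (w i))\<^sup>2)" using insert by (intro insert.IH) auto
  finally show ?case using insert by simp
qed

lemma L2_set_sum_list:
  "L2_set (\<lambda>x. \<Sum>h\<leftarrow>l. b h x) E \<le> (\<Sum>h\<leftarrow>l. L2_set (b h) E)"
proof (induction l)
  case Nil
  show ?case by (simp add: L2_set_def)
next
  case (Cons h l)
  show ?case using L2_set_triangle_ineq[of "b h" "\<lambda>x. \<Sum>h\<leftarrow>l. b h x" E] Cons by simp
qed

lemma sum_list_norm_le: "cmod (\<Sum>h\<leftarrow>l. b h) \<le> (\<Sum>h\<leftarrow>l. cmod (b h))"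
  by (induction l) (auto intro: norm_triangle_le)

lemma sum_list_swap: "(\<Sum>h\<leftarrow>l. \<Sum>s\<leftarrow>l'. b h s) = (\<Sum>s\<leftarrow>l'. \<Sum>h\<leftarrow>l. (b h s :: complex))"
  by (induction l) (simp_all add: sum_list_addf)

context group
begin

lemma reg_span_norm_bound:
  assumes "finite F" "F \<subseteq> carrier G" "f \<in> l2 G"
  shows "l2norm G (\<lambda>x. \<Sum>g\<in>F. c g * lreg G g f x) \<le> (\<Sum>g\<in>F. cmod (c g)) * l2norm G f"
proof -
  have g: "lreg G g f \<in> l2 G" if "g \<in> F" for g using that assms(2) by auto
  have "l2norm G (\<lambda>x. \<Sum>g\<in>F. c g * lreg G g f x) \<le> (\<Sum>g\<in>F. l2norm G (\<lambda>x. c g * lreg G g f x))"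
    using g by (intro l2_sum(2)[OF assms(1)] l2_scale)
  also have "\<dots> = (\<Sum>g\<in>F. cmod (c g) * l2norm G f)"
    using g assms by (intro sum.cong) (auto simp: l2norm_scale subset_iff)
  finally show ?thesis by (simp add: sum_distrib_right)
qed

text \<open>The conjugate by \<open>l ! i\<close> maps vectors supported off the translate of \<open>D\<close> by \<open>l ! i\<close> to vectors supported on it,
  and the translates are disjoint, so these images are orthogonal.\<close>

lemma powers_averaging:
  assumes F: "finite F" "F \<subseteq> carrier G" and D: "D \<subseteq> carrier G"
    and push: "\<And>g x. g \<in> F \<Longrightarrow> x \<in> carrier G - D \<Longrightarrow> g \<otimes> x \<in> D"
    and l: "set l \<subseteq> carrier G" "l \<noteq> []"
    and disj: "\<And>i j. i < length l \<Longrightarrow> j < length l \<Longrightarrow> i \<noteq> j \<Longrightarrow> (\<lambda>x. l ! i \<otimes> x) ` D \<inter> (\<lambda>x. l ! j \<otimes> x) ` D = {}"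
    and f: "f \<in> l2 G"
  shows "l2norm G (conj_avg G l (\<lambda>f x. \<Sum>g\<in>F. c g * lreg G g f x) f)
     \<le> 2 * (\<Sum>g\<in>F. cmod (c g)) / sqrt (length l) * l2norm G f"
proof -
  define U where "U = (\<lambda>f x. \<Sum>g\<in>F. c g * lreg G g f x)"
  define M where "M = (\<Sum>g\<in>F. cmod (c g))"
  define k where "k = length l"
  define Di where "Di i = (\<lambda>x. l ! i \<otimes> x) ` D" for i
  define T where "T i h = lreg G (l ! i) (U (lreg G (inv (l ! i)) h))" for i h
  \<comment> \<open>\<open>f\<close> is split at each \<open>i\<close> into its part on the
    translate of \<open>D\<close> and the rest; each contributes a term of order
    \<open>sqrt k\<close>, whence the factor 2.\<close>
  define p where "p i = (\<lambda>x. if x \<in> Di i then f x else 0)" for i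
  define q where "q i = (\<lambda>x. if x \<in> - Di i then f x else 0)" for i
  have li: "l ! i \<in> carrier G" if "i < k" for i using that l by (auto simp: k_def)
  have k0: "k > 0" using l by (simp add: k_def)
  have M0: "0 \<le> M" by (simp add: M_def sum_nonneg)
  have Ub: "U \<in> bounded_ops G" unfolding U_def using F by (intro reg_span_bounded) (auto simp: reg_span_def)
  have Tb: "T i \<in> bounded_ops G" if "i < k" for i
  proof -
    have "lreg G (l ! i) \<circ> (U \<circ> lreg G (inv (l ! i))) \<in> bounded_ops G"
      using li[OF that] Ub by (intro bounded_ops_comp lreg_bounded) auto
    then show ?thesis by (simp add: T_def[abs_def] o_def)
  qed
  have Tn: "l2norm G (T i h) \<le> M * l2norm G h" if "i < k" "h \<in> l2 G" for i h
  proof -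
    have "l2norm G (U (lreg G (inv (l ! i)) h)) \<le> M * l2norm G (lreg G (inv (l ! i)) h)"
      unfolding U_def M_def using li[OF that(1)] by (intro reg_span_norm_bound F) auto
    then show ?thesis using li[OF that(1)] that(2) bounded_ops_l2[OF Ub] by (simp add: T_def)
  qed
  have pl: "p i \<in> l2 G" and ql: "q i \<in> l2 G" "l2norm G (q i) \<le> l2norm G f" for i
    unfolding p_def q_def by (rule l2_restrict[OF f])+
  have split: "T i f = (\<lambda>x. T i (p i) x + T i (q i) x)" if "i < k" for i
  proof -
    have "f = (\<lambda>x. p i x + q i x)" by (auto simp: p_def q_def)
    then have "T i f = T i (\<lambda>x. p i x + q i x)" by (rule arg_cong)
    then show ?thesis using bounded_ops_add[OF Tb[OF that] pl ql(1)] by simp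
  qed
  have supp: "T i (q i) x = 0" if i: "i < k" and x: "x \<notin> Di i" for i x
  proof (cases "x \<in> carrier G")
    case True
    let ?y = "inv (l ! i) \<otimes> x"
    have y: "?y \<in> carrier G" using True li[OF i] by simp
    have xy: "x = l ! i \<otimes> ?y" using True li[OF i] by (simp add: m_assoc[symmetric])
    have yD: "?y \<notin> D" using x xy unfolding Di_def by blast
    let ?q = "lreg G (inv (l ! i)) (q i)"
    have qy: "lreg G g ?q ?y = 0" if g: "g \<in> F" for g
    proof -
      have gc: "g \<in> carrier G" using g F by auto
      have "inv g \<otimes> ?y \<in> D"
      proof (rule ccontr)
        assume "inv g \<otimes> ?y \<notin> D"
        then have "g \<otimes> (inv g \<otimes> ?y) \<in> D" using push[OF g] gc y by auto
        then show False using yD gc y by (simp add: m_assoc[symmetric])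
      qed
      then have "l ! i \<otimes> (inv g \<otimes> ?y) \<in> Di i" unfolding Di_def by blast
      then have "q i (l ! i \<otimes> (inv g \<otimes> ?y)) = 0" by (simp add: q_def)
      then show ?thesis using gc y li[OF i] ql(1) by (simp add: lreg_apply)
    qed
    have Uq: "U ?q \<in> l2 G" by (rule bounded_ops_l2[OF Ub]) (use li[OF i] ql(1) in auto)
    have "T i (q i) x = U ?q ?y" unfolding T_def using lreg_apply[OF Uq True] by simp
    also have "\<dots> = 0" unfolding U_def using qy by (intro sum.neutral) auto
    finally show ?thesis .
  next
    case False
    then show ?thesis using l2_outside[OF bounded_ops_l2[OF Tb[OF i] ql(1)]] by blast
  qed
  have dis: "Di i \<inter> Di j = {}" if "i < k" "j < k" "i \<noteq> j" for i j using disj that by (simp add: Di_def k_def)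
  have "(\<Sum>s\<leftarrow>l. lreg G s (U (lreg G (inv s) f)) x) = (\<Sum>i<k. T i f x)" for x
    unfolding sum_list_sum_nth k_def T_def by (simp add: atLeast0LessThan)
  then have eq: "conj_avg G l U f = (\<lambda>x. (\<Sum>i<k. T i f x) / of_nat k)"
    unfolding conj_avg_def k_def by simp
  have a: "l2norm G (\<lambda>x. \<Sum>i<k. T i (q i) x) \<le> sqrt k * (M * l2norm G f)"
  proof (rule power2_le_imp_le)
    have "(l2norm G (\<lambda>x. \<Sum>i<k. T i (q i) x))\<^sup>2 = (\<Sum>i<k. (l2norm G (T i (q i)))\<^sup>2)"
    proof (rule l2_pythagoras)
      fix i j x assume ij: "i \<in> {..<k}" "j \<in> {..<k}" "i \<noteq> j"
      then have "x \<notin> Di i \<or> x \<notin> Di j" using dis[of i j] by auto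
      then show "T i (q i) x = 0 \<or> T j (q j) x = 0" using supp[of i x] supp[of j x] ij by auto
    qed (use bounded_ops_l2[OF Tb ql(1)] in auto)
    also have "\<dots> \<le> (\<Sum>i<k. (M * l2norm G f)\<^sup>2)"
      using order_trans[OF Tn[OF _ ql(1)] mult_left_mono[OF ql(2) M0]] by (intro sum_mono power_mono) auto
    also have "\<dots> = (sqrt k * (M * l2norm G f))\<^sup>2" by (simp add: power_mult_distrib)
    finally show "(l2norm G (\<lambda>x. \<Sum>i<k. T i (q i) x))\<^sup>2 \<le> (sqrt k * (M * l2norm G f))\<^sup>2" .
  qed (use M0 in auto)
  \<comment> \<open>Here the images may overlap but the inputs \<open>p i\<close> are orthogonal;
    Cauchy-Schwarz over the \<open>k\<close> terms gives the same factor.\<close>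
  have b: "l2norm G (\<lambda>x. \<Sum>i<k. T i (p i) x) \<le> sqrt k * (M * l2norm G f)"
  proof -
    have "l2norm G (\<lambda>x. \<Sum>i<k. T i (p i) x) \<le> (\<Sum>i<k. l2norm G (T i (p i)))"
      by (rule l2_sum(2)) (use bounded_ops_l2[OF Tb pl] in auto)
    also have "\<dots> \<le> (\<Sum>i<k. M * l2norm G (p i))" using Tn[OF _ pl] by (intro sum_mono) auto
    also have "\<dots> = M * (\<Sum>i<k. l2norm G (p i))" by (simp add: sum_distrib_left)
    also have "\<dots> \<le> M * (sqrt k * l2norm G f)"
    proof (rule mult_left_mono[OF _ M0], rule power2_le_imp_le)
      have "(\<Sum>i<k. l2norm G (p i))\<^sup>2 \<le> (\<Sum>i<k. (l2norm G (p i))\<^sup>2) * card {..<k}"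
        by (rule sum_squared_le_sum_of_squares)
      also have "(\<Sum>i<k. (l2norm G (p i))\<^sup>2) = (l2norm G (\<lambda>x. \<Sum>i<k. p i x))\<^sup>2"
      proof (rule l2_pythagoras[symmetric])
        fix i j x assume ij: "i \<in> {..<k}" "j \<in> {..<k}" "i \<noteq> j"
        then have "x \<notin> Di i \<or> x \<notin> Di j" using dis[of i j] by auto
        then show "p i x = 0 \<or> p j x = 0" by (auto simp: p_def)
      qed (use pl in auto)
      also have "(\<lambda>x. \<Sum>i<k. p i x) = (\<lambda>x. if x \<in> (\<Union>i<k. Di i) then f x else 0)"
      proof
        fix x
        show "(\<Sum>i<k. p i x) = (if x \<in> (\<Union>i<k. Di i) then f x else 0)"
        proof (cases "x \<in> (\<Union>i<k. Di i)")
          case True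
          then obtain i where i: "i < k" "x \<in> Di i" by auto
          have "x \<notin> Di j" if "j < k" "j \<noteq> i" for j using dis[OF that(1) i(1) that(2)] i by auto
          then have "(\<Sum>j<k. p j x) = (\<Sum>j<k. if j = i then f x else 0)"
            using i by (intro sum.cong) (auto simp: p_def)
          then show ?thesis using True i by simp
        qed (auto simp: p_def)
      qed
      also have "(l2norm G \<dots>)\<^sup>2 * real (card {..<k}) \<le> (l2norm G f)\<^sup>2 * real k"
        using power_mono[OF l2_restrict(2)[OF f, of "\<Union>i<k. Di i"] l2norm_nonneg, of 2]
        by (simp only: card_lessThan) (rule mult_right_mono, assumption, simp)
      also have "\<dots> = (sqrt k * l2norm G f)\<^sup>2" by (simp add: power_mult_distrib mult.commute)
      finally show "(\<Sum>i<k. l2norm G (p i))\<^sup>2 \<le> (sqrt k * l2norm G f)\<^sup>2" .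
    qed auto
    finally show ?thesis by (simp add: mult.left_commute)
  qed
  have tot: "l2norm G (\<lambda>x. \<Sum>i<k. T i f x) \<le> 2 * (sqrt k * (M * l2norm G f))"
  proof -
    have "(\<lambda>x. \<Sum>i<k. T i f x) = (\<lambda>x. (\<Sum>i<k. T i (p i) x) + (\<Sum>i<k. T i (q i) x))"
    proof
      fix x
      have "(\<Sum>i<k. T i f x) = (\<Sum>i<k. T i (p i) x + T i (q i) x)"
        using fun_cong[OF split] by (intro sum.cong) auto
      then show "(\<Sum>i<k. T i f x) = (\<Sum>i<k. T i (p i) x) + (\<Sum>i<k. T i (q i) x)" by (simp only: sum.distrib)
    qed
    moreover have "(\<lambda>x. \<Sum>i<k. T i (p i) x) \<in> l2 G" "(\<lambda>x. \<Sum>i<k. T i (q i) x) \<in> l2 G"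
      by (rule l2_sum(1); use bounded_ops_l2[OF Tb pl] bounded_ops_l2[OF Tb ql(1)] in auto)+
    ultimately show ?thesis using l2norm_add[of "\<lambda>x. \<Sum>i<k. T i (p i) x" G "\<lambda>x. \<Sum>i<k. T i (q i) x"] a b by simp
  qed
  have sl: "(\<lambda>x. \<Sum>i<k. T i f x) \<in> l2 G" by (rule l2_sum(1)) (use bounded_ops_l2[OF Tb f] in auto)
  have "l2norm G (conj_avg G l U f) = l2norm G (\<lambda>x. \<Sum>i<k. T i f x) / k"
    unfolding eq using l2norm_divide[OF sl, of "of_nat k"] by simp
  also have "\<dots> \<le> 2 * (sqrt k * (M * l2norm G f)) / k" using tot by (intro divide_right_mono) auto
  also have "\<dots> = 2 * M / sqrt k * l2norm G f"
    using k0 by (simp add: field_simps)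
  finally show ?thesis by (simp add: U_def M_def k_def)
qed

lemma avg_op_reg_span: "set l \<subseteq> carrier G \<Longrightarrow> avg_op G l \<in> reg_span G"
proof -
  assume l: "set l \<subseteq> carrier G"
  have "(\<lambda>f x. \<Sum>s\<leftarrow>l. lreg G s f x) \<in> reg_span G" using l
  proof (induction l)
    case Nil
    show ?case using reg_span_zero by simp
  next
    case (Cons s l)
    then show ?case using reg_span_lincomb[OF reg_span_lreg, of s "\<lambda>f x. \<Sum>s\<leftarrow>l. lreg G s f x" 1] by simp
  qed
  from reg_span_lincomb[OF reg_span_zero this, of "1 / of_nat (length l)"]
  show ?thesis by (simp add: avg_op_def[abs_def])
qed

text \<open>Replacing a vector by its norms over the fibres of an equivariant map to \<open>Q\<close>
  bounds an average with nonnegative weights on \<open>G\<close> by the corresponding one on \<open>Q\<close>.\<close>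

lemma avg_op_fibre_bound:
  fixes Q :: "('q, 'n) monoid_scheme" and \<Theta> :: "'a \<Rightarrow> 'q" and \<rho> :: "'a \<Rightarrow> 'r" and \<gamma> :: "'h \<Rightarrow> 'a"
  assumes Q: "group Q" and e: "0 \<le> \<epsilon>"
    and l: "\<And>h. h \<in> set l \<Longrightarrow> \<gamma> h \<in> carrier G" "\<And>h. h \<in> set l \<Longrightarrow> \<kappa> h \<in> carrier Q"
    and \<Theta>: "\<And>x. x \<in> carrier G \<Longrightarrow> \<Theta> x \<in> carrier Q"
    and eqv: "\<And>h x. h \<in> set l \<Longrightarrow> x \<in> carrier G \<Longrightarrow> \<Theta> (\<gamma> h \<otimes> x) = \<kappa> h \<otimes>\<^bsub>Q\<^esub> \<Theta> x"
    and inv: "\<And>h x. h \<in> set l \<Longrightarrow> x \<in> carrier G \<Longrightarrow> \<rho> (\<gamma> h \<otimes> x) = \<rho> x"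
    and bd: "\<And>\<psi>. \<psi> \<in> l2 Q \<Longrightarrow> l2norm Q (avg_op Q (map \<kappa> l) \<psi>) \<le> \<epsilon> * l2norm Q \<psi>"
    and f: "f \<in> l2 G"
  shows "l2norm G (avg_op G (map \<gamma> l) f) \<le> \<epsilon> * l2norm G f"
proof -
  interpret Q: group Q by (rule Q)
  have lc: "set (map \<gamma> l) \<subseteq> carrier G" "set (map \<kappa> l) \<subseteq> carrier Q" using l by auto
  show ?thesis
  proof (rule reg_span_bound_finite_support[OF avg_op_reg_span[OF lc(1)] e _ f])
    fix X E and f :: "'a \<Rightarrow> complex"
    assume X: "finite X" "X \<subseteq> carrier G" and E: "finite E" "E \<subseteq> carrier G" and f0: "\<And>x. x \<notin> X \<Longrightarrow> f x = 0"
    have fl: "f \<in> l2 G" using l2_finite_support(1)[OF X f0] .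
    let ?u = "\<lambda>x. cmod (f x)" and ?U = "avg_op G (map \<gamma> l) f"
    define n where "n = real (length l)"
    have ptw: "cmod (?U x) \<le> (\<Sum>h\<leftarrow>l. ?u (inv (\<gamma> h) \<otimes> x)) / n" if x: "x \<in> carrier G" for x
    proof -
      have "(\<Sum>s\<leftarrow>map \<gamma> l. lreg G s f x) = (\<Sum>h\<leftarrow>l. f (inv (\<gamma> h) \<otimes> x))"
        using fl x by (simp add: lreg_apply o_def)
      then have "cmod (?U x) = cmod (\<Sum>h\<leftarrow>l. f (inv (\<gamma> h) \<otimes> x)) / n"
        by (simp add: avg_op_def n_def norm_divide)
      also have "\<dots> \<le> (\<Sum>h\<leftarrow>l. ?u (inv (\<gamma> h) \<otimes> x)) / n"
        by (intro divide_right_mono sum_list_norm_le) (simp add: n_def)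
      finally show ?thesis .
    qed
    \<comment> \<open>The averaging elements preserve each class of \<rho>, so every class yields
      its own vector on \<open>Q\<close>, to which \<open>bd\<close> is applied separately.\<close>
    have piece: "(\<Sum>x\<in>{x\<in>E. \<rho> x = r}. (cmod (?U x))\<^sup>2) \<le> \<epsilon>\<^sup>2 * (\<Sum>x\<in>{x\<in>X. \<rho> x = r}. (?u x)\<^sup>2)" for r
    proof -
      define w where "w q = L2_set ?u {x\<in>X. \<rho> x = r \<and> \<Theta> x = q}" for q
      define \<psi> where "\<psi> q = complex_of_real (w q)" for q
      have w0: "w q = 0" if "q \<notin> \<Theta> ` X" for q
      proof -
        have "{x\<in>X. \<rho> x = r \<and> \<Theta> x = q} = {}" using that by auto
        then show ?thesis unfolding w_def by (simp only: L2_set_empty)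
      qed
      have wge: "0 \<le> w q" for q by (simp add: w_def)
      have TX: "finite (\<Theta> ` X)" "\<Theta> ` X \<subseteq> carrier Q" using X \<Theta> by auto
      have \<psi>0: "\<psi> q = 0" if "q \<notin> \<Theta> ` X" for q using w0[OF that] by (simp add: \<psi>_def)
      have \<psi>l: "\<psi> \<in> l2 Q" and \<psi>n: "l2norm Q \<psi> = L2_set (\<lambda>x. cmod (\<psi> x)) (\<Theta> ` X)"
        using l2_finite_support[OF TX \<psi>0] by auto
      have \<psi>sq: "(l2norm Q \<psi>)\<^sup>2 = (\<Sum>x\<in>{x\<in>X. \<rho> x = r}. (?u x)\<^sup>2)"
      proof -
        have "(l2norm Q \<psi>)\<^sup>2 = (\<Sum>q\<in>\<Theta> ` X. (w q)\<^sup>2)"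
          unfolding \<psi>n L2_set_def by (simp add: sum_nonneg \<psi>_def)
        also have "\<dots> = (\<Sum>q\<in>\<Theta> ` X. \<Sum>x\<in>{x\<in>{x\<in>X. \<rho> x = r}. \<Theta> x = q}. (?u x)\<^sup>2)"
          unfolding w_def L2_set_def by (intro sum.cong) (auto simp: sum_nonneg conj_ac)
        also have "\<dots> = (\<Sum>x\<in>{x\<in>X. \<rho> x = r}. (?u x)\<^sup>2)"
          using X by (intro sum.group) auto
        finally show ?thesis .
      qed
      have fibre: "(\<Sum>x\<in>{x\<in>E. \<rho> x = r \<and> \<Theta> x = q}. (cmod (?U x))\<^sup>2) \<le> (cmod (avg_op Q (map \<kappa> l) \<psi> q))\<^sup>2"
        if q: "q \<in> \<Theta> ` E" for q
      proof -
        have qc: "q \<in> carrier Q" using q E \<Theta> by auto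
        let ?E = "{x\<in>E. \<rho> x = r \<and> \<Theta> x = q}"
        have one: "L2_set (\<lambda>x. ?u (inv (\<gamma> h) \<otimes> x)) ?E \<le> w (inv\<^bsub>Q\<^esub> (\<kappa> h) \<otimes>\<^bsub>Q\<^esub> q)" if h: "h \<in> set l" for h
        proof -
          let ?t = "\<lambda>x. inv (\<gamma> h) \<otimes> x"
          have gh: "\<gamma> h \<in> carrier G" "\<kappa> h \<in> carrier Q" using l h by auto
          have inj: "inj_on ?t ?E"
            using E by (intro inj_on_subset[OF bij_betw_imp_inj_on[OF bij_betw_ltimes[OF inv_closed[OF gh(1)]]]]) auto
          let ?Y = "{x\<in>X. \<rho> x = r \<and> \<Theta> x = inv\<^bsub>Q\<^esub> (\<kappa> h) \<otimes>\<^bsub>Q\<^esub> q}"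
          have im: "?t x \<in> ?Y" if x: "x \<in> ?E" "?t x \<in> X" for x
          proof -
            have xc: "x \<in> carrier G" using x E by auto
            have bk: "\<gamma> h \<otimes> ?t x = x" using xc gh by (simp add: m_assoc[symmetric])
            have tc: "?t x \<in> carrier G" using xc gh by simp
            have "\<rho> (?t x) = r" using inv[OF h tc] bk x by simp
            moreover have "q = \<kappa> h \<otimes>\<^bsub>Q\<^esub> \<Theta> (?t x)" using eqv[OF h tc] bk x by simp
            then have "\<Theta> (?t x) = inv\<^bsub>Q\<^esub> (\<kappa> h) \<otimes>\<^bsub>Q\<^esub> q"
              using gh \<Theta>[OF tc] by (simp add: Q.m_assoc[symmetric])
            ultimately show ?thesis using x by simp
          qed
          have "(\<Sum>x\<in>?E. (?u (?t x))\<^sup>2) = (\<Sum>y\<in>?t ` ?E. (?u y)\<^sup>2)" using inj by (simp add: sum.reindex)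
          also have "\<dots> = (\<Sum>y\<in>?t ` ?E \<inter> X. (?u y)\<^sup>2)"
            using E f0 by (intro sum.mono_neutral_right) auto
          also have "\<dots> \<le> (\<Sum>y\<in>?Y. (?u y)\<^sup>2)" using im X by (intro sum_mono2) auto
          finally show ?thesis unfolding w_def L2_set_def by (rule real_sqrt_le_mono)
        qed
        have n0: "0 \<le> n" by (simp add: n_def)
        have "L2_set (\<lambda>x. cmod (?U x)) ?E \<le> L2_set (\<lambda>x. (\<Sum>h\<leftarrow>l. ?u (inv (\<gamma> h) \<otimes> x)) / n) ?E"
          using ptw E by (intro L2_set_mono) auto
        also have "\<dots> = L2_set (\<lambda>x. \<Sum>h\<leftarrow>l. ?u (inv (\<gamma> h) \<otimes> x)) ?E / n"
          using L2_set_left_distrib[of "1/n" "\<lambda>x. \<Sum>h\<leftarrow>l. ?u (inv (\<gamma> h) \<otimes> x)" ?E] n0 by simp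
        also have "\<dots> \<le> (\<Sum>h\<leftarrow>l. L2_set (\<lambda>x. ?u (inv (\<gamma> h) \<otimes> x)) ?E) / n"
          using n0 by (intro divide_right_mono L2_set_sum_list)
        also have "\<dots> \<le> (\<Sum>h\<leftarrow>l. w (inv\<^bsub>Q\<^esub> (\<kappa> h) \<otimes>\<^bsub>Q\<^esub> q)) / n"
          using n0 one by (intro divide_right_mono sum_list_mono)
        also have "\<dots> = cmod (avg_op Q (map \<kappa> l) \<psi> q)"
        proof -
          have "(\<Sum>s\<leftarrow>map \<kappa> l. lreg Q s \<psi> q) = complex_of_real (\<Sum>h\<leftarrow>l. w (inv\<^bsub>Q\<^esub> (\<kappa> h) \<otimes>\<^bsub>Q\<^esub> q))"
            using lreg_apply[OF \<psi>l qc] by (induction l) (auto simp: \<psi>_def)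
          moreover have "0 \<le> (\<Sum>h\<leftarrow>l. w (inv\<^bsub>Q\<^esub> (\<kappa> h) \<otimes>\<^bsub>Q\<^esub> q))" using wge by (intro sum_list_nonneg) auto
          ultimately show ?thesis by (simp add: avg_op_def n_def norm_divide)
        qed
        finally have "(L2_set (\<lambda>x. cmod (?U x)) ?E)\<^sup>2 \<le> (cmod (avg_op Q (map \<kappa> l) \<psi> q))\<^sup>2"
          by (intro power_mono) auto
        then show ?thesis by (simp add: L2_set_def sum_nonneg)
      qed
      have Al: "avg_op Q (map \<kappa> l) \<psi> \<in> l2 Q" using Q.avg_op_l2[OF lc(2)] .
      have "(\<Sum>x\<in>{x\<in>E. \<rho> x = r}. (cmod (?U x))\<^sup>2) = (\<Sum>q\<in>\<Theta> ` E. \<Sum>x\<in>{x\<in>{x\<in>E. \<rho> x = r}. \<Theta> x = q}. (cmod (?U x))\<^sup>2)"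
        using E by (intro sum.group[symmetric]) auto
      also have "\<dots> = (\<Sum>q\<in>\<Theta> ` E. \<Sum>x\<in>{x\<in>E. \<rho> x = r \<and> \<Theta> x = q}. (cmod (?U x))\<^sup>2)"
        by (intro sum.cong) (auto simp: conj_ac)
      also have "\<dots> \<le> (\<Sum>q\<in>\<Theta> ` E. (cmod (avg_op Q (map \<kappa> l) \<psi> q))\<^sup>2)" using fibre by (rule sum_mono)
      also have "\<dots> = (L2_set (\<lambda>q. cmod (avg_op Q (map \<kappa> l) \<psi> q)) (\<Theta> ` E))\<^sup>2" by (simp add: L2_set_def sum_nonneg)
      also have "\<dots> \<le> (l2norm Q (avg_op Q (map \<kappa> l) \<psi>))\<^sup>2"
        using E \<Theta> by (intro power_mono l2_L2_set_le[OF Al]) auto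
      also have "\<dots> \<le> (\<epsilon> * l2norm Q \<psi>)\<^sup>2" using bd[OF \<psi>l] by (intro power_mono) auto
      also have "\<dots> = \<epsilon>\<^sup>2 * (\<Sum>x\<in>{x\<in>X. \<rho> x = r}. (?u x)\<^sup>2)" by (simp add: power_mult_distrib \<psi>sq)
      finally show ?thesis .
    qed
    have "(\<Sum>x\<in>E. (cmod (?U x))\<^sup>2) = (\<Sum>r\<in>\<rho> ` E. \<Sum>x\<in>{x\<in>E. \<rho> x = r}. (cmod (?U x))\<^sup>2)"
      by (rule sum.image_gen[OF E(1)])
    also have "\<dots> \<le> (\<Sum>r\<in>\<rho> ` E. \<epsilon>\<^sup>2 * (\<Sum>x\<in>{x\<in>X. \<rho> x = r}. (?u x)\<^sup>2))"
      using piece by (rule sum_mono)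
    also have "\<dots> = \<epsilon>\<^sup>2 * (\<Sum>r\<in>\<rho> ` E. \<Sum>x\<in>{x\<in>X. \<rho> x = r}. (?u x)\<^sup>2)" by (simp add: sum_distrib_left)
    also have "\<dots> \<le> \<epsilon>\<^sup>2 * (\<Sum>r\<in>\<rho> ` E \<union> \<rho> ` X. \<Sum>x\<in>{x\<in>X. \<rho> x = r}. (?u x)\<^sup>2)"
      using E X by (intro mult_left_mono sum_mono2) (auto simp: sum_nonneg)
    also have "(\<Sum>r\<in>\<rho> ` E \<union> \<rho> ` X. \<Sum>x\<in>{x\<in>X. \<rho> x = r}. (?u x)\<^sup>2) = (\<Sum>x\<in>X. (?u x)\<^sup>2)"
      using E X by (intro sum.group) auto
    finally have "(\<Sum>x\<in>E. (cmod (?U x))\<^sup>2) \<le> \<epsilon>\<^sup>2 * (\<Sum>x\<in>X. (?u x)\<^sup>2)" .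
    then show "L2_set (\<lambda>x. cmod (?U x)) E \<le> \<epsilon> * L2_set ?u X"
      unfolding L2_set_def using e by (metis real_sqrt_le_iff real_sqrt_mult real_sqrt_unique)
  qed
qed

lemma conj_avg_list_average:
  assumes l: "set l \<subseteq> carrier G" and W: "\<And>s h. s \<in> set l' \<Longrightarrow> h \<in> l2 G \<Longrightarrow> W s h \<in> l2 G"
  shows "conj_avg G l (\<lambda>f x. (\<Sum>s\<leftarrow>l'. W s f x) / of_nat (length l')) f
    = (\<lambda>x. (\<Sum>s\<leftarrow>l'. conj_avg G l (W s) f x) / of_nat (length l'))"
proof
  fix x
  have "lreg G h (\<lambda>x. (\<Sum>s\<leftarrow>l'. W s (lreg G (inv h) f) x) / of_nat (length l')) x
     = (\<Sum>s\<leftarrow>l'. lreg G h (W s (lreg G (inv h) f)) x) / of_nat (length l')" if "h \<in> set l" for h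
    using lreg_list_average[of l' "\<lambda>s. W s (lreg G (inv h) f)" h] W l that by (auto simp: subset_iff)
  then have "(\<Sum>h\<leftarrow>l. lreg G h (\<lambda>x. (\<Sum>s\<leftarrow>l'. W s (lreg G (inv h) f) x) / of_nat (length l')) x)
    = (\<Sum>h\<leftarrow>l. (\<Sum>s\<leftarrow>l'. lreg G h (W s (lreg G (inv h) f)) x) / of_nat (length l'))"
    by (intro arg_cong[where f=sum_list] map_cong) auto
  also have "\<dots> = (\<Sum>s\<leftarrow>l'. \<Sum>h\<leftarrow>l. lreg G h (W s (lreg G (inv h) f)) x) / of_nat (length l')"
    unfolding sum_list_divide by (subst sum_list_swap) (rule refl)
  finally show "conj_avg G l (\<lambda>f x. (\<Sum>s\<leftarrow>l'. W s f x) / of_nat (length l')) f x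
     = (\<Sum>s\<leftarrow>l'. conj_avg G l (W s) f x) / of_nat (length l')"
    unfolding conj_avg_def by (simp add: sum_list_divide mult.commute)
qed

end

section \<open>A non-trivial ideal from an amenable subgroup\<close>

context group
begin

text \<open>The ideal is the kernel of the quasi-regular representation on \<open>G/H\<close>, which is weakly
  contained in the regular one because almost \<open>H\<close>-invariant vectors stand in for \<open>\<delta>\<^sub>H\<close>.\<close>

definition vanishing_ideal :: "'a set \<Rightarrow> (('a \<Rightarrow> complex) \<Rightarrow> ('a \<Rightarrow> complex)) set" where
  "vanishing_ideal H = {T \<in> reduced_cstar G. \<forall>s\<in>carrier G. \<forall>\<epsilon>>0. \<exists>S \<delta>. finite S \<and> S \<subseteq> H \<and> \<delta> > 0 \<and>
     (\<forall>\<psi>\<in>almost_inv G S \<delta>. l2norm G (T (lreg G s \<psi>)) \<le> \<epsilon>)}"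

text \<open>Convergence of \<theta> to 0 along the filter of almost \<open>H\<close>-invariant unit
  vectors; with it the ideal properties reduce to rules for null limits.\<close>

definition evanescent :: "'a set \<Rightarrow> (('a \<Rightarrow> complex) \<Rightarrow> real) \<Rightarrow> bool" where
  "evanescent H \<theta> \<longleftrightarrow> (\<forall>\<epsilon>>0. \<exists>S \<delta>. finite S \<and> S \<subseteq> H \<and> \<delta> > 0 \<and> (\<forall>\<psi>\<in>almost_inv G S \<delta>. \<theta> \<psi> \<le> \<epsilon>))"

lemma evanescentD:
  "evanescent H \<theta> \<Longrightarrow> \<epsilon> > 0 \<Longrightarrow> \<exists>S \<delta>. finite S \<and> S \<subseteq> H \<and> \<delta> > 0 \<and> (\<forall>\<psi>\<in>almost_inv G S \<delta>. \<theta> \<psi> \<le> \<epsilon>)"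
  by (simp only: evanescent_def)

lemma evanescent_mono:
  assumes "evanescent H \<theta>" "\<And>\<psi>. \<psi> \<in> l2 G \<Longrightarrow> l2norm G \<psi> = 1 \<Longrightarrow> \<theta>' \<psi> \<le> \<theta> \<psi>"
  shows "evanescent H \<theta>'"
  unfolding evanescent_def
proof (intro allI impI)
  fix \<epsilon> :: real assume e: "\<epsilon> > 0"
  obtain S \<delta> where S: "finite S" "S \<subseteq> H" "\<delta> > 0" "\<forall>\<psi>\<in>almost_inv G S \<delta>. \<theta> \<psi> \<le> \<epsilon>"
    using evanescentD[OF assms(1) e] by (elim exE conjE)
  have "\<theta>' \<psi> \<le> \<epsilon>" if "\<psi> \<in> almost_inv G S \<delta>" for \<psi>
    using order_trans[OF assms(2) bspec[OF S(4) that]] that by (simp add: almost_inv_def)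
  then show "\<exists>S \<delta>. finite S \<and> S \<subseteq> H \<and> \<delta> > 0 \<and> (\<forall>\<psi>\<in>almost_inv G S \<delta>. \<theta>' \<psi> \<le> \<epsilon>)"
    using S(1-3) by (intro exI[of _ S] exI[of _ \<delta>]) simp
qed

lemma evanescent_add:
  assumes "evanescent H \<theta>" "evanescent H \<theta>'"
  shows "evanescent H (\<lambda>\<psi>. \<theta> \<psi> + \<theta>' \<psi>)"
  unfolding evanescent_def
proof (intro allI impI)
  fix \<epsilon> :: real assume "\<epsilon> > 0"
  then have e2: "\<epsilon> / 2 > 0" by simp
  obtain S \<delta> where S: "finite S" "S \<subseteq> H" "\<delta> > 0" "\<forall>\<psi>\<in>almost_inv G S \<delta>. \<theta> \<psi> \<le> \<epsilon>/2"
    using evanescentD[OF assms(1) e2] by (elim exE conjE)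
  obtain S' \<delta>' where S': "finite S'" "S' \<subseteq> H" "\<delta>' > 0" "\<forall>\<psi>\<in>almost_inv G S' \<delta>'. \<theta>' \<psi> \<le> \<epsilon>/2"
    using evanescentD[OF assms(2) e2] by (elim exE conjE)
  have "\<theta> \<psi> + \<theta>' \<psi> \<le> \<epsilon>" if "\<psi> \<in> almost_inv G (S \<union> S') (min \<delta> \<delta>')" for \<psi>
  proof -
    have "\<psi> \<in> almost_inv G S \<delta>" "\<psi> \<in> almost_inv G S' \<delta>'" using that by (auto simp: almost_inv_def)
    then show ?thesis using bspec[OF S(4)] bspec[OF S'(4)] by fastforce
  qed
  then show "\<exists>S \<delta>. finite S \<and> S \<subseteq> H \<and> \<delta> > 0 \<and> (\<forall>\<psi>\<in>almost_inv G S \<delta>. \<theta> \<psi> + \<theta>' \<psi> \<le> \<epsilon>)"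
    using S(1-3) S'(1-3) by (intro exI[of _ "S \<union> S'"] exI[of _ "min \<delta> \<delta>'"]) simp
qed

lemma evanescent_scale:
  assumes "evanescent H \<theta>" "0 \<le> c"
  shows "evanescent H (\<lambda>\<psi>. c * \<theta> \<psi>)"
  unfolding evanescent_def
proof (intro allI impI)
  fix \<epsilon> :: real assume e: "\<epsilon> > 0"
  have e2: "\<epsilon> / (c + 1) > 0" using e assms(2) by simp
  obtain S \<delta> where S: "finite S" "S \<subseteq> H" "\<delta> > 0" "\<forall>\<psi>\<in>almost_inv G S \<delta>. \<theta> \<psi> \<le> \<epsilon> / (c + 1)"
    using evanescentD[OF assms(1) e2] by (elim exE conjE)
  have "c * \<theta> \<psi> \<le> \<epsilon>" if "\<psi> \<in> almost_inv G S \<delta>" for \<psi>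
  proof -
    have "c * \<theta> \<psi> \<le> c * (\<epsilon> / (c + 1))" using bspec[OF S(4) that] assms(2) by (rule mult_left_mono)
    also have "\<dots> \<le> \<epsilon>" using e assms(2) by (simp add: field_simps)
    finally show ?thesis .
  qed
  then show "\<exists>S \<delta>. finite S \<and> S \<subseteq> H \<and> \<delta> > 0 \<and> (\<forall>\<psi>\<in>almost_inv G S \<delta>. c * \<theta> \<psi> \<le> \<epsilon>)"
    using S(1-3) by (intro exI[of _ S] exI[of _ \<delta>]) simp
qed

lemma evanescent_limit:
  assumes "\<And>\<epsilon>. \<epsilon> > 0 \<Longrightarrow> \<exists>\<theta>'. evanescent H \<theta>' \<and> (\<forall>\<psi>\<in>l2 G. l2norm G \<psi> = 1 \<longrightarrow> \<theta> \<psi> \<le> \<theta>' \<psi> + \<epsilon>)"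
  shows "evanescent H \<theta>"
  unfolding evanescent_def
proof (intro allI impI)
  fix \<epsilon> :: real assume "\<epsilon> > 0"
  then have e2: "\<epsilon> / 2 > 0" by simp
  obtain \<theta>' where t: "evanescent H \<theta>'" "\<forall>\<psi>\<in>l2 G. l2norm G \<psi> = 1 \<longrightarrow> \<theta> \<psi> \<le> \<theta>' \<psi> + \<epsilon>/2" using assms[OF e2] by (elim exE conjE)
  obtain S \<delta> where S: "finite S" "S \<subseteq> H" "\<delta> > 0" "\<forall>\<psi>\<in>almost_inv G S \<delta>. \<theta>' \<psi> \<le> \<epsilon>/2"
    using evanescentD[OF t(1) e2] by (elim exE conjE)
  have "\<theta> \<psi> \<le> \<epsilon>" if "\<psi> \<in> almost_inv G S \<delta>" for \<psi>
    using bspec[OF S(4) that] t(2) that by (force simp: almost_inv_def)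
  then show "\<exists>S \<delta>. finite S \<and> S \<subseteq> H \<and> \<delta> > 0 \<and> (\<forall>\<psi>\<in>almost_inv G S \<delta>. \<theta> \<psi> \<le> \<epsilon>)"
    using S(1-3) by (intro exI[of _ S] exI[of _ \<delta>]) simp
qed

lemma evanescent_inv:
  assumes "k \<in> H" shows "evanescent H (\<lambda>\<psi>. l2norm G (\<lambda>x. lreg G k \<psi> x - \<psi> x))"
  unfolding evanescent_def
proof (intro allI impI)
  fix \<epsilon> :: real assume "\<epsilon> > 0"
  then show "\<exists>S \<delta>. finite S \<and> S \<subseteq> H \<and> \<delta> > 0 \<and> (\<forall>\<psi>\<in>almost_inv G S \<delta>. l2norm G (\<lambda>x. lreg G k \<psi> x - \<psi> x) \<le> \<epsilon>)"
    using assms by (intro exI[of _ "{k}"] exI[of _ \<epsilon>]) (simp add: almost_inv_def)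
qed

lemma vanishing_ideal_iff:
  "T \<in> vanishing_ideal H \<longleftrightarrow> T \<in> reduced_cstar G \<and> (\<forall>s\<in>carrier G. evanescent H (\<lambda>\<psi>. l2norm G (T (lreg G s \<psi>))))"
  by (simp add: vanishing_ideal_def evanescent_def)

text \<open>Requiring smallness on all translates \<open>s\<close> of the almost invariant vectors
  is what allows multiplication on the right: a finite combination sends a translate to a
  combination of translates, and norm limits follow.\<close>

lemma vanishing_ideal_ideal: "closed_ideal G (reduced_cstar G) (vanishing_ideal H)"
proof (rule closed_idealI)
  show "vanishing_ideal H \<subseteq> reduced_cstar G" by (auto simp: vanishing_ideal_iff)
  show "reduced_cstar G \<subseteq> bounded_ops G" by (rule reduced_cstar_sub)
  have ev0: "evanescent H (\<lambda>\<psi>. 0)" unfolding evanescent_def by (auto intro!: exI[of _ "{}"] exI[of _ 1])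
  show "(\<lambda>f x. 0) \<in> vanishing_ideal H"
    using reg_span_reduced_cstar[OF reg_span_zero] ev0 by (simp add: vanishing_ideal_iff)
  have D: "T \<in> reduced_cstar G" "T \<in> bounded_ops G" "\<And>s. s \<in> carrier G \<Longrightarrow> evanescent H (\<lambda>\<psi>. l2norm G (T (lreg G s \<psi>)))"
    if "T \<in> vanishing_ideal H" for T
    using that reduced_cstar_bounded[of T] by (simp_all add: vanishing_ideal_iff)
  {
    fix S T c assume S: "S \<in> vanishing_ideal H" and T: "T \<in> vanishing_ideal H"
    have "evanescent H (\<lambda>\<psi>. l2norm G (\<lambda>x. S (lreg G s \<psi>) x + c * T (lreg G s \<psi>) x))" if s: "s \<in> carrier G" for s
      by (rule evanescent_mono[OF evanescent_add[OF D(3)[OF S s] evanescent_scale[OF D(3)[OF T s] norm_ge_zero[of c]]]])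
        (rule l2_lincomb(2)[OF bounded_ops_l2'[OF D(2)[OF S]] bounded_ops_l2'[OF D(2)[OF T]]])
    then show "(\<lambda>f x. S f x + c * T f x) \<in> vanishing_ideal H"
      using reduced_cstar_lincomb[OF D(1)[OF S] D(1)[OF T]] by (simp add: vanishing_ideal_iff)
  }
  {
    fix a S assume a: "a \<in> reduced_cstar G" and S: "S \<in> vanishing_ideal H"
    note ab = reduced_cstar_bounded[OF a]
    have "evanescent H (\<lambda>\<psi>. l2norm G ((a \<circ> S) (lreg G s \<psi>)))" if s: "s \<in> carrier G" for s
      by (rule evanescent_mono[OF evanescent_scale[OF D(3)[OF S s] opnorm_nonneg[OF ab]]])
        (simp add: opnorm_bound[OF ab bounded_ops_l2'[OF D(2)[OF S]]])
    then show "a \<circ> S \<in> vanishing_ideal H"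
      using reduced_cstar_comp[OF a D(1)[OF S]] by (simp add: vanishing_ideal_iff)
    have span: "evanescent H (\<lambda>\<psi>. l2norm G (S (R (lreg G s \<psi>))))" if R: "R \<in> reg_span G" and s: "s \<in> carrier G" for R s
      using R
    proof (induction rule: reg_span_induct)
      case zero
      then show ?case using ev0 bounded_ops_zero[OF D(2)[OF S]] by simp
    next
      case (add R g c)
      note Rb = reg_span_bounded[OF add(1)]
      have gs: "g \<otimes> s \<in> carrier G" using add s by simp
      have "evanescent H (\<lambda>\<psi>. l2norm G (S (R (lreg G s \<psi>))) + cmod c * l2norm G (S (lreg G (g \<otimes> s) \<psi>)))"
        by (rule evanescent_add[OF add.IH evanescent_scale[OF D(3)[OF S gs] norm_ge_zero]])
      then show ?case
      proof (rule evanescent_mono)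
        fix \<psi> assume "\<psi> \<in> l2 G"
        have "S (\<lambda>x. R (lreg G s \<psi>) x + c * lreg G g (lreg G s \<psi>) x)
           = (\<lambda>x. S (R (lreg G s \<psi>)) x + c * S (lreg G (g \<otimes> s) \<psi>) x)"
          using bounded_ops_lin[OF D(2)[OF S] bounded_ops_l2'[OF Rb] lreg_l2[OF gs]] add s by (simp add: lreg_lreg)
        then show "l2norm G (S (\<lambda>x. R (lreg G s \<psi>) x + c * lreg G g (lreg G s \<psi>) x))
          \<le> l2norm G (S (R (lreg G s \<psi>))) + cmod c * l2norm G (S (lreg G (g \<otimes> s) \<psi>))"
          using l2_lincomb(2)[OF bounded_ops_l2'[OF D(2)[OF S]] bounded_ops_l2'[OF D(2)[OF S]]] by simp
      qed
    qed
    have "evanescent H (\<lambda>\<psi>. l2norm G ((S \<circ> a) (lreg G s \<psi>)))" if s: "s \<in> carrier G" for s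
    proof (rule evanescent_limit)
      fix \<epsilon> :: real assume e: "\<epsilon> > 0"
      define d where "d = \<epsilon> / (opnorm G S + 1)"
      have S0: "0 \<le> opnorm G S" using opnorm_nonneg[OF D(2)[OF S]] .
      have d: "d > 0" using e S0 by (simp add: d_def)
      have Sd: "opnorm G S * d \<le> \<epsilon>" using e S0 by (simp add: d_def field_simps)
      obtain R where R: "R \<in> reg_span G" "op_close G a R d" using reduced_cstar_approx[OF a d] by blast
      note Rb = reg_span_bounded[OF R(1)]
      have "l2norm G ((S \<circ> a) (lreg G s \<psi>)) \<le> l2norm G (S (R (lreg G s \<psi>))) + \<epsilon>" if p: "\<psi> \<in> l2 G" "l2norm G \<psi> = 1" for \<psi>
      proof -
        let ?v = "lreg G s \<psi>"
        have v: "?v \<in> l2 G" "l2norm G ?v = 1" using s p by auto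
        have av: "a ?v \<in> l2 G" "R ?v \<in> l2 G" using bounded_ops_l2[OF ab v(1)] bounded_ops_l2[OF Rb v(1)] .
        have dv: "(\<lambda>x. a ?v x - R ?v x) \<in> l2 G" using av by (rule l2_diff)
        have "a ?v = (\<lambda>x. R ?v x + (a ?v x - R ?v x))" by simp
        then have "S (a ?v) = (\<lambda>x. S (R ?v) x + S (\<lambda>x. a ?v x - R ?v x) x)"
          using bounded_ops_add[OF D(2)[OF S] av(2) dv] by simp
        then have "l2norm G (S (a ?v)) \<le> l2norm G (S (R ?v)) + l2norm G (S (\<lambda>x. a ?v x - R ?v x))"
          using l2norm_add[OF bounded_ops_l2'[OF D(2)[OF S]] bounded_ops_l2'[OF D(2)[OF S]]] by simp
        moreover have "l2norm G (S (\<lambda>x. a ?v x - R ?v x)) \<le> opnorm G S * d"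
          using order_trans[OF opnorm_bound[OF D(2)[OF S] dv] mult_left_mono[OF op_closeD[OF R(2) v(1)] S0]] v(2) by simp
        ultimately show ?thesis using Sd by simp
      qed
      then show "\<exists>\<theta>'. evanescent H \<theta>' \<and> (\<forall>\<psi>\<in>l2 G. l2norm G \<psi> = 1 \<longrightarrow> l2norm G ((S \<circ> a) (lreg G s \<psi>)) \<le> \<theta>' \<psi> + \<epsilon>)"
        using span[OF R(1) s] by (intro exI[of _ "\<lambda>\<psi>. l2norm G (S (R (lreg G s \<psi>)))"] conjI ballI impI)
    qed
    then show "S \<circ> a \<in> vanishing_ideal H"
      using reduced_cstar_comp[OF D(1)[OF S] a] by (simp add: vanishing_ideal_iff)
  }
  fix T assume T: "T \<in> reduced_cstar G" and c: "\<And>\<epsilon>. \<epsilon> > 0 \<Longrightarrow> \<exists>S\<in>vanishing_ideal H. op_close G T S \<epsilon>"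
  note Tb = reduced_cstar_bounded[OF T]
  have "evanescent H (\<lambda>\<psi>. l2norm G (T (lreg G s \<psi>)))" if s: "s \<in> carrier G" for s
  proof (rule evanescent_limit)
    fix \<epsilon> :: real assume "\<epsilon> > 0"
    then obtain S where S: "S \<in> vanishing_ideal H" "op_close G T S \<epsilon>" using c by blast
    have "l2norm G (T (lreg G s \<psi>)) \<le> l2norm G (S (lreg G s \<psi>)) + \<epsilon>" if p: "\<psi> \<in> l2 G" "l2norm G \<psi> = 1" for \<psi>
    proof -
      let ?v = "lreg G s \<psi>"
      have v: "?v \<in> l2 G" "l2norm G ?v = 1" using s p by auto
      have av: "S ?v \<in> l2 G" "T ?v \<in> l2 G" using bounded_ops_l2[OF D(2)[OF S(1)] v(1)] bounded_ops_l2[OF Tb v(1)] .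
      have "T ?v = (\<lambda>x. S ?v x + (T ?v x - S ?v x))" by simp
      then have "l2norm G (T ?v) \<le> l2norm G (S ?v) + l2norm G (\<lambda>x. T ?v x - S ?v x)"
        using l2norm_add[OF av(1) l2_diff[OF av(2,1)]] by simp
      then show ?thesis using op_closeD[OF S(2) v(1)] v(2) by simp
    qed
    then show "\<exists>\<theta>'. evanescent H \<theta>' \<and> (\<forall>\<psi>\<in>l2 G. l2norm G \<psi> = 1 \<longrightarrow> l2norm G (T (lreg G s \<psi>)) \<le> \<theta>' \<psi> + \<epsilon>)"
      using D(3)[OF S(1) s] by (intro exI[of _ "\<lambda>\<psi>. l2norm G (S (lreg G s \<psi>))"] conjI ballI impI)
  qed
  then show "T \<in> vanishing_ideal H" using T by (simp add: vanishing_ideal_iff)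
qed

text \<open>By \<open>cov\<close>, either \<open>g2\<close> fixes the coset of \<open>s\<close> in
  \<open>G/H\<close>, or \<open>g1\<close> fixes it together with its \<open>g2\<close>-translate.
  In both cases the four terms of \<open>W\<close> cancel in pairs up to almost invariance, so
  \<open>W\<close> lies in the ideal. The identity does not, since \<open>amen\<close> provides unit
  vectors on which it is not small.\<close>

theorem not_C_star_simple:
  assumes H: "H \<subseteq> carrier G"
    and amen: "\<And>S \<delta>. finite S \<Longrightarrow> S \<subseteq> H \<Longrightarrow> \<delta> > 0 \<Longrightarrow> almost_inv G S \<delta> \<noteq> {}"
    and g: "g1 \<in> carrier G" "g2 \<in> carrier G" "g1 \<noteq> \<one>" "g2 \<noteq> \<one>"
    and cov: "\<And>s. s \<in> carrier G \<Longrightarrow> inv s \<otimes> g2 \<otimes> s \<in> H \<or>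
       (inv s \<otimes> g1 \<otimes> s \<in> H \<and> inv (g2 \<otimes> s) \<otimes> g1 \<otimes> (g2 \<otimes> s) \<in> H)"
  shows "\<not> C_star_simple G"
proof
  assume simple: "C_star_simple G"
  \<comment> \<open>The expanded product of \<open>1 - g1\<close> and \<open>1 - g2\<close>.\<close>
  define W where "W = (\<lambda>f x. ((lreg G \<one> f x + (-1) * lreg G g1 f x) + (-1) * lreg G g2 f x) + 1 * lreg G (g1 \<otimes> g2) f x)"
  have WR: "W \<in> reduced_cstar G"
    unfolding W_def using g by (intro reduced_cstar_lincomb lreg_reduced_cstar) auto
  have near: "evanescent H (\<lambda>\<psi>. l2norm G (\<lambda>x. lreg G (g \<otimes> s) \<psi> x - lreg G s \<psi> x))"
    if gs: "g \<in> carrier G" "s \<in> carrier G" "inv s \<otimes> g \<otimes> s \<in> H" for g s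
  proof (rule evanescent_mono[OF evanescent_inv[OF gs(3)]])
    fix \<psi> assume p: "\<psi> \<in> l2 G"
    let ?k = "inv s \<otimes> g \<otimes> s"
    have k: "?k \<in> carrier G" "s \<otimes> ?k = g \<otimes> s" using gs by (auto simp: m_assoc[symmetric])
    have "(\<lambda>x. lreg G (g \<otimes> s) \<psi> x - lreg G s \<psi> x) = lreg G s (\<lambda>x. lreg G ?k \<psi> x - \<psi> x)"
      using lreg_diff[OF lreg_l2[OF k(1)] p, of s] lreg_lreg[OF gs(2) k(1)] k(2) by simp
    then show "l2norm G (\<lambda>x. lreg G (g \<otimes> s) \<psi> x - lreg G s \<psi> x) \<le> l2norm G (\<lambda>x. lreg G ?k \<psi> x - \<psi> x)"
      using l2norm_lreg[OF gs(2) l2_diff[OF lreg_l2[OF k(1)] p]] by simp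
  qed
  have dl: "(\<lambda>x. lreg G a \<psi> x - lreg G b \<psi> x) \<in> l2 G" if "a \<in> carrier G" "b \<in> carrier G" for a b \<psi>
    by (rule l2_diff[OF lreg_l2[OF that(1)] lreg_l2[OF that(2)]])
  have Ws: "W (lreg G s \<psi>) = (\<lambda>x. lreg G s \<psi> x - lreg G (g1 \<otimes> s) \<psi> x - lreg G (g2 \<otimes> s) \<psi> x + lreg G (g1 \<otimes> (g2 \<otimes> s)) \<psi> x)"
    if "s \<in> carrier G" for s \<psi>
    unfolding W_def using g that by (simp add: lreg_lreg m_assoc)
  have "evanescent H (\<lambda>\<psi>. l2norm G (W (lreg G s \<psi>)))" if s: "s \<in> carrier G" for s
  proof -
    have sc: "g1 \<otimes> s \<in> carrier G" "g2 \<otimes> s \<in> carrier G" "g1 \<otimes> (g2 \<otimes> s) \<in> carrier G" using g s by auto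
    show ?thesis using cov[OF s]
    proof
      assume "inv s \<otimes> g2 \<otimes> s \<in> H"
      note n = near[OF g(2) s this]
      show ?thesis
      proof (rule evanescent_mono[OF evanescent_add[OF n n]])
        fix \<psi> assume p: "\<psi> \<in> l2 G"
        let ?d = "\<lambda>x. lreg G (g2 \<otimes> s) \<psi> x - lreg G s \<psi> x"
        have d: "?d \<in> l2 G" by (rule dl[OF sc(2) s])
        have "lreg G g1 ?d = (\<lambda>x. lreg G (g1 \<otimes> (g2 \<otimes> s)) \<psi> x - lreg G (g1 \<otimes> s) \<psi> x)"
          using lreg_diff[OF lreg_l2[OF sc(2)] lreg_l2[OF s], of g1] g s by (simp add: lreg_lreg)
        then have "W (lreg G s \<psi>) = (\<lambda>x. lreg G g1 ?d x - ?d x)" unfolding Ws[OF s] by (simp add: algebra_simps)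
        then show "l2norm G (W (lreg G s \<psi>)) \<le> l2norm G ?d + l2norm G ?d"
          using l2norm_diff[OF lreg_l2[OF g(1), of ?d] d] l2norm_lreg[OF g(1) d] by simp
      qed
    next
      assume a: "inv s \<otimes> g1 \<otimes> s \<in> H \<and> inv (g2 \<otimes> s) \<otimes> g1 \<otimes> (g2 \<otimes> s) \<in> H"
      note n1 = near[OF g(1) s conjunct1[OF a]] and n2 = near[OF g(1) sc(2) conjunct2[OF a]]
      show ?thesis
      proof (rule evanescent_mono[OF evanescent_add[OF n2 n1]])
        fix \<psi> assume p: "\<psi> \<in> l2 G"
        let ?d = "\<lambda>x. lreg G (g1 \<otimes> s) \<psi> x - lreg G s \<psi> x" and ?e = "\<lambda>x. lreg G (g1 \<otimes> (g2 \<otimes> s)) \<psi> x - lreg G (g2 \<otimes> s) \<psi> x"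
        have "W (lreg G s \<psi>) = (\<lambda>x. ?e x - ?d x)" unfolding Ws[OF s] by (simp add: algebra_simps)
        then show "l2norm G (W (lreg G s \<psi>)) \<le> l2norm G ?e + l2norm G ?d"
          using l2norm_diff[OF dl[OF sc(3,2)] dl[OF sc(1) s]] by simp
      qed
    qed
  qed
  then have WI: "W \<in> vanishing_ideal H" using WR by (simp add: vanishing_ideal_iff)
  \<comment> \<open>The coefficient at the identity is 1, or 2 when \<open>g1\<close> and
    \<open>g2\<close> are mutually inverse: the product term enters with a plus sign and cannot
    cancel.\<close>
  have "W (delta \<one>) \<one> \<noteq> 0"
  proof -
    have "W (delta \<one>) \<one> = 1 + delta (g1 \<otimes> g2) \<one>"
      unfolding W_def using g by (simp add: lreg_delta) (auto simp: delta_def)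
    moreover have "Re (1 + delta (g1 \<otimes> g2) \<one>) > 0" by (simp add: delta_def)
    ultimately show ?thesis by (metis less_irrefl zero_complex.sel(1))
  qed
  then have "W \<noteq> (\<lambda>f x. 0)" by (metis)
  then have "vanishing_ideal H \<noteq> {\<lambda>f x. 0}" using WI by (metis singletonD)
  then have "vanishing_ideal H = reduced_cstar G"
    using simple vanishing_ideal_ideal unfolding C_star_simple_def by blast
  then have "lreg G \<one> \<in> vanishing_ideal H" using lreg_reduced_cstar[OF one_closed] by simp
  then have ev: "evanescent H (\<lambda>\<psi>. l2norm G (lreg G \<one> (lreg G \<one> \<psi>)))" by (simp add: vanishing_ideal_iff)
  obtain S \<delta> where S: "finite S" "S \<subseteq> H" "\<delta> > 0" "\<forall>\<psi>\<in>almost_inv G S \<delta>. l2norm G (lreg G \<one> (lreg G \<one> \<psi>)) \<le> 1/2"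
    using evanescentD[OF ev half_gt_zero[OF zero_less_one]] by (elim exE conjE)
  obtain \<psi> where "\<psi> \<in> almost_inv G S \<delta>" using amen[OF S(1-3)] by blast
  then show False using bspec[OF S(4)] by (force simp: almost_inv_def lreg_one)
qed

end

section \<open>Fixators of half-trees\<close>

text \<open>The quotient by the trivial subgroup consists of singletons, so a mean is carried back
  along \<open>the_elem\<close>. This links the condition on \<open>K Mod N\<close> with the one on
  \<open>K\<close> when \<open>N\<close> is trivial.\<close>

lemma amenable_trivial_quotient:
  assumes "group K" and am: "amenable (K Mod {\<one>\<^bsub>K\<^esub>})" shows "amenable K"
proof -
  interpret group K by (rule assms)
  have coset: "{\<one>\<^bsub>K\<^esub>} #>\<^bsub>K\<^esub> x = {x}" if "x \<in> carrier K" for x using that by (auto simp: r_coset_def)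
  have car: "carrier (K Mod {\<one>\<^bsub>K\<^esub>}) = (\<lambda>x. {x}) ` carrier K"
    using coset by (auto simp: FactGroup_def RCOSETS_def)
  have mult: "{x} \<otimes>\<^bsub>K Mod {\<one>\<^bsub>K\<^esub>}\<^esub> {y} = {x \<otimes>\<^bsub>K\<^esub> y}" for x y by (simp add: set_mult_def)
  obtain m :: "('a set \<Rightarrow> real) \<Rightarrow> real" where
      mc: "\<And>f f'. bounded_on (carrier (K Mod {\<one>\<^bsub>K\<^esub>})) f \<Longrightarrow> (\<forall>x\<in>carrier (K Mod {\<one>\<^bsub>K\<^esub>}). f x = f' x) \<Longrightarrow> m f = m f'"
    and mlin: "\<And>f g c. bounded_on (carrier (K Mod {\<one>\<^bsub>K\<^esub>})) f \<Longrightarrow> bounded_on (carrier (K Mod {\<one>\<^bsub>K\<^esub>})) g \<Longrightarrow> m (\<lambda>x. f x + c * g x) = m f + c * m g"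
    and mpos: "\<And>f. bounded_on (carrier (K Mod {\<one>\<^bsub>K\<^esub>})) f \<Longrightarrow> (\<forall>x\<in>carrier (K Mod {\<one>\<^bsub>K\<^esub>}). f x \<ge> 0) \<Longrightarrow> m f \<ge> 0"
    and m1: "m (\<lambda>_. 1) = 1"
    and minv: "\<And>f g. bounded_on (carrier (K Mod {\<one>\<^bsub>K\<^esub>})) f \<Longrightarrow> g \<in> carrier (K Mod {\<one>\<^bsub>K\<^esub>}) \<Longrightarrow> m (\<lambda>x. f (g \<otimes>\<^bsub>K Mod {\<one>\<^bsub>K\<^esub>}\<^esub> x)) = m f"
    using am unfolding amenable_def by blast
  define L where "L f X = f (the_elem X)" for f :: "'a \<Rightarrow> real" and X
  have bL: "bounded_on (carrier (K Mod {\<one>\<^bsub>K\<^esub>})) (L f) \<longleftrightarrow> bounded_on (carrier K) f" for f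
    by (simp add: bounded_on_def car L_def)
  show ?thesis unfolding amenable_def
  proof (intro exI[of _ "\<lambda>f. m (L f)"] conjI allI impI ballI)
    fix f f' assume "bounded_on (carrier K) f" "\<forall>x\<in>carrier K. f x = f' x"
    then show "m (L f) = m (L f')" by (intro mc) (simp_all only: bL, simp add: car L_def)
  next
    fix f g c assume "bounded_on (carrier K) f" "bounded_on (carrier K) g"
    then show "m (L (\<lambda>x. f x + c * g x)) = m (L f) + c * m (L g)"
      using mlin[of "L f" "L g" c] by (simp add: bL) (simp add: L_def[abs_def])
  next
    fix f assume "bounded_on (carrier K) f" "\<forall>x\<in>carrier K. 0 \<le> f x"
    then show "0 \<le> m (L f)" by (intro mpos) (simp_all only: bL, simp add: car L_def)
  next
    show "m (L (\<lambda>_. 1)) = 1" using m1 by (simp add: L_def[abs_def])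
  next
    fix f g assume f: "bounded_on (carrier K) f" and g: "g \<in> carrier K"
    have "m (L (\<lambda>x. f (g \<otimes>\<^bsub>K\<^esub> x))) = m (\<lambda>X. L f ({g} \<otimes>\<^bsub>K Mod {\<one>\<^bsub>K\<^esub>}\<^esub> X))"
    proof (rule mc)
      obtain B where "\<forall>x\<in>carrier K. \<bar>f x\<bar> \<le> B" using f by (auto simp: bounded_on_def)
      then have "bounded_on (carrier K) (\<lambda>x. f (g \<otimes>\<^bsub>K\<^esub> x))" using g by (auto simp: bounded_on_def)
      then show "bounded_on (carrier (K Mod {\<one>\<^bsub>K\<^esub>})) (L (\<lambda>x. f (g \<otimes>\<^bsub>K\<^esub> x)))" by (simp only: bL)
      show "\<forall>X\<in>carrier (K Mod {\<one>\<^bsub>K\<^esub>}). L (\<lambda>x. f (g \<otimes>\<^bsub>K\<^esub> x)) X = L f ({g} \<otimes>\<^bsub>K Mod {\<one>\<^bsub>K\<^esub>}\<^esub> X)"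
        unfolding car by (simp add: L_def mult del: mult_FactGroup)
    qed
    also have "\<dots> = m (L f)" using f g by (intro minv) (simp_all only: bL, simp add: car)
    finally show "m (L (\<lambda>x. f (g \<otimes>\<^bsub>K\<^esub> x))) = m (L f)" .
  qed
qed

text \<open>The Hilbert space is one-dimensional, so a nonzero element of an ideal is a scalar
  multiple of the identity.\<close>

lemma (in group) trivial_C_star_simple: "C_star_simple (G\<lparr>carrier := {\<one>}\<rparr>)"
  unfolding C_star_simple_def
proof (intro allI impI)
  let ?H = "G\<lparr>carrier := {\<one>}\<rparr>"
  interpret H: group ?H using triv_subgroup by (rule subgroup_imp_group)
  fix I assume I: "closed_ideal ?H (reduced_cstar ?H) I"
  have sub: "I \<subseteq> reduced_cstar ?H" and z: "(\<lambda>f x. 0) \<in> I"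
    and lin: "\<And>S T c. S \<in> I \<Longrightarrow> T \<in> I \<Longrightarrow> (\<lambda>f x. S f x + c * T f x) \<in> I" using I by (simp_all add: closed_ideal_def)
  show "I = {\<lambda>f x. 0} \<or> I = reduced_cstar ?H"
  proof (cases "I = {\<lambda>f x. 0}")
    case False
    then obtain T where T: "T \<in> I" "T \<noteq> (\<lambda>f x. 0)" using z by blast
    have Tb: "T \<in> bounded_ops ?H" using T sub H.reduced_cstar_sub by auto
    have oneH: "\<one> \<in> carrier ?H" by simp
    define c where "c = T (delta \<one>) \<one>"
    have Td: "T (delta \<one>) = (\<lambda>x. c * delta \<one> x)"
      using l2_outside[OF bounded_ops_l2[OF Tb delta_l2[OF oneH]]] by (auto simp: c_def delta_def)
    have Tf: "T f = (\<lambda>x. c * lreg ?H \<one> f x)" for f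
    proof (cases "f \<in> l2 ?H")
      case True
      have f: "f = (\<lambda>x. f \<one> * delta \<one> x)" using l2_outside[OF True] by (auto simp: delta_def)
      have "T f = (\<lambda>x. f \<one> * T (delta \<one>) x)" by (subst f) (rule bounded_ops_scale[OF Tb delta_l2[OF oneH]])
      also have "\<dots> = (\<lambda>x. c * (f \<one> * delta \<one> x))" unfolding Td by (simp add: mult.left_commute)
      also have "\<dots> = (\<lambda>x. c * f x)" by (rule ext) (simp only: fun_cong[OF f, symmetric])
      finally show ?thesis using H.lreg_one[OF True] by simp
    next
      case False
      then show ?thesis using bounded_ops_outside[OF Tb] by (simp add: lreg_outside)
    qed
    have c0: "c \<noteq> 0" using T(2) Tf by auto
    have "(\<lambda>f x. 0 + (1/c) * T f x) \<in> I" using lin[OF z T(1)] .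
    moreover have "(\<lambda>f x. 0 + (1/c) * T f x) = lreg ?H \<one>" using c0 by (simp add: Tf)
    ultimately have "lreg ?H \<one>\<^bsub>?H\<^esub> \<in> I" by simp
    then show ?thesis using H.closed_ideal_full[OF I] by blast
  qed simp
qed

section \<open>Pointwise fixators and their conjugates\<close>

context tree_act
begin

lemma fixator_carrier: "g \<in> fixator G \<phi> A \<Longrightarrow> g \<in> carrier G"
  and fixator_fixes: "g \<in> fixator G \<phi> A \<Longrightarrow> v \<in> A \<Longrightarrow> \<phi> g v = v"
  by (auto simp: fixator_def)

lemma fixatorI: "g \<in> carrier G \<Longrightarrow> (\<And>v. v \<in> A \<Longrightarrow> \<phi> g v = v) \<Longrightarrow> g \<in> fixator G \<phi> A"
  by (auto simp: fixator_def)

lemma fixator_mono: "A \<subseteq> B \<Longrightarrow> fixator G \<phi> B \<subseteq> fixator G \<phi> A"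
  by (auto simp: fixator_def)

lemma fixator_subgroup:
  assumes A: "A \<subseteq> V" shows "subgroup (fixator G \<phi> A) G"
proof (rule subgroup.intro)
  show "fixator G \<phi> A \<subseteq> carrier G" by (auto simp: fixator_def)
  show "\<one> \<in> fixator G \<phi> A" using A act_one by (auto simp: fixator_def)
  fix g assume g: "g \<in> fixator G \<phi> A"
  have "\<phi> (inv g) v = v" if v: "v \<in> A" for v
    using act_inv(1)[OF fixator_carrier[OF g], of v] fixator_fixes[OF g v] A v by auto
  then show "inv g \<in> fixator G \<phi> A" using fixator_carrier[OF g] by (intro fixatorI) auto
  fix h assume h: "h \<in> fixator G \<phi> A"
  have "\<phi> (g \<otimes> h) v = v" if v: "v \<in> A" for v
    using act_mult[OF fixator_carrier[OF g] fixator_carrier[OF h], of v] fixator_fixes[OF g v] fixator_fixes[OF h v] A v by auto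
  then show "g \<otimes> h \<in> fixator G \<phi> A" using fixator_carrier[OF g] fixator_carrier[OF h] by (intro fixatorI) auto
qed

lemma fixator_conj:
  assumes s: "s \<in> carrier G" and g: "g \<in> carrier G" and A: "A \<subseteq> V"
  shows "inv s \<otimes> g \<otimes> s \<in> fixator G \<phi> A \<longleftrightarrow> g \<in> fixator G \<phi> (im s A)"
proof -
  have "\<phi> (inv s \<otimes> g \<otimes> s) v = v \<longleftrightarrow> \<phi> g (\<phi> s v) = \<phi> s v" if v: "v \<in> A" for v
  proof -
    have vV: "v \<in> V" "\<phi> s v \<in> V" "\<phi> g (\<phi> s v) \<in> V" using v A act_V s g by auto
    have e: "\<phi> (inv s \<otimes> g \<otimes> s) v = \<phi> (inv s) (\<phi> g (\<phi> s v))" using s g vV by (simp add: act_mult m_assoc)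
    show ?thesis unfolding e act_inj[OF s act_V[OF inv_closed[OF s] vV(3)] vV(1), symmetric] act_inv(2)[OF s vV(3)] ..
  qed
  then show ?thesis using s g by (auto simp: fixator_def im_def)
qed

lemma kernel_normal: "fixator G \<phi> V \<lhd> G"
  unfolding normal_inv_iff
proof (intro conjI ballI)
  show "subgroup (fixator G \<phi> V) G" by (rule fixator_subgroup) simp
  fix x h assume x: "x \<in> carrier G" and h: "h \<in> fixator G \<phi> V"
  have "inv (inv x) \<otimes> h \<otimes> inv x \<in> fixator G \<phi> V"
    unfolding fixator_conj[OF inv_closed[OF x] fixator_carrier[OF h] subset_refl]
    using h im_sub[OF inv_closed[OF x] subset_refl] fixator_mono by blast
  then show "x \<otimes> h \<otimes> inv x \<in> fixator G \<phi> V" using x by simp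
qed

lemma fixator_preserves:
  assumes g: "g \<in> fixator G \<phi> (V - A)" and A: "A \<subseteq> V" shows "im g A = A"
proof -
  have "im g (V - A) = V - A" using fixator_fixes[OF g] by (force simp: im_def)
  then have "V - im g A = V - A" using im_compl[OF fixator_carrier[OF g] A] by simp
  then show ?thesis using A im_sub[OF fixator_carrier[OF g] A] by blast
qed

text \<open>With \<open>L = f K f\<^sup>-\<^sup>1\<close>, the product \<open>K L\<close> is a subgroup and \<open>K \<inter> L\<close> is the kernel \<open>N\<close>; projecting
  \<open>K L \<rightarrow> K/N\<close> sends \<open>h f h\<^sup>-\<^sup>1 f\<^sup>-\<^sup>1\<close> to the class of \<open>h\<close>.\<close>

lemma conj_avg_displaced:
  assumes Z0: "Z0 \<subseteq> V" and K: "K = fixator G \<phi> Z0" and N: "N = fixator G \<phi> V"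
    and l: "set l \<subseteq> K" "l \<noteq> []" and e: "0 \<le> \<epsilon>"
    and bd: "\<And>\<psi>. \<psi> \<in> l2 (G\<lparr>carrier := K\<rparr> Mod N) \<Longrightarrow>
      l2norm (G\<lparr>carrier := K\<rparr> Mod N) (avg_op (G\<lparr>carrier := K\<rparr> Mod N) (map (\<lambda>h. N #> h) l) \<psi>)
        \<le> \<epsilon> * l2norm (G\<lparr>carrier := K\<rparr> Mod N) \<psi>"
    and f: "f \<in> carrier G" "im f (V - Z0) \<inter> (V - Z0) = {}" and \<xi>: "\<xi> \<in> l2 G"
  shows "l2norm G (conj_avg G l (lreg G f) \<xi>) \<le> \<epsilon> * l2norm G \<xi>"
proof -
  let ?Q = "G\<lparr>carrier := K\<rparr> Mod N"
  define Y where "Y = im f (V - Z0)"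
  have Y: "Y \<subseteq> V" "Y \<subseteq> Z0" using im_sub[OF f(1), of "V - Z0"] f(2) by (auto simp: Y_def)
  define L where "L = fixator G \<phi> (V - Y)"
  have Ks: "subgroup K G" and Ls: "subgroup L G" and Ns: "subgroup N G"
    unfolding K L_def N using Z0 by (auto intro!: fixator_subgroup)
  have Kc: "K \<subseteq> carrier G" "L \<subseteq> carrier G" "N \<subseteq> carrier G" using Ks Ls Ns by (auto dest: subgroup.subset)
  have NG: "N \<lhd> G" unfolding N by (rule kernel_normal)
  have NK: "N \<subseteq> K" unfolding N K using Z0 by (rule fixator_mono)
  have NKn: "N \<lhd> (G\<lparr>carrier := K\<rparr>)" using normal_restrict_supergroup[OF Ks NG NK] .
  have Q: "group ?Q" using normal.factorgroup_is_group[OF NKn] .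
  have KL: "K \<inter> L \<subseteq> N"
  proof
    fix g assume g: "g \<in> K \<inter> L"
    have "\<phi> g v = v" if v: "v \<in> V" for v
    proof (cases "v \<in> Z0")
      case True
      then show ?thesis using g fixator_fixes[of g Z0] by (auto simp: K)
    next
      case False
      then have "v \<in> V - Y" using v Y by auto
      then show ?thesis using g fixator_fixes[of g "V - Y"] by (auto simp: L_def)
    qed
    then show "g \<in> N" unfolding N using g Kc by (intro fixatorI) auto
  qed
  \<comment> \<open>\<open>K\<close> normalises \<open>L\<close>, because it fixes \<open>Y\<close>,
    a subset of \<open>Z0\<close>, pointwise.\<close>
  have conjL: "inv h \<otimes> w \<otimes> h \<in> L" if hw: "h \<in> K" "w \<in> L" for h w
  proof -
    have hc: "h \<in> carrier G" "w \<in> carrier G" using hw Kc by auto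
    have hY: "im h Y = Y" using fixator_fixes[of h Z0] hw(1) Y(2) by (force simp: K im_def)
    have "im h (V - Y) = V - Y" using im_compl[OF hc(1) Y(1)] hY by simp
    then show ?thesis using fixator_conj[OF hc, of "V - Y"] hw(2) by (simp add: L_def)
  qed
  define M where "M = {h \<otimes> w | h w. h \<in> K \<and> w \<in> L}"
  have prod: "(h \<otimes> w) \<otimes> (h' \<otimes> w') = (h \<otimes> h') \<otimes> ((inv h' \<otimes> w \<otimes> h') \<otimes> w')"
    if "h \<in> K" "h' \<in> K" "w \<in> L" "w' \<in> L" for h h' w w'
  proof -
    have c: "h \<in> carrier G" "h' \<in> carrier G" "w \<in> carrier G" "w' \<in> carrier G" using that Kc by auto
    have "h' \<otimes> (inv h' \<otimes> (w \<otimes> (h' \<otimes> w'))) = w \<otimes> (h' \<otimes> w')" using c by (simp add: m_assoc[symmetric])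
    then show ?thesis using c by (simp add: m_assoc)
  qed
  have Mmult: "\<exists>w''\<in>L. (h \<otimes> w) \<otimes> (h' \<otimes> w') = (h \<otimes> h') \<otimes> w''"
    if "h \<in> K" "h' \<in> K" "w \<in> L" "w' \<in> L" for h h' w w'
    using prod[OF that] subgroup.m_closed[OF Ls conjL[OF that(2,3)] that(4)] by blast
  have Ms: "subgroup M G"
  proof (rule subgroup.intro)
    show "M \<subseteq> carrier G" using Kc by (auto simp: M_def)
    show "\<one> \<in> M" unfolding M_def using subgroup.one_closed[OF Ks] subgroup.one_closed[OF Ls] r_one[OF one_closed, symmetric] by blast
    fix x assume "x \<in> M"
    then obtain h w where x: "h \<in> K" "w \<in> L" "x = h \<otimes> w" by (auto simp: M_def)
    have c: "h \<in> carrier G" "w \<in> carrier G" using x Kc by auto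
    have ih: "inv h \<in> K" "inv w \<in> L" using x subgroup.m_inv_closed[OF Ks] subgroup.m_inv_closed[OF Ls] by auto
    have "inv (inv h) \<otimes> inv w \<otimes> inv h \<in> L" using conjL[OF ih] .
    moreover have "inv x = inv h \<otimes> (inv (inv h) \<otimes> inv w \<otimes> inv h)"
      unfolding x(3) using c by (simp add: inv_mult_group m_assoc[symmetric])
    ultimately show "inv x \<in> M" unfolding M_def using ih by blast
    fix y assume "y \<in> M"
    then obtain h' w' where y: "h' \<in> K" "w' \<in> L" "y = h' \<otimes> w'" by (auto simp: M_def)
    obtain w'' where "w'' \<in> L" "x \<otimes> y = (h \<otimes> h') \<otimes> w''" using Mmult[OF x(1) y(1) x(2) y(2)] x(3) y(3) by blast
    then show "x \<otimes> y \<in> M" unfolding M_def using subgroup.m_closed[OF Ks x(1) y(1)] by blast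
  qed
  \<comment> \<open>The chosen factor in \<open>K\<close> is determined only up to
    \<open>K \<inter> L\<close>, which is contained in \<open>N\<close>.\<close>
  define \<kappa> where "\<kappa> m = N #> (SOME h. h \<in> K \<and> (\<exists>w\<in>L. m = h \<otimes> w))" for m
  have kap: "\<kappa> (h \<otimes> w) = N #> h" if hw: "h \<in> K" "w \<in> L" for h w
  proof -
    let ?P = "\<lambda>h'. h' \<in> K \<and> (\<exists>w'\<in>L. h \<otimes> w = h' \<otimes> w')"
    define h' where "h' = (SOME h'. ?P h')"
    have "?P h'" unfolding h'_def by (rule someI[of ?P h]) (use hw in blast)
    then obtain w' where h': "h' \<in> K" "w' \<in> L" "h \<otimes> w = h' \<otimes> w'" by blast
    have c: "h \<in> carrier G" "w \<in> carrier G" "h' \<in> carrier G" "w' \<in> carrier G" using hw h' Kc by auto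
    have "inv h \<otimes> h' = w \<otimes> inv w'"
    proof -
      have "inv h \<otimes> h' = inv h \<otimes> (h' \<otimes> w') \<otimes> inv w'" using c by (simp add: m_assoc)
      also have "\<dots> = w \<otimes> inv w'" unfolding h'(3)[symmetric] using c by (simp add: m_assoc[symmetric])
      finally show ?thesis .
    qed
    then have "inv h \<otimes> h' \<in> N"
      using KL subgroup.m_closed[OF Ks subgroup.m_inv_closed[OF Ks hw(1)] h'(1)]
        subgroup.m_closed[OF Ls hw(2) subgroup.m_inv_closed[OF Ls h'(2)]] by auto
    then have "h \<otimes> (inv h \<otimes> h') \<otimes> inv h \<in> N" using normal.inv_op_closed2[OF NG c(1)] by blast
    then have "h' \<otimes> inv h \<in> N" using c by (simp add: m_assoc[symmetric])
    then have "h' \<in> N #> h" unfolding r_coset_def using c by (force simp: m_assoc)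
    then have "N #> h' = N #> h" using repr_independence[OF _ c(1) Ns] by simp
    then show ?thesis unfolding \<kappa>_def h'_def by simp
  qed
  have cos: "N #>\<^bsub>G\<lparr>carrier := K\<rparr>\<^esub> h = N #> h" for h by (simp add: r_coset_def)
  have Qc: "N #> h \<in> carrier ?Q" if "h \<in> K" for h
    using that cos unfolding FactGroup_def RCOSETS_def by auto
  have Qm: "(N #> h) \<otimes>\<^bsub>?Q\<^esub> (N #> h') = N #> (h \<otimes> h')" if "h \<in> K" "h' \<in> K" for h h'
    using normal.rcos_sum[OF NKn, of h h'] that by (simp add: cos)
  have kapc: "\<kappa> m \<in> carrier ?Q" if "m \<in> M" for m using that kap Qc by (auto simp: M_def)
  have kapm: "\<kappa> ((h \<otimes> w) \<otimes> m) = (N #> h) \<otimes>\<^bsub>?Q\<^esub> \<kappa> m" if hw: "h \<in> K" "w \<in> L" and m: "m \<in> M" for h w m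
  proof -
    obtain h' w' where h': "h' \<in> K" "w' \<in> L" "m = h' \<otimes> w'" using m by (auto simp: M_def)
    obtain w'' where "w'' \<in> L" "(h \<otimes> w) \<otimes> m = (h \<otimes> h') \<otimes> w''" using Mmult[OF hw(1) h'(1) hw(2) h'(2)] h'(3) by blast
    then show ?thesis using kap[of "h \<otimes> h'" w''] kap[OF h'(1,2)] h' Qm[OF hw(1) h'(1)] subgroup.m_closed[OF Ks hw(1) h'(1)] by simp
  qed
  obtain \<rho> where \<rho>c: "\<And>x. x \<in> carrier G \<Longrightarrow> \<rho> x \<in> carrier G"
    and \<rho>n: "\<And>x. x \<in> carrier G \<Longrightarrow> \<exists>m\<in>M. x = m \<otimes> \<rho> x"
    and \<rho>m: "\<And>m x. m \<in> M \<Longrightarrow> x \<in> carrier G \<Longrightarrow> \<rho> (m \<otimes> x) = \<rho> x"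
    using right_coset_representatives[OF Ms] by blast
  \<comment> \<open>Writing \<open>x\<close> as an element of \<open>M\<close> times the
    representative of its coset, the map takes the \<open>K/N\<close>-class of the first factor;
    this extends \<kappa> equivariantly from \<open>M\<close> to the whole group.\<close>
  define \<Theta> where "\<Theta> x = \<kappa> (x \<otimes> inv (\<rho> x))" for x
  have inM: "x \<otimes> inv (\<rho> x) \<in> M" if x: "x \<in> carrier G" for x
  proof -
    obtain m where m: "m \<in> M" "x = m \<otimes> \<rho> x" using \<rho>n[OF x] by blast
    have "m \<in> carrier G" using m(1) Ms by (auto dest: subgroup.subset)
    then have "x \<otimes> inv (\<rho> x) = m" using iffD2[OF inv_solve_right[OF _ x \<rho>c[OF x]] m(2)] by simp
    then show ?thesis using m by simp
  qed
  \<comment> \<open>The conjugate of \<open>f\<close> by \<open>h\<close> is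
    \<open>\<gamma> h \<otimes> f\<close>, so the average of conjugates is the plain average over
    the elements \<gamma>, applied to a fixed translate of the vector.\<close>
  define \<gamma> where "\<gamma> h = h \<otimes> (f \<otimes> inv h \<otimes> inv f)" for h
  have wL: "f \<otimes> inv h \<otimes> inv f \<in> L" if h: "h \<in> K" for h
  proof -
    have ih: "inv h \<in> K" using subgroup.m_inv_closed[OF Ks h] .
    have ic: "inv h \<in> carrier G" using ih Kc by auto
    have *: "inv (inv f) \<otimes> inv h \<otimes> inv f \<in> fixator G \<phi> (V - Y) \<longleftrightarrow> inv h \<in> fixator G \<phi> (im (inv f) (V - Y))"
      by (rule fixator_conj[OF inv_closed[OF f(1)] ic]) auto
    have "im (inv f) (V - Y) = V - im (inv f) Y" using im_compl[OF inv_closed[OF f(1)] Y(1)] .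
    also have "im (inv f) Y = V - Z0" unfolding Y_def by (rule im_inv(1)[OF f(1)]) auto
    also have "V - (V - Z0) = Z0" using Z0 by auto
    finally show ?thesis using * ih f(1) by (simp add: L_def K)
  qed
  have \<gamma>M: "\<gamma> h \<in> M" if "h \<in> K" for h unfolding \<gamma>_def M_def using wL[OF that] that by blast
  have \<gamma>c: "\<gamma> h \<in> carrier G" if "h \<in> K" for h using \<gamma>M[OF that] Ms by (auto dest: subgroup.subset)
  have lf: "lreg G f \<xi> \<in> l2 G" using f by simp
  have "l2norm G (avg_op G (map \<gamma> l) (lreg G f \<xi>)) \<le> \<epsilon> * l2norm G (lreg G f \<xi>)"
  proof (rule avg_op_fibre_bound[OF Q e, where \<Theta>=\<Theta> and \<rho>=\<rho> and \<kappa>="\<lambda>h. N #> h"])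
    show "\<gamma> h \<in> carrier G" if "h \<in> set l" for h using \<gamma>c that l by auto
    show "N #> h \<in> carrier ?Q" if "h \<in> set l" for h using Qc that l by auto
    show "\<Theta> x \<in> carrier ?Q" if "x \<in> carrier G" for x unfolding \<Theta>_def using kapc[OF inM[OF that]] .
    show "\<rho> (\<gamma> h \<otimes> x) = \<rho> x" if "h \<in> set l" "x \<in> carrier G" for h x using \<rho>m[OF \<gamma>M] that l by auto
    show "\<Theta> (\<gamma> h \<otimes> x) = (N #> h) \<otimes>\<^bsub>?Q\<^esub> \<Theta> x" if h: "h \<in> set l" and x: "x \<in> carrier G" for h x
    proof -
      have hK: "h \<in> K" using h l by auto
      have "\<gamma> h \<otimes> x \<otimes> inv (\<rho> (\<gamma> h \<otimes> x)) = \<gamma> h \<otimes> (x \<otimes> inv (\<rho> x))"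
        using \<rho>m[OF \<gamma>M[OF hK] x] \<gamma>c[OF hK] \<rho>c[OF x] x by (simp add: m_assoc)
      then show ?thesis unfolding \<Theta>_def \<gamma>_def using kapm[OF hK wL[OF hK] inM[OF x]] by simp
    qed
    show "l2norm ?Q (avg_op ?Q (map (\<lambda>h. N #> h) l) \<psi>) \<le> \<epsilon> * l2norm ?Q \<psi>" if "\<psi> \<in> l2 ?Q" for \<psi> using bd[OF that] .
    show "lreg G f \<xi> \<in> l2 G" by (rule lf)
  qed
  also have "avg_op G (map \<gamma> l) (lreg G f \<xi>) = conj_avg G l (lreg G f) \<xi>"
  proof -
    have lc: "set l \<subseteq> carrier G" using l Kc by auto
    have "lreg G (\<gamma> h) (lreg G f \<xi>) = lreg G (h \<otimes> f \<otimes> inv h) \<xi>" if "h \<in> set l" for h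
    proof -
      have h: "h \<in> K" "h \<in> carrier G" using that l Kc by auto
      have "\<gamma> h \<otimes> f = h \<otimes> f \<otimes> inv h" unfolding \<gamma>_def using h f by (simp add: m_assoc)
      then show ?thesis using lreg_lreg[OF \<gamma>c[OF h(1)] f(1)] by simp
    qed
    then have "map (\<lambda>h. lreg G (\<gamma> h) (lreg G f \<xi>) x) l = map (\<lambda>h. lreg G (h \<otimes> f \<otimes> inv h) \<xi> x) l" for x
      by (intro map_cong) auto
    then have "(\<Sum>s\<leftarrow>map \<gamma> l. lreg G s (lreg G f \<xi>) x) = (\<Sum>h\<leftarrow>l. lreg G (h \<otimes> f \<otimes> inv h) \<xi> x)" for x
      unfolding map_map o_def by (rule arg_cong)
    then show ?thesis unfolding conj_avg_lreg[OF lc f(1)] avg_op_def by (simp only: length_map)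
  qed
  finally show ?thesis using f \<xi> by simp
qed

end

section \<open>Averages of finite combinations\<close>

context group
begin

lemma conj_avg_scale_lreg:
  assumes l: "set l \<subseteq> carrier G" and g: "g \<in> carrier G"
  shows "conj_avg G l (\<lambda>f x. c * lreg G g f x) f = (\<lambda>x. c * conj_avg G l (lreg G g) f x)"
proof
  fix x
  have "lreg G s (\<lambda>x. c * lreg G g (lreg G (inv s) f) x) x = c * lreg G s (lreg G g (lreg G (inv s) f)) x" if "s \<in> set l" for s
  proof -
    have "s \<in> carrier G" using that l by auto
    then show ?thesis using fun_cong[OF bounded_ops_scale[OF lreg_bounded lreg_l2[OF g]]] by blast
  qed
  then have "map (\<lambda>s. lreg G s (\<lambda>x. c * lreg G g (lreg G (inv s) f) x) x) l
      = map (\<lambda>s. c * lreg G s (lreg G g (lreg G (inv s) f)) x) l" by (intro map_cong) auto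
  then show "conj_avg G l (\<lambda>f x. c * lreg G g f x) f x = c * conj_avg G l (lreg G g) f x"
    unfolding conj_avg_def by (simp only: sum_list_const_mult times_divide_eq_right)
qed

lemma conj_avg_span:
  assumes l: "set l \<subseteq> carrier G" and F: "finite F" "F \<subseteq> carrier G" and f: "f \<in> l2 G"
  shows "conj_avg G l (\<lambda>f x. \<Sum>g\<in>F. c g * lreg G g f x) f = (\<lambda>x. \<Sum>g\<in>F. c g * conj_avg G l (lreg G g) f x)"
  using F
proof (induction F)
  case empty
  have "lreg G s (\<lambda>x. 0) x = 0" if "s \<in> set l" for s x
    using bounded_ops_zero[OF lreg_bounded, of s] that l by auto
  then have "map (\<lambda>s. lreg G s (\<lambda>x. 0) x) l = map (\<lambda>s. 0) l" for x by (intro map_cong) auto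
  then have "(\<Sum>s\<leftarrow>l. lreg G s (\<lambda>x. 0) x) = 0" for x by (simp only: sum_list_0)
  then show ?case unfolding conj_avg_def by simp
next
  case (insert a F)
  have "conj_avg G l (\<lambda>f x. c a * lreg G a f x + (\<Sum>g\<in>F. c g * lreg G g f x)) f
     = (\<lambda>x. conj_avg G l (\<lambda>f x. c a * lreg G a f x) f x + conj_avg G l (\<lambda>f x. \<Sum>g\<in>F. c g * lreg G g f x) f x)"
  proof (rule conj_avg_add[OF _ _ l f])
    show "(\<lambda>x. c a * lreg G a f x) \<in> l2 G" for f using insert by (intro l2_scale) auto
    show "(\<lambda>x. \<Sum>g\<in>F. c g * lreg G g f x) \<in> l2 G" for f
      using insert by (intro l2_sum(1) l2_scale) auto
  qed
  also have "\<dots> = (\<lambda>x. c a * conj_avg G l (lreg G a) f x + (\<Sum>g\<in>F. c g * conj_avg G l (lreg G g) f x))"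
    using insert conj_avg_scale_lreg[OF l, of a "c a" f] by simp
  finally show ?case using insert by simp
qed

lemma l2norm_conj_avg_span:
  assumes l: "set l \<subseteq> carrier G" and F: "finite F" "F \<subseteq> carrier G" and f: "f \<in> l2 G"
    and b: "\<And>g. g \<in> F \<Longrightarrow> l2norm G (conj_avg G l (lreg G g) f) \<le> C"
  shows "l2norm G (conj_avg G l (\<lambda>f x. \<Sum>g\<in>F. c g * lreg G g f x) f) \<le> (\<Sum>g\<in>F. cmod (c g)) * C"
proof -
  have "l2norm G (\<lambda>x. \<Sum>g\<in>F. c g * conj_avg G l (lreg G g) f x) \<le> (\<Sum>g\<in>F. l2norm G (\<lambda>x. c g * conj_avg G l (lreg G g) f x))"
    using F by (intro l2_sum(2) l2_scale conj_avg_l2 l) auto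
  also have "\<dots> = (\<Sum>g\<in>F. cmod (c g) * l2norm G (conj_avg G l (lreg G g) f))"
    by (intro sum.cong refl l2norm_scale conj_avg_l2 l)
  also have "\<dots> \<le> (\<Sum>g\<in>F. cmod (c g) * C)" using b by (intro sum_mono mult_left_mono) auto
  finally show ?thesis unfolding conj_avg_span[OF l F f] by (simp add: sum_distrib_right)
qed

end

section \<open>The criteria for the acting group\<close>

context nonelementary_tree_act
begin

lemma displaced_half_tree:
  assumes f: "f \<in> carrier G" "f \<notin> fixator G \<phi> V"
  shows "\<exists>A\<in>HH. im f A \<inter> A = {}"
proof -
  obtain v where v: "v \<in> V" "\<phi> f v \<noteq> v" using f by (auto simp: fixator_def)
  obtain A where A: "A \<in> HH" "v \<in> A" using HH_separates[OF v(1) act_V[OF f(1) v(1)]] v(2) by auto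
  show ?thesis using displaced_sub[OF f(1) A v(2)] by blast
qed

text \<open>Moving \<open>Zz\<close> into \<open>A\<close> conjugates the fixator of
  \<open>A\<close> into that of \<open>Zz\<close>, which is the normal subgroup
  \<open>fixator G \<phi> V\<close>.\<close>

lemma fixator_half_tree_eq_kernel:
  assumes Zz: "Zz \<in> HH" "fixator G \<phi> Zz = fixator G \<phi> V" and A: "A \<in> HH"
  shows "fixator G \<phi> A = fixator G \<phi> V"
proof
  show "fixator G \<phi> V \<subseteq> fixator G \<phi> A" using HH_sub[OF A] by (rule fixator_mono)
  show "fixator G \<phi> A \<subseteq> fixator G \<phi> V"
  proof
    fix g assume g: "g \<in> fixator G \<phi> A"
    have gc: "g \<in> carrier G" using fixator_carrier[OF g] .
    obtain t where t: "t \<in> carrier G" "im t Zz \<subseteq> A" using move_into[OF Zz(1) A] by blast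
    have "g \<in> fixator G \<phi> (im t Zz)" using g fixator_mono[OF t(2)] by blast
    then have "inv t \<otimes> g \<otimes> t \<in> fixator G \<phi> V" using fixator_conj[OF t(1) gc HH_sub[OF Zz(1)]] Zz(2) by simp
    then have "t \<otimes> (inv t \<otimes> g \<otimes> t) \<otimes> inv t \<in> fixator G \<phi> V" by (rule normal.inv_op_closed2[OF kernel_normal t(1)])
    moreover have "t \<otimes> (inv t \<otimes> g \<otimes> t) \<otimes> inv t = g" using t(1) gc by (simp add: m_assoc[symmetric]) (simp add: m_assoc)
    ultimately show "g \<in> fixator G \<phi> V" by simp
  qed
qed

text \<open>Half-trees inside a displaced one are displaced as well, so elements can be handled one
  after another. The next element moves a vertex of the current half-tree because its fixator is
  only the kernel.\<close>

lemma common_displaced_half_tree: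
  assumes "finite F" "F \<subseteq> carrier G - fixator G \<phi> V" "Zz \<in> HH" "fixator G \<phi> Zz = fixator G \<phi> V"
  shows "\<exists>B\<in>HH. \<forall>f\<in>F. im f B \<inter> B = {}"
  using assms(1,2)
proof (induction F)
  case empty
  then show ?case using assms(3) by blast
next
  case (insert f F)
  then obtain B where B: "B \<in> HH" "\<forall>f\<in>F. im f B \<inter> B = {}" by auto
  have f: "f \<in> carrier G" "f \<notin> fixator G \<phi> B"
    using insert fixator_half_tree_eq_kernel[OF assms(3,4) B(1)] by auto
  then obtain v where v: "v \<in> B" "\<phi> f v \<noteq> v" by (auto simp: fixator_def)
  obtain C where C: "C \<in> HH" "C \<subseteq> B" "im f C \<inter> C = {}" using displaced_sub[OF f(1) B(1) v] by blast
  have "im h C \<inter> C = {}" if "h \<in> F" for h using B(2) that im_mono[OF C(2), of h] C(2) by blast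
  then show ?case using C by blast
qed

text \<open>Powers' property is read off from the orbit of one vertex: the group is divided
  according to whether \<open>v0\<close> lands in the common displaced half-tree \<open>B\<close> or
  not.\<close>

theorem C_star_simple_if_fixator_eq_kernel:
  assumes Zz: "Zz \<in> HH" "fixator G \<phi> Zz = fixator G \<phi> V"
    and simple: "C_star_simple (G\<lparr>carrier := fixator G \<phi> V\<rparr>)"
  shows "C_star_simple G"
proof (rule C_star_simple_criterion[OF fixator_subgroup[OF subset_refl] simple])
  fix F and c :: "'b \<Rightarrow> complex" and \<epsilon> :: real
  assume F: "finite F" "F \<subseteq> carrier G - fixator G \<phi> V" and e: "\<epsilon> > 0"
  obtain B where B: "B \<in> HH" "\<And>f. f \<in> F \<Longrightarrow> im f B \<inter> B = {}"
    using common_displaced_half_tree[OF F Zz] by blast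
  have BV: "B \<subseteq> V" using HH_sub[OF B(1)] .
  obtain v0 where v0: "v0 \<in> B" using HH_ne[OF B(1)] by blast
  have v0V: "v0 \<in> V" using v0 BV by auto
  define M where "M = (\<Sum>g\<in>F. cmod (c g))"
  have M0: "0 \<le> M" by (simp add: M_def sum_nonneg)
  \<comment> \<open>Large enough that \<open>2 * M / sqrt k\<close> is at most \<epsilon>;
    \<open>Suc\<close> keeps the list of conjugators non-empty.\<close>
  define k where "k = Suc (nat \<lceil>(2 * M / \<epsilon>)\<^sup>2\<rceil>)"
  have k: "(2 * M / \<epsilon>)\<^sup>2 \<le> real k" unfolding k_def by linarith
  obtain Bs where Bs: "length Bs = k" "set Bs \<subseteq> HH" "\<And>i j. i < k \<Longrightarrow> j < k \<Longrightarrow> i \<noteq> j \<Longrightarrow> Bs ! i \<inter> Bs ! j = {}"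
  proof -
    have "set (replicate k B) \<subseteq> HH" using B(1) by auto
    from disjointify[OF this] show ?thesis using that by auto
  qed
  have "\<forall>i. \<exists>t. i < k \<longrightarrow> t \<in> carrier G \<and> im t (V - B) \<subseteq> Bs ! i"
  proof
    fix i
    show "\<exists>t. i < k \<longrightarrow> t \<in> carrier G \<and> im t (V - B) \<subseteq> Bs ! i"
    proof (cases "i < k")
      case True
      then have "Bs ! i \<in> HH" using Bs(1,2) nth_mem[of i Bs] by auto
      from move_into[OF HH_compl[OF B(1)] this] show ?thesis by blast
    qed simp
  qed
  from choice[OF this] obtain t where t: "\<And>i. i < k \<Longrightarrow> t i \<in> carrier G" "\<And>i. i < k \<Longrightarrow> im (t i) (V - B) \<subseteq> Bs ! i" by blast
  define l where "l = map t [0..<k]"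
  have len: "length l = k" by (simp add: l_def)
  have lc: "set l \<subseteq> carrier G" using t(1) by (auto simp: l_def)
  have ln: "l \<noteq> []" using len by (auto simp: k_def)
  \<comment> \<open>Elements of \<open>F\<close> displace \<open>B\<close>, hence map the complement
    of \<open>D\<close> into \<open>D\<close>. Each \<open>t i\<close> takes \<open>V - B\<close>
    into its own \<open>Bs ! i\<close>, so the translates of \<open>D\<close> are disjoint.\<close>
  define D where "D = {x \<in> carrier G. \<phi> x v0 \<notin> B}"
  have lD: "\<phi> y v0 \<in> Bs ! i" if i: "i < k" and y: "y \<in> (\<lambda>x. l ! i \<otimes> x) ` D" for i y
  proof -
    obtain x where x: "x \<in> D" "y = t i \<otimes> x" using y i by (auto simp: l_def)
    have "\<phi> x v0 \<in> V - B" using x(1) act_V v0V by (auto simp: D_def)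
    then have "\<phi> (t i) (\<phi> x v0) \<in> Bs ! i" using t(2)[OF i] by (auto simp: im_def)
    then show ?thesis using x act_mult[OF t(1)[OF i] _ v0V] by (simp add: D_def)
  qed
  have bd: "2 * M / sqrt (length l) \<le> \<epsilon>"
  proof -
    have "2 * M / \<epsilon> \<le> sqrt k" using k by (rule real_le_rsqrt)
    then have "2 * M \<le> \<epsilon> * sqrt k" using e by (simp add: divide_le_eq mult.commute)
    moreover have "0 < k" unfolding k_def by (rule zero_less_Suc)
    then have "0 < sqrt k" by simp
    ultimately show ?thesis unfolding len by (simp add: divide_le_eq)
  qed
  have "l2norm G (conj_avg G l (\<lambda>f x. \<Sum>g\<in>F. c g * lreg G g f x) f) \<le> \<epsilon> * l2norm G f" if f: "f \<in> l2 G" for f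
  proof -
    have "l2norm G (conj_avg G l (\<lambda>f x. \<Sum>g\<in>F. c g * lreg G g f x) f) \<le> 2 * (\<Sum>g\<in>F. cmod (c g)) / sqrt (length l) * l2norm G f"
    proof (rule powers_averaging[OF F(1) _ _ _ lc ln _ f, where D=D])
      show "F \<subseteq> carrier G" using F by auto
      show "D \<subseteq> carrier G" by (auto simp: D_def)
      fix g x assume g: "g \<in> F" and x: "x \<in> carrier G - D"
      have gc: "g \<in> carrier G" using g F by auto
      have "\<phi> (g \<otimes> x) v0 \<in> im g B" using x gc act_mult[OF gc _ v0V, of x] by (auto simp: D_def im_def)
      then show "g \<otimes> x \<in> D" using B(2)[OF g] x gc by (auto simp: D_def)
    next
      fix i j assume ij: "i < length l" "j < length l" "i \<noteq> j"
      then have "Bs ! i \<inter> Bs ! j = {}" using Bs(3) len by simp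
      then show "(\<lambda>x. l ! i \<otimes> x) ` D \<inter> (\<lambda>x. l ! j \<otimes> x) ` D = {}"
        using lD[of i] lD[of j] ij unfolding len by (metis disjoint_iff)
    qed
    also have "\<dots> \<le> \<epsilon> * l2norm G f" using bd unfolding M_def by (intro mult_right_mono) auto
    finally show ?thesis .
  qed
  then show "\<exists>l. l \<noteq> [] \<and> set l \<subseteq> carrier G \<and>
        (\<forall>f\<in>l2 G. l2norm G (conj_avg G l (\<lambda>f x. \<Sum>g\<in>F. c g * lreg G g f x) f) \<le> \<epsilon> * l2norm G f)"
    using lc ln by blast
qed

text \<open>The average exists over \<open>K\<close> itself and is transported by an element
  \<open>t\<close> moving the complement of \<open>Zz\<close> into \<open>B\<close>. One list serves
  all elements that displace \<open>B\<close>, which matters when averages are composed.\<close>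

lemma local_averaging:
  assumes Zz: "Zz \<in> HH" and na: "\<not> amenable (G\<lparr>carrier := fixator G \<phi> Zz\<rparr> Mod fixator G \<phi> V)"
    and e: "\<epsilon> > 0" and B: "B \<in> HH"
  shows "\<exists>l. l \<noteq> [] \<and> set l \<subseteq> fixator G \<phi> (V - B) \<and>
     (\<forall>f\<in>carrier G. im f B \<inter> B = {} \<longrightarrow> (\<forall>\<xi>\<in>l2 G. l2norm G (conj_avg G l (lreg G f) \<xi>) \<le> \<epsilon> * l2norm G \<xi>))"
proof -
  let ?K = "fixator G \<phi> Zz" and ?N = "fixator G \<phi> V"
  let ?Q = "G\<lparr>carrier := ?K\<rparr> Mod ?N"
  have ZV: "Zz \<subseteq> V" "V - Zz \<subseteq> V" using HH_sub[OF Zz] by auto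
  have NKn: "?N \<lhd> (G\<lparr>carrier := ?K\<rparr>)"
    using normal_restrict_supergroup[OF fixator_subgroup[OF ZV(1)] kernel_normal fixator_mono[OF ZV(1)]] .
  interpret Q: group ?Q by (rule normal.factorgroup_is_group[OF NKn])
  obtain q where q: "q \<noteq> []" "set q \<subseteq> carrier ?Q" "\<And>\<psi>. \<psi> \<in> l2 ?Q \<Longrightarrow> l2norm ?Q (avg_op ?Q q \<psi>) \<le> \<epsilon> * l2norm ?Q \<psi>"
    using Q.kesten[OF na e] by blast
  have "\<forall>X\<in>set q. \<exists>h. h \<in> ?K \<and> X = ?N #> h"
    using q(2) by (auto simp: FactGroup_def RCOSETS_def r_coset_def)
  from bchoice[OF this] obtain \<eta> where \<eta>: "\<And>X. X \<in> set q \<Longrightarrow> \<eta> X \<in> ?K" "\<And>X. X \<in> set q \<Longrightarrow> X = ?N #> \<eta> X" by blast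
  define l0 where "l0 = map \<eta> q"
  have l0: "set l0 \<subseteq> ?K" "l0 \<noteq> []" using \<eta>(1) q(1) by (auto simp: l0_def)
  have l0c: "set l0 \<subseteq> carrier G" using l0(1) fixator_carrier by blast
  have q': "map (\<lambda>h. ?N #> h) l0 = q" unfolding l0_def map_map o_def using \<eta>(2) by (simp add: map_idI)
  obtain t where t: "t \<in> carrier G" "im t (V - Zz) \<subseteq> B" using move_into[OF HH_compl[OF Zz] B] by blast
  \<comment> \<open>The averaging elements of \<open>K\<close> conjugated by \<open>t\<close>; they
    are supported in \<open>B\<close>, and averaging \<open>f\<close> over them amounts to averaging
    \<open>f'\<close> over \<open>l0\<close>.\<close>
  define l where "l = list_prod G [t] (list_prod G l0 [inv t])"
  have l1c: "set (list_prod G l0 [inv t]) \<subseteq> carrier G" using l0c t by (intro set_list_prod) auto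
  have ln: "l \<noteq> []" unfolding l_def using l0 by (intro list_prod_ne) auto
  have lfix: "set l \<subseteq> fixator G \<phi> (V - B)"
  proof
    fix x assume "x \<in> set l"
    then obtain h where h: "h \<in> set l0" "x = t \<otimes> (h \<otimes> inv t)" by (auto simp: l_def list_prod_def)
    have hK: "h \<in> ?K" "h \<in> carrier G" using h l0 l0c by auto
    have "inv (inv t) \<otimes> h \<otimes> inv t \<in> fixator G \<phi> (im t Zz)"
      unfolding fixator_conj[OF inv_closed[OF t(1)] hK(2) im_sub[OF t(1) ZV(1)]] im_inv(1)[OF t(1) ZV(1)] by (rule hK(1))
    moreover have "V - B \<subseteq> im t Zz" using t(2) unfolding im_compl[OF t(1) ZV(1)] by blast
    ultimately have "inv (inv t) \<otimes> h \<otimes> inv t \<in> fixator G \<phi> (V - B)" using fixator_mono by blast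
    then show "x \<in> fixator G \<phi> (V - B)" using h(2) hK t by (simp add: m_assoc)
  qed
  have "l2norm G (conj_avg G l (lreg G f) \<xi>) \<le> \<epsilon> * l2norm G \<xi>"
    if f: "f \<in> carrier G" "im f B \<inter> B = {}" and \<xi>: "\<xi> \<in> l2 G" for f \<xi>
  proof -
    define f' where "f' = inv t \<otimes> f \<otimes> t"
    have f'c: "f' \<in> carrier G" using f t by (simp add: f'_def)
    have "im t (im f' (V - Zz)) = im f (im t (V - Zz))"
    proof -
      have "t \<otimes> f' = f \<otimes> t" unfolding f'_def using f t by (simp add: m_assoc[symmetric])
      then show ?thesis using im_mult[OF t(1) f'c ZV(2)] im_mult[OF f(1) t(1) ZV(2)] by simp
    qed
    moreover have "im f (im t (V - Zz)) \<inter> im t (V - Zz) = {}" using f(2) im_mono[OF t(2), of f] t(2) by blast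
    ultimately have dis: "im f' (V - Zz) \<inter> (V - Zz) = {}"
      using im_disjoint_iff[OF t(1) im_sub[OF f'c ZV(2)] ZV(2)] by simp
    have bd: "l2norm G (conj_avg G l0 (lreg G f') \<xi>) \<le> \<epsilon> * l2norm G \<xi>" if "\<xi> \<in> l2 G" for \<xi>
      by (rule conj_avg_displaced[OF ZV(1) refl refl l0 less_imp_le[OF e] _ f'c dis that]) (unfold q', rule q(3))
    have "conj_avg G [inv t] (lreg G f) \<xi> = lreg G f' \<xi>" for \<xi>
      using conj_avg_lreg[of "[inv t]" f \<xi>] f t by (simp add: f'_def)
    then have eq: "conj_avg G [inv t] (lreg G f) = lreg G f'" by (rule ext)
    have "conj_avg G l (lreg G f) \<xi> = conj_avg G [t] (conj_avg G (list_prod G l0 [inv t]) (lreg G f)) \<xi>"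
      unfolding l_def using t l1c by (intro conj_avg_list_prod) auto
    also have "conj_avg G (list_prod G l0 [inv t]) (lreg G f) = conj_avg G l0 (lreg G f')"
      unfolding eq[symmetric] by (rule ext, rule conj_avg_list_prod[OF l0c]) (use t in simp)
    finally have "conj_avg G l (lreg G f) \<xi> = conj_avg G [t] (conj_avg G l0 (lreg G f')) \<xi>" .
    moreover have "l2norm G (conj_avg G [t] (conj_avg G l0 (lreg G f')) \<xi>) \<le> \<epsilon> * l2norm G \<xi>"
      by (rule l2norm_conj_avg[OF _ _ conj_avg_l2[OF l0c] bd \<xi>]) (use t in auto)
    ultimately show ?thesis by simp
  qed
  then show ?thesis using ln lfix by blast
qed

text \<open>The averaging sets for disjoint half-trees can be multiplied together: conjugating by elements that fix
  a half-tree pointwise preserves the property of displacing it.\<close>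

lemma joint_averaging:
  assumes Zz: "Zz \<in> HH" and na: "\<not> amenable (G\<lparr>carrier := fixator G \<phi> Zz\<rparr> Mod fixator G \<phi> V)" and e: "\<epsilon> > 0"
    and ps: "\<And>f B. (f, B) \<in> set ps \<Longrightarrow> f \<in> carrier G \<and> B \<in> HH \<and> im f B \<inter> B = {}"
    and disj: "sorted_wrt (\<lambda>p q. snd p \<inter> snd q = {}) ps"
  shows "\<exists>l. l \<noteq> [] \<and> set l \<subseteq> fixator G \<phi> (V - \<Union>(snd ` set ps)) \<and>
     (\<forall>f\<in>fst ` set ps. \<forall>\<xi>\<in>l2 G. l2norm G (conj_avg G l (lreg G f) \<xi>) \<le> \<epsilon> * l2norm G \<xi>)"
  using ps disj
proof (induction ps)
  case Nil
  have "\<one> \<in> fixator G \<phi> V" using subgroup.one_closed[OF fixator_subgroup[OF subset_refl]] .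
  then show ?case by (intro exI[of _ "[\<one>]"]) auto
next
  case (Cons p ps)
  obtain f B where p: "p = (f, B)" by (cases p)
  let ?U = "\<Union>(snd ` set ps)"
  have f: "f \<in> carrier G" and B: "B \<in> HH" "im f B \<inter> B = {}" using Cons.prems(1)[of f B] p by auto
  have BV: "B \<subseteq> V" using HH_sub[OF B(1)] .
  have "\<exists>l. l \<noteq> [] \<and> set l \<subseteq> fixator G \<phi> (V - ?U) \<and>
     (\<forall>f\<in>fst ` set ps. \<forall>\<xi>\<in>l2 G. l2norm G (conj_avg G l (lreg G f) \<xi>) \<le> \<epsilon> * l2norm G \<xi>)"
    using Cons.prems by (intro Cons.IH) auto
  then obtain l where l: "l \<noteq> []" "set l \<subseteq> fixator G \<phi> (V - ?U)"
    "\<And>g \<xi>. g \<in> fst ` set ps \<Longrightarrow> \<xi> \<in> l2 G \<Longrightarrow> l2norm G (conj_avg G l (lreg G g) \<xi>) \<le> \<epsilon> * l2norm G \<xi>" by blast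
  obtain lB where lB: "lB \<noteq> []" "set lB \<subseteq> fixator G \<phi> (V - B)"
    "\<And>g \<xi>. g \<in> carrier G \<Longrightarrow> im g B \<inter> B = {} \<Longrightarrow> \<xi> \<in> l2 G \<Longrightarrow> l2norm G (conj_avg G lB (lreg G g) \<xi>) \<le> \<epsilon> * l2norm G \<xi>"
    using local_averaging[OF Zz na e B(1)] by blast
  have lc: "set l \<subseteq> carrier G" and lBc: "set lB \<subseteq> carrier G" using l(2) lB(2) fixator_carrier by blast+
  have BU: "B \<subseteq> V - ?U" using Cons.prems(2) BV by (auto simp: p)
  let ?l = "list_prod G lB l" and ?W = "V - \<Union>(snd ` set (p # ps))"
  have fixW: "fixator G \<phi> (V - B) \<subseteq> fixator G \<phi> ?W" "fixator G \<phi> (V - ?U) \<subseteq> fixator G \<phi> ?W"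
    by (rule fixator_mono; auto simp: p)+
  have Ws: "subgroup (fixator G \<phi> ?W) G" by (rule fixator_subgroup) blast
  have "set ?l \<subseteq> fixator G \<phi> ?W"
  proof
    fix x assume "x \<in> set ?l"
    then obtain h s where x: "h \<in> set lB" "s \<in> set l" "x = h \<otimes> s" by (auto simp: list_prod_def)
    have "h \<in> fixator G \<phi> ?W" "s \<in> fixator G \<phi> ?W" using x l(2) lB(2) fixW by blast+
    then show "x \<in> fixator G \<phi> ?W" unfolding x(3) by (rule subgroup.m_closed[OF Ws])
  qed
  moreover have "l2norm G (conj_avg G ?l (lreg G g) \<xi>) \<le> \<epsilon> * l2norm G \<xi>"
    if g: "g \<in> fst ` set (p # ps)" and \<xi>: "\<xi> \<in> l2 G" for g \<xi>
  proof (cases "g \<in> fst ` set ps")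
    case True
    show ?thesis unfolding conj_avg_list_prod[OF lBc lc]
      by (rule l2norm_conj_avg[OF lBc lB(1) conj_avg_l2[OF lc] l(3)[OF True] \<xi>])
  next
    case False
    \<comment> \<open>The inner average turns \<open>f\<close> into several of its conjugates. All
      of them displace \<open>B\<close>, so the single list \<open>lB\<close> makes each of them
      small, and with them their average.\<close>
    then have gf: "g = f" using g p by auto
    have s: "s \<otimes> f \<otimes> inv s \<in> carrier G" "im (s \<otimes> f \<otimes> inv s) B \<inter> B = {}" if s: "s \<in> set l" for s
    proof -
      have sc: "s \<in> carrier G" using s lc by auto
      show "s \<otimes> f \<otimes> inv s \<in> carrier G" using sc f by simp
      have "\<phi> s v = v" if "v \<in> B" for v using fixator_fixes[of s "V - ?U" v] s l(2) BU that by blast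
      then have sB: "im s B = B" by (force simp: im_def)
      then have sB': "im (inv s) B = B" using im_inv(1)[OF sc BV] by simp
      have "im (s \<otimes> f \<otimes> inv s) B = im s (im f B)"
        using im_mult[OF m_closed[OF sc f] inv_closed[OF sc] BV] im_mult[OF sc f BV] sB' by simp
      then show "im (s \<otimes> f \<otimes> inv s) B \<inter> B = {}"
        using im_disjoint_iff[OF sc im_sub[OF f BV] BV] B(2) sB by simp
    qed
    have eq: "conj_avg G l (lreg G f) = (\<lambda>h x. (\<Sum>s\<leftarrow>l. lreg G (s \<otimes> f \<otimes> inv s) h x) / of_nat (length l))"
      by (rule ext) (rule conj_avg_lreg[OF lc f])
    have av: "conj_avg G lB (\<lambda>h x. (\<Sum>s\<leftarrow>l. lreg G (s \<otimes> f \<otimes> inv s) h x) / of_nat (length l)) \<xi>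
       = (\<lambda>x. (\<Sum>s\<leftarrow>l. conj_avg G lB (lreg G (s \<otimes> f \<otimes> inv s)) \<xi> x) / of_nat (length l))"
      by (rule conj_avg_list_average[OF lBc lreg_l2[OF s(1)]])
    show ?thesis unfolding gf conj_avg_list_prod[OF lBc lc] eq av
      by (rule l2norm_list_average[OF conj_avg_l2[OF lBc] lB(3)[OF s \<xi>] l(1)])
  qed
  ultimately show ?case using list_prod_ne[OF lB(1) l(1)] by blast
qed

theorem C_star_simple_if_quotient_nonamenable:
  assumes Zz: "Zz \<in> HH" and na: "\<not> amenable (G\<lparr>carrier := fixator G \<phi> Zz\<rparr> Mod fixator G \<phi> V)"
    and simple: "C_star_simple (G\<lparr>carrier := fixator G \<phi> V\<rparr>)"
  shows "C_star_simple G"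
proof (rule C_star_simple_criterion[OF fixator_subgroup[OF subset_refl] simple])
  fix F and c :: "'b \<Rightarrow> complex" and \<epsilon> :: real
  assume F: "finite F" "F \<subseteq> carrier G - fixator G \<phi> V" and e: "\<epsilon> > 0"
  \<comment> \<open>The summand 1 makes division by \<open>M\<close> legitimate when all
    coefficients vanish.\<close>
  define M where "M = 1 + (\<Sum>g\<in>F. cmod (c g))"
  have M: "M > 0" "(\<Sum>g\<in>F. cmod (c g)) \<le> M" by (simp_all add: M_def add_pos_nonneg sum_nonneg)
  have "\<forall>f\<in>F. \<exists>A. A \<in> HH \<and> im f A \<inter> A = {}" using displaced_half_tree F(2) by blast
  from bchoice[OF this] obtain A where A: "\<And>f. f \<in> F \<Longrightarrow> A f \<in> HH" "\<And>f. f \<in> F \<Longrightarrow> im f (A f) \<inter> A f = {}" by blast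
  obtain fs where fs: "set fs = F" using finite_list[OF F(1)] by blast
  obtain Bs where Bs: "length Bs = length fs" "set Bs \<subseteq> HH" "\<And>i. i < length fs \<Longrightarrow> Bs ! i \<subseteq> A (fs ! i)"
    "\<And>i j. i < length fs \<Longrightarrow> j < length fs \<Longrightarrow> i \<noteq> j \<Longrightarrow> Bs ! i \<inter> Bs ! j = {}"
  proof -
    have "set (map A fs) \<subseteq> HH" using A(1) fs by auto
    from disjointify[OF this] show ?thesis using that by auto
  qed
  let ?ps = "zip fs Bs"
  have "f \<in> carrier G \<and> B \<in> HH \<and> im f B \<inter> B = {}" if fB: "(f, B) \<in> set ?ps" for f B
  proof -
    obtain i where i: "i < length fs" "f = fs ! i" "B = Bs ! i" using fB Bs(1) by (auto simp: in_set_zip)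
    have fF: "f \<in> F" using i fs by auto
    have BA: "B \<subseteq> A f" using Bs(3)[OF i(1)] i by simp
    have "im f B \<inter> B = {}" using A(2)[OF fF] BA im_mono[OF BA, of f] by blast
    moreover have "B \<in> HH" using i Bs(1,2) nth_mem[of i Bs] by auto
    ultimately show ?thesis using fF F(2) by blast
  qed
  moreover have "sorted_wrt (\<lambda>p q. snd p \<inter> snd q = {}) ?ps"
    using Bs(1,4) by (auto simp: sorted_wrt_iff_nth_less)
  ultimately have "\<exists>l. l \<noteq> [] \<and> set l \<subseteq> fixator G \<phi> (V - \<Union>(snd ` set ?ps)) \<and>
     (\<forall>f\<in>fst ` set ?ps. \<forall>\<xi>\<in>l2 G. l2norm G (conj_avg G l (lreg G f) \<xi>) \<le> \<epsilon> / M * l2norm G \<xi>)"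
    using e M(1) by (intro joint_averaging[OF Zz na]) auto
  moreover have "fst ` set ?ps = F"
  proof -
    have "fst ` set ?ps = set (map fst ?ps)" by simp
    also have "\<dots> = F" using fs Bs(1) by (simp only: map_fst_zip)
    finally show ?thesis .
  qed
  ultimately obtain l where l: "l \<noteq> []" "set l \<subseteq> fixator G \<phi> (V - \<Union>(snd ` set ?ps))"
    "\<And>f \<xi>. f \<in> F \<Longrightarrow> \<xi> \<in> l2 G \<Longrightarrow> l2norm G (conj_avg G l (lreg G f) \<xi>) \<le> \<epsilon> / M * l2norm G \<xi>" by auto
  have lc: "set l \<subseteq> carrier G" using l(2) fixator_carrier by blast
  have "l2norm G (conj_avg G l (\<lambda>f x. \<Sum>g\<in>F. c g * lreg G g f x) f) \<le> \<epsilon> * l2norm G f" if f: "f \<in> l2 G" for f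
  proof -
    have "l2norm G (conj_avg G l (\<lambda>f x. \<Sum>g\<in>F. c g * lreg G g f x) f) \<le> (\<Sum>g\<in>F. cmod (c g)) * (\<epsilon> / M * l2norm G f)"
      using F l(3)[OF _ f] by (intro l2norm_conj_avg_span[OF lc F(1) _ f]) auto
    also have "\<dots> \<le> M * (\<epsilon> / M * l2norm G f)" using M e by (intro mult_right_mono) auto
    also have "\<dots> = \<epsilon> * l2norm G f" using M by simp
    finally show ?thesis .
  qed
  then show "\<exists>l. l \<noteq> [] \<and> set l \<subseteq> carrier G \<and>
        (\<forall>f\<in>l2 G. l2norm G (conj_avg G l (\<lambda>f x. \<Sum>g\<in>F. c g * lreg G g f x) f) \<le> \<epsilon> * l2norm G f)"
    using lc l(1) by blast
qed

text \<open>The fixator of the image of \<open>Zz\<close> under \<open>u\<close> is the conjugate of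
  \<open>K\<close> by \<open>u\<close>. A vector almost invariant under \<open>K\<close>, extended
  by 0 to the group and translated by \<open>u\<close>, is almost invariant under this
  conjugate.\<close>

lemma almost_inv_conjugate_fixator:
  assumes Zz: "Zz \<subseteq> V" and am: "amenable (G\<lparr>carrier := fixator G \<phi> Zz\<rparr>)" and u: "u \<in> carrier G"
    and S: "finite S" "S \<subseteq> fixator G \<phi> (im u Zz)" and d: "\<delta> > 0"
  shows "almost_inv G S \<delta> \<noteq> {}"
proof -
  let ?K = "fixator G \<phi> Zz"
  let ?GK = "G\<lparr>carrier := ?K\<rparr>"
  have Ks: "subgroup ?K G" by (rule fixator_subgroup[OF Zz])
  interpret C: subgroup_compression G ?K
    by (intro subgroup_compression.intro is_group subgroup_compression_axioms.intro Ks)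
  define \<sigma> where "\<sigma> s = inv u \<otimes> s \<otimes> u" for s
  have Sc: "s \<in> carrier G" if "s \<in> S" for s using that S(2) fixator_carrier by blast
  have \<sigma>K: "\<sigma> s \<in> ?K" if "s \<in> S" for s
    unfolding \<sigma>_def fixator_conj[OF u Sc[OF that] Zz] using that S(2) by blast
  have "almost_inv ?GK (\<sigma> ` S) \<delta> \<noteq> {}"
    using \<sigma>K S(1) d by (intro group.amenable_almost_inv[OF C.group_GN am]) auto
  then obtain \<psi> where \<psi>: "\<psi> \<in> l2 ?GK" "l2norm ?GK \<psi> = 1"
    "\<And>s. s \<in> S \<Longrightarrow> l2norm ?GK (\<lambda>x. lreg ?GK (\<sigma> s) \<psi> x - \<psi> x) \<le> \<delta>" unfolding almost_inv_def by blast
  have \<psi>G: "\<psi> \<in> l2 G" by (rule C.l2_GN_sub[OF \<psi>(1)])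
  have "lreg G u \<psi> \<in> almost_inv G S \<delta>"
    unfolding almost_inv_def
  proof (intro CollectI conjI ballI)
    show "lreg G u \<psi> \<in> l2 G" using u by simp
    show "l2norm G (lreg G u \<psi>) = 1" using u \<psi>G \<psi>(2) C.l2norm_GN[OF \<psi>(1)] by simp
    fix s assume s: "s \<in> S"
    have \<sigma>c: "\<sigma> s \<in> carrier G" using \<sigma>K[OF s] fixator_carrier by blast
    have "lreg ?GK (\<sigma> s) \<psi> \<in> l2 ?GK" using group.lreg_l2[OF C.group_GN] \<sigma>K[OF s] by simp
    then have dl: "(\<lambda>x. lreg ?GK (\<sigma> s) \<psi> x - \<psi> x) \<in> l2 ?GK" using \<psi>(1) by (rule l2_diff)
    have "lreg G s (lreg G u \<psi>) = lreg G u (lreg G (\<sigma> s) \<psi>)"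
    proof -
      have "s \<otimes> u = u \<otimes> \<sigma> s" unfolding \<sigma>_def using u Sc[OF s] by (simp add: m_assoc[symmetric])
      then show ?thesis using lreg_lreg[OF Sc[OF s] u] lreg_lreg[OF u \<sigma>c] by simp
    qed
    then have "(\<lambda>x. lreg G s (lreg G u \<psi>) x - lreg G u \<psi> x) = lreg G u (\<lambda>x. lreg G (\<sigma> s) \<psi> x - \<psi> x)"
      using lreg_diff[OF lreg_l2[OF \<sigma>c] \<psi>G] by simp
    then have "l2norm G (\<lambda>x. lreg G s (lreg G u \<psi>) x - lreg G u \<psi> x) = l2norm G (\<lambda>x. lreg G (\<sigma> s) \<psi> x - \<psi> x)"
      using l2norm_lreg[OF u l2_diff[OF lreg_l2[OF \<sigma>c] \<psi>G]] by simp
    also have "\<dots> = l2norm ?GK (\<lambda>x. lreg ?GK (\<sigma> s) \<psi> x - \<psi> x)"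
      using C.l2norm_GN[OF dl] C.lreg_GN[OF \<sigma>K[OF s] \<psi>(1)] by simp
    also have "\<dots> \<le> \<delta>" by (rule \<psi>(3)[OF s])
    finally show "l2norm G (\<lambda>x. lreg G s (lreg G u \<psi>) x - lreg G u \<psi> x) \<le> \<delta>" .
  qed
  then show ?thesis by blast
qed

text \<open>One non-trivial element fixing \<open>Zz\<close> provides, after conjugation, a
  non-trivial element supported in any prescribed half-tree.\<close>

lemma fixator_compl_nontrivial:
  assumes Zz: "Zz \<in> HH" and k: "k \<in> fixator G \<phi> Zz" "k \<noteq> \<one>" and D: "D \<in> HH"
  shows "\<exists>g\<in>fixator G \<phi> (V - D). g \<noteq> \<one>"
proof -
  have kc: "k \<in> carrier G" by (rule fixator_carrier[OF k(1)])
  obtain u where u: "u \<in> carrier G" "im u (V - D) \<subseteq> Zz" using move_into[OF HH_compl[OF D] Zz] by blast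
  have "k \<in> fixator G \<phi> (im u (V - D))" using k(1) fixator_mono[OF u(2)] by blast
  then have "inv u \<otimes> k \<otimes> u \<in> fixator G \<phi> (V - D)" using fixator_conj[OF u(1) kc, of "V - D"] by simp
  moreover have "inv u \<otimes> k \<otimes> u \<noteq> \<one>"
  proof
    assume a: "inv u \<otimes> k \<otimes> u = \<one>"
    have "k = u \<otimes> (inv u \<otimes> k \<otimes> u) \<otimes> inv u" using u(1) kc by (simp add: m_assoc[symmetric]) (simp add: m_assoc)
    then show False using k(2) u(1) unfolding a by simp
  qed
  ultimately show ?thesis by blast
qed

text \<open>The fixators of the half-trees \<open>t\<^sup>n Zz\<close>, which shrink to an end, form an increasing chain of
  amenable groups; their union is amenable and plays the role of an amenable stabiliser of that end.\<close>

theorem not_C_star_simple_if_fixator_amenable: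
  assumes Zz: "Zz \<in> HH" and am: "amenable (G\<lparr>carrier := fixator G \<phi> Zz\<rparr>)" and nt: "fixator G \<phi> Zz \<noteq> {\<one>}"
  shows "\<not> C_star_simple G"
proof -
  have ZV: "Zz \<subseteq> V" using HH_sub[OF Zz] .
  have "\<one> \<in> fixator G \<phi> Zz" by (rule subgroup.one_closed[OF fixator_subgroup[OF ZV]])
  then obtain k where k: "k \<in> fixator G \<phi> Zz" "k \<noteq> \<one>" using nt by blast
  obtain t where t: "t \<in> carrier G" "im t Zz \<subset> Zz" using transl_all[OF Zz] by blast
  define A where "A n = im (t [^] (n::nat)) Zz" for n
  have A: "shrinking A" unfolding A_def by (rule shrinking_powers[OF t(1) Zz t(2)])
  have AV: "A n \<subseteq> V" for n using HH_sub[OF shrinkingD(1)[OF A]] .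
  define H where "H = (\<Union>n. fixator G \<phi> (A n))"
  have HI: "g \<in> H" if "g \<in> fixator G \<phi> (A n)" for g n using that by (auto simp: H_def)
  obtain D1 D2 where D: "D1 \<in> HH" "D2 \<in> HH" "D1 \<inter> D2 = {}" using facing_triple by blast
  obtain g1 where g1: "g1 \<in> fixator G \<phi> (V - D1)" "g1 \<noteq> \<one>" using fixator_compl_nontrivial[OF Zz k D(1)] by blast
  obtain g2 where g2: "g2 \<in> fixator G \<phi> (V - D2)" "g2 \<noteq> \<one>" using fixator_compl_nontrivial[OF Zz k D(2)] by blast
  have gc: "g1 \<in> carrier G" "g2 \<in> carrier G" using fixator_carrier g1(1) g2(1) by blast+
  show ?thesis
  proof (rule not_C_star_simple[where H=H, OF _ _ gc g1(2) g2(2)])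
    show "H \<subseteq> carrier G" unfolding H_def using fixator_carrier by blast
  next
    fix S and \<delta> :: real assume S: "finite S" "S \<subseteq> H" and d: "\<delta> > 0"
    have "\<forall>s\<in>S. \<exists>n. s \<in> fixator G \<phi> (A n)" using S(2) by (auto simp: H_def)
    from bchoice[OF this] obtain n where n: "\<And>s. s \<in> S \<Longrightarrow> s \<in> fixator G \<phi> (A (n s))" by blast
    obtain m where m: "\<And>s. s \<in> S \<Longrightarrow> n s \<le> m"
      using finite_imageI[OF S(1), of n] unfolding finite_nat_set_iff_bounded_le by auto
    have "S \<subseteq> fixator G \<phi> (A m)"
    proof
      fix s assume s: "s \<in> S"
      show "s \<in> fixator G \<phi> (A m)" using n[OF s] fixator_mono[OF shrinkingD(2)[OF A m[OF s]]] by blast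
    qed
    then show "almost_inv G S \<delta> \<noteq> {}"
      unfolding A_def by (rule almost_inv_conjugate_fixator[OF ZV am nat_pow_closed[OF t(1)] S(1) _ d])
  next
    fix s assume s: "s \<in> carrier G"
    \<comment> \<open>The covering condition depends on where \<open>s\<close> sends the end. Off
      \<open>D2\<close> it is fixed by \<open>g2\<close>; inside \<open>D2\<close> it stays there
      under \<open>g2\<close>, and \<open>g1\<close>, supported in the disjoint \<open>D1\<close>,
      fixes both positions.\<close>
    obtain n where n: "im s (A n) \<subseteq> D2 \<or> im s (A n) \<inter> D2 = {}"
      using shrinking_dichotomy[OF shrinking_im[OF A s] D(2)] by blast
    have sV: "im s (A n) \<subseteq> V" by (rule im_sub[OF s AV])
    have conj: "inv r \<otimes> g \<otimes> r \<in> H" if "r \<in> carrier G" "g \<in> fixator G \<phi> (V - D)" "im r (A n) \<subseteq> V - D" for r g D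
    proof -
      have "g \<in> fixator G \<phi> (im r (A n))" using that(2) fixator_mono[OF that(3)] by blast
      then show ?thesis using fixator_conj[OF that(1) fixator_carrier[OF that(2)] AV] HI by blast
    qed
    from n show "inv s \<otimes> g2 \<otimes> s \<in> H \<or> (inv s \<otimes> g1 \<otimes> s \<in> H \<and> inv (g2 \<otimes> s) \<otimes> g1 \<otimes> (g2 \<otimes> s) \<in> H)"
    proof
      assume a: "im s (A n) \<subseteq> D2"
      have "im (g2 \<otimes> s) (A n) = im g2 (im s (A n))" by (rule im_mult[OF gc(2) s AV])
      also have "\<dots> \<subseteq> im g2 D2" using a by (rule im_mono)
      also have "im g2 D2 = D2" by (rule fixator_preserves[OF g2(1) HH_sub[OF D(2)]])
      finally have b: "im (g2 \<otimes> s) (A n) \<subseteq> D2" .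
      have D2: "D2 \<subseteq> V - D1" using HH_sub[OF D(2)] D(3) by blast
      show ?thesis
        using conj[OF s g1(1) subset_trans[OF a D2]] conj[OF m_closed[OF gc(2) s] g1(1) subset_trans[OF b D2]] by blast
    next
      assume "im s (A n) \<inter> D2 = {}"
      then have "im s (A n) \<subseteq> V - D2" using sV by blast
      then show ?thesis using conj[OF s g2(1)] by blast
    qed
  qed
qed

end

theorem mainTheorem11:
  fixes G :: "'g monoid" and V :: "'v set" and adj :: "'v \<Rightarrow> 'v \<Rightarrow> bool"
    and \<phi> :: "'g \<Rightarrow> 'v \<Rightarrow> 'v" and K N :: "'g set" and x y :: 'v
  assumes act: "tree_action G V adj \<phi>"
    and minimal: "minimal_action G V adj \<phi>"
    and sh: "strongly_hyperbolic G V adj \<phi>"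
    and edge: "adj x y"
    and K_def: "K = fixator G \<phi> (half_tree V adj x y)"
    and N_def: "N = action_kernel G V \<phi>"
  shows "(C_star_simple G \<longrightarrow> K = {\<one>\<^bsub>G\<^esub>} \<or> \<not> amenable (G\<lparr>carrier := K\<rparr>))
    \<and> (K = N \<and> C_star_simple (G\<lparr>carrier := N\<rparr>) \<longrightarrow> C_star_simple G)
    \<and> (\<not> amenable ((G\<lparr>carrier := K\<rparr>) Mod N) \<and> C_star_simple (G\<lparr>carrier := N\<rparr>) \<longrightarrow> C_star_simple G)
    \<and> (N = {\<one>\<^bsub>G\<^esub>} \<longrightarrow> (C_star_simple G \<longleftrightarrow> K = {\<one>\<^bsub>G\<^esub>} \<or> \<not> amenable (G\<lparr>carrier := K\<rparr>)))
    \<and> (amenable (G\<lparr>carrier := K\<rparr>) \<longrightarrow> (C_star_simple G \<longleftrightarrow> K = {\<one>\<^bsub>G\<^esub>}))"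
proof -
  have "is_tree V adj" using act by (simp add: tree_action_def)
  then interpret nonelementary_tree_act V adj G \<phi>
    by (intro nonelementary_tree_act.intro tree_act.intro tree.intro tree_act_axioms.intro
        nonelementary_tree_act_axioms.intro act minimal sh)
  have Zz: "half_tree V adj x y \<in> HH" by (rule HH_I[OF edge])
  have N: "N = fixator G \<phi> V" by (simp add: N_def action_kernel_def)
  have NK: "N \<subseteq> K" unfolding N K_def by (rule fixator_mono[OF HH_sub[OF Zz]])
  have oneN: "\<one>\<^bsub>G\<^esub> \<in> N" unfolding N by (rule subgroup.one_closed[OF fixator_subgroup[OF subset_refl]])
  have i: "K = {\<one>\<^bsub>G\<^esub>} \<or> \<not> amenable (G\<lparr>carrier := K\<rparr>)" if "C_star_simple G"
    using not_C_star_simple_if_fixator_amenable[OF Zz] that unfolding K_def by blast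
  have ii: "C_star_simple G" if "K = N" "C_star_simple (G\<lparr>carrier := N\<rparr>)"
    using C_star_simple_if_fixator_eq_kernel[OF Zz] that unfolding K_def N by blast
  have iii: "C_star_simple G" if "\<not> amenable (G\<lparr>carrier := K\<rparr> Mod N)" "C_star_simple (G\<lparr>carrier := N\<rparr>)"
    using C_star_simple_if_quotient_nonamenable[OF Zz] that unfolding K_def N by blast
  \<comment> \<open>The last two equivalences carry no simplicity assumption on \<open>N\<close>: a
    trivial \<open>K\<close> forces \<open>N\<close> to be trivial, and the trivial group is simple
    in this sense.\<close>
  have ii': "C_star_simple G" if "K = {\<one>\<^bsub>G\<^esub>}"
  proof -
    have "N = {\<one>\<^bsub>G\<^esub>}" using that NK oneN by blast
    then show ?thesis using ii that trivial_C_star_simple by simp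
  qed
  \<comment> \<open>For trivial \<open>N\<close> the quotient by \<open>N\<close> is a copy of
    \<open>K\<close>, so non-amenability passes from \<open>K\<close> to it.\<close>
  have iii': "C_star_simple G" if n: "N = {\<one>\<^bsub>G\<^esub>}" and na: "\<not> amenable (G\<lparr>carrier := K\<rparr>)"
  proof (rule iii)
    have "group (G\<lparr>carrier := K\<rparr>)"
      unfolding K_def using fixator_subgroup[OF HH_sub[OF Zz]] by (rule subgroup_imp_group)
    from amenable_trivial_quotient[OF this] show "\<not> amenable (G\<lparr>carrier := K\<rparr> Mod N)" using na n by auto
    show "C_star_simple (G\<lparr>carrier := N\<rparr>)" unfolding n by (rule trivial_C_star_simple)
  qed
  show ?thesis using i ii iii ii' iii' by blast
qed

end
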